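(* Let $X$ be a scheme over a field $F$ and let $\mathcal{L}\in\operatorname{Pic}(X)$ be a line bundle on $X$. Assume the Kodaira-Spencer sheaf $\mathbb{V}_{\mathcal{L}}$ is locally free and that $\mathbb{V}_{\mathcal{L}}^*=\mathcal{F}=\Omega^1_X/\mathcal{I}$ for some sub $\mathcal{O}_X$-module $\mathcal{I}\subseteq\Omega^1_X$. Let $\operatorname{KS}(\mathcal{L})\in\operatorname{Ext}^1_{\mathcal{O}_X}(\mathbb{V}_{\mathcal{L}},\operatorname{End}_{\mathcal{O}_X}(\mathcal{L}))$ be the Kodaira-Spencer class of $\mathcal{L}$, let $\overline{c}_1(\mathcal{L})\in \operatorname{H}^1(X,\mathcal{F})$ be the generalized first Chern class of $\mathcal{L}$, and let $\psi:\operatorname{Ext}^1_{\mathcal{O}_X}(\mathbb{V}_{\mathcal{L}},\operatorname{End}_{\mathcal{O}_X}(\mathcal{L}))\to\operatorname{H}^1(X,\mathcal{F})$ be the canonical map. Then there is an equality $$\psi(\operatorname{KS}(\mathcal{L}))=\overline{c}_1(\mathcal{L})$$ in $\operatorname{H}^1(X,\mathcal{F})$.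
   Context: $\Omega^1_X$ is the sheaf of Kähler differentials of $X$ over $F$ and $T_X$ is the tangent sheaf of $X$, with $T_X(U)=\operatorname{Der}_F(A)$ for $U=\operatorname{Spec}(A)\subseteq X$ open affine. Tensor products are over $\mathcal{O}_X$ and $(-)^*$ is the $\mathcal{O}_X$-dual. Kodaira-Spencer sheaf: for an $\mathcal{O}_X$-module $\mathcal{E}$, $\mathbb{V}_{\mathcal{E}}\subseteq T_X$ is the subsheaf of local sections $\partial\in T_X(U)$ which lift to some $\nabla(\partial)\in\operatorname{End}_F(\mathcal{E}|_U)$ with $\nabla(\partial)(se)=s\nabla(\partial)(e)+\partial(s)e$ for local sections $s$ of $\mathcal{O}_X$ and $e$ of $\mathcal{E}$. The identification $\mathbb{V}_{\mathcal{L}}^*=\Omega^1_X/\mathcal{I}$ is the one induced by the natural map $\Omega^1_X\to T_X^*\to\mathbb{V}_{\mathcal{L}}^*$. Kodaira-Spencer class: a lift $\nabla(\partial)$ is chosen for each local section $\partial$ of $\mathbb{V}_{\mathcal{E}}$, the assignment $\partial\mapsto\nabla(\partial)$ being additive and compatible with restrictions. Put $L(a,\partial)=a\nabla(\partial)-\nabla(a\partial)$, a local section of $\operatorname{End}_{\mathcal{O}_X}(\mathcal{E})$, and let $\operatorname{LR}(\mathbb{V}_{\mathcal{E}})=\operatorname{End}_{\mathcal{O}_X}(\mathcal{E})\oplus\mathbb{V}_{\mathcal{E}}$ as sheaf of abelian groups with left $\mathcal{O}_X$-module structure $a(\phi,\partial)=(a\phi+L(a,\partial),a\partial)$. Then $\operatorname{KS}(\mathcal{E})\in\operatorname{Ext}^1_{\mathcal{O}_X}(\mathbb{V}_{\mathcal{E}},\operatorname{End}_{\mathcal{O}_X}(\mathcal{E}))$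 is the class of the extension $0\to\operatorname{End}_{\mathcal{O}_X}(\mathcal{E})\to\operatorname{LR}(\mathbb{V}_{\mathcal{E}})\to\mathbb{V}_{\mathcal{E}}\to0$ (canonical inclusion and projection). Chern class: $\operatorname{dlog}:\mathcal{O}^*\to\Omega^1_X$, $x\mapsto d(x)/x$ ($\mathcal{O}^*$ the sheaf of units of $\mathcal{O}_X$, $d$ the universal derivation) induces $\operatorname{dlog}:\operatorname{Pic}(X)=\operatorname{H}^1(X,\mathcal{O}^* )\to\operatorname{H}^1(X,\Omega^1_X)$; $c_1(\mathcal{L})=\operatorname{dlog}(\mathcal{L})$, and $\overline{c}_1(\mathcal{L})$ is the image of $c_1(\mathcal{L})$ under the canonical map $\operatorname{H}^1(X,\Omega^1_X)\to\operatorname{H}^1(X,\mathcal{F})$. The map $\psi$ is the composite of the canonical maps $\operatorname{Ext}^1_{\mathcal{O}_X}(\mathbb{V}_{\mathcal{L}},\operatorname{End}_{\mathcal{O}_X}(\mathcal{L}))\cong\operatorname{Ext}^1_{\mathcal{O}_X}(\mathcal{O}_X,\operatorname{End}_{\mathcal{O}_X}(\mathcal{L})\otimes\mathbb{V}_{\mathcal{L}}^* )\cong\operatorname{Ext}^1_{\mathcal{O}_X}(\mathcal{O}_X,\operatorname{End}_{\mathcal{O}_X}(\mathcal{L})\otimes\mathcal{F})\to\operatorname{H}^1(X,\mathcal{F})$, using $\operatorname{End}_{\mathcal{O}_X}(\mathcal{L})\cong\mathcal{O}_X$. *)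

theory Defs
  imports "HOL-Analysis.Abstract_Topology" "HOL-Algebra.Module" "HOL-Algebra.Ideal"
    "HOL-Algebra.QuotRing"
begin

section \<open>Sheaves on a topological space\<close>

text \<open>
  The sections of a (pre)sheaf over an open set \<open>U\<close> form a set \<open>S U\<close>, and
  \<open>r U V\<close> is the restriction from \<open>U\<close> to \<open>V \<subseteq> U\<close>. Values at sets that are not
  open are irrelevant. The empty covering is allowed in the gluing condition, so a
  sheaf has exactly one section over the empty set.
\<close>

definition presheaf_on :: "'x topology \<Rightarrow> ('x set \<Rightarrow> 'a set) \<Rightarrow> ('x set \<Rightarrow> 'x set \<Rightarrow> 'a \<Rightarrow> 'a) \<Rightarrow> bool"
  where "presheaf_on T S r \<longleftrightarrow>
    (\<forall>U V. openin T U \<and> openin T V \<and> V \<subseteq> U \<longrightarrow> r U V \<in> S U \<rightarrow> S V) \<and>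
    (\<forall>U. openin T U \<longrightarrow> (\<forall>s\<in>S U. r U U s = s)) \<and>
    (\<forall>U V W. openin T U \<and> openin T V \<and> openin T W \<and> W \<subseteq> V \<and> V \<subseteq> U \<longrightarrow>
       (\<forall>s\<in>S U. r V W (r U V s) = r U W s))"

definition sheaf_on :: "'x topology \<Rightarrow> ('x set \<Rightarrow> 'a set) \<Rightarrow> ('x set \<Rightarrow> 'x set \<Rightarrow> 'a \<Rightarrow> 'a) \<Rightarrow> bool"
  where "sheaf_on T S r \<longleftrightarrow> presheaf_on T S r \<and>
    (\<forall>\<U> s. (\<forall>V\<in>\<U>. openin T V \<and> s V \<in> S V) \<and>
           (\<forall>V\<in>\<U>. \<forall>W\<in>\<U>. r V (V \<inter> W) (s V) = r W (V \<inter> W) (s W)) \<longrightarrow>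
           (\<exists>!t. t \<in> S (\<Union>\<U>) \<and> (\<forall>V\<in>\<U>. r (\<Union>\<U>) V t = s V)))"

section \<open>Ringed spaces and schemes over a field\<close>

record ('x, 'r) ringed_space =
  tsp :: "'x topology"
  osec :: "'x set \<Rightarrow> 'r ring"
  ores :: "'x set \<Rightarrow> 'x set \<Rightarrow> 'r \<Rightarrow> 'r"

abbreviation pts :: "('x, 'r, 'z) ringed_space_scheme \<Rightarrow> 'x set"
  where "pts X \<equiv> topspace (tsp X)"

definition opens :: "('x, 'r, 'z) ringed_space_scheme \<Rightarrow> 'x set \<Rightarrow> 'x set set"
  where "opens X U = {V. openin (tsp X) V \<and> V \<subseteq> U}"

definition is_ringed_space :: "('x, 'r, 'z) ringed_space_scheme \<Rightarrow> bool"
  where "is_ringed_space X \<longleftrightarrow>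
    sheaf_on (tsp X) (\<lambda>U. carrier (osec X U)) (ores X) \<and>
    (\<forall>U. openin (tsp X) U \<longrightarrow> cring (osec X U)) \<and>
    (\<forall>U V. openin (tsp X) U \<and> V \<in> opens X U \<longrightarrow> ores X U V \<in> ring_hom (osec X U) (osec X V))"

text \<open>
  \<open>frac R p a s\<close> is the element \<open>a / s\<close> of the localization of \<open>R\<close> at the prime \<open>p\<close>,
  as an equivalence class of pairs (numerator, denominator).
\<close>

definition frac :: "('r, 'z) ring_scheme \<Rightarrow> 'r set \<Rightarrow> 'r \<Rightarrow> 'r \<Rightarrow> ('r \<times> 'r) set"
  where "frac R p a s = {(b, t). b \<in> carrier R \<and> t \<in> carrier R - p \<and>
    (\<exists>u\<in>carrier R - p. u \<otimes>\<^bsub>R\<^esub> (a \<otimes>\<^bsub>R\<^esub> t \<ominus>\<^bsub>R\<^esub> b \<otimes>\<^bsub>R\<^esub> s) = \<zero>\<^bsub>R\<^esub>)}"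

definition localization :: "('r, 'z) ring_scheme \<Rightarrow> 'r set \<Rightarrow> ('r \<times> 'r) set ring"
  where "localization R p = \<lparr>
    carrier = {frac R p a s | a s. a \<in> carrier R \<and> s \<in> carrier R - p},
    mult = (\<lambda>x y. \<Union>(a, s)\<in>x. \<Union>(b, t)\<in>y. frac R p (a \<otimes>\<^bsub>R\<^esub> b) (s \<otimes>\<^bsub>R\<^esub> t)),
    one = frac R p \<one>\<^bsub>R\<^esub> \<one>\<^bsub>R\<^esub>,
    zero = frac R p \<zero>\<^bsub>R\<^esub> \<one>\<^bsub>R\<^esub>,
    add = (\<lambda>x y. \<Union>(a, s)\<in>x. \<Union>(b, t)\<in>y.
             frac R p (a \<otimes>\<^bsub>R\<^esub> t \<oplus>\<^bsub>R\<^esub> b \<otimes>\<^bsub>R\<^esub> s) (s \<otimes>\<^bsub>R\<^esub> t))\<rparr>"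

definition spec_top :: "('r, 'z) ring_scheme \<Rightarrow> 'r set topology"
  where "spec_top R = topology (\<lambda>U. \<exists>S\<subseteq>carrier R. U = {p. primeideal p R \<and> \<not> S \<subseteq> p})"

definition Spec :: "('r, 'z) ring_scheme \<Rightarrow> ('r set, 'r set \<Rightarrow> ('r \<times> 'r) set) ringed_space"
  where "Spec R = \<lparr>
    tsp = spec_top R,
    osec = (\<lambda>U. \<lparr>
      carrier = {s \<in> (\<Pi>\<^sub>E p\<in>U. carrier (localization R p)).
        \<forall>p\<in>U. \<exists>V a f. openin (spec_top R) V \<and> p \<in> V \<and> V \<subseteq> U \<and> a \<in> carrier R \<and> f \<in> carrier R \<and>
          (\<forall>q\<in>V. f \<notin> q \<and> s q = frac R q a f)},
      mult = (\<lambda>s t. \<lambda>p\<in>U. s p \<otimes>\<^bsub>localization R p\<^esub> t p),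
      one = (\<lambda>p\<in>U. \<one>\<^bsub>localization R p\<^esub>),
      zero = (\<lambda>p\<in>U. \<zero>\<^bsub>localization R p\<^esub>),
      add = (\<lambda>s t. \<lambda>p\<in>U. s p \<oplus>\<^bsub>localization R p\<^esub> t p)\<rparr>),
    ores = (\<lambda>U V s. restrict s V)\<rparr>"

text \<open>
  The open subspace \<open>U\<close> of \<open>X\<close> is isomorphic to \<open>Y\<close> as a ringed space. When \<open>Y\<close> is a
  spectrum, such an isomorphism is automatically one of locally ringed spaces.
\<close>

definition open_iso :: "('x, 'r, 'z) ringed_space_scheme \<Rightarrow> 'x set \<Rightarrow> ('y, 's, 'w) ringed_space_scheme \<Rightarrow> bool"
  where "open_iso X U Y \<longleftrightarrow> (\<exists>f \<phi>.
    homeomorphic_map (subtopology (tsp X) U) (tsp Y) f \<and>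
    (\<forall>V. openin (tsp Y) V \<longrightarrow> \<phi> V \<in> ring_iso (osec Y V) (osec X (U \<inter> f -` V))) \<and>
    (\<forall>V W. openin (tsp Y) V \<and> openin (tsp Y) W \<and> W \<subseteq> V \<longrightarrow>
       (\<forall>s\<in>carrier (osec Y V). \<phi> W (ores Y V W s) = ores X (U \<inter> f -` V) (U \<inter> f -` W) (\<phi> V s))))"

text \<open>
  It is no restriction that the ring \<open>R\<close> below has elements of type \<open>'r\<close>: if \<open>U\<close> is
  isomorphic to any spectrum, then it is isomorphic to the spectrum of \<open>osec X U\<close>.
\<close>

definition is_scheme :: "('x, 'r, 'z) ringed_space_scheme \<Rightarrow> bool"
  where "is_scheme X \<longleftrightarrow> is_ringed_space X \<and>
    (\<forall>x\<in>pts X. \<exists>U. openin (tsp X) U \<and> x \<in> U \<and> (\<exists>R :: 'r ring. cring R \<and> open_iso X U (Spec R)))"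

text \<open>A morphism from \<open>X\<close> to the spectrum of \<open>base X\<close> amounts to the ring homomorphism \<open>str X\<close>.\<close>

record ('x, 'r, 'f) over_space = "('x, 'r) ringed_space" +
  base :: "'f ring"
  str :: "'f \<Rightarrow> 'r"

definition scheme_over_field :: "('x, 'r, 'f) over_space \<Rightarrow> bool"
  where "scheme_over_field X \<longleftrightarrow> is_scheme X \<and> field (base X) \<and> str X \<in> ring_hom (base X) (osec X (pts X))"

definition scal :: "('x, 'r, 'f) over_space \<Rightarrow> 'x set \<Rightarrow> 'f \<Rightarrow> 'r"
  where "scal X U c = ores X (pts X) U (str X c)"

section \<open>Sheaves of modules\<close>

text \<open>The ring fields \<open>mult\<close> and \<open>one\<close> of the records \<open>sec M U\<close> play no role.\<close>

record ('x, 'r, 'm) omod =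
  sec :: "'x set \<Rightarrow> ('r, 'm) module"
  res :: "'x set \<Rightarrow> 'x set \<Rightarrow> 'm \<Rightarrow> 'm"

abbreviation mcar :: "('x, 'r, 'm) omod \<Rightarrow> 'x set \<Rightarrow> 'm set"
  where "mcar M U \<equiv> carrier (sec M U)"

definition O_module :: "('x, 'r, 'z) ringed_space_scheme \<Rightarrow> ('x, 'r, 'm) omod \<Rightarrow> bool"
  where "O_module X M \<longleftrightarrow>
    sheaf_on (tsp X) (mcar M) (res M) \<and>
    (\<forall>U. openin (tsp X) U \<longrightarrow> module (osec X U) (sec M U)) \<and>
    (\<forall>U V. openin (tsp X) U \<and> V \<in> opens X U \<longrightarrow>
       (\<forall>m\<in>mcar M U. \<forall>n\<in>mcar M U. res M U V (m \<oplus>\<^bsub>sec M U\<^esub> n) = res M U V m \<oplus>\<^bsub>sec M V\<^esub> res M U V n) \<and>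
       (\<forall>a\<in>carrier (osec X U). \<forall>m\<in>mcar M U.
          res M U V (a \<odot>\<^bsub>sec M U\<^esub> m) = ores X U V a \<odot>\<^bsub>sec M V\<^esub> res M U V m))"

definition ox :: "('x, 'r, 'z) ringed_space_scheme \<Rightarrow> ('x, 'r, 'r) omod"
  where "ox X = \<lparr>
    sec = (\<lambda>U. \<lparr>carrier = carrier (osec X U), mult = mult (osec X U), one = one (osec X U),
                zero = zero (osec X U), add = add (osec X U), smult = mult (osec X U)\<rparr>),
    res = ores X\<rparr>"

definition free_sheaf :: "('x, 'r, 'z) ringed_space_scheme \<Rightarrow> nat \<Rightarrow> ('x, 'r, nat \<Rightarrow> 'r) omod"
  where "free_sheaf X n = \<lparr>
    sec = (\<lambda>U. \<lparr>carrier = {..<n} \<rightarrow>\<^sub>E carrier (osec X U), mult = undefined, one = undefined,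
                zero = (\<lambda>i\<in>{..<n}. \<zero>\<^bsub>osec X U\<^esub>),
                add = (\<lambda>v w. \<lambda>i\<in>{..<n}. v i \<oplus>\<^bsub>osec X U\<^esub> w i),
                smult = (\<lambda>a v. \<lambda>i\<in>{..<n}. a \<otimes>\<^bsub>osec X U\<^esub> v i)\<rparr>),
    res = (\<lambda>U V v. \<lambda>i\<in>{..<n}. ores X U V (v i))\<rparr>"

subsection \<open>Sheaves of local homomorphisms\<close>

text \<open>
  A homomorphism between the restrictions to \<open>U\<close> of two sheaves is a family of maps, one for
  every open \<open>V \<subseteq> U\<close>. All families are extensional, so equality of families is
  equality of homomorphisms.
\<close>

type_synonym ('x, 'a, 'b) fam = "'x set \<Rightarrow> 'a \<Rightarrow> 'b"

definition add_fams :: "('x, 'r, 'z) ringed_space_scheme \<Rightarrow> ('x, 'r, 'm) omod \<Rightarrow> ('x, 'r, 'n) omod \<Rightarrow>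
    'x set \<Rightarrow> ('x, 'm, 'n) fam set"
  where "add_fams X M N U = {\<phi> \<in> (\<Pi>\<^sub>E V\<in>opens X U. mcar M V \<rightarrow>\<^sub>E mcar N V).
    (\<forall>V\<in>opens X U. \<forall>m\<in>mcar M V. \<forall>n\<in>mcar M V.
       \<phi> V (m \<oplus>\<^bsub>sec M V\<^esub> n) = \<phi> V m \<oplus>\<^bsub>sec N V\<^esub> \<phi> V n) \<and>
    (\<forall>V\<in>opens X U. \<forall>W\<in>opens X V. \<forall>m\<in>mcar M V. \<phi> W (res M V W m) = res N V W (\<phi> V m))}"

definition homs :: "('x, 'r, 'z) ringed_space_scheme \<Rightarrow> ('x, 'r, 'm) omod \<Rightarrow> ('x, 'r, 'n) omod \<Rightarrow>
    'x set \<Rightarrow> ('x, 'm, 'n) fam set"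
  where "homs X M N U = {\<phi> \<in> add_fams X M N U. \<forall>V\<in>opens X U. \<forall>a\<in>carrier (osec X V). \<forall>m\<in>mcar M V.
    \<phi> V (a \<odot>\<^bsub>sec M V\<^esub> m) = a \<odot>\<^bsub>sec N V\<^esub> \<phi> V m}"

definition f_homs :: "('x, 'r, 'f) over_space \<Rightarrow> ('x, 'r, 'm) omod \<Rightarrow> ('x, 'r, 'n) omod \<Rightarrow>
    'x set \<Rightarrow> ('x, 'm, 'n) fam set"
  where "f_homs X M N U = {\<phi> \<in> add_fams X M N U. \<forall>V\<in>opens X U. \<forall>c\<in>carrier (base X). \<forall>m\<in>mcar M V.
    \<phi> V (scal X V c \<odot>\<^bsub>sec M V\<^esub> m) = scal X V c \<odot>\<^bsub>sec N V\<^esub> \<phi> V m}"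

definition ders :: "('x, 'r, 'f) over_space \<Rightarrow> 'x set \<Rightarrow> ('x, 'r, 'r) fam set"
  where "ders X U = {D \<in> f_homs X (ox X) (ox X) U. \<forall>V\<in>opens X U.
    \<forall>a\<in>carrier (osec X V). \<forall>b\<in>carrier (osec X V).
      D V (a \<otimes>\<^bsub>osec X V\<^esub> b) = a \<otimes>\<^bsub>osec X V\<^esub> D V b \<oplus>\<^bsub>osec X V\<^esub> b \<otimes>\<^bsub>osec X V\<^esub> D V a}"

text \<open>The families of maps from \<open>M\<close> to \<open>N\<close> in \<open>C U\<close>, with the pointwise operations of \<open>N\<close>.\<close>

definition fam_sheaf :: "('x, 'r, 'z) ringed_space_scheme \<Rightarrow> ('x, 'r, 'm) omod \<Rightarrow> ('x, 'r, 'n) omod \<Rightarrow>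
    ('x set \<Rightarrow> ('x, 'm, 'n) fam set) \<Rightarrow> ('x, 'r, ('x, 'm, 'n) fam) omod"
  where "fam_sheaf X M N C = \<lparr>
    sec = (\<lambda>U. \<lparr>carrier = C U, mult = undefined, one = undefined,
      zero = (\<lambda>V\<in>opens X U. \<lambda>m\<in>mcar M V. \<zero>\<^bsub>sec N V\<^esub>),
      add = (\<lambda>\<phi> \<psi>. \<lambda>V\<in>opens X U. \<lambda>m\<in>mcar M V. \<phi> V m \<oplus>\<^bsub>sec N V\<^esub> \<psi> V m),
      smult = (\<lambda>a \<phi>. \<lambda>V\<in>opens X U. \<lambda>m\<in>mcar M V. ores X U V a \<odot>\<^bsub>sec N V\<^esub> \<phi> V m)\<rparr>),
    res = (\<lambda>U V \<phi>. restrict \<phi> (opens X V))\<rparr>"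

definition hom_sheaf :: "('x, 'r, 'z) ringed_space_scheme \<Rightarrow> ('x, 'r, 'm) omod \<Rightarrow> ('x, 'r, 'n) omod \<Rightarrow>
    ('x, 'r, ('x, 'm, 'n) fam) omod"
  where "hom_sheaf X M N = fam_sheaf X M N (homs X M N)"

abbreviation end_sheaf where "end_sheaf X M \<equiv> hom_sheaf X M M"

abbreviation dual where "dual X M \<equiv> hom_sheaf X M (ox X)"

definition f_end_sheaf :: "('x, 'r, 'f) over_space \<Rightarrow> ('x, 'r, 'm) omod \<Rightarrow> ('x, 'r, ('x, 'm, 'm) fam) omod"
  where "f_end_sheaf X M = fam_sheaf X M M (f_homs X M M)"

definition tangent :: "('x, 'r, 'f) over_space \<Rightarrow> ('x, 'r, ('x, 'r, 'r) fam) omod"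
  where "tangent X = fam_sheaf X (ox X) (ox X) (ders X)"

subsection \<open>Morphisms\<close>

abbreviation mor where "mor X M N \<equiv> homs X M N (pts X)"

definition mor_comp :: "('x, 'r, 'z) ringed_space_scheme \<Rightarrow> ('x, 'r, 'm) omod \<Rightarrow>
    ('x, 'n, 'k) fam \<Rightarrow> ('x, 'm, 'n) fam \<Rightarrow> ('x, 'm, 'k) fam"
  where "mor_comp X M \<psi> \<phi> = (\<lambda>V\<in>opens X (pts X). \<lambda>m\<in>mcar M V. \<psi> V (\<phi> V m))"

definition iso_over :: "('x, 'r, 'z) ringed_space_scheme \<Rightarrow> ('x, 'r, 'm) omod \<Rightarrow> ('x, 'r, 'n) omod \<Rightarrow>
    'x set \<Rightarrow> ('x, 'm, 'n) fam \<Rightarrow> bool"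
  where "iso_over X M N U \<phi> \<longleftrightarrow> \<phi> \<in> homs X M N U \<and> (\<forall>V\<in>opens X U. bij_betw (\<phi> V) (mcar M V) (mcar N V))"

abbreviation mor_iso where "mor_iso X M N \<equiv> iso_over X M N (pts X)"

definition mor_inv :: "('x, 'r, 'z) ringed_space_scheme \<Rightarrow> ('x, 'r, 'm) omod \<Rightarrow> ('x, 'r, 'n) omod \<Rightarrow>
    ('x, 'm, 'n) fam \<Rightarrow> ('x, 'n, 'm) fam"
  where "mor_inv X M N \<phi> = (\<lambda>V\<in>opens X (pts X). \<lambda>n\<in>mcar N V. inv_into (mcar M V) (\<phi> V) n)"

definition locally_free :: "('x, 'r, 'z) ringed_space_scheme \<Rightarrow> ('x, 'r, 'm) omod \<Rightarrow> bool"
  where "locally_free X M \<longleftrightarrow> O_module X M \<and>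
    (\<forall>x\<in>pts X. \<exists>U n \<phi>. openin (tsp X) U \<and> x \<in> U \<and> iso_over X (free_sheaf X n) M U \<phi>)"

definition line_bundle :: "('x, 'r, 'z) ringed_space_scheme \<Rightarrow> ('x, 'r, 'm) omod \<Rightarrow> bool"
  where "line_bundle X M \<longleftrightarrow> O_module X M \<and>
    (\<forall>x\<in>pts X. \<exists>U \<phi>. openin (tsp X) U \<and> x \<in> U \<and> iso_over X (ox X) M U \<phi>)"

definition sub_O_module :: "('x, 'r, 'z) ringed_space_scheme \<Rightarrow> ('x, 'r, 'm) omod \<Rightarrow> ('x set \<Rightarrow> 'm set) \<Rightarrow> bool"
  where "sub_O_module X M I \<longleftrightarrow> sheaf_on (tsp X) I (res M) \<and>
    (\<forall>U. openin (tsp X) U \<longrightarrow> submodule (I U) (osec X U) (sec M U))"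

text \<open>The map sending \<open>a\<close> to multiplication by \<open>a\<close>; for a line bundle it is an isomorphism.\<close>

definition homothety :: "('x, 'r, 'z) ringed_space_scheme \<Rightarrow> ('x, 'r, 'm) omod \<Rightarrow> ('x, 'r, ('x, 'm, 'm) fam) fam"
  where "homothety X M = (\<lambda>U\<in>opens X (pts X). \<lambda>a\<in>carrier (osec X U).
    \<lambda>V\<in>opens X U. \<lambda>m\<in>mcar M V. ores X U V a \<odot>\<^bsub>sec M V\<^esub> m)"

subsection \<open>Sheafification\<close>

text \<open>
  Here \<open>P\<close> is a presheaf of modules. The germ at \<open>x\<close> of a section \<open>m\<close> over \<open>U\<close>
  is the class of all pairs \<open>(W, n)\<close> agreeing with \<open>(U, m)\<close> near \<open>x\<close>.
\<close>

type_synonym ('x, 'p) germ = "('x set \<times> 'p) set"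

definition germ :: "('x, 'r, 'z) ringed_space_scheme \<Rightarrow> ('x, 'r, 'p) omod \<Rightarrow> 'x \<Rightarrow> 'x set \<Rightarrow> 'p \<Rightarrow> ('x, 'p) germ"
  where "germ X P x U m = {(W, n). openin (tsp X) W \<and> x \<in> W \<and> n \<in> mcar P W \<and>
    (\<exists>Y\<in>opens X (U \<inter> W). x \<in> Y \<and> res P U Y m = res P W Y n)}"

definition sheafify :: "('x, 'r, 'z) ringed_space_scheme \<Rightarrow> ('x, 'r, 'p) omod \<Rightarrow> ('x, 'r, 'x \<Rightarrow> ('x, 'p) germ) omod"
  where "sheafify X P = \<lparr>
    sec = (\<lambda>U. \<lparr>
      carrier = {s \<in> extensional U. \<forall>x\<in>U. \<exists>V\<in>opens X U. x \<in> V \<and> (\<exists>m\<in>mcar P V. \<forall>y\<in>V. s y = germ X P y V m)},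
      mult = undefined, one = undefined,
      zero = (\<lambda>x\<in>U. germ X P x U \<zero>\<^bsub>sec P U\<^esub>),
      add = (\<lambda>s t. \<lambda>x\<in>U. \<Union>(V, m)\<in>s x. \<Union>(W, n)\<in>t x.
               germ X P x (V \<inter> W) (res P V (V \<inter> W) m \<oplus>\<^bsub>sec P (V \<inter> W)\<^esub> res P W (V \<inter> W) n)),
      smult = (\<lambda>a s. \<lambda>x\<in>U. \<Union>(V, m)\<in>s x.
               germ X P x (U \<inter> V) (ores X U (U \<inter> V) a \<odot>\<^bsub>sec P (U \<inter> V)\<^esub> res P V (U \<inter> V) m))\<rparr>),
    res = (\<lambda>U V s. restrict s V)\<rparr>"

definition to_sheaf :: "('x, 'r, 'z) ringed_space_scheme \<Rightarrow> ('x, 'r, 'p) omod \<Rightarrow> 'x set \<Rightarrow> 'p \<Rightarrow> 'x \<Rightarrow> ('x, 'p) germ"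
  where "to_sheaf X P U m = (\<lambda>x\<in>U. germ X P x U m)"

subsection \<open>Quotients\<close>

definition quot_mod :: "('r, 'm) module \<Rightarrow> 'm set \<Rightarrow> ('r, 'm set) module"
  where "quot_mod M H = \<lparr>carrier = a_rcosets\<^bsub>M\<^esub> H, mult = undefined, one = undefined,
    zero = H, add = set_add M, smult = (\<lambda>a C. \<Union>c\<in>C. H +>\<^bsub>M\<^esub> (a \<odot>\<^bsub>M\<^esub> c))\<rparr>"

definition quot_presheaf :: "('x, 'r, 'm) omod \<Rightarrow> ('x set \<Rightarrow> 'm set) \<Rightarrow> ('x, 'r, 'm set) omod"
  where "quot_presheaf M I = \<lparr>sec = (\<lambda>U. quot_mod (sec M U) (I U)),
    res = (\<lambda>U V C. \<Union>c\<in>C. I V +>\<^bsub>sec M V\<^esub> res M U V c)\<rparr>"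

definition quot_sheaf :: "('x, 'r, 'z) ringed_space_scheme \<Rightarrow> ('x, 'r, 'm) omod \<Rightarrow> ('x set \<Rightarrow> 'm set) \<Rightarrow>
    ('x, 'r, 'x \<Rightarrow> ('x, 'm set) germ) omod"
  where "quot_sheaf X M I = sheafify X (quot_presheaf M I)"

definition quot_map :: "('x, 'r, 'z) ringed_space_scheme \<Rightarrow> ('x, 'r, 'm) omod \<Rightarrow> ('x set \<Rightarrow> 'm set) \<Rightarrow>
    ('x, 'm, 'x \<Rightarrow> ('x, 'm set) germ) fam"
  where "quot_map X M I = (\<lambda>U\<in>opens X (pts X). \<lambda>m\<in>mcar M U.
    to_sheaf X (quot_presheaf M I) U (I U +>\<^bsub>sec M U\<^esub> m))"

subsection \<open>Presheaves of modules given by generators and relations\<close>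

definition free_mod :: "('r, 'z) ring_scheme \<Rightarrow> 's set \<Rightarrow> ('r, 's \<Rightarrow> 'r) module"
  where "free_mod R S = \<lparr>
    carrier = {f \<in> S \<rightarrow> carrier R. finite {s \<in> S. f s \<noteq> \<zero>\<^bsub>R\<^esub>} \<and> (\<forall>s. s \<notin> S \<longrightarrow> f s = \<zero>\<^bsub>R\<^esub>)},
    mult = undefined, one = undefined,
    zero = (\<lambda>s. \<zero>\<^bsub>R\<^esub>), add = (\<lambda>f g s. f s \<oplus>\<^bsub>R\<^esub> g s), smult = (\<lambda>a f s. a \<otimes>\<^bsub>R\<^esub> f s)\<rparr>"

definition free_gen :: "('r, 'z) ring_scheme \<Rightarrow> 's \<Rightarrow> 's \<Rightarrow> 'r"
  where "free_gen R s = (\<lambda>t. if t = s then \<one>\<^bsub>R\<^esub> else \<zero>\<^bsub>R\<^esub>)"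

definition submod_gen :: "('r, 'z) ring_scheme \<Rightarrow> ('r, 'm) module \<Rightarrow> 'm set \<Rightarrow> 'm set"
  where "submod_gen R M K = \<Inter>{H. submodule H R M \<and> K \<subseteq> H}"

text \<open>
  The presheaf with generators \<open>S U\<close> and relations \<open>K U\<close> over \<open>U\<close>; restriction applies
  \<open>ores X\<close> to the coefficients and \<open>\<sigma>\<close> to the generators (adding up the coefficients of
  generators that become equal).
\<close>

definition pres_sub :: "('x, 'r, 'z) ringed_space_scheme \<Rightarrow> ('x set \<Rightarrow> 's set) \<Rightarrow> ('x set \<Rightarrow> ('s \<Rightarrow> 'r) set) \<Rightarrow>
    'x set \<Rightarrow> ('s \<Rightarrow> 'r) set"
  where "pres_sub X S K U = submod_gen (osec X U) (free_mod (osec X U) (S U)) (K U)"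

definition pres_presheaf :: "('x, 'r, 'z) ringed_space_scheme \<Rightarrow> ('x set \<Rightarrow> 's set) \<Rightarrow>
    ('x set \<Rightarrow> ('s \<Rightarrow> 'r) set) \<Rightarrow> ('x set \<Rightarrow> 'x set \<Rightarrow> 's \<Rightarrow> 's) \<Rightarrow> ('x, 'r, ('s \<Rightarrow> 'r) set) omod"
  where "pres_presheaf X S K \<sigma> = \<lparr>
    sec = (\<lambda>U. quot_mod (free_mod (osec X U) (S U)) (pres_sub X S K U)),
    res = (\<lambda>U V C. \<Union>f\<in>C. pres_sub X S K V +>\<^bsub>free_mod (osec X V) (S V)\<^esub>
      (\<lambda>t. finsum (osec X V) (\<lambda>s. ores X U V (f s)) {s. f s \<noteq> \<zero>\<^bsub>osec X U\<^esub> \<and> \<sigma> U V s = t}))\<rparr>"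

definition pres_gen :: "('x, 'r, 'z) ringed_space_scheme \<Rightarrow> ('x set \<Rightarrow> 's set) \<Rightarrow>
    ('x set \<Rightarrow> ('s \<Rightarrow> 'r) set) \<Rightarrow> ('x set \<Rightarrow> 'x set \<Rightarrow> 's \<Rightarrow> 's) \<Rightarrow> 'x set \<Rightarrow> 's \<Rightarrow> 'x \<Rightarrow> ('x, ('s \<Rightarrow> 'r) set) germ"
  where "pres_gen X S K \<sigma> U s = to_sheaf X (pres_presheaf X S K \<sigma>) U
    (pres_sub X S K U +>\<^bsub>free_mod (osec X U) (S U)\<^esub> free_gen (osec X U) s)"

subsection \<open>Tensor products\<close>

type_synonym ('x, 'r, 'm, 'n) tns = "'x \<Rightarrow> ('x, ('m \<times> 'n \<Rightarrow> 'r) set) germ"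

definition tensor_gens :: "('x, 'r, 'm) omod \<Rightarrow> ('x, 'r, 'n) omod \<Rightarrow> 'x set \<Rightarrow> ('m \<times> 'n) set"
  where "tensor_gens M N U = mcar M U \<times> mcar N U"

definition tensor_rels :: "('x, 'r, 'z) ringed_space_scheme \<Rightarrow> ('x, 'r, 'm) omod \<Rightarrow> ('x, 'r, 'n) omod \<Rightarrow>
    'x set \<Rightarrow> ('m \<times> 'n \<Rightarrow> 'r) set"
  where "tensor_rels X M N U = (let R = osec X U; G = free_mod R (tensor_gens M N U); g = free_gen R in
    {g (m \<oplus>\<^bsub>sec M U\<^esub> m', n) \<ominus>\<^bsub>G\<^esub> (g (m, n) \<oplus>\<^bsub>G\<^esub> g (m', n)) | m m' n. m \<in> mcar M U \<and> m' \<in> mcar M U \<and> n \<in> mcar N U} \<union>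
    {g (m, n \<oplus>\<^bsub>sec N U\<^esub> n') \<ominus>\<^bsub>G\<^esub> (g (m, n) \<oplus>\<^bsub>G\<^esub> g (m, n')) | m n n'. m \<in> mcar M U \<and> n \<in> mcar N U \<and> n' \<in> mcar N U} \<union>
    {g (a \<odot>\<^bsub>sec M U\<^esub> m, n) \<ominus>\<^bsub>G\<^esub> a \<odot>\<^bsub>G\<^esub> g (m, n) | a m n. a \<in> carrier R \<and> m \<in> mcar M U \<and> n \<in> mcar N U} \<union>
    {g (m, a \<odot>\<^bsub>sec N U\<^esub> n) \<ominus>\<^bsub>G\<^esub> a \<odot>\<^bsub>G\<^esub> g (m, n) | a m n. a \<in> carrier R \<and> m \<in> mcar M U \<and> n \<in> mcar N U})"

definition tensor_res :: "('x, 'r, 'm) omod \<Rightarrow> ('x, 'r, 'n) omod \<Rightarrow> 'x set \<Rightarrow> 'x set \<Rightarrow> 'm \<times> 'n \<Rightarrow> 'm \<times> 'n"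
  where "tensor_res M N U V = map_prod (res M U V) (res N U V)"

definition tensor :: "('x, 'r, 'z) ringed_space_scheme \<Rightarrow> ('x, 'r, 'm) omod \<Rightarrow> ('x, 'r, 'n) omod \<Rightarrow>
    ('x, 'r, ('x, 'r, 'm, 'n) tns) omod"
  where "tensor X M N = sheafify X (pres_presheaf X (tensor_gens M N) (tensor_rels X M N) (tensor_res M N))"

definition pure_tensor :: "('x, 'r, 'z) ringed_space_scheme \<Rightarrow> ('x, 'r, 'm) omod \<Rightarrow> ('x, 'r, 'n) omod \<Rightarrow>
    'x set \<Rightarrow> 'm \<Rightarrow> 'n \<Rightarrow> ('x, 'r, 'm, 'n) tns"
  where "pure_tensor X M N U m n = pres_gen X (tensor_gens M N) (tensor_rels X M N) (tensor_res M N) U (m, n)"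

text \<open>The morphism out of the tensor product induced by a bilinear map \<open>\<beta>\<close> of sheaves.\<close>

definition tensor_lift :: "('x, 'r, 'z) ringed_space_scheme \<Rightarrow> ('x, 'r, 'm) omod \<Rightarrow> ('x, 'r, 'n) omod \<Rightarrow>
    ('x, 'r, 'k) omod \<Rightarrow> ('x set \<Rightarrow> 'm \<Rightarrow> 'n \<Rightarrow> 'k) \<Rightarrow> ('x, ('x, 'r, 'm, 'n) tns, 'k) fam"
  where "tensor_lift X M N P \<beta> = (THE \<phi>. \<phi> \<in> mor X (tensor X M N) P \<and>
    (\<forall>U\<in>opens X (pts X). \<forall>m\<in>mcar M U. \<forall>n\<in>mcar N U. \<phi> U (pure_tensor X M N U m n) = \<beta> U m n))"

definition tensor_map :: "('x, 'r, 'z) ringed_space_scheme \<Rightarrow> ('x, 'r, 'm) omod \<Rightarrow> ('x, 'r, 'n) omod \<Rightarrow>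
    ('x, 'r, 'k) omod \<Rightarrow> ('x, 'r, 'l) omod \<Rightarrow> ('x, 'm, 'k) fam \<Rightarrow> ('x, 'n, 'l) fam \<Rightarrow>
    ('x, ('x, 'r, 'm, 'n) tns, ('x, 'r, 'k, 'l) tns) fam"
  where "tensor_map X M N P Q f g =
    tensor_lift X M N (tensor X P Q) (\<lambda>U m n. pure_tensor X P Q U (f U m) (g U n))"

definition mor_id :: "('x, 'r, 'z) ringed_space_scheme \<Rightarrow> ('x, 'r, 'm) omod \<Rightarrow> ('x, 'm, 'm) fam"
  where "mor_id X M = (\<lambda>U\<in>opens X (pts X). \<lambda>m\<in>mcar M U. m)"

subsection \<open>Kaehler differentials\<close>

text \<open>
  The sheaf associated with the presheaf that sends \<open>U\<close> to the module of Kaehler differentials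
  of \<open>osec X U\<close> over \<open>base X\<close>, the latter given by generators \<open>d a\<close> and the usual relations.
\<close>

type_synonym ('x, 'r) kd = "'x \<Rightarrow> ('x, ('r \<Rightarrow> 'r) set) germ"

definition kd_rels :: "('x, 'r, 'f) over_space \<Rightarrow> 'x set \<Rightarrow> ('r \<Rightarrow> 'r) set"
  where "kd_rels X U = (let R = osec X U; G = free_mod R (carrier R); g = free_gen R in
    {g (a \<oplus>\<^bsub>R\<^esub> b) \<ominus>\<^bsub>G\<^esub> (g a \<oplus>\<^bsub>G\<^esub> g b) | a b. a \<in> carrier R \<and> b \<in> carrier R} \<union>
    {g (a \<otimes>\<^bsub>R\<^esub> b) \<ominus>\<^bsub>G\<^esub> (a \<odot>\<^bsub>G\<^esub> g b \<oplus>\<^bsub>G\<^esub> b \<odot>\<^bsub>G\<^esub> g a) | a b. a \<in> carrier R \<and> b \<in> carrier R} \<union>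
    {g (scal X U c) | c. c \<in> carrier (base X)})"

definition kaehler :: "('x, 'r, 'f) over_space \<Rightarrow> ('x, 'r, ('x, 'r) kd) omod"
  where "kaehler X = sheafify X (pres_presheaf X (\<lambda>U. carrier (osec X U)) (kd_rels X) (ores X))"

definition kd_d :: "('x, 'r, 'f) over_space \<Rightarrow> ('x, 'r, ('x, 'r) kd) fam"
  where "kd_d X U a = pres_gen X (\<lambda>U. carrier (osec X U)) (kd_rels X) (ores X) U a"

text \<open>The natural map to the dual of the tangent sheaf, sending \<open>d a\<close> to evaluation at \<open>a\<close>.\<close>

definition kd_to_tangent_dual :: "('x, 'r, 'f) over_space \<Rightarrow> ('x, ('x, 'r) kd, ('x, ('x, 'r, 'r) fam, 'r) fam) fam"
  where "kd_to_tangent_dual X = (THE \<phi>. \<phi> \<in> mor X (kaehler X) (dual X (tangent X)) \<and>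
    (\<forall>U\<in>opens X (pts X). \<forall>a\<in>carrier (osec X U). \<forall>V\<in>opens X U. \<forall>D\<in>ders X V.
       \<phi> U (kd_d X U a) V D = D V (ores X U V a)))"

section \<open>Kodaira-Spencer sheaf and class\<close>

definition lifts :: "('x, 'r, 'f) over_space \<Rightarrow> ('x, 'r, 'm) omod \<Rightarrow> 'x set \<Rightarrow> ('x, 'r, 'r) fam \<Rightarrow> ('x, 'm, 'm) fam \<Rightarrow> bool"
  where "lifts X E U D T \<longleftrightarrow> T \<in> f_homs X E E U \<and>
    (\<forall>V\<in>opens X U. \<forall>s\<in>carrier (osec X V). \<forall>e\<in>mcar E V.
       T V (s \<odot>\<^bsub>sec E V\<^esub> e) = s \<odot>\<^bsub>sec E V\<^esub> T V e \<oplus>\<^bsub>sec E V\<^esub> D V s \<odot>\<^bsub>sec E V\<^esub> e)"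

text \<open>The condition is local, so that a subsheaf of the tangent sheaf results.\<close>

definition ks_ders :: "('x, 'r, 'f) over_space \<Rightarrow> ('x, 'r, 'm) omod \<Rightarrow> 'x set \<Rightarrow> ('x, 'r, 'r) fam set"
  where "ks_ders X E U = {D \<in> ders X U.
    \<forall>x\<in>U. \<exists>V\<in>opens X U. x \<in> V \<and> (\<exists>T. lifts X E V (restrict D (opens X V)) T)}"

definition ks_sheaf :: "('x, 'r, 'f) over_space \<Rightarrow> ('x, 'r, 'm) omod \<Rightarrow> ('x, 'r, ('x, 'r, 'r) fam) omod"
  where "ks_sheaf X E = fam_sheaf X (ox X) (ox X) (ks_ders X E)"

text \<open>The natural map from the differentials to the dual of the Kodaira-Spencer sheaf.\<close>

definition kd_to_ks_dual :: "('x, 'r, 'f) over_space \<Rightarrow> ('x, 'r, 'm) omod \<Rightarrow>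
    ('x, ('x, 'r) kd, ('x, ('x, 'r, 'r) fam, 'r) fam) fam"
  where "kd_to_ks_dual X E = (\<lambda>U\<in>opens X (pts X). \<lambda>\<omega>\<in>mcar (kaehler X) U.
    \<lambda>V\<in>opens X U. \<lambda>D\<in>ks_ders X E V. kd_to_tangent_dual X U \<omega> V D)"

text \<open>
  An additive choice of lifts, compatible with restriction. The class defined from it below
  does not depend on the choice.
\<close>

definition lift_choice :: "('x, 'r, 'f) over_space \<Rightarrow> ('x, 'r, 'm) omod \<Rightarrow> ('x, ('x, 'r, 'r) fam, ('x, 'm, 'm) fam) fam \<Rightarrow> bool"
  where "lift_choice X E N \<longleftrightarrow>
    (\<forall>U\<in>opens X (pts X). \<forall>D\<in>ks_ders X E U. lifts X E U D (N U D)) \<and>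
    (\<forall>U\<in>opens X (pts X). \<forall>D\<in>ks_ders X E U. \<forall>D'\<in>ks_ders X E U.
       N U (D \<oplus>\<^bsub>sec (ks_sheaf X E) U\<^esub> D') = N U D \<oplus>\<^bsub>sec (f_end_sheaf X E) U\<^esub> N U D') \<and>
    (\<forall>U\<in>opens X (pts X). \<forall>V\<in>opens X U. \<forall>D\<in>ks_ders X E U.
       N V (res (ks_sheaf X E) U V D) = res (f_end_sheaf X E) U V (N U D))"

definition defect :: "('x, 'r, 'f) over_space \<Rightarrow> ('x, 'r, 'm) omod \<Rightarrow> ('x, ('x, 'r, 'r) fam, ('x, 'm, 'm) fam) fam \<Rightarrow>
    'x set \<Rightarrow> 'r \<Rightarrow> ('x, 'r, 'r) fam \<Rightarrow> ('x, 'm, 'm) fam"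
  where "defect X E N U a D =
    a \<odot>\<^bsub>sec (f_end_sheaf X E) U\<^esub> N U D \<ominus>\<^bsub>sec (f_end_sheaf X E) U\<^esub> N U (a \<odot>\<^bsub>sec (ks_sheaf X E) U\<^esub> D)"

definition lr_sheaf :: "('x, 'r, 'f) over_space \<Rightarrow> ('x, 'r, 'm) omod \<Rightarrow> ('x, ('x, 'r, 'r) fam, ('x, 'm, 'm) fam) fam \<Rightarrow>
    ('x, 'r, ('x, 'm, 'm) fam \<times> ('x, 'r, 'r) fam) omod"
  where "lr_sheaf X E N = \<lparr>
    sec = (\<lambda>U. \<lparr>carrier = mcar (end_sheaf X E) U \<times> mcar (ks_sheaf X E) U, mult = undefined, one = undefined,
      zero = (\<zero>\<^bsub>sec (end_sheaf X E) U\<^esub>, \<zero>\<^bsub>sec (ks_sheaf X E) U\<^esub>),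
      add = (\<lambda>(\<phi>, D) (\<phi>', D'). (\<phi> \<oplus>\<^bsub>sec (end_sheaf X E) U\<^esub> \<phi>', D \<oplus>\<^bsub>sec (ks_sheaf X E) U\<^esub> D')),
      smult = (\<lambda>a (\<phi>, D). (a \<odot>\<^bsub>sec (end_sheaf X E) U\<^esub> \<phi> \<oplus>\<^bsub>sec (end_sheaf X E) U\<^esub> defect X E N U a D,
                           a \<odot>\<^bsub>sec (ks_sheaf X E) U\<^esub> D))\<rparr>),
    res = (\<lambda>U V. map_prod (res (end_sheaf X E) U V) (res (ks_sheaf X E) U V))\<rparr>"

definition lr_inc :: "('x, 'r, 'f) over_space \<Rightarrow> ('x, 'r, 'm) omod \<Rightarrow> ('x, ('x, 'm, 'm) fam, ('x, 'm, 'm) fam \<times> ('x, 'r, 'r) fam) fam"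
  where "lr_inc X E = (\<lambda>U\<in>opens X (pts X). \<lambda>\<phi>\<in>mcar (end_sheaf X E) U. (\<phi>, \<zero>\<^bsub>sec (ks_sheaf X E) U\<^esub>))"

definition lr_prj :: "('x, 'r, 'f) over_space \<Rightarrow> ('x, 'r, 'm) omod \<Rightarrow> ('x, ('x, 'm, 'm) fam \<times> ('x, 'r, 'r) fam, ('x, 'r, 'r) fam) fam"
  where "lr_prj X E = (\<lambda>U\<in>opens X (pts X). \<lambda>z\<in>mcar (end_sheaf X E) U \<times> mcar (ks_sheaf X E) U. snd z)"

subsection \<open>First Ext groups as groups of extensions\<close>

text \<open>An extension of \<open>B\<close> by \<open>A\<close> is a triple consisting of \<open>E\<close>, the map from \<open>A\<close> to \<open>E\<close> and the map from \<open>E\<close> to \<open>B\<close>.\<close>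

type_synonym ('x, 'r, 'a, 'e, 'b) ext = "('x, 'r, 'e) omod \<times> ('x, 'a, 'e) fam \<times> ('x, 'e, 'b) fam"

definition extension :: "('x, 'r, 'z) ringed_space_scheme \<Rightarrow> ('x, 'r, 'b) omod \<Rightarrow> ('x, 'r, 'a) omod \<Rightarrow>
    ('x, 'r, 'a, 'e, 'b) ext \<Rightarrow> bool"
  where "extension X B A = (\<lambda>(E, i, p). O_module X E \<and> i \<in> mor X A E \<and> p \<in> mor X E B \<and>
    (\<forall>U\<in>opens X (pts X). inj_on (i U) (mcar A U) \<and>
       i U ` mcar A U = {e \<in> mcar E U. p U e = \<zero>\<^bsub>sec B U\<^esub>} \<and>
       (\<forall>b\<in>mcar B U. \<forall>x\<in>U. \<exists>V\<in>opens X U. x \<in> V \<and> (\<exists>e\<in>mcar E V. p V e = res B U V b))))"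

definition ext_equiv :: "('x, 'r, 'z) ringed_space_scheme \<Rightarrow> ('x, 'r, 'b) omod \<Rightarrow> ('x, 'r, 'a) omod \<Rightarrow>
    ('x, 'r, 'a, 'e, 'b) ext \<Rightarrow> ('x, 'r, 'a, 'k, 'b) ext \<Rightarrow> bool"
  where "ext_equiv X B A = (\<lambda>(E, i, p) (E', i', p'). \<exists>\<phi>. mor_iso X E E' \<phi> \<and>
    mor_comp X A \<phi> i = i' \<and> mor_comp X E p' \<phi> = p)"

text \<open>
  Every extension of \<open>B\<close> by \<open>A\<close>, with sections of any type, is equivalent to one whose sections
  have type \<open>'a \<times> 'b\<close>, since the fibres of the map from \<open>E(U)\<close> to \<open>B(U)\<close> are
  empty or in bijection with \<open>A(U)\<close>. Hence fixing this type in \<open>Ext1 X B A\<close> is no restriction.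
\<close>

definition ext_class :: "('x, 'r, 'z) ringed_space_scheme \<Rightarrow> ('x, 'r, 'b) omod \<Rightarrow> ('x, 'r, 'a) omod \<Rightarrow>
    ('x, 'r, 'a, 'e, 'b) ext \<Rightarrow> ('x, 'r, 'a, 'a \<times> 'b, 'b) ext set"
  where "ext_class X B A \<epsilon> = {\<epsilon>'. extension X B A \<epsilon>' \<and> ext_equiv X B A \<epsilon> \<epsilon>'}"

definition Ext1 :: "('x, 'r, 'z) ringed_space_scheme \<Rightarrow> ('x, 'r, 'b) omod \<Rightarrow> ('x, 'r, 'a) omod \<Rightarrow>
    ('x, 'r, 'a, 'a \<times> 'b, 'b) ext set set"
  where "Ext1 X B A = {ext_class X B A \<epsilon> | \<epsilon> :: ('x, 'r, 'a, 'a \<times> 'b, 'b) ext. extension X B A \<epsilon>}"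

definition KS :: "('x, 'r, 'f) over_space \<Rightarrow> ('x, 'r, 'm) omod \<Rightarrow> ('x, ('x, 'r, 'r) fam, ('x, 'm, 'm) fam) fam \<Rightarrow>
    ('x, 'r, ('x, 'm, 'm) fam, ('x, 'm, 'm) fam \<times> ('x, 'r, 'r) fam, ('x, 'r, 'r) fam) ext set"
  where "KS X E N = ext_class X (ks_sheaf X E) (end_sheaf X E) (lr_sheaf X E N, lr_inc X E, lr_prj X E)"

section \<open>First cohomology and the Chern class\<close>

text \<open>
  The first cohomology of a sheaf of abelian groups \<open>G\<close> (written multiplicatively, with
  restriction maps \<open>r\<close>), as the colimit of first Cech cohomology over all open coverings; in
  degree one this is sheaf cohomology on any space. Coverings are sets of open sets, indexed by
  themselves. A cohomology class is the set of all (covering, 1-cocycle) representing it.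
\<close>

type_synonym ('x, 'g) cech = "'x set set \<times> ('x set \<Rightarrow> 'x set \<Rightarrow> 'g)"

definition covering :: "('x, 'r, 'z) ringed_space_scheme \<Rightarrow> 'x set set \<Rightarrow> bool"
  where "covering X \<U> \<longleftrightarrow> \<U> \<subseteq> opens X (pts X) \<and> \<Union>\<U> = pts X"

definition cocycle :: "('x, 'r, 'z) ringed_space_scheme \<Rightarrow> ('x set \<Rightarrow> ('g, 'w) monoid_scheme) \<Rightarrow>
    ('x set \<Rightarrow> 'x set \<Rightarrow> 'g \<Rightarrow> 'g) \<Rightarrow> ('x, 'g) cech \<Rightarrow> bool"
  where "cocycle X G r = (\<lambda>(\<U>, c). covering X \<U> \<and>
    (\<forall>U\<in>\<U>. \<forall>V\<in>\<U>. c U V \<in> carrier (G (U \<inter> V))) \<and>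
    (\<forall>U\<in>\<U>. \<forall>V\<in>\<U>. \<forall>W\<in>\<U>.
       r (U \<inter> V) (U \<inter> V \<inter> W) (c U V) \<otimes>\<^bsub>G (U \<inter> V \<inter> W)\<^esub> r (V \<inter> W) (U \<inter> V \<inter> W) (c V W) =
       r (U \<inter> W) (U \<inter> V \<inter> W) (c U W)))"

definition cohomologous :: "('x, 'r, 'z) ringed_space_scheme \<Rightarrow> ('x set \<Rightarrow> ('g, 'w) monoid_scheme) \<Rightarrow>
    ('x set \<Rightarrow> 'x set \<Rightarrow> 'g \<Rightarrow> 'g) \<Rightarrow> ('x, 'g) cech \<Rightarrow> ('x, 'g) cech \<Rightarrow> bool"
  where "cohomologous X G r = (\<lambda>(\<U>, c) (\<V>, d). \<exists>\<W> \<sigma> \<tau> b. covering X \<W> \<and>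
    (\<forall>W\<in>\<W>. \<sigma> W \<in> \<U> \<and> W \<subseteq> \<sigma> W \<and> \<tau> W \<in> \<V> \<and> W \<subseteq> \<tau> W \<and> b W \<in> carrier (G W)) \<and>
    (\<forall>W\<in>\<W>. \<forall>W'\<in>\<W>.
       r (\<sigma> W \<inter> \<sigma> W') (W \<inter> W') (c (\<sigma> W) (\<sigma> W')) \<otimes>\<^bsub>G (W \<inter> W')\<^esub> r W' (W \<inter> W') (b W') =
       r W (W \<inter> W') (b W) \<otimes>\<^bsub>G (W \<inter> W')\<^esub> r (\<tau> W \<inter> \<tau> W') (W \<inter> W') (d (\<tau> W) (\<tau> W'))))"

definition H1_class :: "('x, 'r, 'z) ringed_space_scheme \<Rightarrow> ('x set \<Rightarrow> ('g, 'w) monoid_scheme) \<Rightarrow>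
    ('x set \<Rightarrow> 'x set \<Rightarrow> 'g \<Rightarrow> 'g) \<Rightarrow> ('x, 'g) cech \<Rightarrow> ('x, 'g) cech set"
  where "H1_class X G r z = {z'. cocycle X G r z' \<and> cohomologous X G r z z'}"

definition H1 :: "('x, 'r, 'z) ringed_space_scheme \<Rightarrow> ('x set \<Rightarrow> ('g, 'w) monoid_scheme) \<Rightarrow>
    ('x set \<Rightarrow> 'x set \<Rightarrow> 'g \<Rightarrow> 'g) \<Rightarrow> ('x, 'g) cech set set"
  where "H1 X G r = {H1_class X G r z | z. cocycle X G r z}"

abbreviation madd :: "('x, 'r, 'm) omod \<Rightarrow> 'x set \<Rightarrow> 'm monoid"
  where "madd M \<equiv> (\<lambda>U. \<lparr>carrier = mcar M U, mult = add (sec M U), one = zero (sec M U)\<rparr>)"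

abbreviation H1_mod_class where "H1_mod_class X M \<equiv> H1_class X (madd M) (res M)"

abbreviation H1_mod where "H1_mod X M \<equiv> H1 X (madd M) (res M)"

abbreviation units :: "('x, 'r, 'z) ringed_space_scheme \<Rightarrow> 'x set \<Rightarrow> 'r monoid"
  where "units X \<equiv> (\<lambda>U. units_of (osec X U))"

text \<open>The map to the cohomology of the module \<open>M\<close> induced by a homomorphism \<open>f\<close> of sheaves of abelian groups.\<close>

definition H1_map :: "('x, 'r, 'z) ringed_space_scheme \<Rightarrow> ('x, 'r, 'm) omod \<Rightarrow> ('x, 'g, 'm) fam \<Rightarrow>
    ('x, 'g) cech set \<Rightarrow> ('x, 'm) cech set"
  where "H1_map X M f \<xi> = (\<Union>(\<U>, c)\<in>\<xi>. H1_mod_class X M (\<U>, \<lambda>U V. f (U \<inter> V) (c U V)))"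

text \<open>
  The class of a line bundle is given by the cocycle \<open>g\<close> with \<open>e U = g U V e V\<close>
  for local generators \<open>e\<close>. With the opposite convention \<open>e V = g U V e U\<close>, and with the
  connecting map in \<open>ext_to_H1\<close> below left unchanged, a sign would appear when comparing the
  Kodaira-Spencer class with the Chern class.
\<close>

definition pic_class :: "('x, 'r, 'z) ringed_space_scheme \<Rightarrow> ('x, 'r, 'm) omod \<Rightarrow> ('x, 'r) cech set"
  where "pic_class X L = \<Union>{H1_class X (units X) (ores X) (\<U>, g) | \<U> e g. covering X \<U> \<and>
    (\<forall>U\<in>\<U>. e U \<in> mcar L U \<and>
       (\<forall>V\<in>opens X U. bij_betw (\<lambda>a. a \<odot>\<^bsub>sec L V\<^esub> res L U V (e U)) (carrier (osec X V)) (mcar L V))) \<and>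
    (\<forall>U\<in>\<U>. \<forall>V\<in>\<U>. g U V \<in> Units (osec X (U \<inter> V)) \<and>
       res L U (U \<inter> V) (e U) = g U V \<odot>\<^bsub>sec L (U \<inter> V)\<^esub> res L V (U \<inter> V) (e V))}"

definition dlog :: "('x, 'r, 'f) over_space \<Rightarrow> ('x, 'r, ('x, 'r) kd) fam"
  where "dlog X U u = inv\<^bsub>osec X U\<^esub> u \<odot>\<^bsub>sec (kaehler X) U\<^esub> kd_d X U u"

definition chern_class :: "('x, 'r, 'f) over_space \<Rightarrow> ('x, 'r, 'm) omod \<Rightarrow> ('x, ('x, 'r) kd) cech set"
  where "chern_class X L = H1_map X (kaehler X) (dlog X) (pic_class X L)"

definition gen_chern_class :: "('x, 'r, 'f) over_space \<Rightarrow> ('x set \<Rightarrow> ('x, 'r) kd set) \<Rightarrow> ('x, 'r, 'm) omod \<Rightarrow>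
    ('x, 'x \<Rightarrow> ('x, ('x, 'r) kd set) germ) cech set"
  where "gen_chern_class X I L =
    H1_map X (quot_sheaf X (kaehler X) I) (quot_map X (kaehler X) I) (chern_class X L)"

section \<open>The canonical map from Ext to cohomology\<close>

definition ext_tensor :: "('x, 'r, 'z) ringed_space_scheme \<Rightarrow> ('x, 'r, 'b) omod \<Rightarrow> ('x, 'r, 'a) omod \<Rightarrow> ('x, 'r, 'n) omod \<Rightarrow>
    ('x, 'r, 'a, 'e, 'b) ext \<Rightarrow> ('x, 'r, ('x, 'r, 'a, 'n) tns, ('x, 'r, 'e, 'n) tns, ('x, 'r, 'b, 'n) tns) ext"
  where "ext_tensor X B A N = (\<lambda>(E, i, p).
    (tensor X E N, tensor_map X A N E N i (mor_id X N), tensor_map X E N B N p (mor_id X N)))"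

definition ext_pullback :: "('x, 'r, 'z) ringed_space_scheme \<Rightarrow> ('x, 'r, 'c) omod \<Rightarrow> ('x, 'r, 'a) omod \<Rightarrow> ('x, 'c, 'b) fam \<Rightarrow>
    ('x, 'r, 'a, 'e, 'b) ext \<Rightarrow> ('x, 'r, 'a, 'e \<times> 'c, 'c) ext"
  where "ext_pullback X C A g = (\<lambda>(E, i, p).
    let P = (\<lambda>U. {(e, c). e \<in> mcar E U \<and> c \<in> mcar C U \<and> p U e = g U c}) in
    (\<lparr>sec = (\<lambda>U. \<lparr>carrier = P U, mult = undefined, one = undefined,
        zero = (\<zero>\<^bsub>sec E U\<^esub>, \<zero>\<^bsub>sec C U\<^esub>),
        add = (\<lambda>(e, c) (e', c'). (e \<oplus>\<^bsub>sec E U\<^esub> e', c \<oplus>\<^bsub>sec C U\<^esub> c')),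
        smult = (\<lambda>a (e, c). (a \<odot>\<^bsub>sec E U\<^esub> e, a \<odot>\<^bsub>sec C U\<^esub> c))\<rparr>),
      res = (\<lambda>U V. map_prod (res E U V) (res C U V))\<rparr>,
     \<lambda>U\<in>opens X (pts X). \<lambda>a\<in>mcar A U. (i U a, \<zero>\<^bsub>sec C U\<^esub>),
     \<lambda>U\<in>opens X (pts X). \<lambda>z\<in>P U. snd z))"

text \<open>
  The coevaluation from the structure sheaf to \<open>V \<otimes> V\<^sup>*\<close>, for \<open>V\<close> locally free of finite rank:
  multiplication into the endomorphism sheaf of \<open>V\<close>, followed by the inverse of the
  isomorphism \<open>end_contraction\<close>, which sends \<open>v \<otimes> \<lambda>\<close> to the endomorphism \<open>w \<mapsto> \<lambda>(w) v\<close>.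
\<close>

definition end_contraction :: "('x, 'r, 'z) ringed_space_scheme \<Rightarrow> ('x, 'r, 'b) omod \<Rightarrow>
    ('x, ('x, 'r, 'b, ('x, 'b, 'r) fam) tns, ('x, 'b, 'b) fam) fam"
  where "end_contraction X B = tensor_lift X B (dual X B) (end_sheaf X B)
    (\<lambda>U v l. \<lambda>W\<in>opens X U. \<lambda>w\<in>mcar B W. l W w \<odot>\<^bsub>sec B W\<^esub> res B U W v)"

definition coev :: "('x, 'r, 'z) ringed_space_scheme \<Rightarrow> ('x, 'r, 'b) omod \<Rightarrow>
    ('x, 'r, ('x, 'r, 'b, ('x, 'b, 'r) fam) tns) fam"
  where "coev X B = mor_comp X (ox X)
    (mor_inv X (tensor X B (dual X B)) (end_sheaf X B) (end_contraction X B)) (homothety X B)"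

text \<open>The map from \<open>Ext\<^sup>1(B, A)\<close> to \<open>Ext\<^sup>1(O, A \<otimes> B\<^sup>*)\<close>: tensor with the dual of \<open>B\<close> and pull back along coevaluation.\<close>

definition ext_dual_shift :: "('x, 'r, 'z) ringed_space_scheme \<Rightarrow> ('x, 'r, 'b) omod \<Rightarrow> ('x, 'r, 'a) omod \<Rightarrow>
    ('x, 'r, 'a, 'a \<times> 'b, 'b) ext set \<Rightarrow>
    ('x, 'r, ('x, 'r, 'a, ('x, 'b, 'r) fam) tns, ('x, 'r, 'a, ('x, 'b, 'r) fam) tns \<times> 'r, 'r) ext set"
  where "ext_dual_shift X B A \<xi> = (\<Union>\<epsilon>\<in>\<xi>. ext_class X (ox X) (tensor X A (dual X B))
    (ext_pullback X (ox X) (tensor X A (dual X B)) (coev X B) (ext_tensor X B A (dual X B) \<epsilon>)))"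

text \<open>The map on extension classes induced by an isomorphism \<open>f\<close> from \<open>A\<close> to \<open>A'\<close>.\<close>

definition ext_push :: "('x, 'r, 'z) ringed_space_scheme \<Rightarrow> ('x, 'r, 'b) omod \<Rightarrow> ('x, 'r, 'a) omod \<Rightarrow> ('x, 'r, 'k) omod \<Rightarrow>
    ('x, 'a, 'k) fam \<Rightarrow> ('x, 'r, 'a, 'a \<times> 'b, 'b) ext set \<Rightarrow> ('x, 'r, 'k, 'k \<times> 'b, 'b) ext set"
  where "ext_push X B A A' f \<xi> = (\<Union>(E, i, p)\<in>\<xi>.
    ext_class X B A' (E, mor_comp X A' i (mor_inv X A A' f), p))"

text \<open>The canonical isomorphism from \<open>End(L) \<otimes> G\<close> to \<open>G\<close> for a line bundle \<open>L\<close>.\<close>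

definition end_tensor_iso :: "('x, 'r, 'z) ringed_space_scheme \<Rightarrow> ('x, 'r, 'm) omod \<Rightarrow> ('x, 'r, 'n) omod \<Rightarrow>
    ('x, ('x, 'r, ('x, 'm, 'm) fam, 'n) tns, 'n) fam"
  where "end_tensor_iso X L G = tensor_lift X (end_sheaf X L) G G
    (\<lambda>U \<phi> y. mor_inv X (ox X) (end_sheaf X L) (homothety X L) U \<phi> \<odot>\<^bsub>sec G U\<^esub> y)"

text \<open>
  The canonical map from \<open>Ext\<^sup>1(O, G)\<close> to the first cohomology of \<open>G\<close>: local lifts \<open>e\<close> of the section
  1 of the structure sheaf give the cocycle \<open>e V - e U\<close>.
\<close>

definition ext_to_H1 :: "('x, 'r, 'z) ringed_space_scheme \<Rightarrow> ('x, 'r, 'n) omod \<Rightarrow>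
    ('x, 'r, 'n, 'n \<times> 'r, 'r) ext set \<Rightarrow> ('x, 'n) cech set"
  where "ext_to_H1 X G \<xi> = (\<Union>(E, i, p)\<in>\<xi>. \<Union>{H1_mod_class X G (\<U>, c) | \<U> e c. covering X \<U> \<and>
    (\<forall>U\<in>\<U>. e U \<in> mcar E U \<and> p U (e U) = \<one>\<^bsub>osec X U\<^esub>) \<and>
    (\<forall>U\<in>\<U>. \<forall>V\<in>\<U>. c U V \<in> mcar G (U \<inter> V) \<and>
       i (U \<inter> V) (c U V) = res E V (U \<inter> V) (e V) \<ominus>\<^bsub>sec E (U \<inter> V)\<^esub> res E U (U \<inter> V) (e U))})"

text \<open>
  The canonical map of the theorem, for an isomorphism \<open>\<theta>\<close> from \<open>G\<close> to the dual of the Kodaira-Spencer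
  sheaf of \<open>L\<close>.
\<close>

definition psi :: "('x, 'r, 'f) over_space \<Rightarrow> ('x, 'r, 'm) omod \<Rightarrow> ('x, 'r, 'n) omod \<Rightarrow>
    ('x, 'n, ('x, ('x, 'r, 'r) fam, 'r) fam) fam \<Rightarrow>
    ('x, 'r, ('x, 'm, 'm) fam, ('x, 'm, 'm) fam \<times> ('x, 'r, 'r) fam, ('x, 'r, 'r) fam) ext set \<Rightarrow> ('x, 'n) cech set"
  where "psi X L G \<theta> \<xi> = (let A = end_sheaf X L; V = ks_sheaf X L; D = dual X V in
    ext_to_H1 X G
     (ext_push X (ox X) (tensor X A G) G (end_tensor_iso X L G)
       (ext_push X (ox X) (tensor X A D) (tensor X A G)
         (tensor_map X A D A G (mor_id X A) (mor_inv X G D \<theta>))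
         (ext_dual_shift X V A \<xi>))))"

end

theory Submission
 imports Defs
begin

text \<open>
  Choose generators \<open>e U\<close> of \<open>L\<close> over the members \<open>U\<close> of a covering and units with
  \<open>e U = g U V e V\<close>. Over \<open>U\<close> the operator \<open>a (e U) \<mapsto> D(a) (e U)\<close> is a lift of \<open>D\<close> which is linear in
  \<open>D\<close>; subtracting the chosen lift of \<open>D\<close> gives a splitting of the Kodaira-Spencer extension
  over \<open>U\<close>. By the Leibniz rule, the splittings over \<open>V\<close> and \<open>U\<close> differ by multiplication with
  \<open>D(g U V) / g U V\<close>. Local splittings survive tensoring with the dual of the Kodaira-Spencer
  sheaf, and applied to the coevaluation of 1 they are local lifts of 1 in the pulled back
  extension. The resulting cocycle is the contraction of the coevaluation of 1, that is of the
  identity, with the functional \<open>D \<mapsto> D(g U V) / g U V\<close>, hence it is this functional, and the latter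
  is the image of \<open>dlog (g U V)\<close>.
\<close>

text \<open>The definitions evaluate by unions over representatives, by \<open>THE\<close> and by
  sets of equivalent extensions, so each construction must be shown to exist and to be independent
  of choices before it has a value. On the Ext side this is packed into \<open>represents\<close>: a
  nonempty set of extensions all of which produce one and the same Cech cocycle, a property that
  passes through every map composing \<open>psi\<close>. Nonemptiness is a genuine point, because
  \<open>ext_class\<close> fixes the type of the middle term; transport of structure provides a
  member. Local splittings are also what keeps the tensored sequence exact: tensoring preserves
  equations between morphisms, but not exactness in general. The coevaluation is obtained by
  inverting the contraction and is accessible only through it; this is why the last comparison is
  made between two maps on the whole tensor product, tested on pure tensors, and specialized to the
  coevaluation of 1 at the end. The sign comes out right because the convention
  \<open>e U = g U V e V\<close> and the connecting map both lead to the difference \<open>V\<close>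
  minus \<open>U\<close>.\<close>

abbreviation (input) ring_add ("_ +{_} _" [65, 1000, 66] 65) where "a +{R} b \<equiv> a \<oplus>\<^bsub>R\<^esub> b"
abbreviation (input) ring_minus ("_ -{_} _" [65, 1000, 66] 65) where "a -{R} b \<equiv> a \<ominus>\<^bsub>R\<^esub> b"
abbreviation (input) ring_mult ("_ *{_} _" [70, 1000, 71] 70) where "a *{R} b \<equiv> a \<otimes>\<^bsub>R\<^esub> b"
abbreviation (input) module_smult ("_ .{_} _" [70, 1000, 71] 70) where "a .{R} b \<equiv> a \<odot>\<^bsub>R\<^esub> b"
abbreviation (input) ring_zero ("0{_}" [1000] 1000) where "0{R} \<equiv> \<zero>\<^bsub>R\<^esub>"
abbreviation (input) monoid_one ("1{_}" [1000] 1000) where "1{R} \<equiv> \<one>\<^bsub>R\<^esub>"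
abbreviation (input) sec_mem :: "'m => ('x, 'r, 'm) omod => 'x set => bool" ("_ :<_ _>" [51, 1000, 1000] 50)
 where "m :<M U> \<equiv> m \<in> mcar M U"

abbreviation (input) sec_add :: "'m => ('x, 'r, 'm) omod => 'x set => 'm => 'm" ("_ +<_ _> _" [65, 1000, 1000, 66] 65)
 where "a +<M U> b \<equiv> a \<oplus>\<^bsub>sec M U\<^esub> b"
abbreviation (input) sec_minus :: "'m => ('x, 'r, 'm) omod => 'x set => 'm => 'm" ("_ -<_ _> _" [65, 1000, 1000, 66] 65)
 where "a -<M U> b \<equiv> a \<ominus>\<^bsub>sec M U\<^esub> b"
abbreviation (input) sec_smult :: "'r => ('x, 'r, 'm) omod => 'x set => 'm => 'm" ("_ *<_ _> _" [70, 1000, 1000, 71] 70)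
 where "a *<M U> b \<equiv> a \<odot>\<^bsub>sec M U\<^esub> b"
abbreviation (input) sec_zero :: "('x, 'r, 'm) omod => 'x set => 'm" ("0<_ _>" [1000, 1000] 1000)
 where "0<M U> \<equiv> \<zero>\<^bsub>sec M U\<^esub>"

section \<open>Presheaves of modules and their homomorphisms\<close>

lemma opens_iff [simp]: "V : opens X U \<longleftrightarrow> openin (tsp X) V & V <= U"
 by (simp add: opens_def)

text \<open>Free presheaves, quotients and presentations may fail the gluing axiom, so module
  arithmetic is developed for presheaves; adding the sheaf condition gives back
  \<open>O_module\<close>.\<close>

definition pmodule :: "('x, 'r, 'z) ringed_space_scheme => ('x, 'r, 'm) omod => bool"
 where "pmodule X M \<longleftrightarrow>
  presheaf_on (tsp X) (mcar M) (res M) &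
  (\<forall>U. openin (tsp X) U --> module (osec X U) (sec M U)) &
  (\<forall>U V. openin (tsp X) U & V : opens X U -->
   (ALL m:mcar M U. ALL n:mcar M U. res M U V (m +<M U> n) = res M U V m +<M V> res M U V n) &
   (ALL a:carrier (osec X U). ALL m:mcar M U.
     res M U V (a *<M U> m) = ores X U V a *<M V> res M U V m))"

lemma O_module_iff: "O_module X M \<longleftrightarrow> pmodule X M & sheaf_on (tsp X) (mcar M) (res M)"
 unfolding O_module_def pmodule_def sheaf_on_def
 by (rule iffI; elim conjE; intro conjI; assumption)

lemma omod_pmod [simp]: "O_module X M ==> pmodule X M"
 by (simp add: O_module_iff)

text \<open>Elements of \<open>homs\<close> are extensional in both arguments. Cutting a raw family
  down to the open subsets of \<open>U\<close> and their sections puts it into this normal form, so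
  that equality of morphisms becomes equality of functions.\<close>

abbreviation mkfam :: "('x, 'r, 'z) ringed_space_scheme => ('x, 'r, 'm) omod => 'x set => ('x, 'm, 'n) fam => ('x, 'm, 'n) fam"
 where "mkfam X M U f \<equiv> (\<lambda>V\<in>opens X U. \<lambda>m\<in>mcar M V. f V m)"

lemma sheaf_on_ex1:
 assumes "sheaf_on T S r" "!!V. V : C ==> openin T V" "!!V. V : C ==> s V : S V"
  "!!V W. V : C ==> W : C ==> r V (V Int W) (s V) = r W (V Int W) (s W)"
 shows "\<exists>!t. t : S (\<Union>C) & (ALL V:C. r (\<Union>C) V t = s V)"
proof -
 have *: "(ALL V:C. openin T V & s V : S V) & (ALL V:C. ALL W:C. r V (V Int W) (s V) = r W (V Int W) (s W))"
  using assms(2-4) by blast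
 show ?thesis
  by (rule assms(1)[unfolded sheaf_on_def, THEN conjunct2, THEN spec, THEN spec, THEN mp, OF *])
qed

locale rsp =
 fixes X :: "('x, 'r, 'z) ringed_space_scheme"
 assumes ringed: "is_ringed_space X"
begin

abbreviation op :: "'x set => bool" where "op \<equiv> openin (tsp X)"
abbreviation (input) O_mem :: "'r => 'x set => bool" ("_ :<_>" [51, 1000] 50) where "a :<U> \<equiv> a \<in> carrier (osec X U)"
abbreviation (input) "Hom \<equiv> homs X"
abbreviation (input) "pmod \<equiv> pmodule X"
abbreviation (input) "rs \<equiv> ores X"
abbreviation (input) "ops \<equiv> opens X"
abbreviation (input) "fam' \<equiv> mkfam X"
abbreviation (input) "omod \<equiv> O_module X"
abbreviation (input) "tens \<equiv> tensor X"
abbreviation (input) "pt \<equiv> pure_tensor X"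
abbreviation (input) "End \<equiv> end_sheaf X"
abbreviation (input) O_car :: "'x set => 'r set" ("\<O>") where "\<O> U \<equiv> carrier (osec X U)"
abbreviation (input) O_add :: "'r => 'x set => 'r => 'r" ("_ +<_> _" [65, 1000, 66] 65)
 where "a +<U> b \<equiv> a \<oplus>\<^bsub>osec X U\<^esub> b"
abbreviation (input) O_minus :: "'r => 'x set => 'r => 'r" ("_ -<_> _" [65, 1000, 66] 65)
 where "a -<U> b \<equiv> a \<ominus>\<^bsub>osec X U\<^esub> b"
abbreviation (input) O_mult :: "'r => 'x set => 'r => 'r" ("_ *<_> _" [70, 1000, 71] 70)
 where "a *<U> b \<equiv> a \<otimes>\<^bsub>osec X U\<^esub> b"
abbreviation (input) O_zero :: "'x set => 'r" ("0<_>" [1000] 1000) where "0<U> \<equiv> \<zero>\<^bsub>osec X U\<^esub>"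
abbreviation (input) O_one :: "'x set => 'r" ("1<_>" [1000] 1000) where "1<U> \<equiv> \<one>\<^bsub>osec X U\<^esub>"


lemma op_pts [simp]: "op U ==> U <= pts X"
 by (rule openin_subset)

lemma op_Int [simp]: "op U ==> op V ==> op (U Int V)"
 by (rule openin_Int)

lemma op_inD: "op U ==> x : U ==> x : pts X"
 using op_pts by blast

subsection \<open>The structure sheaf\<close>

lemma O_cring: "op U ==> cring (osec X U)"
 using ringed by (simp add: is_ringed_space_def)

lemma O_res_hom: "op U ==> op V ==> V <= U ==> rs U V : ring_hom (osec X U) (osec X V)"
 using ringed by (simp add: is_ringed_space_def)

lemma O_sheaf: "sheaf_on (tsp X) (%U. \<O> U) (rs)"
 using ringed by (simp add: is_ringed_space_def)

context
 fixes U assumes U: "op U"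
begin
interpretation R: cring "osec X U" by (rule O_cring[OF U])
lemma O_closed [simp]:
 "a :<U> ==> b :<U> ==> a +<U> b :<U>"
 "a :<U> ==> b :<U> ==> a *<U> b :<U>"
 "a :<U> ==> b :<U> ==> a -<U> b :<U>"
 "a :<U> ==> \<ominus>\<^bsub>osec X U\<^esub> a :<U>"
 "0<U> :<U>"
 "1<U> :<U>"
 by simp_all
lemma O_mult_unit [simp]:
 "a :<U> ==> a *<U> 1<U> = a"
 "a :<U> ==> 1<U> *<U> a = a"
 by simp_all
end

lemma O_res_closed [simp]:
 "op U ==> op V ==> V <= U ==> a :<U> ==> rs U V a :<V>"
 by (rule ring_hom_closed[OF O_res_hom])

lemma O_res_add [simp]:
 "op U ==> op V ==> V <= U ==> a :<U> ==> b :<U> ==>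
 rs U V (a +<U> b) = rs U V a +<V> rs U V b"
 by (rule ring_hom_add[OF O_res_hom])

lemma O_res_mult [simp]:
 "op U ==> op V ==> V <= U ==> a :<U> ==> b :<U> ==>
 rs U V (a *<U> b) = rs U V a *<V> rs U V b"
 by (rule ring_hom_mult[OF O_res_hom])

lemma O_res_one [simp]:
 "op U ==> op V ==> V <= U ==> rs U V 1<U> = 1<V>"
 by (rule ring_hom_one[OF O_res_hom])

lemma O_res_id [simp]: "op U ==> a :<U> ==> rs U U a = a"
 using O_sheaf by (simp add: sheaf_on_def presheaf_on_def)

lemma O_res_res [simp]:
 "op U ==> op V ==> op W ==> W <= V ==> V <= U ==> a :<U> ==>
 rs V W (rs U V a) = rs U W a"
 using O_sheaf unfolding sheaf_on_def presheaf_on_def by blast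

lemma O_res_zero [simp]:
 assumes "op U" "op V" "V <= U"
 shows "rs U V 0<U> = 0<V>"
using ring_hom_zero[OF O_res_hom[OF assms] cring.axioms(1) cring.axioms(1)] assms O_cring by blast

subsection \<open>Sections of presheaves of modules\<close>

lemma pm_module: "pmod M ==> op U ==> module (osec X U) (sec M U)"
 by (simp add: pmodule_def)

lemma pm_presheaf: "pmod M ==> presheaf_on (tsp X) (mcar M) (res M)"
 by (simp add: pmodule_def)

lemma pm_res [simp]:
 "pmod M ==> op U ==> op V ==> V <= U ==> m :<M U> ==> res M U V m :<M V>"
 using pm_presheaf[of M] by (auto simp: presheaf_on_def Pi_iff)

lemma pm_res_id [simp]: "pmod M ==> op U ==> m :<M U> ==> res M U U m = m"
 using pm_presheaf[of M] by (auto simp: presheaf_on_def Pi_iff)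

lemma pm_res_res [simp]:
 "pmod M ==> op U ==> op V ==> op W ==> W <= V ==> V <= U ==> m :<M U> ==>
 res M V W (res M U V m) = res M U W m"
 using pm_presheaf[of M] by (auto simp: presheaf_on_def Pi_iff)

lemma pm_res_add [simp]:
 "pmod M ==> op U ==> op V ==> V <= U ==> m :<M U> ==> n :<M U> ==>
 res M U V (m +<M U> n) = res M U V m +<M V> res M U V n"
 by (simp add: pmodule_def)

lemma pm_res_smult [simp]:
 "pmod M ==> op U ==> op V ==> V <= U ==> a :<U> ==> m :<M U> ==>
 res M U V (a *<M U> m) = rs U V a *<M V> res M U V m"
 by (simp add: pmodule_def)

context
 fixes M :: "('x, 'r, 'm) omod" and U
 assumes M: "pmod M" and U: "op U"
begin
interpretation M: module "osec X U" "sec M U" by (rule pm_module[OF M U])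
lemma pm_closed [simp]:
 "m :<M U> ==> n :<M U> ==> m +<M U> n :<M U>"
 "m :<M U> ==> n :<M U> ==> m -<M U> n :<M U>"
 "m :<M U> ==> \<ominus>\<^bsub>sec M U\<^esub> m :<M U>"
 "a :<U> ==> m :<M U> ==> a *<M U> m :<M U>"
 "0<M U> :<M U>"
 by simp_all
lemma pm_simps [simp]:
 "m :<M U> ==> m +<M U> 0<M U> = m"
 "m :<M U> ==> 0<M U> +<M U> m = m"
 "m :<M U> ==> 1<U> *<M U> m = m"
 "m :<M U> ==> 0<U> *<M U> m = 0<M U>"
 "a :<U> ==> a *<M U> 0<M U> = 0<M U>"
 "m :<M U> ==> m -<M U> m = 0<M U>"
 by (simp_all add: M.r_neg M.minus_eq)
lemma pm_comm:
 "m :<M U> ==> n :<M U> ==> m +<M U> n = n +<M U> m"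
 by (rule M.a_comm)
lemma pm_neg_eq: "m :<M U> ==> (\<ominus>\<^bsub>osec X U\<^esub> 1<U>) *<M U> m = \<ominus>\<^bsub>sec M U\<^esub> m"
 by (simp add: M.smult_l_minus)
lemma pm_minus_eq: "m -<M U> n = m +<M U> \<ominus>\<^bsub>sec M U\<^esub> n"
 by (rule M.minus_eq)
lemma pm_minus_add: "m :<M U> ==> n :<M U> ==> (m -<M U> n) +<M U> n = m"
 by (simp add: M.minus_eq M.a_assoc M.l_neg)
lemma pm_add_minus: "m :<M U> ==> n :<M U> ==> (m +<M U> n) -<M U> n = m"
 by (simp add: M.minus_eq M.a_assoc M.r_neg)
lemma pm_minus_zero_iff: "m :<M U> ==> n :<M U> ==> m -<M U> n = 0<M U> \<longleftrightarrow> m = n"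
 using pm_minus_add[of m n] by auto
lemma pm_smult_add:
 "a :<U> ==> m :<M U> ==> n :<M U> ==>
 a *<M U> (m +<M U> n) = a *<M U> m +<M U> a *<M U> n"
 "a :<U> ==> b :<U> ==> m :<M U> ==>
 (a +<U> b) *<M U> m = a *<M U> m +<M U> b *<M U> m"
 by (simp_all add: M.smult_r_distr M.smult_l_distr)
lemma pm_smult_smult:
 "a :<U> ==> b :<U> ==> m :<M U> ==>
 a *<M U> (b *<M U> m) = (a *<U> b) *<M U> m"
 by (simp add: M.smult_assoc1)
lemma pm_smult_commute:
 "a :<U> ==> b :<U> ==> m :<M U> ==>
 a *<M U> (b *<M U> m) = b *<M U> (a *<M U> m)"
 by (simp flip: M.smult_assoc1 add: M.R.m_comm)
lemma pm_add_swap: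
 "a :<M U> ==> b :<M U> ==> c :<M U> ==> d :<M U> ==>
 (a +<M U> b) +<M U> (c +<M U> d) = (a +<M U> c) +<M U> (b +<M U> d)"
 by (simp add: M.a_ac)
lemma pm_minus_swap:
 "a :<M U> ==> b :<M U> ==> c :<M U> ==> d :<M U> ==>
 (a +<M U> b) -<M U> (c +<M U> d) = (a -<M U> c) +<M U> (b -<M U> d)"
 by (simp add: M.minus_eq M.minus_add M.a_ac)
lemma pm_smult_minus:
 "a :<U> ==> m :<M U> ==> n :<M U> ==>
 a *<M U> (m -<M U> n) = a *<M U> m -<M U> a *<M U> n"
 by (simp add: M.minus_eq M.smult_r_distr M.smult_r_minus)
end

lemma pm_res_zero [simp]:
 assumes "pmod M" "op U" "op V" "V <= U"
 shows "res M U V 0<M U> = 0<M V>"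
 using pm_res_smult[OF assms, of "0<U>" "0<M U>"] assms by simp

lemma pm_res_neg [simp]:
 assumes "pmod M" "op U" "op V" "V <= U" "m :<M U>"
 shows "res M U V (\<ominus>\<^bsub>sec M U\<^esub> m) = \<ominus>\<^bsub>sec M V\<^esub> res M U V m"
proof -
 interpret N: module "osec X V" "sec M V" using assms by (intro pm_module)
 interpret M: module "osec X U" "sec M U" using assms by (intro pm_module)
 have "res M U V (\<ominus>\<^bsub>sec M U\<^esub> m) +<M V> res M U V m = 0<M V>"
  using assms by (simp flip: pm_res_add add: M.l_neg)
 then show ?thesis using assms by (simp add: N.minus_equality)
qed

lemma pm_res_minus [simp]:
 assumes "pmod M" "op U" "op V" "V <= U" "m :<M U>" "n :<M U>"
 shows "res M U V (m -<M U> n) = res M U V m -<M V> res M U V n"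
 using assms by (simp add: pm_minus_eq)

text \<open>Both sections glue the restrictions of \<open>m\<close> over the cover by all opens on
  which \<open>m\<close> and \<open>n\<close> agree; uniqueness of the glued section identifies
  them.\<close>

lemma sheaf_eqI:
 assumes M: "omod M" and U: "op U" and mn: "m :<M U>" "n :<M U>"
  and loc: "!!x. x : U ==> \<exists>V. op V & x : V & V <= U & res M U V m = res M U V n"
 shows "m = n"
proof -
 let ?C = "{V. op V & V <= U & res M U V m = res M U V n}"
 let ?s = "%V. res M U V m"
 have U': "\<Union>?C = U" using loc by auto
 have "\<exists>!t. t :<M (\<Union>?C)> & (ALL V:?C. res M (\<Union>?C) V t = ?s V)"
  by (rule sheaf_on_ex1) (use M U mn in \<open>auto simp: O_module_iff\<close>)
 then have uniq: "t = t'" if "t :<M U> & (ALL V:?C. res M U V t = res M U V m)"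
   "t' :<M U> & (ALL V:?C. res M U V t' = res M U V m)" for t t'
  unfolding U' using that by blast
 show ?thesis by (rule uniq) (use mn in auto)
qed

text \<open>\<open>sheaf_on\<close> indexes local sections by the open sets themselves. An indexed
  family fits this form because two indices with the same open set carry the same section, by
  agreement on the overlap, which is then the whole set.\<close>

lemma sheaf_glue:
 assumes M: "omod M"
  and W: "!!i. i : J ==> op (W i)" "!!i. i : J ==> s i :<M (W i)>"
  and agree: "!!i j. i : J ==> j : J ==> res M (W i) (W i Int W j) (s i) = res M (W j) (W i Int W j) (s j)"
 obtains t where "t :<M (\<Union>i\<in>J. W i)>" "!!i. i : J ==> res M (\<Union>i\<in>J. W i) (W i) t = s i"
proof -
 let ?C = "W ` J"
 define g where "g V = (SOME i. i : J & W i = V)" for V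
 have g: "g V : J & W (g V) = V" if "V : ?C" for V
  unfolding g_def by (rule someI_ex) (use that in blast)
 have s': "s (g (W i)) = s i" if i: "i : J" for i
 proof -
  define j where "j = g (W i)"
  have j: "j : J" "W j = W i" using g[of "W i"] i by (auto simp: j_def)
  have "res M (W i) (W i) (s j) = res M (W i) (W i) (s i)" using agree[of j i] j i by simp
  then have "s j = s i" using W(1)[OF i] W(2)[OF i] W(2)[OF j(1)] j(2) M by simp
  then show ?thesis by (simp add: j_def)
 qed
 have "\<exists>!t. t :<M (\<Union>?C)> & (ALL V:?C. res M (\<Union>?C) V t = s (g V))"
 proof (rule sheaf_on_ex1)
  show "sheaf_on (tsp X) (mcar M) (res M)" using M by (simp add: O_module_iff)
  show "op V" if "V : ?C" for V using that W by auto
  show "s (g V) :<M V>" if "V : ?C" for V using g[OF that] W(2)[of "g V"] by simp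
  show "res M V (V Int V') (s (g V)) = res M V' (V Int V') (s (g V'))" if "V : ?C" "V' : ?C" for V V'
   using g[OF that(1)] g[OF that(2)] agree[of "g V" "g V'"] by simp
 qed
 then obtain t where t: "t :<M (\<Union>?C)>" "!!V. V : ?C ==> res M (\<Union>?C) V t = s (g V)"
  by (elim ex1E conjE) (erule that, erule bspec)
 show ?thesis
 proof (rule that[OF t(1)])
  show "res M (\<Union>?C) (W i) t = s i" if "i : J" for i
   using t(2)[OF imageI[OF that]] s'[OF that] by (rule trans)
 qed
qed

subsection \<open>The structure sheaf as a module\<close>

lemma ox_simps [simp]:
 "mcar (ox X) U = \<O> U" "add (sec (ox X) U) = add (osec X U)"
 "zero (sec (ox X) U) = zero (osec X U)" "smult (sec (ox X) U) = mult (osec X U)"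
 "res (ox X) = rs"
 by (simp_all add: ox_def)

lemma ox_neg [simp]: "\<ominus>\<^bsub>sec (ox X) U\<^esub> a = \<ominus>\<^bsub>osec X U\<^esub> a"
 by (simp add: a_inv_def m_inv_def)

lemma ox_minus [simp]: "a -<(ox X) U> b = a -<U> b"
 by (simp add: a_minus_def)

lemma ox_finsum [simp]: "finsum (sec (ox X) U) = finsum (osec X U)"
 by (simp add: finsum_def fun_eq_iff finprod_def)

lemma ox_O_module [simp]: "omod (ox X)"
 unfolding O_module_iff pmodule_def
proof (intro conjI allI impI ballI; simp?)
 show "presheaf_on (tsp X) (%U. \<O> U) (rs)" using O_sheaf by (simp add: sheaf_on_def)
 show "sheaf_on (tsp X) (%U. \<O> U) (rs)" by (rule O_sheaf)
 fix U assume U: "op U"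
 interpret R: cring "osec X U" by (rule O_cring[OF U])
 show "module (osec X U) (sec (ox X) U)"
  by (intro moduleI abelian_groupI O_cring U)
   (auto simp: R.l_distr R.r_distr R.a_ac R.m_ac intro: R.add.l_inv_ex)
qed

subsection \<open>Homomorphisms over an open set\<close>

lemma homs_closed:
 "k : Hom M N U ==> op V ==> V <= U ==> m :<M V> ==> k V m :<N V>"
 unfolding homs_def add_fams_def by (auto simp: PiE_def Pi_def)

lemma homs_add:
 "k : Hom M N U ==> op V ==> V <= U ==> m :<M V> ==> n :<M V> ==>
 k V (m +<M V> n) = k V m +<N V> k V n"
 unfolding homs_def add_fams_def by auto

lemma homs_smult:
 "k : Hom M N U ==> op V ==> V <= U ==> a :<V> ==> m :<M V> ==>
 k V (a *<M V> m) = a *<N V> k V m"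
 unfolding homs_def by auto

lemma homs_res:
 "k : Hom M N U ==> op V ==> V <= U ==> op W ==> W <= V ==> m :<M V> ==>
 k W (res M V W m) = res N V W (k V m)"
 unfolding homs_def add_fams_def by auto

lemma homs_extensional:
 "k : Hom M N U ==> k = fam' M U k"
 unfolding homs_def add_fams_def PiE_def extensional_def restrict_def by (auto simp: fun_eq_iff Pi_def)

lemma homs_eqI:
 assumes "p : Hom M N U" "k : Hom M N' U"
  "!!V m. op V ==> V <= U ==> m :<M V> ==> p V m = k V m"
 shows "p = k"
proof -
 have "fam' M U p = fam' M U k"
  by (intro restrict_ext) (simp add: assms(3))
 then show ?thesis
  using homs_extensional[OF assms(1)] homs_extensional[OF assms(2)] by simp
qed

lemma homsI:
 assumes "pmod M"
  "!!V m. op V ==> V <= U ==> m :<M V> ==> f V m :<N V>"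
  "!!V m n. op V ==> V <= U ==> m :<M V> ==> n :<M V> ==>
   f V (m +<M V> n) = f V m +<N V> f V n"
  "!!V a m. op V ==> V <= U ==> a :<V> ==> m :<M V> ==>
   f V (a *<M V> m) = a *<N V> f V m"
  "!!V W m. op V ==> V <= U ==> op W ==> W <= V ==> m :<M V> ==>
   f W (res M V W m) = res N V W (f V m)"
 shows "fam' M U f : Hom M N U"
proof -
 have t: "W <= U" if "W : ops V" "V : ops U" for V W using that by auto
 show ?thesis
  using assms unfolding homs_def add_fams_def by (simp add: PiE_iff) (blast dest: t)
qed

lemma homs_zero:
 assumes "k : Hom M N U" "op V" "V <= U" "pmod M" "pmod N"
 shows "k V 0<M V> = 0<N V>"
 using homs_smult[OF assms(1-3), of "0<V>" "0<M V>"] assms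
 by (simp add: homs_closed[OF assms(1-3)])

lemma homs_neg:
 assumes "k : Hom M N U" "op V" "V <= U" "pmod M" "pmod N" "m :<M V>"
 shows "k V (\<ominus>\<^bsub>sec M V\<^esub> m) = \<ominus>\<^bsub>sec N V\<^esub> k V m"
 using homs_smult[OF assms(1-3), of "\<ominus>\<^bsub>osec X V\<^esub> 1<V>" m] assms
 by (simp add: pm_neg_eq homs_closed[OF assms(1-3)])

lemma homs_minus:
 assumes "k : Hom M N U" "op V" "V <= U" "pmod M" "pmod N" "m :<M V>" "n :<M V>"
 shows "k V (m -<M V> n) = k V m -<N V> k V n"
 using assms by (simp add: pm_minus_eq homs_add[OF assms(1-3)] homs_neg[OF assms(1-5)])

lemma homs_finsum:
 assumes "k : Hom M N U" "op V" "V <= U" "pmod M" "pmod N"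
  "finite A" "f : A \<rightarrow> mcar M V"
 shows "k V (finsum (sec M V) f A) = finsum (sec N V) (%i. k V (f i)) A"
proof -
 interpret M: module "osec X V" "sec M V" using assms by (intro pm_module)
 interpret N: module "osec X V" "sec N V" using assms by (intro pm_module)
 show ?thesis using assms(6,7)
 proof (induction A)
  case (insert x F)
  then have "(%i. k V (f i)) : F \<rightarrow> mcar N V" "k V (f x) :<N V>"
   using assms by (auto simp: Pi_def homs_closed[OF assms(1-3)])
  with insert show ?case using assms by (simp add: homs_add[OF assms(1-3)])
 qed (use assms in \<open>simp add: homs_zero[OF assms(1-3)]\<close>)
qed

lemma homs_restrict:
 assumes "k : Hom M N U" "op V" "V <= U"
 shows "restrict k (ops V) : Hom M N V"
proof -
 have t: "W <= V" if "W : ops W'" "W' : ops V" for W W' using that by auto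
 have t': "W <= V ==> W <= U" for W using assms by blast
 show ?thesis
  using assms(1,2) unfolding homs_def add_fams_def by (simp add: PiE_iff t') (blast dest: t)
qed

lemma homs_comp:
 assumes "p : Hom M N U" "k : Hom N K U" "pmod M"
 shows "fam' M U (%V m. k V (p V m)) : Hom M K U"
 using assms
 by (intro homsI) (auto simp: homs_closed[of _ _ _ U] homs_add[of _ _ _ U] homs_smult[of _ _ _ U] homs_res[of _ _ _ U])

lemma mor_comp_hom:
 "p : mor X M N ==> k : mor X N K ==> pmod M ==> mor_comp X M k p : mor X M K"
 unfolding mor_comp_def by (rule homs_comp)

lemma mor_comp_apply [simp]:
 "op V ==> m :<M V> ==> mor_comp X M k p V m = k V (p V m)"
 by (simp add: mor_comp_def)

lemma homs_id: "pmod M ==> fam' M U (%V m. m) : Hom M M U"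
 by (intro homsI) auto

lemma mor_id_hom [simp]: "pmod M ==> mor_id X M : mor X M M"
 unfolding mor_id_def by (rule homs_id)

lemma mor_id_apply [simp]: "op V ==> m :<M V> ==> mor_id X M V m = m"
 by (simp add: mor_id_def)

lemma homs_sum:
 assumes "p : Hom M N U" "k : Hom M N U" "pmod M" "pmod N"
 shows "fam' M U (%V m. p V m +<N V> k V m) : Hom M N U"
 using assms
 by (intro homsI)
  (auto simp: homs_closed[of _ _ _ U] homs_add[of _ _ _ U] homs_smult[of _ _ _ U] homs_res[of _ _ _ U] pm_add_swap pm_smult_add)

end

subsection \<open>Sheaves of families of maps\<close>

lemma sheaf_onI:
 assumes "presheaf_on T S r"
  and "!!C s. \<lbrakk>!!V. V : C ==> openin T V; !!V. V : C ==> s V : S V;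
   !!V W. V : C ==> W : C ==> r V (V Int W) (s V) = r W (V Int W) (s W)\<rbrakk> \<Longrightarrow>
   EX t:S (\<Union>C). ALL V:C. r (\<Union>C) V t = s V"
  and "!!C t t'. \<lbrakk>!!V. V : C ==> openin T V; t : S (\<Union>C); t' : S (\<Union>C);
   !!V. V : C ==> r (\<Union>C) V t = r (\<Union>C) V t'\<rbrakk> \<Longrightarrow> t = t'"
 shows "sheaf_on T S r"
 unfolding sheaf_on_def
proof (intro conjI allI impI)
 show "presheaf_on T S r" by fact
 fix C s
 assume *: "(ALL V:C. openin T V & s V : S V) & (ALL V:C. ALL W:C. r V (V Int W) (s V) = r W (V Int W) (s W))"
 have "EX t:S (\<Union>C). ALL V:C. r (\<Union>C) V t = s V" by (rule assms(2)) (use * in blast)+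
 then obtain t where t: "t : S (\<Union>C)" "!!V. V : C ==> r (\<Union>C) V t = s V" by blast
 show "\<exists>!t. t : S (\<Union>C) & (ALL V:C. r (\<Union>C) V t = s V)"
 proof (rule ex1I[of _ t])
  show "t : S (\<Union>C) & (ALL V:C. r (\<Union>C) V t = s V)" using t by blast
  show "t' = t" if "t' : S (\<Union>C) & (ALL V:C. r (\<Union>C) V t' = s V)" for t'
   by (rule assms(3)[of C]) (use * that t in auto)
 qed
qed

lemma fam_sheaf_simps [simp]:
 "mcar (fam_sheaf X M N C) U = C U"
 "0<(fam_sheaf X M N C) U> = mkfam X M U (%V m. 0<N V>)"
 "k +<(fam_sheaf X M N C) U> p = mkfam X M U (%V m. k V m +<N V> p V m)"
 "a *<(fam_sheaf X M N C) U> k = mkfam X M U (%V m. ores X U V a *<N V> k V m)"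
 "res (fam_sheaf X M N C) = (%U V k. restrict k (opens X V))"
 by (simp_all add: fam_sheaf_def)

lemma opens_Int_subset: "W <= V ==> opens X V Int opens X W = opens X W"
 unfolding opens_def by blast

context rsp
begin

definition fams :: "('x, 'r, 'm) omod => ('x, 'r, 'n) omod => 'x set => ('x, 'm, 'n) fam set"
 where "fams M N U = (\<Pi>\<^sub>E V\<in>ops U. mcar M V \<rightarrow>\<^sub>E mcar N V)"

lemma fams_closed: "k : fams M N U ==> op V ==> V <= U ==> m :<M V> ==> k V m :<N V>"
 unfolding fams_def by (auto simp: PiE_def Pi_def)

lemma fams_extensional: "k : fams M N U ==> fam' M U k = k"
 unfolding fams_def PiE_def extensional_def restrict_def by (auto simp: fun_eq_iff Pi_def)

lemma add_fams_fams: "add_fams X M N U <= fams M N U"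
 unfolding add_fams_def fams_def by blast

lemma homs_add_fams: "Hom M N U <= add_fams X M N U"
 unfolding homs_def by blast

lemma homs_fams: "Hom M N U <= fams M N U"
 using add_fams_fams homs_add_fams by blast

text \<open>Serves homomorphisms, F-linear endomorphisms and derivations at once. Closure of
  \<open>C\<close> under negatives comes from \<open>smult\<close> with the scalar -1.\<close>

lemma fam_sheaf_pmodule:
 assumes N: "pmod N" and C: "!!U. op U ==> C U <= fams M N U"
  and zero: "!!U. op U ==> fam' M U (%V m. 0<N V>) : C U"
  and add: "!!U k p. op U ==> k : C U ==> p : C U ==> fam' M U (%V m. k V m +<N V> p V m) : C U"
  and smult: "!!U a k. op U ==> a :<U> ==> k : C U ==>
   fam' M U (%V m. rs U V a *<N V> k V m) : C U"
  and restr: "!!U V k. op U ==> op V ==> V <= U ==> k : C U ==> restrict k (ops V) : C V"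
 shows "pmod (fam_sheaf X M N C)"
proof -
 have cl: "k V m :<N V>" if "k : C U" "op U" "op V" "V <= U" "m :<M V>" for k U V m
  by (rule fams_closed[OF subsetD[OF C[OF that(2)] that(1)] that(3-5)])
 have ext: "fam' M U k = k" if "k : C U" "op U" for k U
  by (rule fams_extensional[OF subsetD[OF C[OF that(2)] that(1)]])
 let ?F = "fam_sheaf X M N C"
 have presheaf: "presheaf_on (tsp X) (mcar ?F) (res ?F)"
  unfolding presheaf_on_def fam_sheaf_simps
 proof (intro conjI allI impI funcsetI ballI)
  show "restrict k (ops V) : C V" if "op U & op V & V <= U" "k : C U" for U V k
   using that restr by blast
  show "restrict k (ops U) = k" if "op U" "k : C U" for U k
   using C[OF that(1)] that(2) unfolding fams_def PiE_def by (auto intro: extensional_restrict)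
  show "restrict (restrict k (ops V)) (ops W) = restrict k (ops W)"
   if "op U & op V & op W & W <= V & V <= U" for U V W k
   using that by (simp add: restrict_restrict opens_Int_subset)
 qed
 have module: "module (osec X U) (sec ?F U)" if U: "op U" for U
 proof (intro moduleI abelian_groupI O_cring U; unfold fam_sheaf_simps)
  show "fam' M U (%V m. 0<N V>) : C U" by (rule zero[OF U])
  fix k p q a b
  assume *: "k : C U"
  note clk = cl[OF * U] and e = ext[OF * U]
  show "fam' M U (%V m. fam' M U (%V m. 0<N V>) V m +<N V> k V m) = k"
   by (subst (2) e[symmetric], intro restrict_ext) (simp add: clk N)
  show "fam' M U (%V m. rs U V 1<U> *<N V> k V m) = k"
   by (subst (2) e[symmetric], intro restrict_ext) (simp add: clk N U)
  show "EX p:C U. fam' M U (%V m. p V m +<N V> k V m) = fam' M U (%V m. 0<N V>)"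
  proof (rule bexI[of _ "fam' M U (%V m. rs U V (\<ominus>\<^bsub>osec X U\<^esub> 1<U>) *<N V> k V m)"])
   show "fam' M U (%V m. rs U V (\<ominus>\<^bsub>osec X U\<^esub> 1<U>) *<N V> k V m) : C U"
    by (rule smult) (use * U in auto)
   show "fam' M U (%V m. fam' M U (%V m. rs U V (\<ominus>\<^bsub>osec X U\<^esub> 1<U>) *<N V> k V m) V m
     +<N V> k V m) = fam' M U (%V m. 0<N V>)"
   proof (intro restrict_ext)
    fix V m assume V: "V : ops U" and m: "m :<M V>"
    interpret N: module "osec X V" "sec N V" using V N by (intro pm_module) auto
    have "rs U V (\<ominus>\<^bsub>osec X U\<^esub> 1<U>) = \<ominus>\<^bsub>osec X V\<^esub> 1<V>"
     using V U pm_res_neg[of "ox X" U V "1<U>"] by simp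
    then show "fam' M U (%V m. rs U V (\<ominus>\<^bsub>osec X U\<^esub> 1<U>) *<N V> k V m) V m
     +<N V> k V m = 0<N V>"
     using V m N by (simp add: clk pm_neg_eq N.l_neg)
   qed
  qed
  {
   assume a: "a :<U>"
   then show "fam' M U (%V m. rs U V a *<N V> k V m) : C U" by (rule smult[OF U]) fact
   assume b: "b :<U>"
   show "fam' M U (%V m. rs U V (a +<U> b) *<N V> k V m) =
    fam' M U (%V m. fam' M U (%V m. rs U V a *<N V> k V m) V m +<N V>
     fam' M U (%V m. rs U V b *<N V> k V m) V m)"
    by (intro restrict_ext) (use a b U N in \<open>simp add: pm_smult_add clk\<close>)
   show "fam' M U (%V m. rs U V (a *<U> b) *<N V> k V m) =
    fam' M U (%V m. rs U V a *<N V> fam' M U (%V m. rs U V b *<N V> k V m) V m)"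
    by (intro restrict_ext) (use a b U N in \<open>simp add: pm_smult_smult clk\<close>)
  }
  assume **: "p : C U"
  note clp = cl[OF ** U]
  show "fam' M U (%V m. k V m +<N V> p V m) : C U" by (rule add[OF U * **])
  show "fam' M U (%V m. k V m +<N V> p V m) = fam' M U (%V m. p V m +<N V> k V m)"
   by (intro restrict_ext) (use N U in \<open>simp add: pm_comm clk clp\<close>)
  {
   assume a: "a :<U>"
   show "fam' M U (%V m. rs U V a *<N V> fam' M U (%V m. k V m +<N V> p V m) V m) =
    fam' M U (%V m. fam' M U (%V m. rs U V a *<N V> k V m) V m +<N V>
     fam' M U (%V m. rs U V a *<N V> p V m) V m)"
    by (intro restrict_ext) (use a U N in \<open>simp add: pm_smult_add clk clp\<close>)
  }
  assume ***: "q : C U"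
  note clq = cl[OF *** U]
  show "fam' M U (%V m. fam' M U (%V m. k V m +<N V> p V m) V m +<N V> q V m) =
   fam' M U (%V m. k V m +<N V> fam' M U (%V m. p V m +<N V> q V m) V m)"
  proof (intro restrict_ext)
   fix V m assume V: "V : ops U" and m: "m :<M V>"
   interpret N: module "osec X V" "sec N V" using V N by (intro pm_module) auto
   show "fam' M U (%V m. k V m +<N V> p V m) V m +<N V> q V m =
    k V m +<N V> fam' M U (%V m. p V m +<N V> q V m) V m"
    using V m by (simp add: clk clp clq N.a_assoc)
  qed
 qed
 have res: "(ALL k:C U. ALL p:C U. restrict (fam' M U (%V m. k V m +<N V> p V m)) (ops V) =
    fam' M V (%W m. restrict k (ops V) W m +<N W> restrict p (ops V) W m)) &
   (ALL a:\<O> U. ALL k:C U. restrict (fam' M U (%V m. rs U V a *<N V> k V m)) (ops V) =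
    fam' M V (%W m. rs V W (rs U V a) *<N W> restrict k (ops V) W m))"
  if "op U" "op V" "V <= U" for U V
 proof -
  have sub: "W <= U" if "W <= V" for W using that \<open>V <= U\<close> by blast
  show ?thesis unfolding restrict_restrict opens_Int_subset[OF that(3)]
   by (intro conjI ballI restrict_ext) (use that sub in simp_all)
 qed
 show ?thesis
  unfolding pmodule_def
 proof (intro conjI allI impI)
  show "presheaf_on (tsp X) (mcar ?F) (res ?F)" by (rule presheaf)
  show "module (osec X U) (sec ?F U)" if "op U" for U by (rule module[OF that])
  fix U V assume "op U & V : ops U"
  then have "op U" "op V" "V <= U" by auto
  note r = res[OF this]
  show "ALL k:mcar ?F U. ALL p:mcar ?F U. res ?F U V (k +<?F U> p) = res ?F U V k +<?F V> res ?F U V p"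
   unfolding fam_sheaf_simps by (rule conjunct1[OF r])
  show "ALL a:\<O> U. ALL k:mcar ?F U. res ?F U V (a *<?F U> k) = rs U V a *<?F V> res ?F U V k"
   unfolding fam_sheaf_simps by (rule conjunct2[OF r])
 qed
qed

subsection \<open>The sheaf of homomorphisms\<close>

lemma homs_zero_fam: "pmod M ==> pmod N ==> fam' M U (%V m. 0<N V>) : Hom M N U"
 by (intro homsI) auto

lemma homs_smult_fam:
 assumes "op U" "a :<U>" "k : Hom M N U" "pmod M" "pmod N"
 shows "fam' M U (%V m. rs U V a *<N V> k V m) : Hom M N U"
proof (rule homsI)
 fix V W m assume V: "op V" "V <= U" "op W" "W <= V" "m :<M V>"
 then have "W <= U" by blast
 then show "rs U W a *<N W> k W (res M V W m) = res N V W (rs U V a *<N V> k V m)"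
  using assms V by (simp add: homs_res[OF assms(3)] homs_closed[OF assms(3)])
qed (use assms in \<open>auto simp: homs_closed[OF assms(3)] homs_add[OF assms(3)] homs_smult[OF assms(3)]
  pm_smult_add pm_smult_commute\<close>)

lemma hom_sheaf_pmodule [simp]:
 assumes "pmod M" "pmod N"
 shows "pmod (hom_sheaf X M N)"
 unfolding hom_sheaf_def using assms homs_fams
 by (intro fam_sheaf_pmodule)
  (auto intro: homs_zero_fam homs_sum homs_smult_fam homs_restrict)

text \<open>The value at a section \<open>m\<close> over \<open>W\<close> is glued from the values
  of \<open>s V\<close> at the restrictions of \<open>m\<close> to \<open>W Int V\<close>. Since
  \<open>N\<close> is a sheaf, the glued value is unique, and additivity, linearity and
  compatibility with restriction all follow from this uniqueness.\<close>

lemma homs_glue: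
 assumes M: "pmod M" and N: "omod N"
  and C: "!!V. V : C ==> op V" and s: "!!V. V : C ==> s V : Hom M N V"
  and agree: "!!V W Y m. V : C ==> W : C ==> op Y ==> Y <= V ==> Y <= W ==> m :<M Y> ==> s V Y m = s W Y m"
 obtains t where "t : Hom M N (\<Union>C)"
  "!!V W m. V : C ==> op W ==> W <= V ==> m :<M W> ==> t W m = s V W m"
proof -
 define P where "P W m n \<longleftrightarrow> n :<N W> &
  (ALL V:C. res N W (W Int V) n = s V (W Int V) (res M W (W Int V) m))" for W m n
 have ex: "\<exists>n. P W m n" if W: "op W" "W <= \<Union>C" "m :<M W>" for W m
 proof -
  have U: "(\<Union>V\<in>C. W Int V) = W" using W(2) by blast
  obtain n where "n :<N (\<Union>V\<in>C. W Int V)>"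
   "!!V. V : C ==> res N (\<Union>V\<in>C. W Int V) (W Int V) n = s V (W Int V) (res M W (W Int V) m)"
  proof (rule sheaf_glue[OF N, of C "%V. W Int V" "%V. s V (W Int V) (res M W (W Int V) m)"])
   show "op (W Int V)" if "V : C" for V using W C[OF that] by simp
   show "s V (W Int V) (res M W (W Int V) m) :<N (W Int V)>" if "V : C" for V
    by (rule homs_closed[OF s[OF that]]) (use W C[OF that] M in auto)
   show "res N (W Int V) (W Int V Int (W Int V')) (s V (W Int V) (res M W (W Int V) m)) =
    res N (W Int V') (W Int V Int (W Int V')) (s V' (W Int V') (res M W (W Int V') m))"
    if V: "V : C" "V' : C" for V V'
   proof -
    let ?Y = "W Int V Int (W Int V')"
    have Y: "op ?Y" "?Y <= W Int V" "?Y <= W Int V'" using W(1) C[OF V(1)] C[OF V(2)] by auto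
    have "res N (W Int V) ?Y (s V (W Int V) (res M W (W Int V) m)) = s V ?Y (res M W ?Y m)"
     using homs_res[OF s[OF V(1)], of "W Int V" ?Y "res M W (W Int V) m"] Y C[OF V(1)] W M
     by simp
    moreover have "res N (W Int V') ?Y (s V' (W Int V') (res M W (W Int V') m)) = s V' ?Y (res M W ?Y m)"
     using homs_res[OF s[OF V(2)], of "W Int V'" ?Y "res M W (W Int V') m"] Y C[OF V(2)] W M
     by simp
    moreover have "s V ?Y (res M W ?Y m) = s V' ?Y (res M W ?Y m)"
     by (rule agree[OF V]) (use Y W M in auto)
    ultimately show ?thesis by simp
   qed
  qed blast
  then show ?thesis unfolding U P_def by blast
 qed
 have uniq: "n = n'" if W: "op W" "W <= \<Union>C" and P: "P W m n" "P W m n'" for W m n n'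
 proof (rule sheaf_eqI[OF N W(1)])
  show "n :<N W>" "n' :<N W>" using P by (simp_all add: P_def)
  fix x assume "x : W"
  then obtain V where V: "V : C" "x : V" using W(2) by blast
  have "res N W (W Int V) n = res N W (W Int V) n'" using P V(1) by (simp add: P_def)
  then show "\<exists>V. op V & x : V & V <= W & res N W V n = res N W V n'"
   using V \<open>x : W\<close> W(1) C by (intro exI[of _ "W Int V"]) auto
 qed
 define g where "g W m = (SOME n. P W m n)" for W m
 have g: "P W m (g W m)" if "op W" "W <= \<Union>C" "m :<M W>" for W m
  unfolding g_def by (rule someI_ex) (rule ex[OF that])
 have geq: "g W m = n" if "op W" "W <= \<Union>C" "m :<M W>" "P W m n" for W m n
  by (rule uniq[OF that(1,2) g[OF that(1-3)] that(4)])
 have gN: "g W m :<N W>" if "op W" "W <= \<Union>C" "m :<M W>" for W m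
  using g[OF that] by (simp add: P_def)
 have gres: "res N W (W Int V) (g W m) = s V (W Int V) (res M W (W Int V) m)"
  if "op W" "W <= \<Union>C" "m :<M W>" "V : C" for W m V
  using g[OF that(1-3)] that(4) by (simp add: P_def)
 have N': "pmod N" using N by simp
 have hom: "fam' M (\<Union>C) g : Hom M N (\<Union>C)"
 proof (rule homsI[OF M])
  fix W m assume W: "op W" "W <= \<Union>C" and m: "m :<M W>"
  show "g W m :<N W>" by (rule gN[OF W m])
  show "g W (m +<M W> n) = g W m +<N W> g W n" if n: "n :<M W>" for n
  proof (rule geq[OF W])
   show "P W (m +<M W> n) (g W m +<N W> g W n)"
    unfolding P_def using gN[OF W] gres[OF W] W m n M N' C
    by (simp add: homs_add[OF s])
  qed (use M m n W in simp)
  show "g W (a *<M W> m) = a *<N W> g W m" if a: "a :<W>" for a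
  proof (rule geq[OF W])
   show "P W (a *<M W> m) (a *<N W> g W m)"
    unfolding P_def using gN[OF W] gres[OF W] W m a M N' C
    by (simp add: homs_smult[OF s])
  qed (use M m a W in simp)
  fix W' assume W': "op W'" "W' <= W"
  have W'C: "W' <= \<Union>C" using W W' by blast
  show "g W' (res M W W' m) = res N W W' (g W m)"
  proof (rule geq[OF W'(1) W'C])
   show "P W' (res M W W' m) (res N W W' (g W m))"
    unfolding P_def
   proof (intro conjI ballI)
    show "res N W W' (g W m) :<N W'>" using gN[OF W m] W W' N' by simp
    fix V assume V: "V : C"
    have sub: "W' Int V <= W Int V" using W' by blast
    have "res N W' (W' Int V) (res N W W' (g W m)) = res N (W Int V) (W' Int V) (res N W (W Int V) (g W m))"
     using gN[OF W m] W W' N' C[OF V] sub by simp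
    also have "\<dots> = res N (W Int V) (W' Int V) (s V (W Int V) (res M W (W Int V) m))"
     by (simp add: gres[OF W m V])
    also have "\<dots> = s V (W' Int V) (res M (W Int V) (W' Int V) (res M W (W Int V) m))"
     by (rule homs_res[OF s[OF V], symmetric]) (use W W' C[OF V] M m in auto)
    also have "res M (W Int V) (W' Int V) (res M W (W Int V) m) = res M W' (W' Int V) (res M W W' m)"
     using W W' C[OF V] M m sub by simp
    finally show "res N W' (W' Int V) (res N W W' (g W m)) = s V (W' Int V) (res M W' (W' Int V) (res M W W' m))" .
   qed
  qed (use M m W W' in simp)
 qed
 show thesis
 proof (rule that[OF hom])
  fix V W m assume *: "V : C" "op W" "W <= V" "m :<M W>"
  then have W: "W <= \<Union>C" "W Int V = W" by auto
  have "res N W W (g W m) = s V W (res M W W m)"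
   using gres[OF *(2) W(1) *(4) *(1)] W(2) by simp
  then show "fam' M (\<Union>C) g W m = s V W m"
   using * W gN[OF *(2) W(1) *(4)] M N' by simp
 qed
qed

lemma restrict_opens_eqD:
 "restrict p (ops V) = restrict k (ops V) ==> op W ==> W <= V ==> p W = k W"
 by (metis opens_iff restrict_apply')

lemma hom_sheaf_O_module [simp]:
 assumes M: "pmod M" and N: "omod N"
 shows "omod (hom_sheaf X M N)"
proof -
 have N': "pmod N" using N by simp
 have "sheaf_on (tsp X) (Hom M N) (%U V k. restrict k (ops V))"
 proof (rule sheaf_onI)
  have "presheaf_on (tsp X) (mcar (hom_sheaf X M N)) (res (hom_sheaf X M N))"
   by (intro pm_presheaf hom_sheaf_pmodule M N')
  then show "presheaf_on (tsp X) (Hom M N) (%U V k. restrict k (ops V))"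
   by (simp add: hom_sheaf_def)
 next
  fix C s assume C: "!!V. V : C ==> op V" and s: "!!V. V : C ==> s V : Hom M N V"
   and agree: "!!V W. V : C ==> W : C ==> restrict (s V) (ops (V Int W)) = restrict (s W) (ops (V Int W))"
  obtain t where t: "t : Hom M N (\<Union>C)"
   "!!V W m. V : C ==> op W ==> W <= V ==> m :<M W> ==> t W m = s V W m"
  proof (rule homs_glue[OF M N, of C s])
   show "s V Y m = s W Y m" if "V : C" "W : C" "op Y" "Y <= V" "Y <= W" for V W Y m
    using restrict_opens_eqD[OF agree[OF that(1,2)] that(3)] that(4,5) by simp
  qed (use C s in blast)+
  show "EX t:Hom M N (\<Union>C). ALL V:C. restrict t (ops V) = s V"
  proof (intro bexI[OF _ t(1)] ballI)
   fix V assume V: "V : C"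
   show "restrict t (ops V) = s V"
    by (rule homs_eqI[OF homs_restrict[OF t(1)] s]) (use V C t(2) in auto)
  qed
 next
  fix C t t' assume C: "!!V. V : C ==> op V" and t: "t : Hom M N (\<Union>C)" "t' : Hom M N (\<Union>C)"
   and agree: "!!V. V : C ==> restrict t (ops V) = restrict t' (ops V)"
  show "t = t'"
  proof (rule homs_eqI[OF t])
   fix W m assume W: "op W" "W <= \<Union>C" "m :<M W>"
   show "t W m = t' W m"
   proof (rule sheaf_eqI[OF N W(1)])
    show "t W m :<N W>" "t' W m :<N W>" using homs_closed[OF _ W] t by blast+
    fix x assume x: "x : W"
    then obtain V where V: "V : C" "x : V" using W(2) by blast
    have "t (W Int V) (res M W (W Int V) m) = t' (W Int V) (res M W (W Int V) m)"
     using restrict_opens_eqD[OF agree[OF V(1)], of "W Int V"] W C[OF V(1)] by simp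
    then have "res N W (W Int V) (t W m) = res N W (W Int V) (t' W m)"
     using homs_res[OF t(1) W(1,2)] homs_res[OF t(2) W(1,2)] W C[OF V(1)] by simp
    then show "\<exists>V. op V & x : V & V <= W & res N W V (t W m) = res N W V (t' W m)"
     using V x W C by (intro exI[of _ "W Int V"]) auto
   qed
  qed
 qed
 then show ?thesis
  unfolding O_module_iff using hom_sheaf_pmodule[OF M N'] by (simp add: hom_sheaf_def)
qed

lemma hom_simps [simp]:
 "mcar (hom_sheaf X M N) U = Hom M N U"
 "0<(hom_sheaf X M N) U> = fam' M U (%V m. 0<N V>)"
 "k +<(hom_sheaf X M N) U> p = fam' M U (%V m. k V m +<N V> p V m)"
 "a *<(hom_sheaf X M N) U> k = fam' M U (%V m. rs U V a *<N V> k V m)"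
 "res (hom_sheaf X M N) = (%U V k. restrict k (ops V))"
 by (simp_all add: hom_sheaf_def)

end

section \<open>Sheafification\<close>

text \<open>Operations on germs and cosets and the maps between cohomology or Ext classes are
  defined as unions over representatives. Such a union has the expected value as soon as every
  representative gives it and at least one representative exists.\<close>

lemma UN_eq_const: "A ~= {} ==> (!!a. a : A ==> F a = c) ==> \<Union>(F ` A) = c"
 by auto

lemma sheafify_simps:
 "mcar (sheafify X P) U = {s : extensional U. ALL x:U. EX V:opens X U. x : V & (EX m:mcar P V. ALL y:V. s y = germ X P y V m)}"
 "0<(sheafify X P) U> = (\<lambda>x\<in>U. germ X P x U 0<P U>)"
 "s +<(sheafify X P) U> t = (\<lambda>x\<in>U. \<Union>(V, m)\<in>s x. \<Union>(W, n)\<in>t x.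
       germ X P x (V Int W) (res P V (V Int W) m +<P (V Int W)> res P W (V Int W) n))"
 "a *<(sheafify X P) U> s = (\<lambda>x\<in>U. \<Union>(V, m)\<in>s x.
       germ X P x (U Int V) (ores X U (U Int V) a *<P (U Int V)> res P V (U Int V) m))"
 by (simp_all add: sheafify_def)

lemma sheafify_res [simp]: "res (sheafify X P) = (%U V s. restrict s V)"
 by (simp add: sheafify_def)

context rsp
begin

text \<open>Makes sections of a sheafification computable: on \<open>V\<close> the function
  \<open>s\<close> of germs comes from a single section \<open>m\<close> of the presheaf, and the
  module operations can be carried out on such sections.\<close>

definition reps :: "('x, 'r, 'p) omod => ('x => ('x, 'p) germ) => 'x set => 'p => bool"
 where "reps P s V m \<longleftrightarrow> op V & m :<P V> & (ALL y:V. s y = germ X P y V m)"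

lemma sheafify_carrier:
 "s :<(sheafify X P) U> \<longleftrightarrow> s : extensional U & (ALL x:U. \<exists>V m. x : V & V <= U & reps P s V m)"
 unfolding sheafify_simps reps_def by (simp add: Bex_def) blast

lemma sheafify_local_reps:
 assumes "s :<(sheafify X P) U>" "x : U"
 obtains V m where "x : V" "V <= U" "reps P s V m"
 using assms unfolding sheafify_carrier by blast

context
 fixes P :: "('x, 'r, 'p) omod"
 assumes P: "pmod P"
begin

lemma germ_memD: "(W, n) : germ X P x U m ==> op W & x : W & n :<P W> &
  (\<exists>Y. op Y & x : Y & Y <= U & Y <= W & res P U Y m = res P W Y n)"
 unfolding germ_def by auto

lemma germ_memI: "op W ==> x : W ==> n :<P W> ==> op Y ==> x : Y ==> Y <= U ==> Y <= W ==>
  res P U Y m = res P W Y n ==> (W, n) : germ X P x U m"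
 unfolding germ_def by auto

lemma germ_self: "op U ==> x : U ==> m :<P U> ==> (U, m) : germ X P x U m"
 by (rule germ_memI[of U x m U]) auto

text \<open>Germs are the classes of an equivalence relation: agreement on \<open>Y\<close> and
  agreement on \<open>Z\<close> combine to agreement on \<open>Y Int Z\<close>.\<close>

lemma germ_eqI:
 assumes U: "op U" "m :<P U>" and V: "op V" "n :<P V>"
  and Y: "op Y" "x : Y" "Y <= U" "Y <= V" "res P U Y m = res P V Y n"
 shows "germ X P x U m = germ X P x V n"
proof -
 have sub: "germ X P x U m <= germ X P x V n"
  if U: "op U" "m :<P U>" and V: "op V" "n :<P V>"
  and Y: "Y <= U" "Y <= V" "res P U Y m = res P V Y n" for U V m n
 proof
  fix z assume z: "z : germ X P x U m"
  obtain W k where zW: "z = (W, k)" by (cases z)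
  obtain Z where Z: "op W" "x : W" "k :<P W>" "op Z" "x : Z" "Z <= U" "Z <= W" "res P U Z m = res P W Z k"
   using germ_memD z zW by meson
  have e: "res P Y (Y Int Z) (res P V Y n) = res P V (Y Int Z) n"
   "res P Y (Y Int Z) (res P U Y m) = res P U (Y Int Z) m"
   "res P Z (Y Int Z) (res P U Z m) = res P U (Y Int Z) m"
   "res P Z (Y Int Z) (res P W Z k) = res P W (Y Int Z) k"
   by (rule pm_res_res[OF P]; use U V Y assms(5) Z in auto)+
  have "res P V (Y Int Z) n = res P W (Y Int Z) k"
   using e(1) e(2) e(3) e(4) Y(3) Z(8) by metis
  then show "z : germ X P x V n" unfolding zW
   by (intro germ_memI[of W x k "Y Int Z"]) (use Z Y assms(5,6) in auto)
 qed
 show ?thesis using sub[OF U V Y(3-5)] sub[OF V U Y(4,3) Y(5)[symmetric]] by (rule equalityI)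
qed

lemma germ_eqD:
 assumes "op U" "x : U" "m :<P U>" "op V" "x : V" "n :<P V>" "germ X P x U m = germ X P x V n"
 obtains Y where "op Y" "x : Y" "Y <= U" "Y <= V" "res P U Y m = res P V Y n"
proof -
 have "(V, n) : germ X P x U m" using germ_self assms by simp
 then show ?thesis using germ_memD that by meson
qed

lemma germ_res: "op U ==> op V ==> V <= U ==> x : V ==> m :<P U> ==> germ X P x V (res P U V m) = germ X P x U m"
 by (rule germ_eqI[of _ _ _ _ V]) (use P in auto)

lemma germ_mem_eq:
 assumes "(W, n) : germ X P x U m" "op U" "m :<P U>"
 shows "op W" "x : W" "n :<P W>" "germ X P x W n = germ X P x U m"
proof -
 obtain Y where "op W & x : W & n :<P W>" "op Y & x : Y & Y <= U & Y <= W & res P U Y m = res P W Y n"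
  using germ_memD[OF assms(1)] by blast
 then show "op W" "x : W" "n :<P W>" "germ X P x W n = germ X P x U m"
  using germ_eqI[of W n U m Y x] assms(2,3) by auto
qed

lemma germ_add_cong:
 assumes U: "op U" "x : U" "m :<P U>" "n :<P U>"
  and V: "op V" "x : V" "m' :<P V>" "n' :<P V>"
  and eq: "germ X P x V m' = germ X P x U m" "germ X P x V n' = germ X P x U n"
 shows "germ X P x V (m' +<P V> n') = germ X P x U (m +<P U> n)"
proof -
 obtain Y where Y: "op Y" "x : Y" "Y <= V" "Y <= U" "res P V Y m' = res P U Y m"
  by (rule germ_eqD[OF V(1-3) U(1-3) eq(1)])
 obtain Z where Z: "op Z" "x : Z" "Z <= V" "Z <= U" "res P V Z n' = res P U Z n"
  by (rule germ_eqD[OF V(1,2,4) U(1,2,4) eq(2)])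
 have sub: "Y Int Z <= V" "Y Int Z <= U" using Y by auto
 have "res P V (Y Int Z) m' = res P U (Y Int Z) m"
  using pm_res_res[OF P V(1) Y(1), of "Y Int Z" m'] pm_res_res[OF P U(1) Y(1), of "Y Int Z" m] Y Z U V by simp
 moreover have "res P V (Y Int Z) n' = res P U (Y Int Z) n"
  using pm_res_res[OF P V(1) Z(1), of "Y Int Z" n'] pm_res_res[OF P U(1) Z(1), of "Y Int Z" n] Y Z U V by simp
 ultimately show ?thesis
  by (intro germ_eqI[of _ _ _ _ "Y Int Z"]) (use U V Y Z P sub in auto)
qed

lemma germ_smult_cong:
 assumes "op U" "op V" "op W" "V <= W" "U <= W" "x : U" "x : V" "m :<P U>" "n :<P V>"
  "a :<W>" "germ X P x U m = germ X P x V n"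
 shows "germ X P x U (rs W U a *<P U> m) = germ X P x V (rs W V a *<P V> n)"
proof -
 obtain Y where Y: "op Y" "x : Y" "Y <= U" "Y <= V" "res P U Y m = res P V Y n"
  by (rule germ_eqD[OF assms(1,6,8,2,7,9,11)])
 then show ?thesis
  by (intro germ_eqI[of _ _ _ _ Y]) (use assms P in auto)
qed

lemma reps_res: "reps P s V m ==> op W ==> W <= V ==> reps P s W (res P V W m)"
 unfolding reps_def using germ_res P by auto

lemma reps_restrict: "W <= V ==> reps P (restrict s V) W m = reps P s W m"
 unfolding reps_def by auto

text \<open>The sum of two germs is a double union over their representatives; by
  \<open>germ_add_cong\<close> all pairs of representatives give the same germ, so the union
  collapses to it.\<close>

lemma reps_add:
 assumes "op U" "V <= U" "reps P s V m" "reps P t V n"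
 shows "reps P (s +<(sheafify X P) U> t) V (m +<P V> n)"
 unfolding reps_def
proof (intro conjI ballI)
 have V: "op V" and m: "m :<P V>" and n: "n :<P V>" using assms by (simp_all add: reps_def)
 then show "op V" "m +<P V> n :<P V>" using P by auto
 fix x assume x: "x : V"
 then have xU: "x : U" using assms by blast
 have s: "s x = germ X P x V m" and t: "t x = germ X P x V n" using assms x by (simp_all add: reps_def)
 have "(\<Union>(V', m')\<in>s x. \<Union>(W, n')\<in>t x.
   germ X P x (V' Int W) (res P V' (V' Int W) m' +<P (V' Int W)> res P W (V' Int W) n')) =
   germ X P x V (m +<P V> n)"
 proof (rule UN_eq_const)
  show "s x ~= {}" unfolding s using germ_self[OF V x m] by blast
  fix z assume z: "z : s x"
  obtain V' m' where zV: "z = (V', m')" by (cases z)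
  have 1: "op V'" "x : V'" "m' :<P V'>" "germ X P x V' m' = germ X P x V m"
   using germ_mem_eq[of V' m' x V m] z zV V m unfolding s by auto
  have "(\<Union>(W, n')\<in>t x. germ X P x (V' Int W) (res P V' (V' Int W) m' +<P (V' Int W)> res P W (V' Int W) n')) =
   germ X P x V (m +<P V> n)"
  proof (rule UN_eq_const)
   show "t x ~= {}" unfolding t using germ_self[OF V x n] by blast
   fix w assume w: "w : t x"
   obtain W n' where wW: "w = (W, n')" by (cases w)
   have 2: "op W" "x : W" "n' :<P W>" "germ X P x W n' = germ X P x V n"
    using germ_mem_eq[of W n' x V n] w wW V n unfolding t by auto
   have "germ X P x (V' Int W) (res P V' (V' Int W) m' +<P (V' Int W)> res P W (V' Int W) n') =
     germ X P x V (m +<P V> n)"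
    by (rule germ_add_cong) (use V x m n 1 2 P in \<open>auto simp: germ_res\<close>)
   then show "(case w of (W, n') => germ X P x (V' Int W) (res P V' (V' Int W) m' +<P (V' Int W)> res P W (V' Int W) n')) =
     germ X P x V (m +<P V> n)" by (simp add: wW)
  qed
  then show "(case z of (V', m') => \<Union>(W, n')\<in>t x.
    germ X P x (V' Int W) (res P V' (V' Int W) m' +<P (V' Int W)> res P W (V' Int W) n')) =
    germ X P x V (m +<P V> n)" by (simp add: zV)
 qed
 then show "(s +<(sheafify X P) U> t) x = germ X P x V (m +<P V> n)"
  using xU by (simp add: sheafify_simps)
qed

lemma reps_smult:
 assumes "op U" "V <= U" "reps P s V m" "a :<U>"
 shows "reps P (a *<(sheafify X P) U> s) V (rs U V a *<P V> m)"
 unfolding reps_def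
proof (intro conjI ballI)
 have V: "op V" and m: "m :<P V>" using assms by (simp_all add: reps_def)
 then show "op V" "rs U V a *<P V> m :<P V>" using P assms by auto
 fix x assume x: "x : V"
 then have xU: "x : U" using assms by blast
 have s: "s x = germ X P x V m" using assms x by (simp add: reps_def)
 have "(\<Union>(V, m)\<in>s x. germ X P x (U Int V) (rs U (U Int V) a *<P (U Int V)> res P V (U Int V) m)) =
   germ X P x V (rs U V a *<P V> m)"
 proof (rule UN_eq_const)
  show "s x ~= {}" unfolding s using germ_self[OF V x m] by blast
  fix z assume z: "z : s x"
  obtain V' m' where zV: "z = (V', m')" by (cases z)
  have 1: "op V'" "x : V'" "m' :<P V'>" "germ X P x V' m' = germ X P x V m"
   using germ_mem_eq[of V' m' x V m] z zV V m unfolding s by auto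
  have "germ X P x (U Int V') (rs U (U Int V') a *<P (U Int V')> res P V' (U Int V') m') =
    germ X P x V (rs U V a *<P V> m)"
   by (rule germ_smult_cong) (use assms V x xU m 1 P in \<open>auto simp: germ_res\<close>)
  then show "(case z of (V, m) => germ X P x (U Int V) (rs U (U Int V) a *<P (U Int V)> res P V (U Int V) m)) =
    germ X P x V (rs U V a *<P V> m)" by (simp add: zV)
 qed
 then show "(a *<(sheafify X P) U> s) x = germ X P x V (rs U V a *<P V> m)"
  using xU by (simp add: sheafify_simps)
qed

lemma reps_zero:
 assumes "op U" "op V" "V <= U"
 shows "reps P 0<(sheafify X P) U> V 0<P V>"
 unfolding reps_def
proof (intro conjI ballI)
 fix x assume x: "x : V"
 then show "0<(sheafify X P) U> x = germ X P x V 0<P V>"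
  using germ_res[of U V x "0<P U>"] assms P by (auto simp: sheafify_simps)
qed (use assms P in auto)

lemma reps_to_sheaf: "op U ==> m :<P U> ==> reps P (to_sheaf X P U m) U m"
 unfolding reps_def to_sheaf_def by auto

lemma reps_eqD: "reps P s V m ==> reps P t V m ==> x : V ==> s x = t x"
 unfolding reps_def by auto

lemma sheafify_extensional: "s :<(sheafify X P) U> ==> s : extensional U"
 by (simp add: sheafify_simps)

lemma sheafify_op_extensional:
 "0<(sheafify X P) U> : extensional U"
 "s +<(sheafify X P) U> t : extensional U"
 "a *<(sheafify X P) U> s : extensional U"
 by (simp_all add: sheafify_simps)

lemma reps_common:
 assumes "op U" "x : U" "finite S" "!!s. s : S ==> s :<(sheafify X P) U>"
 shows "\<exists>V. op V & x : V & V <= U & (ALL s:S. \<exists>m. reps P s V m)"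
 using assms(3,4)
proof (induction S)
 case (insert s S)
 then obtain V where V: "op V" "x : V" "V <= U" "ALL s:S. \<exists>m. reps P s V m" by auto
 obtain W m where W: "x : W" "W <= U" "reps P s W m"
  using sheafify_local_reps[OF insert.prems[OF insertI1] assms(2)] by blast
 have W': "op W" using W(3) by (simp add: reps_def)
 show ?case
 proof (intro exI[of _ "V Int W"] conjI ballI)
  fix t assume "t : insert s S"
  then show "\<exists>m. reps P t (V Int W) m"
   using reps_res[OF W(3), of "V Int W"] V(4) reps_res[of t V _ "V Int W"] V(1) W' by auto
 qed (use V W W' in auto)
qed (use assms in auto)

lemma reps1:
 assumes "op U" "x : U" "s :<(sheafify X P) U>"
 obtains V m where "op V" "x : V" "V <= U" "reps P s V m" "m :<P V>"
proof -
 obtain V m where V: "x : V" "V <= U" "reps P s V m" by (rule sheafify_local_reps[OF assms(3,2)])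
 show ?thesis by (rule that[OF _ V]) (use V(3) in \<open>simp_all add: reps_def\<close>)
qed

lemma reps3:
 assumes "op U" "x : U" "s :<(sheafify X P) U>" "t :<(sheafify X P) U>" "u :<(sheafify X P) U>"
 obtains V m n k where "op V" "x : V" "V <= U" "reps P s V m" "reps P t V n" "reps P u V k"
  "m :<P V>" "n :<P V>" "k :<P V>"
proof -
 have "\<exists>V. op V & x : V & V <= U & (ALL s:{s, t, u}. \<exists>m. reps P s V m)"
  by (rule reps_common) (use assms in auto)
 then obtain V m n k where V: "op V" "x : V" "V <= U" "reps P s V m" "reps P t V n" "reps P u V k"
  by auto
 show ?thesis by (rule that[OF V]) (use V(4-6) in \<open>simp_all add: reps_def\<close>)
qed

lemma reps2:
 assumes "op U" "x : U" "s :<(sheafify X P) U>" "t :<(sheafify X P) U>"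
 obtains V m n where "op V" "x : V" "V <= U" "reps P s V m" "reps P t V n"
  "m :<P V>" "n :<P V>"
 using reps3[OF assms(1-4,4)] by metis

lemma sheafify_memI:
 assumes "s : extensional U" "!!x. x : U ==> \<exists>V m. x : V & V <= U & reps P s V m"
 shows "s :<(sheafify X P) U>"
 using assms by (simp add: sheafify_carrier)

lemma sheafify_add_closed:
 assumes U: "op U" and s: "s :<(sheafify X P) U>" and t: "t :<(sheafify X P) U>"
 shows "s +<(sheafify X P) U> t :<(sheafify X P) U>"
proof (rule sheafify_memI[OF sheafify_op_extensional(2)])
 fix x assume "x : U"
 then obtain V m n where V: "x : V" "V <= U" "reps P s V m" "reps P t V n"
  by (rule reps2[OF U _ s t])
 show "\<exists>V m. x : V & V <= U & reps P (s +<(sheafify X P) U> t) V m"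
  by (intro exI conjI, rule V(1), rule V(2), rule reps_add[OF U V(2-4)])
qed

lemma sheafify_smult_closed:
 assumes U: "op U" and s: "s :<(sheafify X P) U>" and a: "a :<U>"
 shows "a *<(sheafify X P) U> s :<(sheafify X P) U>"
proof (rule sheafify_memI[OF sheafify_op_extensional(3)])
 fix x assume "x : U"
 then obtain V m where V: "x : V" "V <= U" "reps P s V m" by (rule sheafify_local_reps[OF s])
 show "\<exists>V m. x : V & V <= U & reps P (a *<(sheafify X P) U> s) V m"
  by (intro exI conjI, rule V(1), rule V(2), rule reps_smult[OF U V(2,3) a])
qed

lemma sheafify_zero_closed: "op U ==> 0<(sheafify X P) U> :<(sheafify X P) U>"
 using reps_zero[of U U] by (intro sheafify_memI sheafify_op_extensional exI[of _ U]) auto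

lemma sheafify_res_closed:
 assumes "op U" "op V" "V <= U" "s :<(sheafify X P) U>"
 shows "restrict s V :<(sheafify X P) V>"
proof (rule sheafify_memI)
 fix x assume x: "x : V"
 then have "x : U" using assms by blast
 then obtain W m where W: "x : W" "W <= U" "reps P s W m" by (rule sheafify_local_reps[OF assms(4)])
 then have "op W" by (simp add: reps_def)
 then have "reps P s (V Int W) (res P W (V Int W) m)" using W(3) assms by (intro reps_res) auto
 then show "\<exists>W m. x : W & W <= V & reps P (restrict s V) W m"
  using W x reps_restrict[of "V Int W" V s] by auto
qed simp

text \<open>Every axiom is an equality of functions on \<open>U\<close> and can be tested at a point
  \<open>x\<close>. Near \<open>x\<close> the sections involved have representatives on one common
  open set, and there the axiom is the one of the presheaf. The additive inverse is the multiple by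
  -1.\<close>

lemma sheafify_module:
 assumes U: "op U"
 shows "module (osec X U) (sec (sheafify X P) U)"
proof -
 let ?S = "sec (sheafify X P) U"
 note ext = extensionalityI[OF sheafify_op_extensional(2) sheafify_op_extensional(2)]
  extensionalityI[OF sheafify_op_extensional(2) sheafify_extensional]
  extensionalityI[OF sheafify_op_extensional(3) sheafify_op_extensional(2)]
  extensionalityI[OF sheafify_op_extensional(3) sheafify_op_extensional(3)]
  extensionalityI[OF sheafify_op_extensional(3) sheafify_extensional]
  extensionalityI[OF sheafify_op_extensional(2) sheafify_op_extensional(1)]
 show ?thesis
 proof (intro moduleI abelian_groupI O_cring U sheafify_add_closed sheafify_smult_closed sheafify_zero_closed)
  fix s assume s: "s : carrier ?S"
  show "0{?S} +{?S} s = s"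
  proof (rule ext)
   fix x assume "x : U"
   then obtain V m where V: "op V" "x : V" "V <= U" "reps P s V m" and m: "m :<P V>"
    by (rule reps1[OF U _ s])
   interpret M: module "osec X V" "sec P V" by (rule pm_module[OF P V(1)])
   have "reps P (0{?S} +{?S} s) V m"
    using reps_add[OF U V(3) reps_zero[OF U V(1,3)] V(4)] m by simp
   then show "(0{?S} +{?S} s) x = s x" by (rule reps_eqD[OF _ V(4,2)])
  qed (rule s)
  show "1<U> .{?S} s = s"
  proof (rule ext)
   fix x assume "x : U"
   then obtain V m where V: "op V" "x : V" "V <= U" "reps P s V m" and m: "m :<P V>"
    by (rule reps1[OF U _ s])
   have "reps P (1<U> .{?S} s) V m"
    using reps_smult[OF U V(3,4), of "1<U>"] m U V P by simp
   then show "(1<U> .{?S} s) x = s x" by (rule reps_eqD[OF _ V(4,2)])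
  qed (rule s)
  show "EX t:carrier ?S. t +{?S} s = 0{?S}"
  proof (rule bexI)
   let ?n = "\<ominus>\<^bsub>osec X U\<^esub> 1<U>"
   show "?n .{?S} s : carrier ?S" using U s by (simp add: sheafify_smult_closed)
   show "?n .{?S} s +{?S} s = 0{?S}"
   proof (rule extensionalityI[OF sheafify_op_extensional(2,1)])
    fix x assume "x : U"
    then obtain V m where V: "op V" "x : V" "V <= U" "reps P s V m" and m: "m :<P V>"
     by (rule reps1[OF U _ s])
    interpret M: module "osec X V" "sec P V" by (rule pm_module[OF P V(1)])
    have n: "rs U V ?n = \<ominus>\<^bsub>osec X V\<^esub> 1<V>"
     using V U pm_res_neg[of "ox X" U V "1<U>"] by simp
    have "reps P (?n .{?S} s +{?S} s) V 0<P V>"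
     using reps_add[OF U V(3) reps_smult[OF U V(3,4)] V(4), of ?n] m U V P n
     by (simp add: pm_neg_eq M.l_neg)
    then show "(?n .{?S} s +{?S} s) x = 0{?S} x" by (rule reps_eqD[OF _ reps_zero[OF U V(1,3)] V(2)])
   qed
  qed
  fix t assume t: "t : carrier ?S"
  show "s +{?S} t = t +{?S} s"
  proof (rule ext)
   fix x assume "x : U"
   then obtain V m n where V: "op V" "x : V" "V <= U" "reps P s V m" "reps P t V n" and m: "m :<P V>" "n :<P V>"
    by (rule reps2[OF U _ s t])
   interpret M: module "osec X V" "sec P V" by (rule pm_module[OF P V(1)])
   have "reps P (s +{?S} t) V (m +<P V> n)" "reps P (t +{?S} s) V (m +<P V> n)"
    using reps_add[OF U V(3,4,5)] reps_add[OF U V(3,5,4)] m M.a_comm[of m n] by simp_all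
   then show "(s +{?S} t) x = (t +{?S} s) x" by (rule reps_eqD[OF _ _ V(2)])
  qed
  {
   fix a assume a: "a :<U>"
   show "a .{?S} (s +{?S} t) = a .{?S} s +{?S} a .{?S} t"
   proof (rule ext)
    fix x assume "x : U"
    then obtain V m n where V: "op V" "x : V" "V <= U" "reps P s V m" "reps P t V n" and m: "m :<P V>" "n :<P V>"
     by (rule reps2[OF U _ s t])
    interpret M: module "osec X V" "sec P V" by (rule pm_module[OF P V(1)])
    have "reps P (a .{?S} (s +{?S} t)) V (rs U V a *<P V> (m +<P V> n))"
     by (rule reps_smult[OF U V(3) reps_add[OF U V(3-5)] a])
    moreover have "reps P (a .{?S} s +{?S} a .{?S} t) V (rs U V a *<P V> m +<P V> rs U V a *<P V> n)"
     by (rule reps_add[OF U V(3) reps_smult[OF U V(3,4) a] reps_smult[OF U V(3,5) a]])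
    ultimately show "(a .{?S} (s +{?S} t)) x = (a .{?S} s +{?S} a .{?S} t) x"
     using reps_eqD[OF _ _ V(2)] V(1,3) m a U by (simp add: M.smult_r_distr)
   qed
  }
  fix u assume u: "u : carrier ?S"
  show "s +{?S} t +{?S} u = s +{?S} (t +{?S} u)"
  proof (rule ext)
   fix x assume "x : U"
   then obtain V m n k where V: "op V" "x : V" "V <= U" "reps P s V m" "reps P t V n" "reps P u V k" and m: "m :<P V>" "n :<P V>" "k :<P V>"
    by (rule reps3[OF U _ s t u])
   interpret M: module "osec X V" "sec P V" by (rule pm_module[OF P V(1)])
   have "reps P (s +{?S} t +{?S} u) V (m +<P V> n +<P V> k)"
    by (rule reps_add[OF U V(3) reps_add[OF U V(3-5)] V(6)])
   moreover have "reps P (s +{?S} (t +{?S} u)) V (m +<P V> (n +<P V> k))"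
    by (rule reps_add[OF U V(3) V(4) reps_add[OF U V(3,5,6)]])
   ultimately show "(s +{?S} t +{?S} u) x = (s +{?S} (t +{?S} u)) x"
    using reps_eqD[OF _ _ V(2)] V(1,3) m by (simp add: M.a_assoc)
  qed
 next
  fix a b s assume a: "a :<U>" and b: "b :<U>" and s: "s : carrier ?S"
  show "(a +<U> b) .{?S} s = a .{?S} s +{?S} b .{?S} s"
  proof (rule ext)
   fix x assume "x : U"
   then obtain V m where V: "op V" "x : V" "V <= U" "reps P s V m" and m: "m :<P V>"
    by (rule reps1[OF U _ s])
   interpret M: module "osec X V" "sec P V" by (rule pm_module[OF P V(1)])
   have "reps P ((a +<U> b) .{?S} s) V (rs U V (a +<U> b) *<P V> m)"
    by (rule reps_smult[OF U V(3,4)]) (use a b U in simp)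
   moreover have "reps P (a .{?S} s +{?S} b .{?S} s) V (rs U V a *<P V> m +<P V> rs U V b *<P V> m)"
    by (rule reps_add[OF U V(3) reps_smult[OF U V(3,4) a] reps_smult[OF U V(3,4) b]])
   ultimately show "((a +<U> b) .{?S} s) x = (a .{?S} s +{?S} b .{?S} s) x"
    using reps_eqD[OF _ _ V(2)] V(1,3) m a b U by (simp add: M.smult_l_distr)
  qed
  show "(a *<U> b) .{?S} s = a .{?S} (b .{?S} s)"
  proof (rule ext)
   fix x assume "x : U"
   then obtain V m where V: "op V" "x : V" "V <= U" "reps P s V m" and m: "m :<P V>"
    by (rule reps1[OF U _ s])
   interpret M: module "osec X V" "sec P V" by (rule pm_module[OF P V(1)])
   have "reps P ((a *<U> b) .{?S} s) V (rs U V (a *<U> b) *<P V> m)"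
    by (rule reps_smult[OF U V(3,4)]) (use a b U in simp)
   moreover have "reps P (a .{?S} (b .{?S} s)) V (rs U V a *<P V> (rs U V b *<P V> m))"
    by (rule reps_smult[OF U V(3) reps_smult[OF U V(3,4) b] a])
   ultimately show "((a *<U> b) .{?S} s) x = (a .{?S} (b .{?S} s)) x"
    using reps_eqD[OF _ _ V(2)] V(1,3) m a b U by (simp add: M.smult_assoc1)
  qed
 qed
qed

lemma sheafify_pmodule: "pmod (sheafify X P)"
 unfolding pmodule_def
proof (intro conjI allI impI ballI)
 show "presheaf_on (tsp X) (mcar (sheafify X P)) (res (sheafify X P))"
  unfolding presheaf_on_def sheafify_res
 proof (intro conjI allI impI funcsetI ballI)
  show "restrict s V :<(sheafify X P) V>" if "op U & op V & V <= U" "s :<(sheafify X P) U>" for U V s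
   using that sheafify_res_closed by blast
  show "restrict s U = s" if "s :<(sheafify X P) U>" for U s
   using extensional_restrict[OF sheafify_extensional[OF that]] .
  show "restrict (restrict s V) W = restrict s W" if "op U & op V & op W & W <= V & V <= U" for U V W s
   using that by (simp add: restrict_restrict Int_absorb1)
 qed
 show "module (osec X U) (sec (sheafify X P) U)" if "op U" for U by (rule sheafify_module[OF that])
 fix U V s assume "op U & V : ops U" and s: "s :<(sheafify X P) U>"
 then have U: "op U" "op V" "V <= U" by auto
 note ext = extensionalityI[OF restrict_extensional sheafify_op_extensional(2)]
  extensionalityI[OF restrict_extensional sheafify_op_extensional(3)]
 {
  fix t assume t: "t :<(sheafify X P) U>"
  have "restrict (s +<(sheafify X P) U> t) V = restrict s V +<(sheafify X P) V> restrict t V"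
  proof (rule ext)
   fix x assume x: "x : V"
   obtain W m n where W: "op W" "x : W" "W <= U" "reps P s W m" "reps P t W n"
    by (rule reps2[OF U(1) subsetD[OF U(3) x] s t])
   have VW: "op (V Int W)" "V Int W <= W" "V Int W <= V" "V Int W <= U" "x : V Int W" using x W U by auto
   note rs = reps_res[OF W(4) VW(1,2)] reps_res[OF W(5) VW(1,2)]
   have "reps P (restrict s V +<(sheafify X P) V> restrict t V) (V Int W)
     (res P W (V Int W) m +<P (V Int W)> res P W (V Int W) n)"
    by (rule reps_add[OF U(2) VW(3)]) (simp_all add: reps_restrict[OF VW(3)] rs)
   from reps_eqD[OF reps_add[OF U(1) VW(4) rs] this VW(5)]
   show "restrict (s +<(sheafify X P) U> t) V x = (restrict s V +<(sheafify X P) V> restrict t V) x"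
    using x by simp
  qed
  then show "res (sheafify X P) U V (s +<(sheafify X P) U> t) =
    res (sheafify X P) U V s +<(sheafify X P) V> res (sheafify X P) U V t" by simp
 }
 fix a assume a: "a :<U>"
 have "restrict (a *<(sheafify X P) U> s) V = rs U V a *<(sheafify X P) V> restrict s V"
 proof (rule ext)
  fix x assume x: "x : V"
  obtain W m where W: "op W" "x : W" "W <= U" "reps P s W m"
   by (rule reps1[OF U(1) subsetD[OF U(3) x] s])
  have VW: "op (V Int W)" "V Int W <= W" "V Int W <= V" "V Int W <= U" "x : V Int W" using x W U by auto
  note rs = reps_res[OF W(4) VW(1,2)]
  have "reps P (rs U V a *<(sheafify X P) V> restrict s V) (V Int W)
    (rs V (V Int W) (rs U V a) *<P (V Int W)> res P W (V Int W) m)"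
   by (rule reps_smult[OF U(2) VW(3)]) (simp_all add: reps_restrict[OF VW(3)] rs U a)
  then have "reps P (rs U V a *<(sheafify X P) V> restrict s V) (V Int W)
    (rs U (V Int W) a *<P (V Int W)> res P W (V Int W) m)"
   using U VW a by simp
  from reps_eqD[OF reps_smult[OF U(1) VW(4) rs a] this VW(5)]
  show "restrict (a *<(sheafify X P) U> s) V x = (rs U V a *<(sheafify X P) V> restrict s V) x"
   using x by simp
 qed
 then show "res (sheafify X P) U V (a *<(sheafify X P) U> s) =
   rs U V a *<(sheafify X P) V> res (sheafify X P) U V s" by simp
qed

lemma sheafify_O_module: "omod (sheafify X P)"
 unfolding O_module_iff
proof
 show "pmod (sheafify X P)" by (rule sheafify_pmodule)
 show "sheaf_on (tsp X) (mcar (sheafify X P)) (res (sheafify X P))"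
 proof (rule sheaf_onI)
  show "presheaf_on (tsp X) (mcar (sheafify X P)) (res (sheafify X P))"
   by (rule pm_presheaf[OF sheafify_pmodule])
  fix C
  {
   fix s
   assume C: "!!V. V : C ==> op V" and s: "!!V. V : C ==> s V :<(sheafify X P) V>"
    and agree: "!!V W. V : C ==> W : C ==> res (sheafify X P) V (V Int W) (s V) = res (sheafify X P) W (V Int W) (s W)"
   \<comment> \<open>Sections are functions of points, so gluing is pointwise; by
     \<open>agree\<close> it does not matter which member of the cover containing \<open>x\<close>
     is picked.\<close>
   define t where "t = (\<lambda>x\<in>\<Union>C. s (SOME V. V : C & x : V) x)"
   have t: "t x = s V x" if V: "V : C" "x : V" for V x
   proof -
    define W where "W = (SOME V. V : C & x : V)"
    have W: "W : C & x : W" unfolding W_def by (rule someI_ex) (use V in blast)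
    have "restrict (s V) (V Int W) x = restrict (s W) (V Int W) x"
     using agree[of V W] V W by simp
    then have "s V x = s W x" using V W by simp
    then show ?thesis using V by (auto simp: t_def W_def)
   qed
   show "EX t:mcar (sheafify X P) (\<Union>C). ALL V:C. res (sheafify X P) (\<Union>C) V t = s V"
   proof (intro bexI ballI)
    show "t :<(sheafify X P) (\<Union>C)>"
    proof (rule sheafify_memI)
     fix x assume "x : \<Union>C"
     then obtain V where V: "V : C" "x : V" by blast
     obtain W m where W: "x : W" "W <= V" "reps P (s V) W m"
      using sheafify_local_reps[OF s[OF V(1)] V(2)] by blast
     have "reps P t W m" using W(2,3) t[OF V(1)] unfolding reps_def by auto
     then show "\<exists>V m. x : V & V <= \<Union>C & reps P t V m" using W V by blast
    qed (simp add: t_def)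
    fix V assume V: "V : C"
    have "restrict t V = s V"
     by (rule extensionalityI[OF restrict_extensional sheafify_extensional[OF s[OF V]]]) (simp add: t[OF V])
    then show "res (sheafify X P) (\<Union>C) V t = s V" by simp
   qed
  }
  fix t t'
  assume t: "t :<(sheafify X P) (\<Union>C)>" "t' :<(sheafify X P) (\<Union>C)>"
   and eq: "!!V. V : C ==> res (sheafify X P) (\<Union>C) V t = res (sheafify X P) (\<Union>C) V t'"
  show "t = t'"
  proof (rule extensionalityI[OF sheafify_extensional[OF t(1)] sheafify_extensional[OF t(2)]])
   fix x assume "x : \<Union>C"
   then obtain V where V: "V : C" "x : V" by blast
   have "restrict t V x = restrict t' V x" using eq[OF V(1)] by simp
   then show "t x = t' x" using V(2) by simp
  qed
 qed
qed

lemma to_sheaf_closed: "op U ==> m :<P U> ==> to_sheaf X P U m :<(sheafify X P) U>"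
 using reps_to_sheaf by (intro sheafify_memI) (auto simp: to_sheaf_def)

lemma reps_eq_to_sheaf: "reps P s V m ==> restrict s V = to_sheaf X P V m"
 unfolding reps_def to_sheaf_def by (intro restrict_ext) simp

lemma to_sheaf_hom: "fam' P U (to_sheaf X P) : Hom P (sheafify X P) U"
proof (rule homsI[OF P])
 fix V m assume V: "op V" and m: "m :<P V>"
 show "to_sheaf X P V m :<(sheafify X P) V>" by (rule to_sheaf_closed[OF V m])
 have e: "reps P s V n ==> s : extensional V ==> to_sheaf X P V n = s" for s n
  using reps_eq_to_sheaf[of s V n] by (simp add: extensional_restrict)
 show "to_sheaf X P V (m +<P V> n) = to_sheaf X P V m +<(sheafify X P) V> to_sheaf X P V n"
  if n: "n :<P V>" for n
  by (rule e[OF reps_add[OF V order_refl reps_to_sheaf[OF V m] reps_to_sheaf[OF V n]] sheafify_op_extensional(2)])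
 show "to_sheaf X P V (a *<P V> m) = a *<(sheafify X P) V> to_sheaf X P V m"
  if a: "a :<V>" for a
  using e[OF reps_smult[OF V order_refl reps_to_sheaf[OF V m] a] sheafify_op_extensional(3)] V a by simp
 fix W assume W: "op W" "W <= V"
 show "to_sheaf X P W (res P V W m) = res (sheafify X P) V W (to_sheaf X P V m)"
  using reps_eq_to_sheaf[OF reps_res[OF reps_to_sheaf[OF V m] W]] by simp
qed

lemma sheafify_local:
 assumes "s :<(sheafify X P) U>" "x : U"
 obtains V m where "op V" "x : V" "V <= U" "m :<P V>" "res (sheafify X P) U V s = to_sheaf X P V m"
 using sheafify_local_reps[OF assms] reps_eq_to_sheaf unfolding reps_def sheafify_res by metis

lemma sheafify_hom_eqI:
 assumes M: "omod M" and p: "p : Hom (sheafify X P) M U" and k: "k : Hom (sheafify X P) M U"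
  and eq: "!!V m. op V ==> V <= U ==> m :<P V> ==> p V (to_sheaf X P V m) = k V (to_sheaf X P V m)"
 shows "p = k"
proof (rule homs_eqI[OF p k])
 fix V s assume V: "op V" "V <= U" and s: "s :<(sheafify X P) V>"
 show "p V s = k V s"
 proof (rule sheaf_eqI[OF M V(1) homs_closed[OF p V s] homs_closed[OF k V s]])
  fix x assume "x : V"
  then obtain W m where W: "op W" "x : W" "W <= V" "m :<P W>"
   "res (sheafify X P) V W s = to_sheaf X P W m"
   by (rule sheafify_local[OF s])
  have "res M V W (p V s) = p W (to_sheaf X P W m)"
   using homs_res[OF p V W(1,3) s] W(5) by simp
  also have "\<dots> = k W (to_sheaf X P W m)" by (rule eq) (use W V in auto)
  also have "\<dots> = res M V W (k V s)"
   using homs_res[OF k V W(1,3) s] W(5) by simp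
  finally show "\<exists>W. op W & x : W & W <= V & res M V W (p V s) = res M V W (k V s)" using W by blast
 qed
qed

text \<open>Universal property of sheafification. The image of \<open>s\<close> is glued from
  \<open>f W m\<close> over the local representatives \<open>m\<close> of \<open>s\<close>: two
  representatives have equal germs, so their images agree near each point, and the sheaf
  \<open>M\<close> allows gluing. Uniqueness of the glued value then yields all the morphism
  laws.\<close>

lemma sheafify_lift:
 assumes M: "omod M" and f: "f : Hom P M U"
 obtains p where "p : Hom (sheafify X P) M U"
  "!!V m. op V ==> V <= U ==> m :<P V> ==> p V (to_sheaf X P V m) = f V m"
proof -
 have M': "pmod M" using M by simp
 define Q where "Q V s t \<longleftrightarrow> t :<M V> &
  (ALL x:V. \<exists>W m. x : W & W <= V & reps P s W m & res M V W t = f W m)" for V s t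
 have f_eq: "\<exists>Y. op Y & x : Y & Y <= W & Y <= W' & res M W Y (f W m) = res M W' Y (f W' m')"
  if r: "reps P s W m" "reps P s W' m'" and x: "x : W" "x : W'" and W: "W <= U" "W' <= U" for s W W' m m' x
 proof -
  have o: "op W" "m :<P W>" "op W'" "m' :<P W'>" and g: "germ X P x W m = germ X P x W' m'"
   using r x by (auto simp: reps_def)
  obtain Y where Y: "op Y" "x : Y" "Y <= W" "Y <= W'" "res P W Y m = res P W' Y m'"
   by (rule germ_eqD[OF o(1) x(1) o(2) o(3) x(2) o(4) g])
  then have "res M W Y (f W m) = res M W' Y (f W' m')"
   using homs_res[OF f o(1) W(1) Y(1,3) o(2)] homs_res[OF f o(3) W(2) Y(1,4) o(4)] by simp
  then show ?thesis using Y by blast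
 qed
 have uniq: "t = t'" if V: "op V" "V <= U" and t: "Q V s t" "Q V s t'" for V s t t'
 proof (rule sheaf_eqI[OF M V(1)])
  show tM: "t :<M V>" "t' :<M V>" using t by (simp_all add: Q_def)
  fix x assume x: "x : V"
  obtain W m where W: "x : W" "W <= V" "reps P s W m" "res M V W t = f W m"
   using t(1) x unfolding Q_def by blast
  obtain W' m' where W': "x : W'" "W' <= V" "reps P s W' m'" "res M V W' t' = f W' m'"
   using t(2) x unfolding Q_def by blast
  have "W <= U" "W' <= U" using W W' V by auto
  from f_eq[OF W(3) W'(3) W(1) W'(1) this]
  obtain Y where Y: "op Y" "x : Y" "Y <= W" "Y <= W'" "res M W Y (f W m) = res M W' Y (f W' m')" by blast
  have "op W" "op W'" using W W' by (simp_all add: reps_def)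
  then have "res M V Y t = res M W Y (f W m)" "res M V Y t' = res M W' Y (f W' m')"
   using W W' Y V tM M' by (simp_all flip: W(4) W'(4))
  then show "\<exists>Y. op Y & x : Y & Y <= V & res M V Y t = res M V Y t'" using Y W(2) by (intro exI[of _ Y]) auto
 qed
 have ex: "\<exists>t. Q V s t" if V: "op V" "V <= U" and s: "s :<(sheafify X P) V>" for V s
 proof -
  \<comment> \<open>The cover consists of all opens on which \<open>s\<close> has a representative,
    indexed together with the representative, since one open set may carry several of them.\<close>
  define J where "J = {(W, m). W <= V & reps P s W m}"
  have J: "op (fst i)" "fst i <= V" "snd i :<P (fst i)>" "reps P s (fst i) (snd i)" if "i : J" for i
   using that by (auto simp: J_def reps_def)
  have fM: "f (fst i) (snd i) :<M (fst i)>" if "i : J" for i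
   by (rule homs_closed[OF f]) (use J[OF that] V in auto)
  have UJ: "(\<Union>i\<in>J. fst i) = V"
  proof
   show "V <= (\<Union>i\<in>J. fst i)"
   proof
    fix x assume "x : V"
    then obtain W m where "x : W" "W <= V" "reps P s W m" using sheafify_local_reps[OF s] by blast
    then show "x : (\<Union>i\<in>J. fst i)" by (intro UN_I[of "(W, m)"]) (auto simp: J_def)
   qed
  qed (use J(2) in blast)
  obtain t where t: "t :<M (\<Union>i\<in>J. fst i)>"
   "!!i. i : J ==> res M (\<Union>i\<in>J. fst i) (fst i) t = f (fst i) (snd i)"
  proof (rule sheaf_glue[OF M, of J fst "%i. f (fst i) (snd i)"])
   fix i j assume i: "i : J" and j: "j : J"
   let ?Y = "fst i Int fst j"
   have Y: "op ?Y" "?Y <= fst i" "?Y <= fst j" using J(1)[OF i] J(1)[OF j] by auto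
   show "res M (fst i) ?Y (f (fst i) (snd i)) = res M (fst j) ?Y (f (fst j) (snd j))"
   proof (rule sheaf_eqI[OF M Y(1)])
    show "res M (fst i) ?Y (f (fst i) (snd i)) :<M ?Y>" "res M (fst j) ?Y (f (fst j) (snd j)) :<M ?Y>"
     using fM[OF i] fM[OF j] Y J(1)[OF i] J(1)[OF j] M' by auto
    fix x assume x: "x : ?Y"
    have ij: "x : fst i" "x : fst j" "fst i <= U" "fst j <= U" using x J(2)[OF i] J(2)[OF j] V by auto
    obtain Z where Z: "op Z" "x : Z" "Z <= fst i" "Z <= fst j"
      "res M (fst i) Z (f (fst i) (snd i)) = res M (fst j) Z (f (fst j) (snd j))"
     using f_eq[OF J(4)[OF i] J(4)[OF j] ij] by blast
    then show "\<exists>V. op V & x : V & V <= ?Y &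
     res M ?Y V (res M (fst i) ?Y (f (fst i) (snd i))) = res M ?Y V (res M (fst j) ?Y (f (fst j) (snd j)))"
     using fM[OF i] fM[OF j] Y J(1)[OF i] J(1)[OF j] M' by (intro exI[of _ Z]) auto
   qed
  qed (use J fM in auto)
  have "Q V s t" unfolding Q_def
  proof (intro conjI ballI)
   show "t :<M V>" using t(1) UJ by simp
   fix x assume "x : V"
   then obtain W m where W: "x : W" "W <= V" "reps P s W m" using sheafify_local_reps[OF s] by blast
   then have "res M V W t = f W m" using t(2)[of "(W, m)"] UJ by (simp add: J_def)
   then show "\<exists>W m. x : W & W <= V & reps P s W m & res M V W t = f W m" using W by blast
  qed
  then show ?thesis by blast
 qed
 define p where "p V s = (SOME t. Q V s t)" for V s
 have p: "Q V s (p V s)" if "op V" "V <= U" "s :<(sheafify X P) V>" for V s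
  unfolding p_def by (rule someI_ex) (rule ex[OF that])
 have p_eq: "p V s = t" if "op V" "V <= U" "s :<(sheafify X P) V>" "Q V s t" for V s t
  by (rule uniq[OF that(1,2) p[OF that(1-3)] that(4)])
 have Q_res: "\<exists>m. reps P s Y m & res M V Y t = f Y m"
  if "Y <= W" "op Y" "op V" "V <= U" "W <= V" "reps P s W m" "res M V W t = f W m" "t :<M V>" for Y W V s t m
 proof (intro exI conjI)
  have W: "op W" "m :<P W>" using that by (simp_all add: reps_def)
  show "reps P s Y (res P W Y m)" by (rule reps_res) (use that in auto)
  have "res M V Y t = res M W Y (f W m)" using that W M' by (simp flip: that(7))
  also have "\<dots> = f Y (res P W Y m)" by (rule homs_res[OF f, symmetric]) (use that W in auto)
  finally show "res M V Y t = f Y (res P W Y m)" .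
 qed
 have hom: "fam' (sheafify X P) U p : Hom (sheafify X P) M U"
 proof (rule homsI[OF sheafify_pmodule])
  fix V s assume V: "op V" "V <= U" and s: "s :<(sheafify X P) V>"
  note Qs = p[OF V s]
  show pM: "p V s :<M V>" using Qs by (simp add: Q_def)
  {
   fix t assume t: "t :<(sheafify X P) V>"
   note Qt = p[OF V t]
   then have tM: "p V t :<M V>" by (simp add: Q_def)
   show "p V (s +<(sheafify X P) V> t) = p V s +<M V> p V t"
   proof (rule p_eq[OF V sheafify_add_closed[OF V(1) s t]])
    show "Q V (s +<(sheafify X P) V> t) (p V s +<M V> p V t)"
     unfolding Q_def
    proof (intro conjI ballI)
     show "p V s +<M V> p V t :<M V>" using pM tM V M' by simp
     fix x assume x: "x : V"
     obtain W m where W: "x : W" "W <= V" "reps P s W m" "res M V W (p V s) = f W m"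
      using Qs x unfolding Q_def by blast
     obtain W' m' where W': "x : W'" "W' <= V" "reps P t W' m'" "res M V W' (p V t) = f W' m'"
      using Qt x unfolding Q_def by blast
     let ?Y = "W Int W'"
     have oW: "op W" "op W'" using W(3) W'(3) by (simp_all add: reps_def)
     have oY: "op ?Y" "?Y <= V" "?Y <= W" "?Y <= W'" "?Y <= U" using oW W V by auto
     obtain k where k: "reps P s ?Y k" "res M V ?Y (p V s) = f ?Y k"
      using Q_res[OF oY(3,1) V W(2-4) pM] by blast
     obtain k' where k': "reps P t ?Y k'" "res M V ?Y (p V t) = f ?Y k'"
      using Q_res[OF oY(4,1) V W'(2-4) tM] by blast
     have kP: "k :<P ?Y>" "k' :<P ?Y>" using k k' by (simp_all add: reps_def)
     have "res M V ?Y (p V s +<M V> p V t) = f ?Y (k +<P ?Y> k')"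
      using k(2) k'(2) V oY pM tM M' homs_add[OF f oY(1,5) kP] by simp
     then show "\<exists>W m. x : W & W <= V & reps P (s +<(sheafify X P) V> t) W m &
       res M V W (p V s +<M V> p V t) = f W m"
      using reps_add[OF V(1) oY(2) k(1) k'(1)] W(1) W'(1) oY(2) by blast
    qed
   qed
  }
  {
   fix a assume a: "a :<V>"
   show "p V (a *<(sheafify X P) V> s) = a *<M V> p V s"
   proof (rule p_eq[OF V sheafify_smult_closed[OF V(1) s a]])
    show "Q V (a *<(sheafify X P) V> s) (a *<M V> p V s)"
     unfolding Q_def
    proof (intro conjI ballI)
     show "a *<M V> p V s :<M V>" using pM a V M' by simp
     fix x assume x: "x : V"
     obtain W m where W: "x : W" "W <= V" "reps P s W m" "res M V W (p V s) = f W m"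
      using Qs x unfolding Q_def by blast
     have oW: "op W" "W <= U" "m :<P W>" using W(2,3) V by (auto simp: reps_def)
     have "res M V W (a *<M V> p V s) = f W (rs V W a *<P W> m)"
      using W V oW pM a M' homs_smult[OF f oW(1,2) _ oW(3), of "rs V W a"] by simp
     then show "\<exists>W m. x : W & W <= V & reps P (a *<(sheafify X P) V> s) W m &
       res M V W (a *<M V> p V s) = f W m"
      using reps_smult[OF V(1) W(2,3) a] W(1,2) by blast
    qed
   qed
  }
  fix W assume W: "op W" "W <= V"
  have WU: "W <= U" using W V by blast
  have "p W (restrict s W) = res M V W (p V s)"
  proof (rule p_eq[OF W(1) WU sheafify_res_closed[OF V(1) W s]])
   show "Q W (restrict s W) (res M V W (p V s))"
    unfolding Q_def
   proof (intro conjI ballI)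
    show "res M V W (p V s) :<M W>" using pM W V M' by simp
    fix x assume x: "x : W"
    then obtain Z m where Z: "x : Z" "Z <= V" "reps P s Z m" "res M V Z (p V s) = f Z m"
     using Qs W unfolding Q_def by blast
    have oZ: "op Z" using Z(3) by (simp add: reps_def)
    let ?Y = "Z Int W"
    have oY: "op ?Y" "?Y <= Z" "?Y <= W" using oZ W by auto
    obtain k where k: "reps P s ?Y k" "res M V ?Y (p V s) = f ?Y k"
     using Q_res[OF oY(2,1) V Z(2-4) pM] by blast
    have "res M W ?Y (res M V W (p V s)) = f ?Y k" using k(2) oY W V pM M' by simp
    then show "\<exists>Y m. x : Y & Y <= W & reps P (restrict s W) Y m & res M W Y (res M V W (p V s)) = f Y m"
     using x Z(1) oY(3) k(1) reps_restrict[OF oY(3)] by blast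
   qed
  qed
  then show "p W (res (sheafify X P) V W s) = res M V W (p V s)" by simp
 qed
 show thesis
 proof (rule that[OF hom])
  fix V m assume V: "op V" "V <= U" and m: "m :<P V>"
  have fm: "f V m :<M V>" by (rule homs_closed[OF f V m])
  have "p V (to_sheaf X P V m) = f V m"
  proof (rule p_eq[OF V to_sheaf_closed[OF V(1) m]])
   show "Q V (to_sheaf X P V m) (f V m)" unfolding Q_def
    using fm reps_to_sheaf[OF V(1) m] V M' by (intro conjI ballI exI[of _ V] exI[of _ m]) auto
  qed
  then show "fam' (sheafify X P) U p V (to_sheaf X P V m) = f V m"
   using V to_sheaf_closed[OF V(1) m] by simp
 qed
qed

end

end

section \<open>Quotients\<close>

context
 fixes R :: "('r, 'z) ring_scheme" and M :: "('r, 'm) module" and H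
 assumes M: "module R M" and H: "submodule H R M"
begin

interpretation M: module R M by (rule M)
interpretation A: abelian_subgroup H M
 using H by (intro abelian_subgroupI3 additive_subgroupI M.abelian_group_axioms submodule.axioms(1))

lemma coset_eq_iff: "m : carrier M ==> n : carrier M ==> H +>\<^bsub>M\<^esub> m = H +>\<^bsub>M\<^esub> n \<longleftrightarrow> m -{M} n : H"
 unfolding M.minus_eq
 using A.a_rcos_module[of n m] A.a_repr_independence'[of m n] A.a_repr_independenceD[of m n]
 by metis

lemma quot_carrier: "carrier (quot_mod M H) = (%m. H +>\<^bsub>M\<^esub> m) ` carrier M"
 by (auto simp: quot_mod_def A_RCOSETS_def')

lemma quot_add:
 "m : carrier M ==> n : carrier M ==>
 (H +>\<^bsub>M\<^esub> m) +{(quot_mod M H)} (H +>\<^bsub>M\<^esub> n) = H +>\<^bsub>M\<^esub> (m +{M} n)"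
 by (simp add: quot_mod_def A.a_rcos_sum)

lemma coset_memD: "c : H +>\<^bsub>M\<^esub> m ==> m : carrier M ==> c : carrier M & c -{M} m : H"
 using A.a_elemrcos_carrier A.a_rcos_module_imp by (simp add: M.minus_eq)

lemma coset_self: "m : carrier M ==> m : H +>\<^bsub>M\<^esub> m"
 by (rule A.a_rcos_self)

lemma quot_smult:
 assumes "a : carrier R" "m : carrier M"
 shows "a .{(quot_mod M H)} (H +>\<^bsub>M\<^esub> m) = H +>\<^bsub>M\<^esub> (a .{M} m)"
proof -
 have "H +>\<^bsub>M\<^esub> (a .{M} c) = H +>\<^bsub>M\<^esub> (a .{M} m)" if "c : H +>\<^bsub>M\<^esub> m" for c
 proof (subst coset_eq_iff)
  have c: "c : carrier M" "c -{M} m : H" using coset_memD[OF that assms(2)] by auto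
  have "a .{M} (c -{M} m) : H" using submodule.smult_closed[OF H assms(1) c(2)] .
  then show "a .{M} c -{M} a .{M} m : H"
   using assms c by (simp add: M.minus_eq M.smult_r_distr M.smult_r_minus)
 qed (use that assms coset_memD in auto)
 moreover have "H +>\<^bsub>M\<^esub> m ~= {}" using coset_self[OF assms(2)] by blast
 ultimately show ?thesis by (simp add: quot_mod_def UN_eq_const)
qed

lemma quot_zero: "0{(quot_mod M H)} = H +>\<^bsub>M\<^esub> 0{M}"
 by (simp add: quot_mod_def M.a_coset_add_zero[OF A.a_subset])

lemma quot_module: "module R (quot_mod M H)"
proof (intro moduleI abelian_groupI M.is_cring)
 note q = quot_carrier quot_add quot_smult quot_zero
 show "0{(quot_mod M H)} : carrier (quot_mod M H)" by (simp add: q)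
 fix x assume "x : carrier (quot_mod M H)"
 then obtain m where m: "m : carrier M" "x = H +>\<^bsub>M\<^esub> m" by (auto simp: q)
 show "0{(quot_mod M H)} +{(quot_mod M H)} x = x" using m by (simp add: q)
 show "1{R} .{(quot_mod M H)} x = x" using m by (simp add: q)
 show "EX y:carrier (quot_mod M H). y +{(quot_mod M H)} x = 0{(quot_mod M H)}"
  using m by (intro bexI[of _ "H +>\<^bsub>M\<^esub> \<ominus>\<^bsub>M\<^esub> m"]) (simp_all add: q M.l_neg)
 {
  fix a assume a: "a : carrier R"
  show "a .{(quot_mod M H)} x : carrier (quot_mod M H)" using a m by (simp add: q)
  fix b assume b: "b : carrier R"
  show "(a +{R} b) .{(quot_mod M H)} x = a .{(quot_mod M H)} x +{(quot_mod M H)} b .{(quot_mod M H)} x"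
   using a b m by (simp add: q M.smult_l_distr)
  show "(a *{R} b) .{(quot_mod M H)} x = a .{(quot_mod M H)} (b .{(quot_mod M H)} x)"
   using a b m by (simp add: q M.smult_assoc1)
 }
 fix y assume "y : carrier (quot_mod M H)"
 then obtain n where n: "n : carrier M" "y = H +>\<^bsub>M\<^esub> n" by (auto simp: q)
 show "x +{(quot_mod M H)} y : carrier (quot_mod M H)" using m n by (simp add: q)
 show "x +{(quot_mod M H)} y = y +{(quot_mod M H)} x" using m n by (simp add: q M.a_comm)
 show "a .{(quot_mod M H)} (x +{(quot_mod M H)} y) = a .{(quot_mod M H)} x +{(quot_mod M H)} a .{(quot_mod M H)} y"
  if "a : carrier R" for a using that m n by (simp add: q M.smult_r_distr)
 fix z assume "z : carrier (quot_mod M H)"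
 then obtain k where k: "k : carrier M" "z = H +>\<^bsub>M\<^esub> k" by (auto simp: q)
 show "x +{(quot_mod M H)} y +{(quot_mod M H)} z = x +{(quot_mod M H)} (y +{(quot_mod M H)} z)"
  using m n k by (simp add: q M.a_assoc)
qed

end

context rsp
begin

text \<open>No gluing is demanded, so that the relation submodules \<open>pres_sub\<close> of a
  presentation are covered along with the subsheaf \<open>I\<close>.\<close>

definition sub_pmodule :: "('x, 'r, 'm) omod => ('x set => 'm set) => bool"
 where "sub_pmodule M I \<longleftrightarrow> (\<forall>U. op U --> submodule (I U) (osec X U) (sec M U)) &
  (\<forall>U V m. op U & op V & V <= U & m : I U --> res M U V m : I V)"

lemma sub_O_module_sub_pmodule: "sub_O_module X M I ==> sub_pmodule M I"
 unfolding sub_O_module_def sub_pmodule_def sheaf_on_def presheaf_on_def Pi_def by auto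

abbreviation qclass :: "('x, 'r, 'm) omod => ('x set => 'm set) => 'x set => 'm => 'm set"
 where "qclass M I U m \<equiv> I U +>\<^bsub>sec M U\<^esub> m"

context
 fixes M :: "('x, 'r, 'm) omod" and I
 assumes M: "pmod M" and I: "sub_pmodule M I"
begin

lemma I_sub: "op U ==> submodule (I U) (osec X U) (sec M U)"
 using I by (simp add: sub_pmodule_def)

lemma I_res: "op U ==> op V ==> V <= U ==> m : I U ==> res M U V m : I V"
 using I unfolding sub_pmodule_def by blast

lemma qp_sec: "sec (quot_presheaf M I) U = quot_mod (sec M U) (I U)"
 by (simp add: quot_presheaf_def)

lemma qp_carrier: "op U ==> mcar (quot_presheaf M I) U = qclass M I U ` mcar M U"
 unfolding qp_sec by (rule quot_carrier[OF pm_module[OF M] I_sub])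

lemma qp_add: "op U ==> m :<M U> ==> n :<M U> ==>
 qclass M I U m +<(quot_presheaf M I) U> qclass M I U n = qclass M I U (m +<M U> n)"
 unfolding qp_sec by (rule quot_add[OF pm_module[OF M] I_sub])

lemma qp_smult: "op U ==> a :<U> ==> m :<M U> ==>
 a *<(quot_presheaf M I) U> qclass M I U m = qclass M I U (a *<M U> m)"
 unfolding qp_sec by (rule quot_smult[OF pm_module[OF M] I_sub])

lemma qp_eq_iff: "op U ==> m :<M U> ==> n :<M U> ==>
  qclass M I U m = qclass M I U n \<longleftrightarrow> m -<M U> n : I U"
 by (rule coset_eq_iff[OF pm_module[OF M] I_sub])

lemma qp_res:
 assumes "op U" "op V" "V <= U" "m :<M U>"
 shows "res (quot_presheaf M I) U V (qclass M I U m) = qclass M I V (res M U V m)"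
proof -
 have "qclass M I V (res M U V c) = qclass M I V (res M U V m)" if "c : qclass M I U m" for c
 proof -
  have c: "c :<M U>" "c -<M U> m : I U"
   using coset_memD[OF pm_module[OF M assms(1)] I_sub[OF assms(1)] that assms(4)] by auto
  then show ?thesis
   using I_res[OF assms(1-3) c(2)] assms M by (subst qp_eq_iff) auto
 qed
 moreover have "qclass M I U m ~= {}"
  using coset_self[OF pm_module[OF M assms(1)] I_sub[OF assms(1)] assms(4)] by blast
 ultimately show ?thesis by (simp add: quot_presheaf_def UN_eq_const)
qed

lemma quot_presheaf_pmodule: "pmod (quot_presheaf M I)"
 unfolding pmodule_def
proof (intro conjI allI impI ballI)
 show "presheaf_on (tsp X) (mcar (quot_presheaf M I)) (res (quot_presheaf M I))"
  unfolding presheaf_on_def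
 proof (intro conjI allI impI funcsetI ballI)
  show "res (quot_presheaf M I) U V c :<(quot_presheaf M I) V>"
   if "op U & op V & V <= U" "c :<(quot_presheaf M I) U>" for U V c
   using that M by (auto simp: qp_carrier qp_res)
  show "res (quot_presheaf M I) U U c = c" if "op U" "c :<(quot_presheaf M I) U>" for U c
   using that M by (auto simp: qp_carrier qp_res)
  show "res (quot_presheaf M I) V W (res (quot_presheaf M I) U V c) = res (quot_presheaf M I) U W c"
   if "op U & op V & op W & W <= V & V <= U" "c :<(quot_presheaf M I) U>" for U V W c
  proof -
   have "W <= U" using that by blast
   then show ?thesis using that M by (auto simp: qp_carrier qp_res)
  qed
 qed
 show "module (osec X U) (sec (quot_presheaf M I) U)" if "op U" for U
  unfolding qp_sec by (rule quot_module[OF pm_module[OF M that] I_sub[OF that]])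
 fix U V c assume "op U & V : ops U" and c: "c :<(quot_presheaf M I) U>"
 then have U: "op U" "op V" "V <= U" by auto
 obtain m where m: "m :<M U>" "c = qclass M I U m" using c U by (auto simp: qp_carrier)
 show "res (quot_presheaf M I) U V (a *<(quot_presheaf M I) U> c) =
   rs U V a *<(quot_presheaf M I) V> res (quot_presheaf M I) U V c"
  if "a :<U>" for a
  using that U m M by (simp add: qp_res qp_smult)
 fix d assume d: "d :<(quot_presheaf M I) U>"
 obtain n where n: "n :<M U>" "d = qclass M I U n" using d U by (auto simp: qp_carrier)
 show "res (quot_presheaf M I) U V (c +<(quot_presheaf M I) U> d) =
   res (quot_presheaf M I) U V c +<(quot_presheaf M I) V> res (quot_presheaf M I) U V d"
  using U m n M by (simp add: qp_res qp_add)
qed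

lemma qclass_hom: "fam' M U (qclass M I) : Hom M (quot_presheaf M I) U"
 by (rule homsI[OF M]) (auto simp: qp_carrier qp_add qp_smult qp_res)

lemma quot_presheaf_lift:
 assumes N: "pmod N" and f: "f : Hom M N U"
  and kill: "!!V m. op V ==> V <= U ==> m : I V ==> f V m = 0<N V>"
 obtains g where "g : Hom (quot_presheaf M I) N U"
  "!!V m. op V ==> V <= U ==> m :<M V> ==> g V (qclass M I V m) = f V m"
proof -
 \<comment> \<open>Any representative of the coset may be chosen: two of them differ by an element
   of \<open>I V\<close>, which \<open>f\<close> kills.\<close>
 define g where "g V c = f V (SOME m. m :<M V> & c = qclass M I V m)" for V c
 have g: "g V (qclass M I V m) = f V m" if V: "op V" "V <= U" and m: "m :<M V>" for V m
 proof -
  define n where "n = (SOME n. n :<M V> & qclass M I V m = qclass M I V n)"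
  have n: "n :<M V> & qclass M I V m = qclass M I V n"
   unfolding n_def by (rule someI[of _ m]) (use m in simp)
  then have "n -<M V> m : I V" using V m by (metis qp_eq_iff)
  then have "f V (n -<M V> m) = 0<N V>" by (rule kill[OF V])
  then have "f V n -<N V> f V m = 0<N V>"
   using homs_minus[OF f V M N] n m by simp
  then have "f V n = f V m"
   using pm_minus_zero_iff[OF N V(1)] homs_closed[OF f V] n m by simp
  then show ?thesis by (simp add: g_def n_def)
 qed
 have "fam' (quot_presheaf M I) U g : Hom (quot_presheaf M I) N U"
 proof (rule homsI[OF quot_presheaf_pmodule])
  fix V c assume V: "op V" "V <= U" and c: "c :<(quot_presheaf M I) V>"
  obtain m where m: "m :<M V>" "c = qclass M I V m" using c V by (auto simp: qp_carrier)
  show "g V c :<N V>" using m g[OF V] homs_closed[OF f V] by simp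
  show "g V (a *<(quot_presheaf M I) V> c) = a *<N V> g V c" if "a :<V>" for a
   using that m V M g[OF V] homs_smult[OF f V] by (simp add: qp_smult)
  show "g V (c +<(quot_presheaf M I) V> d) = g V c +<N V> g V d"
   if d: "d :<(quot_presheaf M I) V>" for d
  proof -
   obtain n where n: "n :<M V>" "d = qclass M I V n" using d V by (auto simp: qp_carrier)
   show ?thesis using m n V M g[OF V] homs_add[OF f V] by (simp add: qp_add)
  qed
  fix W assume W: "op W" "W <= V"
  then have WU: "W <= U" using V by blast
  show "g W (res (quot_presheaf M I) V W c) = res N V W (g V c)"
   using m V M W g[OF V] g[OF W(1) WU] homs_res[OF f V W] by (simp add: qp_res)
 qed
 moreover have "fam' (quot_presheaf M I) U g V (qclass M I V m) = f V m"
  if "op V" "V <= U" "m :<M V>" for V m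
  using that g by (simp add: qp_carrier)
 ultimately show thesis by (rule that)
qed

lemma quot_sheaf_O_module: "omod (quot_sheaf X M I)"
 unfolding quot_sheaf_def by (rule sheafify_O_module[OF quot_presheaf_pmodule])

lemma quot_map_hom: "quot_map X M I : mor X M (quot_sheaf X M I)"
proof -
 let ?P = "quot_presheaf M I"
 have "fam' M (pts X) (%V m. fam' ?P (pts X) (to_sheaf X ?P) V (fam' M (pts X) (qclass M I) V m)) : mor X M (sheafify X ?P)"
  by (rule homs_comp[OF qclass_hom to_sheaf_hom[OF quot_presheaf_pmodule] M])
 moreover have "fam' M (pts X) (%V m. fam' ?P (pts X) (to_sheaf X ?P) V (fam' M (pts X) (qclass M I) V m)) =
   quot_map X M I"
  unfolding quot_map_def by (intro restrict_ext) (simp add: qp_carrier)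
 ultimately show ?thesis by (simp add: quot_sheaf_def)
qed

end

end

section \<open>Presheaves given by generators and relations\<close>

subsection \<open>Free modules\<close>

definition single :: "('r, 'z) ring_scheme => 's => 'r => 's => 'r"
 where "single R s a = (%t. if t = s then a else 0{R})"

lemma free_gen_single: "free_gen R s = single R s 1{R}"
 by (simp add: free_gen_def single_def)

lemma free_mod_simps:
 "f : carrier (free_mod R S) \<longleftrightarrow> f : S \<rightarrow> carrier R & finite {s. f s ~= 0{R}} & (\<forall>s. s \<notin> S --> f s = 0{R})"
 "0{(free_mod R S)} = (%s. 0{R})"
 "f +{(free_mod R S)} g = (%s. f s +{R} g s)"
 "a .{(free_mod R S)} f = (%s. a *{R} f s)"
proof -
 have "{s : S. f s ~= 0{R}} = {s. f s ~= 0{R}}" if "\<forall>s. s \<notin> S --> f s = 0{R}"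
  using that by auto
 then show "f : carrier (free_mod R S) \<longleftrightarrow> f : S \<rightarrow> carrier R & finite {s. f s ~= 0{R}} & (\<forall>s. s \<notin> S --> f s = 0{R})"
  by (auto simp: free_mod_def)
qed (simp_all add: free_mod_def)

text \<open>The additive extension of \<open>h\<close> from the elements \<open>single R s a\<close>
  to the whole free module. With values in a ring it gives one coefficient of a restricted element;
  with values in a module it gives the linear map determined by the images of the
  generators.\<close>

definition supp_sum :: "('a, 'z) ring_scheme => ('b, 'c) ring_scheme => ('s => 'a => 'b) => ('s => 'a) => 'b"
 where "supp_sum R N h f = finsum N (%s. h s (f s)) {s. f s ~= 0{R}}"

context cring
begin

lemma free_mod_value: "f : carrier (free_mod R S) ==> f s : carrier R"
 by (cases "s : S") (auto simp: free_mod_simps)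

lemma free_mod_memI:
 assumes "!!s. s : S ==> f s : carrier R" "finite A" "!!s. f s ~= \<zero> ==> s : A" "A <= S"
 shows "f : carrier (free_mod R S)"
proof -
 have "{s. f s ~= \<zero>} <= A" using assms(3) by blast
 then have "finite {s. f s ~= \<zero>}" using finite_subset assms(2) by blast
 then show ?thesis using assms by (auto simp: free_mod_simps)
qed

lemma free_mod_add_closed:
 assumes "f : carrier (free_mod R S)" "g : carrier (free_mod R S)"
 shows "(%s. f s \<oplus> g s) : carrier (free_mod R S)"
proof (rule free_mod_memI)
 show "f s \<oplus> g s : carrier R" for s
  using free_mod_value[OF assms(1)] free_mod_value[OF assms(2)] by simp
 show "finite ({s. f s ~= \<zero>} \<union> {s. g s ~= \<zero>})" using assms by (simp add: free_mod_simps)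
qed (use assms in \<open>auto simp: free_mod_simps\<close>)

lemma free_mod_smult_closed:
 assumes "f : carrier (free_mod R S)" "a : carrier R"
 shows "(%s. a \<otimes> f s) : carrier (free_mod R S)"
proof (rule free_mod_memI)
 show "a \<otimes> f s : carrier R" for s
  using free_mod_value[OF assms(1)] assms(2) by simp
 show "finite {s. f s ~= \<zero>}" using assms by (simp add: free_mod_simps)
qed (use assms in \<open>auto simp: free_mod_simps\<close>)

lemma free_mod_zero_closed: "(%s. \<zero>) : carrier (free_mod R S)"
 by (rule free_mod_memI[of _ _ "{}"]) auto

lemma single_closed: "s : S ==> a : carrier R ==> single R s a : carrier (free_mod R S)"
 by (rule free_mod_memI[of _ _ "{s}"]) (auto simp: single_def split: if_splits)

lemma free_module: "module R (free_mod R S)"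
proof (intro moduleI abelian_groupI)
 show "cring R" ..
 note v = free_mod_value[of _ S]
 show "0{(free_mod R S)} : carrier (free_mod R S)"
  by (simp add: free_mod_simps(2) free_mod_zero_closed)
 fix f assume f: "f : carrier (free_mod R S)"
 show "0{(free_mod R S)} +{(free_mod R S)} f = f" "\<one> .{(free_mod R S)} f = f"
  by (simp_all add: free_mod_simps(2-4) v[OF f])
 show "EX g:carrier (free_mod R S). g +{(free_mod R S)} f = 0{(free_mod R S)}"
  using free_mod_smult_closed[OF f, of "\<ominus> \<one>"]
  by (intro bexI[of _ "%s. \<ominus> \<one> \<otimes> f s"]) (auto simp: free_mod_simps(2-4) v[OF f] l_minus l_neg)
 {
  fix a b assume a: "a : carrier R"
  show "a .{(free_mod R S)} f : carrier (free_mod R S)"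
   by (simp add: free_mod_simps(4) free_mod_smult_closed f a)
  assume b: "b : carrier R"
  show "(a \<oplus> b) .{(free_mod R S)} f = a .{(free_mod R S)} f +{(free_mod R S)} b .{(free_mod R S)} f"
   "(a \<otimes> b) .{(free_mod R S)} f = a .{(free_mod R S)} (b .{(free_mod R S)} f)"
   using a b by (simp_all add: free_mod_simps(2-4) v[OF f] l_distr m_assoc)
 }
 fix g assume g: "g : carrier (free_mod R S)"
 show "f +{(free_mod R S)} g : carrier (free_mod R S)"
  by (simp add: free_mod_simps(3) free_mod_add_closed f g)
 show "f +{(free_mod R S)} g = g +{(free_mod R S)} f"
  by (simp add: free_mod_simps(3) v[OF f] v[OF g] a_comm)
 show "a .{(free_mod R S)} (f +{(free_mod R S)} g) = a .{(free_mod R S)} f +{(free_mod R S)} a .{(free_mod R S)} g"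
  if "a : carrier R" for a using that by (simp add: free_mod_simps(3,4) v[OF f] v[OF g] r_distr)
 fix h assume h: "h : carrier (free_mod R S)"
 show "f +{(free_mod R S)} g +{(free_mod R S)} h = f +{(free_mod R S)} (g +{(free_mod R S)} h)"
  by (simp add: free_mod_simps(3) v[OF f] v[OF g] v[OF h] a_assoc)
qed

text \<open>Induction over a finite set containing the support; a generator is split off by setting
  its coefficient to zero.\<close>

lemma free_induct:
 assumes f: "f : carrier (free_mod R S)" and zero: "P 0{(free_mod R S)}"
  and step: "!!s a g. s : S ==> a : carrier R ==> g : carrier (free_mod R S) ==> P g ==>
   P (single R s a +{(free_mod R S)} g)"
 shows "P f"
proof -
 have "P f" if "finite A" "f : carrier (free_mod R S)" "{s. f s ~= \<zero>} <= A" for A f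
  using that
 proof (induction A arbitrary: f)
  case empty
  then have "f = 0{(free_mod R S)}" by (auto simp: free_mod_simps(2))
  then show ?case using zero by simp
 next
  case (insert s A)
  show ?case
  proof (cases "s : S")
   case True
   define g where "g = f(s := \<zero>)"
   have g: "g : carrier (free_mod R S)"
   proof (rule free_mod_memI)
    show "finite {s. f s ~= \<zero>}" using insert.prems(1) by (simp add: free_mod_simps)
    show "{s. f s ~= \<zero>} <= S" using insert.prems(1) by (auto simp: free_mod_simps)
   qed (use free_mod_value[OF insert.prems(1)] in \<open>auto simp: g_def split: if_splits\<close>)
   have "P g" by (rule insert.IH[OF g]) (use insert.prems(2) in \<open>auto simp: g_def\<close>)
   then have "P (single R s (f s) +{(free_mod R S)} g)"
    by (rule step[OF True free_mod_value[OF insert.prems(1)] g])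
   moreover have "single R s (f s) +{(free_mod R S)} g = f"
    using free_mod_value[OF insert.prems(1)] by (auto simp: free_mod_simps(3) single_def g_def fun_eq_iff)
   ultimately show ?thesis by simp
  next
   case False
   then have "f s = \<zero>" using insert.prems(1) by (simp add: free_mod_simps)
   then show ?thesis using insert by auto
  qed
 qed
 from this[OF _ f order_refl] show ?thesis using f by (simp add: free_mod_simps)
qed

text \<open>The elements \<open>single R s a\<close> generate the free module as an abelian group,
  so additivity of the two maps suffices. This covers restriction maps, which are linear only along
  a change of rings.\<close>

lemma free_additive_ext:
 assumes f: "f : carrier (free_mod R S)" and N: "abelian_group N"
  and cl: "!!f. f : carrier (free_mod R S) ==> F f : carrier N" "!!f. f : carrier (free_mod R S) ==> G f : carrier N"
  and add: "!!f g. f : carrier (free_mod R S) ==> g : carrier (free_mod R S) ==> F (f +{(free_mod R S)} g) = F f +{N} F g"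
   "!!f g. f : carrier (free_mod R S) ==> g : carrier (free_mod R S) ==> G (f +{(free_mod R S)} g) = G f +{N} G g"
  and eq: "!!s a. s : S ==> a : carrier R ==> F (single R s a) = G (single R s a)"
 shows "F f = G f"
proof (rule free_induct[OF f, where P = "%f. F f = G f"])
 interpret N: abelian_group N by (rule N)
 interpret S: module R "free_mod R S" by (rule free_module)
 let ?z = "0{(free_mod R S)}"
 have "F ?z +{N} F ?z = F ?z" "G ?z +{N} G ?z = G ?z"
  using add(1)[of ?z ?z] add(2)[of ?z ?z] by simp_all
 then have "F ?z = 0{N}" "G ?z = 0{N}"
  using N.add.l_cancel_one[of "F ?z" "F ?z"] N.add.l_cancel_one[of "G ?z" "G ?z"]
   cl(1)[OF S.zero_closed] cl(2)[OF S.zero_closed] by auto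
 then show "F ?z = G ?z" by simp
next
 fix s a g assume s: "s : S" "a : carrier R" and g: "g : carrier (free_mod R S)" "F g = G g"
 show "F (single R s a +{(free_mod R S)} g) = G (single R s a +{(free_mod R S)} g)"
  unfolding add(1)[OF single_closed[OF s] g(1)] add(2)[OF single_closed[OF s] g(1)] eq[OF s] g(2) ..
qed

context
 fixes S :: "'s set" and N :: "('n, 'q) ring_scheme" and h :: "'s => 'a => 'n"
 assumes N: "abelian_monoid N" and h: "!!s a. s : S ==> a : carrier R ==> h s a : carrier N"
  and h_zero: "!!s. s : S ==> h s \<zero> = 0{N}"
  and h_add: "!!s a b. s : S ==> a : carrier R ==> b : carrier R ==> h s (a \<oplus> b) = h s a +{N} h s b"
begin

interpretation N: abelian_monoid N by (rule N)

text \<open>Since \<open>h s\<close> sends zero to zero, any finite set between the support and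
  \<open>S\<close> may index the sum. This makes the sums for \<open>f\<close>, \<open>g\<close> and
  \<open>f + g\<close> comparable although their supports differ.\<close>

lemma supp_sum_extend:
 assumes f: "f : carrier (free_mod R S)" and A: "finite A" "{s. f s ~= \<zero>} <= A" "A <= S"
 shows "supp_sum R N h f = finsum N (%s. h s (f s)) A"
 unfolding supp_sum_def
proof (rule N.add.finprod_mono_neutral_cong_left)
 show "h s (f s) = 0{N}" if "s : A - {s. f s ~= \<zero>}" for s using that A h_zero[of s] by auto
 show "(%s. h s (f s)) : A \<rightarrow> carrier N" using A f free_mod_value[OF f] h by auto
qed (use A in auto)

lemma supp_sum_closed: "f : carrier (free_mod R S) ==> supp_sum R N h f : carrier N"
 unfolding supp_sum_def
 by (rule N.finsum_closed) (use h in \<open>auto simp: free_mod_simps\<close>)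

lemma supp_sum_add:
 assumes f: "f : carrier (free_mod R S)" and g: "g : carrier (free_mod R S)"
 shows "supp_sum R N h (f +{(free_mod R S)} g) = supp_sum R N h f +{N} supp_sum R N h g"
proof -
 let ?A = "{s. f s ~= \<zero>} \<union> {s. g s ~= \<zero>}"
 interpret S: module R "free_mod R S" by (rule free_module)
 have A: "finite ?A" "?A <= S" using f g by (auto simp: free_mod_simps)
 have fg: "f +{(free_mod R S)} g : carrier (free_mod R S)" using f g by simp
 have "supp_sum R N h (f +{(free_mod R S)} g) = finsum N (%s. h s ((f +{(free_mod R S)} g) s)) ?A"
  by (rule supp_sum_extend[OF fg A(1) _ A(2)]) (auto simp: free_mod_simps(3))
 also have "\<dots> = finsum N (%s. h s (f s) +{N} h s (g s)) ?A"
 proof (rule N.finsum_cong')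
  show "h s ((f +{(free_mod R S)} g) s) = h s (f s) +{N} h s (g s)" if "s : ?A" for s
   using that A(2) h_add[of s] free_mod_value[OF f] free_mod_value[OF g] by (auto simp: free_mod_simps(3))
 qed (use A(2) h free_mod_value[OF f] free_mod_value[OF g] in auto)
 also have "\<dots> = finsum N (%s. h s (f s)) ?A +{N} finsum N (%s. h s (g s)) ?A"
  by (rule N.finsum_addf) (use A(2) h free_mod_value[OF f] free_mod_value[OF g] in auto)
 also have "\<dots> = supp_sum R N h f +{N} supp_sum R N h g"
  using supp_sum_extend[OF f A(1) _ A(2)] supp_sum_extend[OF g A(1) _ A(2)] by simp
 finally show ?thesis .
qed

lemma supp_sum_single:
 assumes s: "s : S" and a: "a : carrier R"
 shows "supp_sum R N h (single R s a) = h s a"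
proof -
 have "supp_sum R N h (single R s a) = finsum N (%t. h t (single R s a t)) {s}"
  by (rule supp_sum_extend[OF single_closed[OF s a]]) (use s in \<open>auto simp: single_def split: if_splits\<close>)
 also have "\<dots> = h s a" using h[OF s a] by (simp add: single_def)
 finally show ?thesis .
qed

end

lemma submod_gen_submodule:
 assumes M: "module R M" and K: "K <= carrier M"
 shows "submodule (submod_gen R M K) R M"
proof -
 interpret M: module R M by (rule M)
 have c: "submodule (carrier M) R M" by (rule M.submoduleI) auto
 show ?thesis
 proof (rule M.submoduleI)
  show "submod_gen R M K <= carrier M" using c K unfolding submod_gen_def by blast
  show "0{M} : submod_gen R M K"
   unfolding submod_gen_def using M.submoduleE(2,3,5) M.submoduleE(1) by (auto dest!: submodule.axioms(1) subgroup.one_closed)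
 qed (auto simp: submod_gen_def M.submoduleE)
qed

lemma submod_gen_incl: "K <= submod_gen R M K"
 unfolding submod_gen_def by blast

lemma submod_gen_least: "submodule H R M ==> K <= H ==> submod_gen R M K <= H"
 unfolding submod_gen_def by blast

end

subsection \<open>Presheaves of free modules\<close>

text \<open>The free presheaf hidden in \<open>pres_presheaf\<close>; naming it exhibits that
  presheaf as a quotient presheaf, to which the general results on quotients apply.\<close>

definition free_pre :: "('x, 'r, 'z) ringed_space_scheme => ('x set => 's set) => ('x set => 'x set => 's => 's) =>
  ('x, 'r, 's => 'r) omod"
 where "free_pre X S \<sigma> = \<lparr>sec = (%U. free_mod (osec X U) (S U)),
  res = (%U V f t. finsum (osec X V) (%s. ores X U V (f s)) {s. f s ~= 0{(osec X U)} & \<sigma> U V s = t})\<rparr>"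

lemma pres_presheaf_quot: "pres_presheaf X S K \<sigma> = quot_presheaf (free_pre X S \<sigma>) (pres_sub X S K)"
 by (simp add: pres_presheaf_def quot_presheaf_def free_pre_def)

lemma free_pre_sec: "sec (free_pre X S \<sigma>) U = free_mod (osec X U) (S U)"
 by (simp add: free_pre_def)

context rsp
begin

definition gens_ok :: "('x set => 's set) => ('x set => 'x set => 's => 's) => bool"
 where "gens_ok S \<sigma> \<longleftrightarrow>
  (\<forall>U V s. op U & op V & V <= U & s : S U --> \<sigma> U V s : S V) &
  (\<forall>U s. op U & s : S U --> \<sigma> U U s = s) &
  (\<forall>U V W s. op U & op V & op W & W <= V & V <= U & s : S U --> \<sigma> V W (\<sigma> U V s) = \<sigma> U W s)"

context
 fixes S :: "'x set => 's set" and \<sigma>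
 assumes gens: "gens_ok S \<sigma>"
begin

lemma gens_closed: "op U ==> op V ==> V <= U ==> s : S U ==> \<sigma> U V s : S V"
 using gens by (simp add: gens_ok_def)

lemma gens_id: "op U ==> s : S U ==> \<sigma> U U s = s"
 using gens by (simp add: gens_ok_def)

lemma gens_comp: "op U ==> op V ==> op W ==> W <= V ==> V <= U ==> s : S U ==> \<sigma> V W (\<sigma> U V s) = \<sigma> U W s"
 using gens by (simp add: gens_ok_def)

abbreviation (input) "FP \<equiv> free_pre X S \<sigma>"

lemma fp_module: "op U ==> module (osec X U) (sec FP U)"
 unfolding free_pre_sec by (rule cring.free_module[OF O_cring])

text \<open>The coefficient at \<open>t\<close> collects the restricted coefficients of all
  generators that become \<open>t\<close>. Written as a \<open>supp_sum\<close>, with 0 for the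
  other generators, it inherits additivity.\<close>

lemma fp_res_supp_sum:
 assumes U: "op U" "op V" "V <= U" and f: "f :<FP U>"
 shows "res FP U V f t = supp_sum (osec X U) (osec X V) (%s a. if \<sigma> U V s = t then rs U V a else 0<V>) f"
proof -
 interpret R: cring "osec X U" by (rule O_cring[OF U(1)])
 interpret V: cring "osec X V" by (rule O_cring[OF U(2)])
 have f': "f : carrier (free_mod (osec X U) (S U))" using f by (simp add: free_pre_sec)
 let ?A = "{s. f s ~= 0<U>}" and ?g = "%s. rs U V (f s)"
 have g: "?g s :<V>" for s using R.free_mod_value[OF f'] U by simp
 have "finsum (osec X V) (%s. if \<sigma> U V s = t then ?g s else 0<V>) ?A = finsum (osec X V) ?g (?A Int {s. \<sigma> U V s = t})"
 proof (rule V.add.finprod_mono_neutral_cong_right)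
  show "finite ?A" using f' by (simp add: free_mod_simps)
 qed (use g in auto)
 moreover have "?A Int {s. \<sigma> U V s = t} = {s. f s ~= 0<U> & \<sigma> U V s = t}" by auto
 ultimately show ?thesis by (simp add: free_pre_def supp_sum_def)
qed

lemma fp_res_hyps:
 assumes "op U" "op V" "V <= U"
 shows "abelian_monoid (osec X V)"
  "!!s a. s : S U ==> a :<U> ==> (if \<sigma> U V s = t then rs U V a else 0<V>) :<V>"
  "!!s. s : S U ==> (if \<sigma> U V s = t then rs U V 0<U> else 0<V>) = 0<V>"
  "!!s a b. s : S U ==> a :<U> ==> b :<U> ==>
   (if \<sigma> U V s = t then rs U V (a +<U> b) else 0<V>) =
   (if \<sigma> U V s = t then rs U V a else 0<V>) +<V>
   (if \<sigma> U V s = t then rs U V b else 0<V>)"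
proof -
 interpret V: cring "osec X V" by (rule O_cring[OF assms(2)])
 show "abelian_monoid (osec X V)" ..
qed (use assms cring.cring_simprules(8)[OF O_cring[OF assms(2)]] in auto)

lemma fp_res_add:
 assumes U: "op U" "op V" "V <= U" and f: "f :<FP U>" and g: "g :<FP U>"
 shows "res FP U V (f +<FP U> g) = res FP U V f +<FP V> res FP U V g"
proof
 fix t
 interpret R: cring "osec X U" by (rule O_cring[OF U(1)])
 interpret F: module "osec X U" "sec FP U" by (rule fp_module[OF U(1)])
 have fg: "f +<FP U> g :<FP U>" using f g by simp
 note fp = fp_res_supp_sum[OF U]
 show "res FP U V (f +<FP U> g) t = (res FP U V f +<FP V> res FP U V g) t"
  using fp[OF fg, of t] fp[OF f, of t] fp[OF g, of t]
   R.supp_sum_add[where h = "%s a. if \<sigma> U V s = t then rs U V a else 0<V>" and S = "S U",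
    OF fp_res_hyps[OF U] f[unfolded free_pre_sec] g[unfolded free_pre_sec]]
  by (simp add: free_pre_sec free_mod_simps(3))
qed

lemma fp_res_single:
 assumes U: "op U" "op V" "V <= U" and s: "s : S U" and a: "a :<U>"
 shows "res FP U V (single (osec X U) s a) = single (osec X V) (\<sigma> U V s) (rs U V a)"
proof
 fix t
 interpret R: cring "osec X U" by (rule O_cring[OF U(1)])
 have "res FP U V (single (osec X U) s a) t =
   (if \<sigma> U V s = t then rs U V a else 0<V>)"
  using fp_res_supp_sum[OF U, of "single (osec X U) s a" t] R.single_closed[OF s a]
   R.supp_sum_single[where h = "%s a. if \<sigma> U V s = t then rs U V a else 0<V>" and S = "S U", OF fp_res_hyps[OF U] s a] by (simp add: free_pre_sec)
 then show "res FP U V (single (osec X U) s a) t = single (osec X V) (\<sigma> U V s) (rs U V a) t"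
  by (simp add: single_def)
qed

lemma fp_res_closed:
 assumes U: "op U" "op V" "V <= U" and f: "f :<FP U>"
 shows "res FP U V f :<FP V>"
proof -
 interpret R: cring "osec X U" by (rule O_cring[OF U(1)])
 interpret V: cring "osec X V" by (rule O_cring[OF U(2)])
 interpret F: module "osec X V" "sec FP V" by (rule fp_module[OF U(2)])
 have "f : carrier (free_mod (osec X U) (S U))" using f by (simp add: free_pre_sec)
 then show ?thesis
 proof (rule R.free_induct)
  have "res FP U V 0{(free_mod (osec X U) (S U))} = 0<FP V>"
   by (simp add: free_pre_def free_mod_simps(2))
  then show "res FP U V 0{(free_mod (osec X U) (S U))} :<FP V>" by simp
  fix s a g assume s: "s : S U" and a: "a :<U>" and g: "g : carrier (free_mod (osec X U) (S U))"
   "res FP U V g :<FP V>"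
  have "single (osec X V) (\<sigma> U V s) (rs U V a) : carrier (free_mod (osec X V) (S V))"
   by (rule V.single_closed) (use U gens_closed s a in auto)
  then have "res FP U V (single (osec X U) s a) :<FP V>"
   by (simp add: fp_res_single[OF U s a] free_pre_sec)
  then show "res FP U V (single (osec X U) s a +{(free_mod (osec X U) (S U))} g) :<FP V>"
   using g fp_res_add[OF U, of "single (osec X U) s a" g] R.single_closed[OF s a] F.add.m_closed
   by (simp add: free_pre_sec[of _ _ _ U])
 qed
qed

text \<open>Identity, composition and scalar compatibility of the restrictions are equalities of
  maps additive in \<open>f\<close>; \<open>free_additive_ext\<close> reduces them to a single
  generator with a coefficient.\<close>

lemma fp_pmodule: "pmod FP"
 unfolding pmodule_def
proof (intro conjI allI impI ballI)
 show m: "module (osec X U) (sec FP U)" if "op U" for U by (rule fp_module[OF that])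
 have ag: "abelian_group (sec FP U)" if "op U" for U
  using m[OF that] by (simp add: module_def)
 note add_closed = abelian_monoid.a_closed[OF abelian_group.axioms(1)[OF ag]]
 show "presheaf_on (tsp X) (mcar FP) (res FP)"
  unfolding presheaf_on_def
 proof (intro conjI allI impI funcsetI ballI)
  show "res FP U V f :<FP V>" if "op U & op V & V <= U" "f :<FP U>" for U V f
   using that by (intro fp_res_closed) auto
  show "res FP U U f = f" if U: "op U" and f: "f :<FP U>" for U f
  proof (rule cring.free_additive_ext[OF O_cring[OF U] _ ag[OF U], where F = "res FP U U" and G = "%f. f"])
   show "f : carrier (free_mod (osec X U) (S U))" using f by (simp add: free_pre_sec)
   show "res FP U U (single (osec X U) s a) = single (osec X U) s a" if "s : S U" "a :<U>" for s a
    using that U by (simp add: fp_res_single gens_id)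
   show "res FP U U g :<FP U>" "g :<FP U>" if "g : carrier (free_mod (osec X U) (S U))" for g
    using that fp_res_closed[OF U U] by (simp_all add: free_pre_sec)
   show "res FP U U (g +{(free_mod (osec X U) (S U))} h) = res FP U U g +<FP U> res FP U U h"
    if "g : carrier (free_mod (osec X U) (S U))" "h : carrier (free_mod (osec X U) (S U))" for g h
    using that fp_res_add[OF U U] by (simp add: free_pre_sec)
  qed (simp add: free_pre_sec)
  show "res FP V W (res FP U V f) = res FP U W f"
   if o: "op U & op V & op W & W <= V & V <= U" and f: "f :<FP U>" for U V W f
  proof (rule cring.free_additive_ext[OF O_cring _ ag, where F = "%f. res FP V W (res FP U V f)" and G = "res FP U W"])
   show o': "op U" "op W" using o by auto
   have o'': "op V" "W <= V" "V <= U" "W <= U" using o by auto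
   show "f : carrier (free_mod (osec X U) (S U))" using f by (simp add: free_pre_sec)
   show "res FP V W (res FP U V (single (osec X U) s a)) = res FP U W (single (osec X U) s a)"
    if "s : S U" "a :<U>" for s a
    using that o' o'' by (simp add: fp_res_single gens_closed gens_comp)
   show "res FP V W (res FP U V g) :<FP W>" "res FP U W g :<FP W>"
    if "g : carrier (free_mod (osec X U) (S U))" for g
    using fp_res_closed[OF o'(1) o''(1,3), of g] fp_res_closed[OF o'(1,2) o''(4), of g]
     fp_res_closed[OF o''(1) o'(2) o''(2), of "res FP U V g"] that
    by (simp_all add: free_pre_sec[of X S \<sigma> U, symmetric])
   show "res FP V W (res FP U V (g +{(free_mod (osec X U) (S U))} h)) =
      res FP V W (res FP U V g) +<FP W> res FP V W (res FP U V h)"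
     "res FP U W (g +{(free_mod (osec X U) (S U))} h) = res FP U W g +<FP W> res FP U W h"
    if "g : carrier (free_mod (osec X U) (S U))" "h : carrier (free_mod (osec X U) (S U))" for g h
    using that fp_res_add[OF o'(1) o''(1,3), of g h] fp_res_add[OF o'(1,2) o''(4), of g h]
     fp_res_add[OF o''(1) o'(2) o''(2), of "res FP U V g" "res FP U V h"]
     fp_res_closed[OF o'(1) o''(1,3), of g] fp_res_closed[OF o'(1) o''(1,3), of h]
    by (simp_all add: free_pre_sec[of X S \<sigma> U, symmetric])
  qed
 qed
 fix U V f assume "op U & V : ops U" and f: "f :<FP U>"
 then have U: "op U" "op V" "V <= U" by auto
 show "res FP U V (f +<FP U> g) = res FP U V f +<FP V> res FP U V g" if "g :<FP U>" for g
  by (rule fp_res_add[OF U f that])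
 fix a assume a: "a :<U>"
 interpret R: cring "osec X U" by (rule O_cring[OF U(1)])
 interpret V: cring "osec X V" by (rule O_cring[OF U(2)])
 interpret FU: module "osec X U" "sec FP U" by (rule fp_module[OF U(1)])
 interpret FV: module "osec X V" "sec FP V" by (rule fp_module[OF U(2)])
 have sm: "b *<FP W> single (osec X W) s c = single (osec X W) s (b *<W> c)"
  if "b :<W>" "op W" for b c s W
 proof -
  interpret W: cring "osec X W" by (rule O_cring[OF that(2)])
  show ?thesis using that by (auto simp: free_pre_sec free_mod_simps(4) single_def fun_eq_iff)
 qed
 show "res FP U V (a *<FP U> f) = rs U V a *<FP V> res FP U V f"
 proof (rule R.free_additive_ext[OF _ ag[OF U(2)],
   where F = "%f. res FP U V (a *<FP U> f)" and G = "%f. rs U V a *<FP V> res FP U V f" and S = "S U"];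
   (unfold free_pre_sec[of X S \<sigma> U, symmetric])?)
  show "f :<FP U>" by (rule f)
  show "res FP U V (a *<FP U> single (osec X U) s b) = rs U V a *<FP V> res FP U V (single (osec X U) s b)"
   if "s : S U" "b :<U>" for s b
   using that a U by (simp add: sm fp_res_single)
  fix g assume g: "g :<FP U>"
  note rg = fp_res_closed[OF U g]
  show "res FP U V (a *<FP U> g) :<FP V>"
   by (rule fp_res_closed[OF U FU.smult_closed[OF a g]])
  show "rs U V a *<FP V> res FP U V g :<FP V>" using rg a U by simp
  fix h assume h: "h :<FP U>"
  show "res FP U V (a *<FP U> (g +<FP U> h)) =
    res FP U V (a *<FP U> g) +<FP V> res FP U V (a *<FP U> h)"
   unfolding FU.smult_r_distr[OF a g h]
   by (rule fp_res_add[OF U FU.smult_closed[OF a g] FU.smult_closed[OF a h]])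
  show "rs U V a *<FP V> res FP U V (g +<FP U> h) =
    rs U V a *<FP V> res FP U V g +<FP V> rs U V a *<FP V> res FP U V h"
   unfolding fp_res_add[OF U g h]
   by (rule FV.smult_r_distr[OF _ rg fp_res_closed[OF U h]]) (use a U in simp)
 qed
qed

lemma fp_gen_closed: "op U ==> s : S U ==> free_gen (osec X U) s :<FP U>"
 unfolding free_gen_single free_pre_sec by (rule cring.single_closed[OF O_cring]) auto

lemma fp_gen_res:
 "op U ==> op V ==> V <= U ==> s : S U ==> res FP U V (free_gen (osec X U) s) = free_gen (osec X V) (\<sigma> U V s)"
 by (simp add: free_gen_single fp_res_single)

lemma fp_smult_gen:
 assumes "op U" "a :<U>"
 shows "a *<FP U> free_gen (osec X U) s = single (osec X U) s a"
proof -
 interpret R: cring "osec X U" by (rule O_cring[OF assms(1)])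
 show ?thesis using assms by (auto simp: free_gen_def free_pre_sec free_mod_simps(4) single_def fun_eq_iff)
qed

lemma fp_hom_eqI:
 assumes N: "pmod N" and U: "op U" and F: "F : Hom FP N U" and G: "G : Hom FP N U"
  and eq: "!!V s. op V ==> V <= U ==> s : S V ==> F V (free_gen (osec X V) s) = G V (free_gen (osec X V) s)"
 shows "F = G"
proof (rule homs_eqI[OF F G])
 fix V f assume V: "op V" "V <= U" and f: "f :<FP V>"
 interpret N: module "osec X V" "sec N V" by (rule pm_module[OF N V(1)])
 show "F V f = G V f"
 proof (rule cring.free_additive_ext[OF O_cring[OF V(1)] _ N.abelian_group_axioms, where F = "F V" and G = "G V" and S = "S V"];
   (unfold free_pre_sec[of X S \<sigma> V, symmetric])?)
  show "f :<FP V>" by (rule f)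
  show "F V g :<N V>" "G V g :<N V>" if "g :<FP V>" for g
   by (rule homs_closed[OF F V that], rule homs_closed[OF G V that])
  show "F V (g +<FP V> h) = F V g +<N V> F V h" "G V (g +<FP V> h) = G V g +<N V> G V h"
   if "g :<FP V>" "h :<FP V>" for g h
   by (rule homs_add[OF F V that], rule homs_add[OF G V that])
  show "F V (single (osec X V) s a) = G V (single (osec X V) s a)" if "s : S V" "a :<V>" for s a
   using homs_smult[OF F V that(2) fp_gen_closed[OF V(1) that(1)]] homs_smult[OF G V that(2) fp_gen_closed[OF V(1) that(1)]]
    eq[OF V that(1)] by (simp add: fp_smult_gen[OF V(1) that(2)])
 qed
qed

lemma fp_lift:
 assumes N: "pmod N" and U: "op U"
  and k: "!!V s. op V ==> V <= U ==> s : S V ==> k V s :<N V>"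
  and k_res: "!!V W s. op V ==> V <= U ==> op W ==> W <= V ==> s : S V ==> k W (\<sigma> V W s) = res N V W (k V s)"
 obtains F where "F : Hom FP N U"
  "!!V s. op V ==> V <= U ==> s : S V ==> F V (free_gen (osec X V) s) = k V s"
proof -
 define F where "F V f = supp_sum (osec X V) (sec N V) (%s a. a *<N V> k V s) f" for V f
 have hyps: "abelian_monoid (sec N V)"
  "!!s a. s : S V ==> a :<V> ==> a *<N V> k V s :<N V>"
  "!!s. s : S V ==> 0<V> *<N V> k V s = 0<N V>"
  "!!s a b. s : S V ==> a :<V> ==> b :<V> ==>
   (a +<V> b) *<N V> k V s = a *<N V> k V s +<N V> b *<N V> k V s"
  if V: "op V" "V <= U" for V
 proof -
  interpret N: module "osec X V" "sec N V" by (rule pm_module[OF N V(1)])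
  show "abelian_monoid (sec N V)" ..
 qed (use V k[OF V] N in \<open>auto simp: pm_smult_add\<close>)
 have F_cl: "F V f :<N V>" if V: "op V" "V <= U" and f: "f :<FP V>" for V f
  unfolding F_def by (rule cring.supp_sum_closed[where h = "%s a. a *<N V> k V s" and S = "S V", OF O_cring[OF V(1)] hyps[OF V]]) (use f in \<open>simp_all add: free_pre_sec\<close>)
 have F_add: "F V (f +<FP V> g) = F V f +<N V> F V g"
  if V: "op V" "V <= U" and f: "f :<FP V>" and g: "g :<FP V>" for V f g
  unfolding F_def free_pre_sec
  by (rule cring.supp_sum_add[where h = "%s a. a *<N V> k V s" and S = "S V", OF O_cring[OF V(1)] hyps[OF V]]) (use f g in \<open>simp_all add: free_pre_sec\<close>)
 have F_single: "F V (single (osec X V) s a) = a *<N V> k V s"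
  if V: "op V" "V <= U" and s: "s : S V" "a :<V>" for V s a
  unfolding F_def by (rule cring.supp_sum_single[where h = "%s a. a *<N V> k V s" and S = "S V", OF O_cring[OF V(1)] hyps[OF V] s])
 have hom: "fam' FP U F : Hom FP N U"
 proof (rule homsI[OF fp_pmodule])
  fix V f assume V: "op V" "V <= U" and f: "f :<FP V>"
  show "F V f :<N V>" by (rule F_cl[OF V f])
  show "F V (f +<FP V> g) = F V f +<N V> F V g" if "g :<FP V>" for g by (rule F_add[OF V f that])
  interpret N: module "osec X V" "sec N V" by (rule pm_module[OF N V(1)])
  interpret P: module "osec X V" "sec FP V" by (rule fp_module[OF V(1)])
  show "F V (a *<FP V> f) = a *<N V> F V f" if a: "a :<V>" for a
  proof (rule cring.free_additive_ext[OF O_cring[OF V(1)] _ N.abelian_group_axioms,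
    where F = "%f. F V (a *<FP V> f)" and G = "%f. a *<N V> F V f" and S = "S V"];
    (unfold free_pre_sec[of X S \<sigma> V, symmetric])?)
   show "f :<FP V>" by (rule f)
   show "F V (a *<FP V> single (osec X V) s b) = a *<N V> F V (single (osec X V) s b)"
    if s: "s : S V" "b :<V>" for s b
   proof -
    have "a *<FP V> single (osec X V) s b = single (osec X V) s (a *<V> b)"
     using a by (auto simp: free_pre_sec free_mod_simps(4) single_def fun_eq_iff)
    then show ?thesis using a s V k[OF V] by (simp add: F_single N.smult_assoc1)
   qed
   fix g assume g: "g :<FP V>"
   show "F V (a *<FP V> g) :<N V>" "a *<N V> F V g :<N V>" using F_cl[OF V] g a by simp_all
   fix h assume h: "h :<FP V>"
   show "F V (a *<FP V> (g +<FP V> h)) = F V (a *<FP V> g) +<N V> F V (a *<FP V> h)"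
    using g h a by (simp add: P.smult_r_distr F_add[OF V])
   show "a *<N V> F V (g +<FP V> h) = a *<N V> F V g +<N V> a *<N V> F V h"
    using g h a F_cl[OF V] by (simp add: N.smult_r_distr F_add[OF V])
  qed
  fix W assume W: "op W" "W <= V"
  then have WU: "W <= U" using V by blast
  interpret NW: module "osec X W" "sec N W" by (rule pm_module[OF N W(1)])
  note rcl = fp_res_closed[OF V(1) W]
  show "F W (res FP V W f) = res N V W (F V f)"
  proof (rule cring.free_additive_ext[OF O_cring[OF V(1)] _ NW.abelian_group_axioms,
    where F = "%f. F W (res FP V W f)" and G = "%f. res N V W (F V f)" and S = "S V"];
    (unfold free_pre_sec[of X S \<sigma> V, symmetric])?)
   show "f :<FP V>" by (rule f)
   show "F W (res FP V W (single (osec X V) s b)) = res N V W (F V (single (osec X V) s b))"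
    if s: "s : S V" "b :<V>" for s b
    using s V W WU k[OF V] N k_res[OF V W] by (simp add: fp_res_single F_single gens_closed)
   fix g assume g: "g :<FP V>"
   show "F W (res FP V W g) :<N W>" by (rule F_cl[OF W(1) WU rcl[OF g]])
   show "res N V W (F V g) :<N W>" using F_cl[OF V g] V W N by simp
   fix h assume h: "h :<FP V>"
   show "F W (res FP V W (g +<FP V> h)) = F W (res FP V W g) +<N W> F W (res FP V W h)"
    unfolding fp_res_add[OF V(1) W g h] by (rule F_add[OF W(1) WU rcl[OF g] rcl[OF h]])
   show "res N V W (F V (g +<FP V> h)) = res N V W (F V g) +<N W> res N V W (F V h)"
    unfolding F_add[OF V g h] by (rule pm_res_add[OF N V(1) W F_cl[OF V g] F_cl[OF V h]])
  qed
 qed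
 show thesis
 proof (rule that[OF hom])
  fix V s assume V: "op V" "V <= U" and s: "s : S V"
  show "fam' FP U F V (free_gen (osec X V) s) = k V s"
   using V fp_gen_closed[OF V(1) s] F_single[OF V s, of "1<V>"] k[OF V s] N
   by (simp add: free_gen_single)
 qed
qed

end

subsection \<open>Relations\<close>

definition pres_ok :: "('x set => 's set) => ('x set => ('s => 'r) set) => ('x set => 'x set => 's => 's) => bool"
 where "pres_ok S K \<sigma> \<longleftrightarrow> gens_ok S \<sigma> &
  (\<forall>U. op U --> K U <= mcar (free_pre X S \<sigma>) U) &
  (\<forall>U V k. op U & op V & V <= U & k : K U --> res (free_pre X S \<sigma>) U V k : K V)"

text \<open>\<open>F\<close> is semilinear over \<open>r\<close>, so that the lemma applies to
  restriction maps, where \<open>r\<close> restricts scalars, as well as to linear maps, where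
  \<open>r\<close> is the identity.\<close>

lemma kernel_submodule:
 assumes "module R M" "module R' M'" "!!a. a : carrier R ==> r a : carrier R'" "submodule H R' M'"
  and F: "!!m. m : carrier M ==> F m : carrier M'"
   "!!m n. m : carrier M ==> n : carrier M ==> F (m +{M} n) = F m +{M'} F n"
   "!!a m. a : carrier R ==> m : carrier M ==> F (a .{M} m) = r a .{M'} F m"
 shows "submodule {m : carrier M. F m : H} R M"
proof -
 interpret M: module R M by fact
 interpret M': module R' M' by fact
 interpret H: submodule H R' M' by fact
 have z: "F 0{M} : H"
 proof -
  have "F 0{M} +{M'} F 0{M} = F 0{M}" using F(2)[of "0{M}" "0{M}"] by simp
  then have "F 0{M} = 0{M'}"
   using M'.add.l_cancel_one[of "F 0{M}" "F 0{M}"] F(1)[OF M.zero_closed] by auto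
  then show ?thesis using H.one_closed by simp
 qed
 have add: "F (m +{M} n) : H" if "m : carrier M" "n : carrier M" "F m : H" "F n : H" for m n
  using F(2)[OF that(1,2)] M'.submoduleE(5)[OF assms(4) that(3,4)] by simp
 have sm: "F (a .{M} m) : H" if "a : carrier R" "m : carrier M" "F m : H" for a m
  using F(3)[OF that(1,2)] H.smult_closed[OF assms(3)[OF that(1)] that(3)] by simp
 show ?thesis
 proof (rule M.submoduleI)
  show "\<ominus>\<^bsub>M\<^esub> m : {m : carrier M. F m : H}" if "m : {m : carrier M. F m : H}" for m
   using that sm[of "\<ominus>\<^bsub>R\<^esub> 1{R}" m] by (simp add: M.smult_l_minus)
 qed (use z add sm in auto)
qed

context
 fixes S :: "'x set => 's set" and K \<sigma>
 assumes pres: "pres_ok S K \<sigma>"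
begin

abbreviation (input) "FR \<equiv> free_pre X S \<sigma>"
abbreviation (input) "PP \<equiv> pres_presheaf X S K \<sigma>"

lemma pres_gens: "gens_ok S \<sigma>" using pres by (simp add: pres_ok_def)
lemma pres_K: "op U ==> K U <= mcar FR U" using pres by (simp add: pres_ok_def)
lemma pres_K_res: "op U ==> op V ==> V <= U ==> k : K U ==> res FR U V k : K V"
 using pres by (simp add: pres_ok_def)

lemma pres_sub_submodule: "op U ==> submodule (pres_sub X S K U) (osec X U) (sec FR U)"
 unfolding pres_sub_def free_pre_sec
 by (rule cring.submod_gen_submodule[OF O_cring cring.free_module[OF O_cring]])
  (use pres_K[unfolded free_pre_sec] in auto)

lemma pres_sub_least: "op U ==> submodule H (osec X U) (sec FR U) ==> K U <= H ==> pres_sub X S K U <= H"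
 unfolding pres_sub_def free_pre_sec by (rule cring.submod_gen_least[OF O_cring])

lemma pres_sub_incl: "op U ==> K U <= pres_sub X S K U"
 unfolding pres_sub_def by (rule cring.submod_gen_incl[OF O_cring])

lemma pres_sub_pmodule: "sub_pmodule FR (pres_sub X S K)"
 unfolding sub_pmodule_def
proof (intro conjI allI impI)
 note FR = fp_pmodule[OF pres_gens]
 show "submodule (pres_sub X S K U) (osec X U) (sec FR U)" if "op U" for U by (rule pres_sub_submodule[OF that])
 fix U V k assume "op U & op V & V <= U & k : pres_sub X S K U"
 then have U: "op U" "op V" "V <= U" and k: "k : pres_sub X S K U" by auto
 \<comment> \<open>The elements that restrict into the relations over \<open>V\<close> form a
   submodule containing \<open>K U\<close>, hence containing everything that \<open>K U\<close>
   generates.\<close>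
 have "submodule {m : mcar FR U. res FR U V m : pres_sub X S K V} (osec X U) (sec FR U)"
  by (rule kernel_submodule[OF pm_module[OF FR U(1)] pm_module[OF FR U(2)] _ pres_sub_submodule[OF U(2)], of "rs U V"])
   (use U FR in auto)
 then have "pres_sub X S K U <= {m : mcar FR U. res FR U V m : pres_sub X S K V}"
 proof (rule pres_sub_least[OF U(1)])
  show "K U <= {m : mcar FR U. res FR U V m : pres_sub X S K V}"
   using pres_K[OF U(1)] pres_K_res[OF U] pres_sub_incl[OF U(2)] by blast
 qed
 then show "res FR U V k : pres_sub X S K V" using k by blast
qed

lemma pres_presheaf_pmodule: "pmod PP"
 unfolding pres_presheaf_quot by (rule quot_presheaf_pmodule[OF fp_pmodule[OF pres_gens] pres_sub_pmodule])

text \<open>The map from the free presheaf to the sheaf it presents, as a morphism. Facts about the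
  generators \<open>pres_gen\<close> are read off from it, because it carries free generators to
  them and relations to zero.\<close>

lemma pres_class:
 obtains c where "c : Hom FR (sheafify X PP) (pts X)"
  "!!U f. op U ==> f :<FR U> ==> c U f = to_sheaf X PP U (qclass FR (pres_sub X S K) U f)"
  "!!U s. op U ==> s : S U ==> c U (free_gen (osec X U) s) = pres_gen X S K \<sigma> U s"
  "!!U k. op U ==> k : K U ==> c U k = 0<(sheafify X PP) U>"
proof -
 note FR = fp_pmodule[OF pres_gens]
 note Q = qclass_hom[OF FR pres_sub_pmodule, folded pres_presheaf_quot, of "pts X"]
 note T = to_sheaf_hom[OF pres_presheaf_pmodule, of "pts X"]
 define c where "c = fam' FR (pts X) (%V m. fam' PP (pts X) (to_sheaf X PP) V (fam' FR (pts X) (qclass FR (pres_sub X S K)) V m))"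
 have c: "c : Hom FR (sheafify X PP) (pts X)" unfolding c_def by (rule homs_comp[OF Q T FR])
 have cl: "qclass FR (pres_sub X S K) U f :<PP U>" if "op U" "f :<FR U>" for U f
  using homs_closed[OF Q that(1) _ that(2)] that by simp
 have val: "c U f = to_sheaf X PP U (qclass FR (pres_sub X S K) U f)" if "op U" "f :<FR U>" for U f
  using that cl[OF that] by (simp add: c_def)
 show thesis
 proof (rule that[OF c val])
  show "c U (free_gen (osec X U) s) = pres_gen X S K \<sigma> U s" if "op U" "s : S U" for U s
   using val[OF that(1) fp_gen_closed[OF pres_gens that]] by (simp add: pres_gen_def free_pre_sec)
  fix U k assume U: "op U" and k: "k : K U"
  have kF: "k :<FR U>" using pres_K[OF U] k by blast
  have "k -<FR U> 0<FR U> = k"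
   using pm_add_minus[OF FR U kF, of "0<FR U>"] FR U kF by simp
  then have "qclass FR (pres_sub X S K) U k = qclass FR (pres_sub X S K) U 0<FR U>"
   using pres_sub_incl[OF U] k kF FR U by (subst qp_eq_iff[OF FR pres_sub_pmodule U]) auto
  then have "c U k = c U 0<FR U>" using val[OF U kF] val[OF U, of "0<FR U>"] FR U by simp
  also have "\<dots> = 0<(sheafify X PP) U>"
   using homs_zero[OF c U _ FR sheafify_pmodule[OF pres_presheaf_pmodule]] U by simp
  finally show "c U k = 0<(sheafify X PP) U>" .
 qed blast+
qed

lemma pres_gen_closed: "op U ==> s : S U ==> pres_gen X S K \<sigma> U s :<(sheafify X PP) U>"
proof -
 assume U: "op U" and s: "s : S U"
 obtain c where c: "c : Hom FR (sheafify X PP) (pts X)"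
  "!!U s. op U ==> s : S U ==> c U (free_gen (osec X U) s) = pres_gen X S K \<sigma> U s"
  by (rule pres_class) (rule that; (assumption | simp))
 show "pres_gen X S K \<sigma> U s :<(sheafify X PP) U>"
  using homs_closed[OF c(1) U op_pts[OF U] fp_gen_closed[OF pres_gens U s]] c(2)[OF U s] by simp
qed

lemma pres_gen_res:
 assumes "op U" "op V" "V <= U" "s : S U"
 shows "res (sheafify X PP) U V (pres_gen X S K \<sigma> U s) = pres_gen X S K \<sigma> V (\<sigma> U V s)"
proof -
 obtain c where c: "c : Hom FR (sheafify X PP) (pts X)"
  "!!U s. op U ==> s : S U ==> c U (free_gen (osec X U) s) = pres_gen X S K \<sigma> U s"
  by (rule pres_class) (rule that; (assumption | simp))
 show ?thesis
  using homs_res[OF c(1) assms(1) op_pts[OF assms(1)] assms(2,3) fp_gen_closed[OF pres_gens assms(1,4)]]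
   c(2)[OF assms(1,4)] c(2)[OF assms(2) gens_closed[OF pres_gens assms]] fp_gen_res[OF pres_gens assms] by simp
qed

lemma pres_hom_eqI:
 assumes N: "omod N" and U: "op U" and F: "F : Hom (sheafify X PP) N U" and G: "G : Hom (sheafify X PP) N U"
  and eq: "!!V s. op V ==> V <= U ==> s : S V ==> F V (pres_gen X S K \<sigma> V s) = G V (pres_gen X S K \<sigma> V s)"
 shows "F = G"
proof (rule sheafify_hom_eqI[OF pres_presheaf_pmodule N F G])
 note FR = fp_pmodule[OF pres_gens]
 obtain c where c: "c : Hom FR (sheafify X PP) (pts X)"
  "!!U f. op U ==> f :<FR U> ==> c U f = to_sheaf X PP U (qclass FR (pres_sub X S K) U f)"
  "!!U s. op U ==> s : S U ==> c U (free_gen (osec X U) s) = pres_gen X S K \<sigma> U s"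
  by (rule pres_class) (rule that; (assumption | simp))
 note cU = homs_restrict[OF c(1) U op_pts[OF U]]
 let ?c = "restrict c (ops U)"
 have "fam' FR U (%V m. F V (?c V m)) = fam' FR U (%V m. G V (?c V m))"
 proof (rule fp_hom_eqI[OF pres_gens _ U homs_comp[OF cU F FR] homs_comp[OF cU G FR]])
  show "pmod N" using N by simp
  show "fam' FR U (%V m. F V (?c V m)) V (free_gen (osec X V) s) = fam' FR U (%V m. G V (?c V m)) V (free_gen (osec X V) s)"
   if "op V" "V <= U" "s : S V" for V s
   using that eq[OF that] c(3)[OF that(1,3)] fp_gen_closed[OF pres_gens that(1,3)] by simp
 qed
 then have FG: "F V (c V m) = G V (c V m)" if "op V" "V <= U" "m :<FR V>" for V m
  using that by (auto dest!: fun_cong[where x = V] fun_cong[where x = m])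
 fix V m assume V: "op V" "V <= U" and m: "m :<PP V>"
 obtain f where f: "f :<FR V>" "m = qclass FR (pres_sub X S K) V f"
  using m qp_carrier[OF FR pres_sub_pmodule V(1)] unfolding pres_presheaf_quot by blast
 show "F V (to_sheaf X PP V m) = G V (to_sheaf X PP V m)"
  using FG[OF V f(1)] c(2)[OF V(1) f(1)] f(2) by simp
qed

text \<open>Universal property of generators and relations. In \<open>rel\<close> the map
  \<open>F\<close> is an arbitrary morphism with the prescribed values on the generators, so that
  checking a relation amounts to linearity and those values.\<close>

lemma pres_lift:
 assumes N: "omod N" and U: "op U"
  and p: "!!V s. op V ==> V <= U ==> s : S V ==> p V s :<N V>"
  and p_res: "!!V W s. op V ==> V <= U ==> op W ==> W <= V ==> s : S V ==> p W (\<sigma> V W s) = res N V W (p V s)"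
  and rel: "!!F V k. F : Hom FR N U ==>
   (!!V s. op V ==> V <= U ==> s : S V ==> F V (free_gen (osec X V) s) = p V s) ==>
   op V ==> V <= U ==> k : K V ==> F V k = 0<N V>"
 obtains q where "q : Hom (sheafify X PP) N U"
  "!!V s. op V ==> V <= U ==> s : S V ==> q V (pres_gen X S K \<sigma> V s) = p V s"
proof -
 note FR = fp_pmodule[OF pres_gens]
 have N': "pmod N" using N by simp
 obtain F where F: "F : Hom FR N U"
  "!!V s. op V ==> V <= U ==> s : S V ==> F V (free_gen (osec X V) s) = p V s"
  by (rule fp_lift[OF pres_gens N' U, of p]) (use p p_res in auto)
 have kill: "F V m = 0<N V>" if V: "op V" "V <= U" and m: "m : pres_sub X S K V" for V m
 proof -
  interpret NV: module "osec X V" "sec N V" by (rule pm_module[OF N' V(1)])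
  have z: "submodule {0<N V>} (osec X V) (sec N V)"
   using NV.minus_equality[of "0<N V>" "0<N V>"] by (intro NV.submoduleI) auto
  have "submodule {m : mcar FR V. F V m : {0<N V>}} (osec X V) (sec FR V)"
  proof (rule kernel_submodule[OF pm_module[OF FR V(1)] pm_module[OF N' V(1)] _ z, of "%a. a"])
   show "F V f :<N V>" if "f :<FR V>" for f by (rule homs_closed[OF F(1) V that])
   show "F V (f +<FR V> g) = F V f +<N V> F V g" if "f :<FR V>" "g :<FR V>" for f g
    by (rule homs_add[OF F(1) V that])
   show "F V (a *<FR V> f) = a *<N V> F V f" if "a :<V>" "f :<FR V>" for a f
    by (rule homs_smult[OF F(1) V that])
  qed
  moreover have "K V <= {m : mcar FR V. F V m : {0<N V>}}"
   using pres_K[OF V(1)] rel[OF F V] by blast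
  ultimately have "pres_sub X S K V <= {m : mcar FR V. F V m : {0<N V>}}"
   by (rule pres_sub_least[OF V(1)])
  then show ?thesis using m by blast
 qed
 obtain g where g: "g : Hom PP N U"
  "!!V m. op V ==> V <= U ==> m :<FR V> ==> g V (qclass FR (pres_sub X S K) V m) = F V m"
  using quot_presheaf_lift[OF FR pres_sub_pmodule N' F(1) kill] unfolding pres_presheaf_quot by blast
 obtain q where q: "q : Hom (sheafify X PP) N U"
  "!!V m. op V ==> V <= U ==> m :<PP V> ==> q V (to_sheaf X PP V m) = g V m"
  by (rule sheafify_lift[OF pres_presheaf_pmodule N g(1)]) (rule that; (assumption | simp))
 show thesis
 proof (rule that[OF q(1)])
  fix V s assume V: "op V" "V <= U" and s: "s : S V"
  note gs = fp_gen_closed[OF pres_gens V(1) s]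
  have "qclass FR (pres_sub X S K) V (free_gen (osec X V) s) :<PP V>"
   unfolding pres_presheaf_quot qp_carrier[OF FR pres_sub_pmodule V(1)] using gs by blast
  then have "q V (to_sheaf X PP V (qclass FR (pres_sub X S K) V (free_gen (osec X V) s))) = p V s"
   using q(2)[OF V] g(2)[OF V gs] F(2)[OF V s] by simp
  then show "q V (pres_gen X S K \<sigma> V s) = p V s" by (simp add: pres_gen_def free_pre_sec)
 qed
qed

lemma pres_O_module: "omod (sheafify X PP)"
 by (rule sheafify_O_module[OF pres_presheaf_pmodule])

end

end

section \<open>Tensor products\<close>

context rsp
begin

definition bilin :: "('x, 'r, 'm) omod => ('x, 'r, 'n) omod => ('x, 'r, 'k) omod => 'x set => ('x set => 'm => 'n => 'k) => bool"
 where "bilin M N P U k \<longleftrightarrow> (\<forall>V m n. op V & V <= U & m :<M V> & n :<N V> -->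
  k V m n :<P V> &
  (ALL m':mcar M V. k V (m +<M V> m') n = k V m n +<P V> k V m' n) &
  (ALL n':mcar N V. k V m (n +<N V> n') = k V m n +<P V> k V m n') &
  (ALL a:\<O> V. k V (a *<M V> m) n = a *<P V> k V m n &
   k V m (a *<N V> n) = a *<P V> k V m n) &
  (\<forall>W. op W & W <= V --> k W (res M V W m) (res N V W n) = res P V W (k V m n)))"

lemma bilinI:
 assumes "!!V m n. op V ==> V <= U ==> m :<M V> ==> n :<N V> ==> k V m n :<P V>"
  "!!V m m' n. op V ==> V <= U ==> m :<M V> ==> m' :<M V> ==> n :<N V> ==>
   k V (m +<M V> m') n = k V m n +<P V> k V m' n"
  "!!V m n n'. op V ==> V <= U ==> m :<M V> ==> n :<N V> ==> n' :<N V> ==>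
   k V m (n +<N V> n') = k V m n +<P V> k V m n'"
  "!!V a m n. op V ==> V <= U ==> a :<V> ==> m :<M V> ==> n :<N V> ==>
   k V (a *<M V> m) n = a *<P V> k V m n"
  "!!V a m n. op V ==> V <= U ==> a :<V> ==> m :<M V> ==> n :<N V> ==>
   k V m (a *<N V> n) = a *<P V> k V m n"
  "!!V W m n. op V ==> V <= U ==> op W ==> W <= V ==> m :<M V> ==> n :<N V> ==>
   k W (res M V W m) (res N V W n) = res P V W (k V m n)"
 shows "bilin M N P U k"
 unfolding bilin_def using assms by simp

lemma bilinD:
 assumes "bilin M N P U k" "op V" "V <= U" "m :<M V>" "n :<N V>"
 shows "k V m n :<P V>"
  "m' :<M V> ==> k V (m +<M V> m') n = k V m n +<P V> k V m' n"
  "n' :<N V> ==> k V m (n +<N V> n') = k V m n +<P V> k V m n'"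
  "a :<V> ==> k V (a *<M V> m) n = a *<P V> k V m n"
  "a :<V> ==> k V m (a *<N V> n) = a *<P V> k V m n"
  "op W ==> W <= V ==> k W (res M V W m) (res N V W n) = res P V W (k V m n)"
 using assms unfolding bilin_def by simp_all

abbreviation (input) "FT M N \<equiv> free_pre X (tensor_gens M N) (tensor_res M N)"
abbreviation (input) "fg U z \<equiv> free_gen (osec X U) z"

lemma tensor_rels_iff:
 "k : tensor_rels X M N U \<longleftrightarrow>
  (\<exists>m m' n. m :<M U> & m' :<M U> & n :<N U> &
   k = fg U (m +<M U> m', n) -<(FT M N) U> (fg U (m, n) +<(FT M N) U> fg U (m', n))) \<or>
  (\<exists>m n n'. m :<M U> & n :<N U> & n' :<N U> &
   k = fg U (m, n +<N U> n') -<(FT M N) U> (fg U (m, n) +<(FT M N) U> fg U (m, n'))) \<or>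
  (\<exists>a m n. a :<U> & m :<M U> & n :<N U> &
   k = fg U (a *<M U> m, n) -<(FT M N) U> (a *<(FT M N) U> fg U (m, n))) \<or>
  (\<exists>a m n. a :<U> & m :<M U> & n :<N U> &
   k = fg U (m, a *<N U> n) -<(FT M N) U> (a *<(FT M N) U> fg U (m, n)))"
 unfolding tensor_rels_def Let_def free_pre_sec Un_iff mem_Collect_eq by (simp only: conj_ac disj_assoc)

context
 fixes M :: "('x, 'r, 'm) omod" and N :: "('x, 'r, 'n) omod"
 assumes M: "pmod M" and N: "pmod N"
begin

lemma tensor_gens_ok: "gens_ok (tensor_gens M N) (tensor_res M N)"
 unfolding gens_ok_def tensor_gens_def tensor_res_def using M N by auto

lemma ft_gen: "op U ==> m :<M U> ==> n :<N U> ==> fg U (m, n) :<(FT M N) U>"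
 by (rule fp_gen_closed[OF tensor_gens_ok]) (simp_all add: tensor_gens_def)

lemma ft_gen_res: "op U ==> op V ==> V <= U ==> m :<M U> ==> n :<N U> ==>
  res (FT M N) U V (fg U (m, n)) = fg V (res M U V m, res N U V n)"
 by (subst fp_gen_res[OF tensor_gens_ok]) (simp_all add: tensor_gens_def tensor_res_def)

lemma tensor_pres_ok: "pres_ok (tensor_gens M N) (tensor_rels X M N) (tensor_res M N)"
 unfolding pres_ok_def
proof (intro conjI allI impI subsetI)
 note F = fp_pmodule[OF tensor_gens_ok]
 show "gens_ok (tensor_gens M N) (tensor_res M N)" by (rule tensor_gens_ok)
 show "k :<(FT M N) U>" if "op U" "k : tensor_rels X M N U" for U k
  using that(2) unfolding tensor_rels_iff using that(1) M N F
  by (elim disjE exE conjE; simp add: ft_gen)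
 fix U V k assume "op U & op V & V <= U & k : tensor_rels X M N U"
 then have U: "op U" "op V" "V <= U" and k: "k : tensor_rels X M N U" by auto
 from k[unfolded tensor_rels_iff] show "res (FT M N) U V k : tensor_rels X M N V"
 proof (elim disjE exE conjE)
  fix m m' n assume *: "m :<M U>" "m' :<M U>" "n :<N U>"
   "k = fg U (m +<M U> m', n) -<(FT M N) U> (fg U (m, n) +<(FT M N) U> fg U (m', n))"
  show ?thesis unfolding tensor_rels_iff
   by (rule disjI1, rule exI[of _ "res M U V m"], rule exI[of _ "res M U V m'"], rule exI[of _ "res N U V n"])
    (use * U M N F in \<open>simp add: ft_gen ft_gen_res\<close>)
 next
  fix m n n' assume *: "m :<M U>" "n :<N U>" "n' :<N U>"
   "k = fg U (m, n +<N U> n') -<(FT M N) U> (fg U (m, n) +<(FT M N) U> fg U (m, n'))"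
  show ?thesis unfolding tensor_rels_iff
   by (rule disjI2, rule disjI1, rule exI[of _ "res M U V m"], rule exI[of _ "res N U V n"], rule exI[of _ "res N U V n'"])
    (use * U M N F in \<open>simp add: ft_gen ft_gen_res\<close>)
 next
  fix a m n assume *: "a :<U>" "m :<M U>" "n :<N U>"
   "k = fg U (a *<M U> m, n) -<(FT M N) U> (a *<(FT M N) U> fg U (m, n))"
  show ?thesis unfolding tensor_rels_iff
   by (rule disjI2, rule disjI2, rule disjI1, rule exI[of _ "rs U V a"], rule exI[of _ "res M U V m"], rule exI[of _ "res N U V n"])
    (use * U M N F in \<open>simp add: ft_gen ft_gen_res\<close>)
 next
  fix a m n assume *: "a :<U>" "m :<M U>" "n :<N U>"
   "k = fg U (m, a *<N U> n) -<(FT M N) U> (a *<(FT M N) U> fg U (m, n))"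
  show ?thesis unfolding tensor_rels_iff
   by (rule disjI2, rule disjI2, rule disjI2, rule exI[of _ "rs U V a"], rule exI[of _ "res M U V m"], rule exI[of _ "res N U V n"])
    (use * U M N F in \<open>simp add: ft_gen ft_gen_res\<close>)
 qed
qed

lemma tensor_O_module [simp]: "omod (tens M N)"
 unfolding tensor_def by (rule pres_O_module[OF tensor_pres_ok])

lemma pt_closed [simp]: "op U ==> m :<M U> ==> n :<N U> ==> pt M N U m n :<(tens M N) U>"
 unfolding tensor_def pure_tensor_def by (rule pres_gen_closed[OF tensor_pres_ok]) (simp_all add: tensor_gens_def)

lemma pt_res: "op U ==> op V ==> V <= U ==> m :<M U> ==> n :<N U> ==>
  pt M N V (res M U V m) (res N U V n) = res (tens M N) U V (pt M N U m n)"
 unfolding tensor_def pure_tensor_def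
 by (subst pres_gen_res[OF tensor_pres_ok]) (simp_all add: tensor_gens_def tensor_res_def)

text \<open>Each of the four kinds of relation is a difference that the class map \<open>c\<close>
  kills; equating the images of its two terms gives one clause of bilinearity.\<close>

lemma pt_bilin: "bilin M N (tens M N) U (pt M N)"
proof -
 note F = fp_pmodule[OF tensor_gens_ok]
 note T = omod_pmod[OF tensor_O_module]
 obtain c where c0: "c : Hom (FT M N) (tens M N) (pts X)"
  "!!U s. op U ==> s : tensor_gens M N U ==>
   c U (fg U s) = pres_gen X (tensor_gens M N) (tensor_rels X M N) (tensor_res M N) U s"
  "!!U k. op U ==> k : tensor_rels X M N U ==> c U k = 0<(tens M N) U>"
  by (rule pres_class[OF tensor_pres_ok, folded tensor_def]) (rule that; (assumption | simp))
 have c: "c V (fg V (m, n)) = pt M N V m n" if "op V" "m :<M V>" "n :<N V>" for V m n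
  using c0(2)[OF that(1), of "(m, n)"] that by (simp add: tensor_gens_def pure_tensor_def)
 have rel: "c V u = c V v"
  if V: "op V" and uv: "u :<(FT M N) V>" "v :<(FT M N) V>" "u -<(FT M N) V> v : tensor_rels X M N V" for V u v
  using c0(3)[OF V uv(3)] homs_minus[OF c0(1) V op_pts[OF V] F T uv(1,2)]
   pm_minus_zero_iff[OF T V, of "c V u" "c V v"] homs_closed[OF c0(1) V op_pts[OF V]] uv by simp
 show ?thesis
 proof (rule bilinI)
  fix V m n assume V: "op V" and m: "m :<M V>" and n: "n :<N V>"
  show "pt M N V m n :<(tens M N) V>" using V m n by simp
  show "pt M N V (m +<M V> m') n = pt M N V m n +<(tens M N) V> pt M N V m' n"
   if m': "m' :<M V>" for m'
  proof -
   have "fg V (m +<M V> m', n) -<(FT M N) V> (fg V (m, n) +<(FT M N) V> fg V (m', n)) : tensor_rels X M N V"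
    unfolding tensor_rels_iff using m m' n by blast
   then have "c V (fg V (m +<M V> m', n)) = c V (fg V (m, n) +<(FT M N) V> fg V (m', n))"
    by (intro rel) (use V m m' n M F in \<open>simp_all add: ft_gen\<close>)
   then show ?thesis using V m m' n M homs_add[OF c0(1) V op_pts[OF V]] by (simp add: c ft_gen)
  qed
  show "pt M N V m (n +<N V> n') = pt M N V m n +<(tens M N) V> pt M N V m n'"
   if n': "n' :<N V>" for n'
  proof -
   have "fg V (m, n +<N V> n') -<(FT M N) V> (fg V (m, n) +<(FT M N) V> fg V (m, n')) : tensor_rels X M N V"
    unfolding tensor_rels_iff using m n n' by blast
   then have "c V (fg V (m, n +<N V> n')) = c V (fg V (m, n) +<(FT M N) V> fg V (m, n'))"
    by (intro rel) (use V m n n' N F in \<open>simp_all add: ft_gen\<close>)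
   then show ?thesis using V m n n' N homs_add[OF c0(1) V op_pts[OF V]] by (simp add: c ft_gen)
  qed
  show "pt M N V (a *<M V> m) n = a *<(tens M N) V> pt M N V m n"
   if a: "a :<V>" for a
  proof -
   have "fg V (a *<M V> m, n) -<(FT M N) V> (a *<(FT M N) V> fg V (m, n)) : tensor_rels X M N V"
    unfolding tensor_rels_iff using m n a by blast
   then have "c V (fg V (a *<M V> m, n)) = c V (a *<(FT M N) V> fg V (m, n))"
    by (intro rel) (use V m n a M F in \<open>simp_all add: ft_gen\<close>)
   then show ?thesis using V m n a M homs_smult[OF c0(1) V op_pts[OF V]] by (simp add: c ft_gen)
  qed
  show "pt M N V m (a *<N V> n) = a *<(tens M N) V> pt M N V m n"
   if a: "a :<V>" for a
  proof -
   have "fg V (m, a *<N V> n) -<(FT M N) V> (a *<(FT M N) V> fg V (m, n)) : tensor_rels X M N V"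
    unfolding tensor_rels_iff using m n a by blast
   then have "c V (fg V (m, a *<N V> n)) = c V (a *<(FT M N) V> fg V (m, n))"
    by (intro rel) (use V m n a N F in \<open>simp_all add: ft_gen\<close>)
   then show ?thesis using V m n a N homs_smult[OF c0(1) V op_pts[OF V]] by (simp add: c ft_gen)
  qed
  show "pt M N W (res M V W m) (res N V W n) = res (tens M N) V W (pt M N V m n)"
   if "op W" "W <= V" for W by (rule pt_res[OF V that m n])
 qed
qed

text \<open>Pure tensors generate the tensor sheaf locally. The later identities between maps out of
  tensor products are all reduced to pure tensors in this way.\<close>

lemma tensor_hom_eqI:
 assumes P: "omod P" and U: "op U" and F: "F : Hom (tens M N) P U" and G: "G : Hom (tens M N) P U"
  and eq: "!!V m n. op V ==> V <= U ==> m :<M V> ==> n :<N V> ==>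
   F V (pt M N V m n) = G V (pt M N V m n)"
 shows "F = G"
proof (rule pres_hom_eqI[OF tensor_pres_ok P U F[unfolded tensor_def] G[unfolded tensor_def]])
 fix V s assume V: "op V" "V <= U" and s: "s : tensor_gens M N V"
 then show "F V (pres_gen X (tensor_gens M N) (tensor_rels X M N) (tensor_res M N) V s) =
   G V (pres_gen X (tensor_gens M N) (tensor_rels X M N) (tensor_res M N) V s)"
  using eq[OF V, of "fst s" "snd s"] by (auto simp: pure_tensor_def tensor_gens_def)
qed

lemma tensor_lift_ex:
 assumes P: "omod P" and U: "op U" and p: "bilin M N P U p"
 obtains q where "q : Hom (tens M N) P U"
  "!!V m n. op V ==> V <= U ==> m :<M V> ==> n :<N V> ==> q V (pt M N V m n) = p V m n"
proof -
 note F = fp_pmodule[OF tensor_gens_ok]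
 have P': "pmod P" using P by simp
 obtain q where q: "q : Hom (tens M N) P U"
  "!!V s. op V ==> V <= U ==> s : tensor_gens M N V ==>
   q V (pres_gen X (tensor_gens M N) (tensor_rels X M N) (tensor_res M N) V s) = p V (fst s) (snd s)"
 proof (rule pres_lift[OF tensor_pres_ok P U, of "%V s. p V (fst s) (snd s)", folded tensor_def])
  show "p V (fst s) (snd s) :<P V>" if "op V" "V <= U" "s : tensor_gens M N V" for V s
   by (rule bilinD(1)[OF p that(1,2)]) (use that(3) in \<open>auto simp: tensor_gens_def\<close>)
  show "p W (fst (tensor_res M N V W s)) (snd (tensor_res M N V W s)) = res P V W (p V (fst s) (snd s))"
   if "op V" "V <= U" "op W" "W <= V" "s : tensor_gens M N V" for V W s
   using bilinD(6)[OF p that(1,2), of "fst s" "snd s" W] that(3-5) by (auto simp: tensor_gens_def tensor_res_def)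
  fix G V k assume G: "G : Hom (FT M N) P U"
   and Gg: "!!V s. op V ==> V <= U ==> s : tensor_gens M N V ==> G V (fg V s) = p V (fst s) (snd s)"
   and V: "op V" "V <= U" and k: "k : tensor_rels X M N V"
  have Gp: "G V (fg V (m, n)) = p V m n" if "m :<M V>" "n :<N V>" for m n
   using Gg[OF V, of "(m, n)"] that by (simp add: tensor_gens_def)
  note bil = bilinD[OF p V]
  note Gh = homs_minus[OF G V F P'] homs_add[OF G V] homs_smult[OF G V]
  from k[unfolded tensor_rels_iff] show "G V k = 0<P V>"
   by (elim disjE exE conjE; use V M N F P' in \<open>simp add: Gh Gp ft_gen bil\<close>)
 qed (rule that; (assumption | simp))
 show thesis
 proof (rule that[OF q(1)])
  show "q V (pt M N V m n) = p V m n" if "op V" "V <= U" "m :<M V>" "n :<N V>" for V m n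
   using q(2)[OF that(1,2), of "(m, n)"] that by (simp add: pure_tensor_def tensor_gens_def)
 qed
qed

text \<open>Justifies the description by \<open>THE\<close>: existence is the universal property,
  uniqueness is determination by pure tensors.\<close>

lemma tensor_lift_props:
 assumes P: "omod P" and k: "bilin M N P (pts X) k"
 shows "tensor_lift X M N P k : mor X (tens M N) P"
  "!!V m n. op V ==> m :<M V> ==> n :<N V> ==> tensor_lift X M N P k V (pt M N V m n) = k V m n"
proof -
 let ?Q = "%p. p : mor X (tens M N) P &
  (ALL U:ops (pts X). ALL m:mcar M U. ALL n:mcar N U. p U (pt M N U m n) = k U m n)"
 obtain p where p: "p : mor X (tens M N) P"
  "!!V m n. op V ==> V <= pts X ==> m :<M V> ==> n :<N V> ==> p V (pt M N V m n) = k V m n"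
  by (rule tensor_lift_ex[OF P openin_topspace k]) (rule that; (assumption | simp))
 have "?Q (THE p. ?Q p)"
 proof (rule theI[of ?Q p])
  show "?Q p" using p by simp
  show "q = p" if "?Q q" for q
   by (rule tensor_hom_eqI[OF P openin_topspace]) (use that p in auto)
 qed
 then show "tensor_lift X M N P k : mor X (tens M N) P"
  "!!V m n. op V ==> m :<M V> ==> n :<N V> ==> tensor_lift X M N P k V (pt M N V m n) = k V m n"
  unfolding tensor_lift_def by auto
qed

end

lemma tensor_map_bilin:
 assumes f: "f : Hom M P U" and g: "g : Hom N Q U" and P: "pmod P" and Q: "pmod Q"
 shows "bilin M N (tens P Q) U (%V m n. pt P Q V (f V m) (g V n))"
proof -
 note pt = bilinD[OF pt_bilin[OF P Q, of U]]
 show ?thesis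
 proof (rule bilinI)
  fix V m n assume V: "op V" "V <= U" and m: "m :<M V>" and n: "n :<N V>"
  note fm = homs_closed[OF f V m] and gn = homs_closed[OF g V n]
  show "pt P Q V (f V m) (g V n) :<(tens P Q) V>" by (rule pt(1)[OF V fm gn])
  show "pt P Q V (f V (m +<M V> m')) (g V n) =
    pt P Q V (f V m) (g V n) +<(tens P Q) V> pt P Q V (f V m') (g V n)"
   if "m' :<M V>" for m'
   unfolding homs_add[OF f V m that] by (rule pt(2)[OF V fm gn homs_closed[OF f V that]])
  show "pt P Q V (f V m) (g V (n +<N V> n')) =
    pt P Q V (f V m) (g V n) +<(tens P Q) V> pt P Q V (f V m) (g V n')"
   if "n' :<N V>" for n'
   unfolding homs_add[OF g V n that] by (rule pt(3)[OF V fm gn homs_closed[OF g V that]])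
  show "pt P Q V (f V (a *<M V> m)) (g V n) = a *<(tens P Q) V> pt P Q V (f V m) (g V n)"
   if "a :<V>" for a
   unfolding homs_smult[OF f V that m] by (rule pt(4)[OF V fm gn that])
  show "pt P Q V (f V m) (g V (a *<N V> n)) = a *<(tens P Q) V> pt P Q V (f V m) (g V n)"
   if "a :<V>" for a
   unfolding homs_smult[OF g V that n] by (rule pt(5)[OF V fm gn that])
  show "pt P Q W (f W (res M V W m)) (g W (res N V W n)) = res (tens P Q) V W (pt P Q V (f V m) (g V n))"
   if "op W" "W <= V" for W
   unfolding homs_res[OF f V that m] homs_res[OF g V that n] by (rule pt(6)[OF V fm gn that])
 qed
qed

text \<open>A version over an open set \<open>U\<close>: \<open>tensor_map\<close> is formed from
  global morphisms only, while the splittings of the extensions exist just locally.\<close>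

lemma tensor_map_ex:
 assumes M: "pmod M" and N: "pmod N" and P: "pmod P" and Q: "pmod Q" and U: "op U"
  and f: "f : Hom M P U" and g: "g : Hom N Q U"
 obtains k where "k : Hom (tens M N) (tens P Q) U"
  "!!V m n. op V ==> V <= U ==> m :<M V> ==> n :<N V> ==>
   k V (pt M N V m n) = pt P Q V (f V m) (g V n)"
 by (rule tensor_lift_ex[OF M N tensor_O_module[OF P Q] U tensor_map_bilin[OF f g P Q]]) (rule that; (assumption | simp))

lemma tensor_map_props:
 assumes M: "pmod M" and N: "pmod N" and P: "pmod P" and Q: "pmod Q"
  and f: "f : mor X M P" and g: "g : mor X N Q"
 shows "tensor_map X M N P Q f g : mor X (tens M N) (tens P Q)"
  "!!V m n. op V ==> m :<M V> ==> n :<N V> ==>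
   tensor_map X M N P Q f g V (pt M N V m n) = pt P Q V (f V m) (g V n)"
 unfolding tensor_map_def
 by (rule tensor_lift_props[OF M N tensor_O_module[OF P Q] tensor_map_bilin[OF f g P Q]]; assumption?)+

end

section \<open>Differentials and derivations\<close>

locale fsp =
 fixes X :: "('x, 'r, 'f) over_space"
 assumes sof: "scheme_over_field X"

sublocale fsp \<subseteq> rsp X
 by unfold_locales (use sof in \<open>simp add: scheme_over_field_def is_scheme_def\<close>)

context fsp
begin

lemma scal_closed [simp]: "op U ==> c : carrier (base X) ==> scal X U c :<U>"
 unfolding scal_def using sof
 by (intro O_res_closed) (auto simp: scheme_over_field_def ring_hom_def)

lemma scal_res [simp]: "op U ==> op V ==> V <= U ==> c : carrier (base X) ==> rs U V (scal X U c) = scal X V c"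
 unfolding scal_def using sof
 by (intro O_res_res) (auto simp: scheme_over_field_def ring_hom_def)

abbreviation (input) "KG \<equiv> (%U. \<O> U)"
abbreviation (input) "FK \<equiv> free_pre X KG (ores X)"

lemma kd_rels_iff:
 "k : kd_rels X U \<longleftrightarrow>
  (\<exists>a b. a :<U> & b :<U> &
   k = fg U (a +<U> b) -<FK U> (fg U a +<FK U> fg U b)) \<or>
  (\<exists>a b. a :<U> & b :<U> &
   k = fg U (a *<U> b) -<FK U> (a *<FK U> fg U b +<FK U> b *<FK U> fg U a)) \<or>
  (\<exists>c. c : carrier (base X) & k = fg U (scal X U c))"
 unfolding kd_rels_def Let_def free_pre_sec Un_iff mem_Collect_eq by (simp only: conj_ac disj_assoc)

lemma kd_gens_ok: "gens_ok KG (rs)"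
 unfolding gens_ok_def by simp

lemma fk_gen: "op U ==> a :<U> ==> fg U a :<FK U>"
 by (rule fp_gen_closed[OF kd_gens_ok])

lemma fk_gen_res: "op U ==> op V ==> V <= U ==> a :<U> ==> res FK U V (fg U a) = fg V (rs U V a)"
 by (rule fp_gen_res[OF kd_gens_ok])

lemma kd_pres_ok: "pres_ok KG (kd_rels X) (rs)"
 unfolding pres_ok_def
proof (intro conjI allI impI subsetI)
 note F = fp_pmodule[OF kd_gens_ok]
 show "gens_ok KG (rs)" by (rule kd_gens_ok)
 show "k :<FK U>" if "op U" "k : kd_rels X U" for U k
  using that(2) unfolding kd_rels_iff using that(1) F
  by (elim disjE exE conjE; simp add: fk_gen)
 fix U V k assume "op U & op V & V <= U & k : kd_rels X U"
 then have U: "op U" "op V" "V <= U" and k: "k : kd_rels X U" by auto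
 from k[unfolded kd_rels_iff] show "res FK U V k : kd_rels X V"
 proof (elim disjE exE conjE)
  fix a b assume *: "a :<U>" "b :<U>"
   "k = fg U (a +<U> b) -<FK U> (fg U a +<FK U> fg U b)"
  show ?thesis unfolding kd_rels_iff
   by (rule disjI1, rule exI[of _ "rs U V a"], rule exI[of _ "rs U V b"])
    (use * U F in \<open>simp add: fk_gen fk_gen_res\<close>)
 next
  fix a b assume *: "a :<U>" "b :<U>"
   "k = fg U (a *<U> b) -<FK U> (a *<FK U> fg U b +<FK U> b *<FK U> fg U a)"
  show ?thesis unfolding kd_rels_iff
   by (rule disjI2, rule disjI1, rule exI[of _ "rs U V a"], rule exI[of _ "rs U V b"])
    (use * U F in \<open>simp add: fk_gen fk_gen_res\<close>)
 next
  fix c assume *: "c : carrier (base X)" "k = fg U (scal X U c)"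
  show ?thesis unfolding kd_rels_iff
   by (rule disjI2, rule disjI2, rule exI[of _ c]) (use * U F in \<open>simp add: fk_gen_res\<close>)
 qed
qed

lemma kaehler_O_module [simp]: "omod (kaehler X)"
 unfolding kaehler_def by (rule pres_O_module[OF kd_pres_ok])

lemma kd_closed [simp]: "op U ==> a :<U> ==> kd_d X U a :<(kaehler X) U>"
 unfolding kaehler_def kd_d_def by (rule pres_gen_closed[OF kd_pres_ok])

lemma kd_res: "op U ==> op V ==> V <= U ==> a :<U> ==>
  res (kaehler X) U V (kd_d X U a) = kd_d X V (rs U V a)"
 unfolding kaehler_def kd_d_def by (rule pres_gen_res[OF kd_pres_ok])

lemma kd_mult:
 assumes V: "op V" and a: "a :<V>" and b: "b :<V>"
 shows "kd_d X V (a *<V> b) =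
  a *<(kaehler X) V> kd_d X V b +<(kaehler X) V> b *<(kaehler X) V> kd_d X V a"
proof -
 note F = fp_pmodule[OF kd_gens_ok]
 note T = omod_pmod[OF kaehler_O_module]
 obtain c where c0: "c : Hom FK (kaehler X) (pts X)"
  "!!U s. op U ==> s :<U> ==> c U (fg U s) = pres_gen X KG (kd_rels X) (rs) U s"
  "!!U k. op U ==> k : kd_rels X U ==> c U k = 0<(kaehler X) U>"
  by (rule pres_class[OF kd_pres_ok, folded kaehler_def]) (rule that; (assumption | simp))
 have c: "c V (fg V a) = kd_d X V a" if "a :<V>" for a
  using c0(2)[OF V that] by (simp add: kd_d_def)
 let ?u = "fg V (a *<V> b)" and ?v = "a *<FK V> fg V b +<FK V> b *<FK V> fg V a"
 have uv: "?u :<FK V>" "?v :<FK V>" using V a b F by (simp_all add: fk_gen)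
 have "?u -<FK V> ?v : kd_rels X V" unfolding kd_rels_iff using a b by blast
 then have "c V ?u = c V ?v"
  using c0(3)[OF V] homs_minus[OF c0(1) V op_pts[OF V] F T uv]
   pm_minus_zero_iff[OF T V, of "c V ?u" "c V ?v"] homs_closed[OF c0(1) V op_pts[OF V]] uv by simp
 then show ?thesis
  using V a b F homs_add[OF c0(1) V op_pts[OF V]] homs_smult[OF c0(1) V op_pts[OF V]] by (simp add: c fk_gen)
qed

lemma kd_hom_eqI:
 assumes P: "omod P" and U: "op U" and F: "F : Hom (kaehler X) P U" and G: "G : Hom (kaehler X) P U"
  and eq: "!!V a. op V ==> V <= U ==> a :<V> ==> F V (kd_d X V a) = G V (kd_d X V a)"
 shows "F = G"
 by (rule pres_hom_eqI[OF kd_pres_ok P U F[unfolded kaehler_def] G[unfolded kaehler_def]])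
  (rule eq[unfolded kd_d_def])

lemma kd_lift_ex:
 assumes P: "omod P" and U: "op U"
  and cl: "!!V a. op V ==> V <= U ==> a :<V> ==> p V a :<P V>"
  and add: "!!V a b. op V ==> V <= U ==> a :<V> ==> b :<V> ==>
   p V (a +<V> b) = p V a +<P V> p V b"
  and mult: "!!V a b. op V ==> V <= U ==> a :<V> ==> b :<V> ==>
   p V (a *<V> b) = a *<P V> p V b +<P V> b *<P V> p V a"
  and scal: "!!V c. op V ==> V <= U ==> c : carrier (base X) ==> p V (scal X V c) = 0<P V>"
  and restr: "!!V W a. op V ==> V <= U ==> op W ==> W <= V ==> a :<V> ==>
   p W (rs V W a) = res P V W (p V a)"
 obtains q where "q : Hom (kaehler X) P U"
  "!!V a. op V ==> V <= U ==> a :<V> ==> q V (kd_d X V a) = p V a"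
proof -
 note F = fp_pmodule[OF kd_gens_ok]
 have P': "pmod P" using P by simp
 obtain q where q: "q : Hom (kaehler X) P U"
  "!!V s. op V ==> V <= U ==> s :<V> ==> q V (pres_gen X KG (kd_rels X) (rs) V s) = p V s"
 proof (rule pres_lift[OF kd_pres_ok P U, of p, folded kaehler_def])
  fix G V k assume G: "G : Hom FK P U"
   and Gg: "!!V s. op V ==> V <= U ==> s :<V> ==> G V (fg V s) = p V s"
   and V: "op V" "V <= U" and k: "k : kd_rels X V"
  note Gp = Gg[OF V]
  note Gh = homs_minus[OF G V F P'] homs_add[OF G V] homs_smult[OF G V]
  from k[unfolded kd_rels_iff] show "G V k = 0<P V>"
   by (elim disjE exE conjE; use V F P' in \<open>simp add: Gh Gp fk_gen cl add mult scal\<close>)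
 qed (use cl restr in \<open>auto intro: that\<close>)
 show thesis
  by (rule that[OF q(1)]) (use q(2) in \<open>simp add: kd_d_def\<close>)
qed

subsection \<open>Derivations\<close>

lemma ders_f_homs: "D : ders X U ==> D : f_homs X (ox X) (ox X) U"
 unfolding ders_def by blast

lemma ders_add_fams: "ders X U <= add_fams X (ox X) (ox X) U"
 unfolding ders_def f_homs_def by blast

lemma ders_fams: "ders X U <= fams (ox X) (ox X) U"
 using ders_add_fams add_fams_fams by blast

lemma ders_mkfam: "D : ders X U ==> fam' (ox X) U D = D"
 using fams_extensional[OF subsetD[OF ders_fams]] .

lemma der_closed [simp]: "D : ders X U ==> op V ==> V <= U ==> a :<V> ==> D V a :<V>"
 using fams_closed[OF subsetD[OF ders_fams]] by simp

lemma der_add: "D : ders X U ==> op V ==> V <= U ==> a :<V> ==> b :<V> ==>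
  D V (a +<V> b) = D V a +<V> D V b"
 by (simp add: ders_def f_homs_def add_fams_def)

lemma der_res: "D : ders X U ==> op V ==> V <= U ==> op W ==> W <= V ==> a :<V> ==>
  D W (rs V W a) = rs V W (D V a)"
 by (simp add: ders_def f_homs_def add_fams_def)

lemma der_scal_mult: "D : ders X U ==> op V ==> V <= U ==> c : carrier (base X) ==> a :<V> ==>
  D V (scal X V c *<V> a) = scal X V c *<V> D V a"
 using ders_f_homs[of D U] by (simp add: f_homs_def)

lemma der_mult: "D : ders X U ==> op V ==> V <= U ==> a :<V> ==> b :<V> ==>
  D V (a *<V> b) = a *<V> D V b +<V> b *<V> D V a"
 by (simp add: ders_def)

lemma der_one:
 assumes "D : ders X U" "op V" "V <= U"
 shows "D V 1<V> = 0<V>"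
proof -
 interpret R: cring "osec X V" by (rule O_cring[OF assms(2)])
 have c: "D V 1<V> :<V>" using assms by simp
 have "D V 1<V> +<V> D V 1<V> = D V 1<V>"
  using der_mult[OF assms, of "1<V>" "1<V>"] c by simp
 then show ?thesis using R.add.l_cancel_one[OF c c] by simp
qed

lemma der_scal:
 assumes "D : ders X U" "op V" "V <= U" "c : carrier (base X)"
 shows "D V (scal X V c) = 0<V>"
proof -
 interpret R: cring "osec X V" by (rule O_cring[OF assms(2)])
 show ?thesis using der_scal_mult[OF assms, of "1<V>"] assms by (simp add: der_one[OF assms(1-3)])
qed

lemma dersI:
 assumes cl: "!!V a. op V ==> V <= U ==> a :<V> ==> D V a :<V>"
  and add: "!!V a b. op V ==> V <= U ==> a :<V> ==> b :<V> ==>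
   D V (a +<V> b) = D V a +<V> D V b"
  and restr: "!!V W a. op V ==> V <= U ==> op W ==> W <= V ==> a :<V> ==>
   D W (rs V W a) = rs V W (D V a)"
  and scal: "!!V c a. op V ==> V <= U ==> c : carrier (base X) ==> a :<V> ==>
   D V (scal X V c *<V> a) = scal X V c *<V> D V a"
  and mult: "!!V a b. op V ==> V <= U ==> a :<V> ==> b :<V> ==>
   D V (a *<V> b) = a *<V> D V b +<V> b *<V> D V a"
 shows "fam' (ox X) U D : ders X U"
proof -
 have t: "W <= U" if "W : ops V" "V : ops U" for V W using that by auto
 show ?thesis
  unfolding ders_def f_homs_def add_fams_def using assms by (simp add: PiE_iff) (blast dest: t)
qed

lemma ders_restrict:
 assumes D: "D : ders X U" and V: "op V" "V <= U"
 shows "restrict D (ops V) : ders X V"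
proof -
 have s: "W <= U" if "W <= V" for W using that V by blast
 have "fam' (ox X) V D : ders X V"
  using D V by (intro dersI) (auto simp: s der_add der_res der_scal_mult der_mult)
 moreover have "fam' (ox X) V D = restrict D (ops V)"
  by (subst (2) ders_mkfam[OF D, symmetric]) (simp add: restrict_restrict opens_Int_subset[OF V(2)])
 ultimately show ?thesis by simp
qed

lemma tangent_pmodule: "pmod (tangent X)"
 unfolding tangent_def
proof (rule fam_sheaf_pmodule)
 show "pmod (ox X)" by simp
 fix U assume U: "op U"
 show "ders X U <= fams (ox X) (ox X) U" by (rule ders_fams)
 show "restrict D (ops V) : ders X V" if "op V" "V <= U" "D : ders X U" for V D
  by (rule ders_restrict[OF that(3,1,2)])
 show "fam' (ox X) U (%V m. 0<(ox X) V>) : ders X U"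
 proof (rule dersI)
  fix V a b c assume V: "op V"
  interpret R: cring "osec X V" by (rule O_cring[OF V])
  assume a: "a :<V>"
  show "0<(ox X) V> = scal X V c *<V> 0<(ox X) V>" if "c : carrier (base X)"
   using that V by simp
  show "0<(ox X) V> = 0<(ox X) V> +<V> 0<(ox X) V>" by simp
  show "0<(ox X) V> = a *<V> 0<(ox X) V> +<V> b *<V> 0<(ox X) V>"
   if "b :<V>" using that a by simp
 qed auto
 fix D assume D: "D : ders X U"
 show "fam' (ox X) U (%V m. D V m +<(ox X) V> D' V m) : ders X U" if D': "D' : ders X U" for D'
 proof (rule dersI)
  fix V a assume V: "op V" "V <= U" and a: "a :<V>"
  interpret R: cring "osec X V" by (rule O_cring[OF V(1)])
  note cl = der_closed[OF D V] der_closed[OF D' V]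
  show "D V a +<(ox X) V> D' V a :<V>" using a cl by simp
  show "D V (scal X V c *<V> a) +<(ox X) V> D' V (scal X V c *<V> a) =
    scal X V c *<V> (D V a +<(ox X) V> D' V a)" if "c : carrier (base X)" for c
   using that V a cl by (simp add: der_scal_mult[OF D V] der_scal_mult[OF D' V] R.r_distr)
  show "D W (rs V W a) +<(ox X) W> D' W (rs V W a) = rs V W (D V a +<(ox X) V> D' V a)"
   if W: "op W" "W <= V" for W using W V a cl by (simp add: der_res[OF D V W] der_res[OF D' V W])
  fix b assume b: "b :<V>"
  show "D V (a +<V> b) +<(ox X) V> D' V (a +<V> b) =
    (D V a +<(ox X) V> D' V a) +<V> (D V b +<(ox X) V> D' V b)"
   using a b cl by (simp add: der_add[OF D V] der_add[OF D' V] R.a_ac)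
  show "D V (a *<V> b) +<(ox X) V> D' V (a *<V> b) =
    a *<V> (D V b +<(ox X) V> D' V b) +<V> b *<V> (D V a +<(ox X) V> D' V a)"
   using a b cl by (simp add: der_mult[OF D V] der_mult[OF D' V] R.r_distr R.a_ac)
 qed
 show "fam' (ox X) U (%V m. rs U V r *<(ox X) V> D V m) : ders X U" if r: "r :<U>" for r
 proof (rule dersI)
  fix V a assume V: "op V" "V <= U" and a: "a :<V>"
  interpret R: cring "osec X V" by (rule O_cring[OF V(1)])
  note cl = der_closed[OF D V]
  have rV: "rs U V r :<V>" using r V U by simp
  show "rs U V r *<(ox X) V> D V a :<V>" using a cl rV by simp
  show "rs U V r *<(ox X) V> D V (scal X V c *<V> a) =
    scal X V c *<V> (rs U V r *<(ox X) V> D V a)" if "c : carrier (base X)" for c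
   unfolding der_scal_mult[OF D V that a] using that V a cl rV by (simp add: R.m_lcomm)
  show "rs U W r *<(ox X) W> D W (rs V W a) = rs V W (rs U V r *<(ox X) V> D V a)"
   if W: "op W" "W <= V" for W using W V U r a cl rV by (simp add: der_res[OF D V W])
  fix b assume b: "b :<V>"
  show "rs U V r *<(ox X) V> D V (a +<V> b) =
    rs U V r *<(ox X) V> D V a +<V> rs U V r *<(ox X) V> D V b"
   using a b cl rV by (simp add: der_add[OF D V] R.r_distr)
  show "rs U V r *<(ox X) V> D V (a *<V> b) =
    a *<V> (rs U V r *<(ox X) V> D V b) +<V> b *<V> (rs U V r *<(ox X) V> D V a)"
   using a b cl rV by (simp add: der_mult[OF D V] R.r_distr R.m_ac)
 qed
qed

text \<open>Justifies the description by \<open>THE\<close>. Evaluation of derivations at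
  \<open>a\<close> is additive in \<open>a\<close>, satisfies the product rule and vanishes on
  scalars, hence respects the relations of the differentials; uniqueness holds because the elements
  \<open>kd_d\<close> generate.\<close>

lemma kd_to_tangent_dual_props:
 shows "kd_to_tangent_dual X : mor X (kaehler X) (dual X (tangent X))"
  "!!U V D a. op U ==> a :<U> ==> op V ==> V <= U ==> D : ders X V ==>
   kd_to_tangent_dual X U (kd_d X U a) V D = D V (rs U V a)"
proof -
 let ?T = "tangent X" and ?P = "dual X (tangent X)"
 have P: "omod ?P" by (rule hom_sheaf_O_module[OF tangent_pmodule ox_O_module])
 have Tc: "mcar ?T U = ders X U" for U by (simp add: tangent_def)
 define k where "k U a = fam' ?T U (%V D. D V (rs U V a))" for U a
 have k: "k U a : Hom ?T (ox X) U" if U: "op U" and a: "a :<U>" for U a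
  unfolding k_def
 proof (rule homsI[OF tangent_pmodule]; unfold Tc)
  fix V D assume V: "op V" "V <= U" and D: "D : ders X V"
  have aV: "rs U V a :<V>" using U a V by simp
  show "D V (rs U V a) :<(ox X) V>" using D V aV by simp
  show "(D +<?T V> D') V (rs U V a) = D V (rs U V a) +<(ox X) V> D' V (rs U V a)" for D'
   using V aV by (simp add: tangent_def)
  show "(r *<?T V> D) V (rs U V a) = r *<(ox X) V> D V (rs U V a)" if "r :<V>" for r
   using V aV that by (simp add: tangent_def)
  show "res ?T V W D W (rs U W a) = res (ox X) V W (D V (rs U V a))" if W: "op W" "W <= V" for W
   using V aV W U a der_res[OF D V(1) order_refl W aV] by (simp add: tangent_def)
 qed
 let ?Q = "%p. p : mor X (kaehler X) ?P &
  (ALL U:ops (pts X). ALL a:\<O> U. ALL V:ops U. ALL D:ders X V.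
   p U (kd_d X U a) V D = D V (rs U V a))"
 obtain p where p: "p : Hom (kaehler X) ?P (pts X)"
  "!!V a. op V ==> V <= pts X ==> a :<V> ==> p V (kd_d X V a) = k V a"
 proof (rule kd_lift_ex[OF P openin_topspace, of k])
  fix V a assume V: "op V" and a: "a :<V>"
  show "k V a :<?P V>" using k[OF V a] by simp
  show "k W (rs V W a) = res ?P V W (k V a)" if W: "op W" "W <= V" for W
  proof -
   have "Y <= V" if "Y : ops W" for Y using that W by auto
   then show ?thesis unfolding k_def using V W a
    by (simp add: restrict_restrict opens_Int_subset) (intro restrict_ext, simp)
  qed
  fix b assume b: "b :<V>"
  show "k V (a +<V> b) = k V a +<?P V> k V b"
   unfolding k_def hom_simps
   by (intro restrict_ext) (use V a b in \<open>simp add: Tc der_add\<close>)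
  show "k V (a *<V> b) = a *<?P V> k V b +<?P V> b *<?P V> k V a"
   unfolding k_def hom_simps
   by (intro restrict_ext) (use V a b in \<open>simp add: Tc der_mult\<close>)
 next
  fix V c assume V: "op V" and c: "c : carrier (base X)"
  show "k V (scal X V c) = 0<?P V>"
   unfolding k_def hom_simps
   by (intro restrict_ext) (use V c in \<open>simp add: Tc der_scal\<close>)
 qed (rule that; (assumption | simp))
 have "?Q (THE p. ?Q p)"
 proof (rule theI[of ?Q p])
  show Qp: "?Q p" using p by (auto simp: k_def Tc)
  show "q = p" if q: "?Q q" for q
  proof (rule kd_hom_eqI[OF P openin_topspace])
   show "q : mor X (kaehler X) ?P" "p : mor X (kaehler X) ?P" using q p by auto
   fix V a assume V: "op V" "V <= pts X" and a: "a :<V>"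
   have h: "q V (kd_d X V a) : Hom ?T (ox X) V" "p V (kd_d X V a) : Hom ?T (ox X) V"
    using homs_closed[of q "kaehler X" ?P "pts X" V "kd_d X V a"] homs_closed[OF p(1) V, of "kd_d X V a"] q V a by auto
   show "q V (kd_d X V a) = p V (kd_d X V a)"
    by (rule homs_eqI[OF h]) (use q Qp V a in \<open>simp add: Tc\<close>)
  qed
 qed
 then show "kd_to_tangent_dual X : mor X (kaehler X) (dual X (tangent X))"
  "!!U V D a. op U ==> a :<U> ==> op V ==> V <= U ==> D : ders X V ==>
   kd_to_tangent_dual X U (kd_d X U a) V D = D V (rs U V a)"
  unfolding kd_to_tangent_dual_def by auto
qed

end

section \<open>First cohomology\<close>

text \<open>Common frame for the unit groups and the additive groups of modules, so that cocycles
  and their classes are treated once, in multiplicative notation.\<close>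

definition ab_presheaf :: "('x, 'r, 'z) ringed_space_scheme => ('x set => ('g, 'w) monoid_scheme) =>
  ('x set => 'x set => 'g => 'g) => bool"
 where "ab_presheaf X G r \<longleftrightarrow>
  (\<forall>U. openin (tsp X) U --> comm_group (G U)) &
  (\<forall>U V. openin (tsp X) U & openin (tsp X) V & V <= U --> r U V : hom (G U) (G V)) &
  (\<forall>U V W. openin (tsp X) U & openin (tsp X) V & openin (tsp X) W & W <= V & V <= U -->
   (ALL a:carrier (G U). r V W (r U V a) = r U W a))"

context rsp
begin

lemma coveringD:
 assumes "covering X C"
 shows "U : C ==> op U" "x : pts X ==> EX U:C. x : U"
 using assms unfolding covering_def by auto

lemma coveringI:
 assumes "!!U. U : C ==> op U" "!!x. x : pts X ==> EX U:C. x : U"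
 shows "covering X C"
 using assms op_inD unfolding covering_def by auto

context
 fixes G :: "'x set => ('g, 'w) monoid_scheme" and r
 assumes G: "ab_presheaf X G r"
begin

lemma ab_group: "op U ==> comm_group (G U)"
 using G by (simp add: ab_presheaf_def)

lemma ab_hom: "op U ==> op V ==> V <= U ==> r U V : hom (G U) (G V)"
 using G by (simp add: ab_presheaf_def)

lemma ab_res: "op U ==> op V ==> V <= U ==> a : carrier (G U) ==> r U V a : carrier (G V)"
 by (rule hom_in_carrier[OF ab_hom])

lemma ab_res_mult: "op U ==> op V ==> V <= U ==> a : carrier (G U) ==> b : carrier (G U) ==>
  r U V (a *{(G U)} b) = r U V a *{(G V)} r U V b"
 by (rule hom_mult[OF ab_hom])

lemma ab_res_res: "op U ==> op V ==> op W ==> W <= V ==> V <= U ==> a : carrier (G U) ==> r V W (r U V a) = r U W a"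
 using G by (simp add: ab_presheaf_def)

lemma ab_group_group: "op U ==> group (G U)"
 using ab_group comm_group.axioms(2) by blast

lemma ab_res_one: "op U ==> op V ==> V <= U ==> r U V 1{(G U)} = 1{(G V)}"
 by (rule hom_one[OF ab_hom ab_group_group ab_group_group])

lemma ab_res_inv: "op U ==> op V ==> V <= U ==> a : carrier (G U) ==> r U V (inv\<^bsub>G U\<^esub> a) = inv\<^bsub>G V\<^esub> r U V a"
 using group_hom.hom_inv[of "G U" "G V" "r U V" a] ab_hom ab_group_group
 by (simp add: group_hom_def group_hom_axioms_def)

lemma cocycleD:
 assumes "cocycle X G r (C, c)"
 shows "covering X C" "U : C ==> V : C ==> c U V : carrier (G (U Int V))"
  "U : C ==> V : C ==> W : C ==> r (U Int V) (U Int V Int W) (c U V) *{(G (U Int V Int W))} r (V Int W) (U Int V Int W) (c V W) =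
   r (U Int W) (U Int V Int W) (c U W)"
 using assms by (simp_all add: cocycle_def)

lemma cocycle_op: "cocycle X G r (C, c) ==> U : C ==> op U"
 using cocycleD(1) coveringD(1) by blast

lemma cocycle_restrict:
 assumes z: "cocycle X G r (C, c)" and U: "U : C" "V : C" "T : C" and Y: "op Y" "Y <= U" "Y <= V" "Y <= T"
 shows "r (U Int V) Y (c U V) *{(G Y)} r (V Int T) Y (c V T) = r (U Int T) Y (c U T)"
proof -
 note o = cocycle_op[OF z U(1)] cocycle_op[OF z U(2)] cocycle_op[OF z U(3)]
 let ?Z = "U Int V Int T"
 have Z: "op ?Z" "Y <= ?Z" "?Z <= U Int V" "?Z <= V Int T" "?Z <= U Int T" using o Y by auto
 note m = cocycleD(2)[OF z U(1,2)] cocycleD(2)[OF z U(2,3)] cocycleD(2)[OF z U(1,3)]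
 have oo: "op (U Int V)" "op (V Int T)" "op (U Int T)" using o by auto
 have "r (U Int V) Y (c U V) *{(G Y)} r (V Int T) Y (c V T) =
   r ?Z Y (r (U Int V) ?Z (c U V)) *{(G Y)} r ?Z Y (r (V Int T) ?Z (c V T))"
  using ab_res_res[OF oo(1) Z(1) Y(1) Z(2,3) m(1)] ab_res_res[OF oo(2) Z(1) Y(1) Z(2,4) m(2)] by simp
 also have "\<dots> = r ?Z Y (r (U Int V) ?Z (c U V) *{(G ?Z)} r (V Int T) ?Z (c V T))"
  by (rule ab_res_mult[OF Z(1) Y(1) Z(2) ab_res[OF oo(1) Z(1,3) m(1)] ab_res[OF oo(2) Z(1,4) m(2)], symmetric])
 also have "\<dots> = r ?Z Y (r (U Int T) ?Z (c U T))" using cocycleD(3)[OF z U] by simp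
 also have "\<dots> = r (U Int T) Y (c U T)" by (rule ab_res_res[OF oo(3) Z(1) Y(1) Z(2,5) m(3)])
 finally show ?thesis .
qed

lemma cohomologousI:
 assumes "covering X W"
  "!!w. w : W ==> \<sigma> w : C & w <= \<sigma> w" "!!w. w : W ==> \<tau> w : D & w <= \<tau> w"
  "!!w. w : W ==> b w : carrier (G w)"
  "!!w w'. w : W ==> w' : W ==>
   r (\<sigma> w Int \<sigma> w') (w Int w') (c (\<sigma> w) (\<sigma> w')) *{(G (w Int w'))} r w' (w Int w') (b w') =
   r w (w Int w') (b w) *{(G (w Int w'))} r (\<tau> w Int \<tau> w') (w Int w') (d (\<tau> w) (\<tau> w'))"
 shows "cohomologous X G r (C, c) (D, d)"
 unfolding cohomologous_def prod.case
 by (rule exI[of _ W], rule exI[of _ \<sigma>], rule exI[of _ \<tau>], rule exI[of _ b]) (use assms in simp)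

lemma cohomologousE:
 assumes "cohomologous X G r (C, c) (D, d)"
 obtains W k p b where "covering X W"
  "ALL w:W. k w : C & w <= k w & p w : D & w <= p w & b w : carrier (G w)"
  "ALL w:W. ALL w':W.
   r (k w Int k w') (w Int w') (c (k w) (k w')) *{(G (w Int w'))} r w' (w Int w') (b w') =
   r w (w Int w') (b w) *{(G (w Int w'))} r (p w Int p w') (w Int w') (d (p w) (p w'))"
 using assms unfolding cohomologous_def prod.case by auto

lemma cohomologous_refl:
 assumes z: "cocycle X G r (C, c)"
 shows "cohomologous X G r (C, c) (C, c)"
proof (rule cohomologousI[of C "%w. w" _ "%w. w" _ "%w. 1{(G w)}"])
 show "covering X C" by (rule cocycleD(1)[OF z])
 fix w assume w: "w : C"
 note ow = cocycle_op[OF z w]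
 interpret g: comm_group "G w" by (rule ab_group[OF ow])
 show "1{(G w)} : carrier (G w)" by simp
 fix w' assume w': "w' : C"
 note ow' = cocycle_op[OF z w']
 have o: "op (w Int w')" "w Int w' <= w" "w Int w' <= w'" using ow ow' by auto
 interpret gg: comm_group "G (w Int w')" by (rule ab_group[OF o(1)])
 have "r (w Int w') (w Int w') (c w w') : carrier (G (w Int w'))"
  by (rule ab_res[OF o(1) o(1) order_refl cocycleD(2)[OF z w w']])
 then show "r (w Int w') (w Int w') (c w w') *{(G (w Int w'))} r w' (w Int w') 1{(G w')} =
   r w (w Int w') 1{(G w)} *{(G (w Int w'))} r (w Int w') (w Int w') (c w w')"
  using ab_res_one[OF ow o(1,2)] ab_res_one[OF ow' o(1,3)] by simp
qed auto

text \<open>Multiplying the relation \<open>c b' = b d\<close> by the inverses of \<open>b\<close>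
  and \<open>b'\<close> exchanges the roles of \<open>c\<close> and \<open>d\<close>, so the inverse
  cochain works on the same refinement.\<close>

lemma cohomologous_sym:
 assumes z: "cocycle X G r (C, c)" and z': "cocycle X G r (D, d)" and cd: "cohomologous X G r (C, c) (D, d)"
 shows "cohomologous X G r (D, d) (C, c)"
 using cd
proof (rule cohomologousE)
 fix W \<sigma> \<tau> b
 assume W: "covering X W"
  and a: "ALL w:W. \<sigma> w : C & w <= \<sigma> w & \<tau> w : D & w <= \<tau> w & b w : carrier (G w)"
  and eq: "ALL w:W. ALL w':W.
   r (\<sigma> w Int \<sigma> w') (w Int w') (c (\<sigma> w) (\<sigma> w')) *{(G (w Int w'))} r w' (w Int w') (b w') =
   r w (w Int w') (b w) *{(G (w Int w'))} r (\<tau> w Int \<tau> w') (w Int w') (d (\<tau> w) (\<tau> w'))"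
 show ?thesis
 proof (rule cohomologousI[of W \<tau> _ \<sigma> _ "%w. inv\<^bsub>G w\<^esub> b w", OF W])
  fix w assume w: "w : W"
  show "\<tau> w : D & w <= \<tau> w" "\<sigma> w : C & w <= \<sigma> w" using a w by auto
  note ow = coveringD(1)[OF W w]
  interpret g: comm_group "G w" by (rule ab_group[OF ow])
  show "inv\<^bsub>G w\<^esub> b w : carrier (G w)" using a w by simp
  fix w' assume w': "w' : W"
  note ow' = coveringD(1)[OF W w']
  have o: "op (w Int w')" "w Int w' <= w" "w Int w' <= w'" using ow ow' by auto
  interpret gg: comm_group "G (w Int w')" by (rule ab_group[OF o(1)])
  let ?c = "r (\<sigma> w Int \<sigma> w') (w Int w') (c (\<sigma> w) (\<sigma> w'))" and ?d = "r (\<tau> w Int \<tau> w') (w Int w') (d (\<tau> w) (\<tau> w'))"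
  let ?b = "r w (w Int w') (b w)" and ?b' = "r w' (w Int w') (b w')"
  have s: "\<sigma> w : C" "\<sigma> w' : C" "\<tau> w : D" "\<tau> w' : D" "w Int w' <= \<sigma> w Int \<sigma> w'" "w Int w' <= \<tau> w Int \<tau> w'"
   "b w : carrier (G w)" "b w' : carrier (G w')"
   using a w w' by auto
  have oo: "op (\<sigma> w Int \<sigma> w')" "op (\<tau> w Int \<tau> w')"
   using cocycle_op[OF z s(1)] cocycle_op[OF z s(2)] cocycle_op[OF z' s(3)] cocycle_op[OF z' s(4)] by auto
  have cl: "?c : carrier (G (w Int w'))" "?d : carrier (G (w Int w'))" "?b : carrier (G (w Int w'))" "?b' : carrier (G (w Int w'))"
   by (rule ab_res[OF oo(1) o(1) s(5) cocycleD(2)[OF z s(1,2)]],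
     rule ab_res[OF oo(2) o(1) s(6) cocycleD(2)[OF z' s(3,4)]],
     rule ab_res[OF ow o(1,2) s(7)], rule ab_res[OF ow' o(1,3) s(8)])
  have e: "?c *{(G (w Int w'))} ?b' = ?b *{(G (w Int w'))} ?d" using eq w w' by blast
  have "?d *{(G (w Int w'))} inv\<^bsub>G (w Int w')\<^esub> ?b' = inv\<^bsub>G (w Int w')\<^esub> ?b *{(G (w Int w'))} (?b *{(G (w Int w'))} ?d) *{(G (w Int w'))} inv\<^bsub>G (w Int w')\<^esub> ?b'"
   using cl by (simp flip: gg.m_assoc)
  also have "\<dots> = inv\<^bsub>G (w Int w')\<^esub> ?b *{(G (w Int w'))} ?c"
   using cl by (simp flip: e add: gg.m_assoc)
  finally show "?d *{(G (w Int w'))} r w' (w Int w') (inv\<^bsub>G w'\<^esub> b w') = r w (w Int w') (inv\<^bsub>G w\<^esub> b w) *{(G (w Int w'))} ?c"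
   using ab_res_inv[OF ow o(1,2) s(7)] ab_res_inv[OF ow' o(1,3) s(8)] by simp
 qed
qed

text \<open>On a common refinement the middle cocycle, evaluated between the two refinement maps into its
 covering, corrects the composite of the two cochains.\<close>

lemma cohomologous_trans:
 assumes z: "cocycle X G r (C, c)" and z': "cocycle X G r (D, d)" and z'': "cocycle X G r (K, h)"
  and cd: "cohomologous X G r (C, c) (D, d)" and dh: "cohomologous X G r (D, d) (K, h)"
 shows "cohomologous X G r (C, c) (K, h)"
 using cd
proof (rule cohomologousE)
 fix W \<sigma> \<tau> b
 assume W: "covering X W"
  and a: "ALL w:W. \<sigma> w : C & w <= \<sigma> w & \<tau> w : D & w <= \<tau> w & b w : carrier (G w)"
  and eq: "ALL w:W. ALL w':W.
   r (\<sigma> w Int \<sigma> w') (w Int w') (c (\<sigma> w) (\<sigma> w')) *{(G (w Int w'))} r w' (w Int w') (b w') =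
   r w (w Int w') (b w) *{(G (w Int w'))} r (\<tau> w Int \<tau> w') (w Int w') (d (\<tau> w) (\<tau> w'))"
 from dh show ?thesis
 proof (rule cohomologousE)
  fix W' \<sigma>' \<tau>' b'
  assume W': "covering X W'"
   and a': "ALL w:W'. \<sigma>' w : D & w <= \<sigma>' w & \<tau>' w : K & w <= \<tau>' w & b' w : carrier (G w)"
   and eq': "ALL w:W'. ALL w':W'.
    r (\<sigma>' w Int \<sigma>' w') (w Int w') (d (\<sigma>' w) (\<sigma>' w')) *{(G (w Int w'))} r w' (w Int w') (b' w') =
    r w (w Int w') (b' w) *{(G (w Int w'))} r (\<tau>' w Int \<tau>' w') (w Int w') (h (\<tau>' w) (\<tau>' w'))"
  define Z where "Z = {w Int w' | w w'. w : W & w' : W'}"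
  define pr where "pr u = (SOME q. fst q : W & snd q : W' & u = fst q Int snd q)" for u
  define k where "k u = fst (pr u)" for u
  define t where "t u = snd (pr u)" for u
  have ab: "k u : W" "t u : W'" "u = k u Int t u" if "u : Z" for u
  proof -
   have "\<exists>q. fst q : W & snd q : W' & u = fst q Int snd q" using that by (force simp: Z_def)
   from someI_ex[OF this] show "k u : W" "t u : W'" "u = k u Int t u"
    unfolding k_def t_def pr_def[symmetric] by auto
  qed
  have oa: "op (k u)" "op (t u)" if "u : Z" for u
   using coveringD(1)[OF W ab(1)[OF that]] coveringD(1)[OF W' ab(2)[OF that]] by auto
  have oZ: "op u" if "u : Z" for u
   using oa[OF that] ab(3)[OF that] op_Int by metis
  have sub: "u <= k u" "u <= t u" if "u : Z" for u using ab(3)[OF that] by auto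
  note aa = a[rule_format, OF ab(1)] and aa' = a'[rule_format, OF ab(2)]
  have mem: "\<sigma> (k u) : C" "\<tau> (k u) : D" "\<sigma>' (t u) : D" "\<tau>' (t u) : K"
   "u <= \<sigma> (k u)" "u <= \<tau> (k u)" "u <= \<sigma>' (t u)" "u <= \<tau>' (t u)"
   "b (k u) : carrier (G (k u))" "b' (t u) : carrier (G (t u))" if "u : Z" for u
   using aa[OF that] aa'[OF that] sub[OF that] by auto
  define b'' where "b'' u = r (k u) u (b (k u)) *{(G u)}
   (r (\<tau> (k u) Int \<sigma>' (t u)) u (d (\<tau> (k u)) (\<sigma>' (t u))) *{(G u)} r (t u) u (b' (t u)))" for u
  have odd: "op (\<tau> (k u) Int \<sigma>' (t v))" "d (\<tau> (k u)) (\<sigma>' (t v)) : carrier (G (\<tau> (k u) Int \<sigma>' (t v)))"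
   if "u : Z" "v : Z" for u v
   using cocycle_op[OF z' mem(2)[OF that(1)]] cocycle_op[OF z' mem(3)[OF that(2)]]
    cocycleD(2)[OF z' mem(2)[OF that(1)] mem(3)[OF that(2)]] by auto
  have bcl: "r (k u) u (b (k u)) : carrier (G u)" "r (t u) u (b' (t u)) : carrier (G u)"
   "r (\<tau> (k u) Int \<sigma>' (t u)) u (d (\<tau> (k u)) (\<sigma>' (t u))) : carrier (G u)" if u: "u : Z" for u
  proof -
   have "u <= \<tau> (k u) Int \<sigma>' (t u)" using mem(6,7)[OF u] by blast
   from ab_res[OF odd(1)[OF u u] oZ[OF u] this odd(2)[OF u u]]
   show "r (\<tau> (k u) Int \<sigma>' (t u)) u (d (\<tau> (k u)) (\<sigma>' (t u))) : carrier (G u)" .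
  qed (rule ab_res[OF oa(1)[OF that] oZ[OF that] sub(1)[OF that] mem(9)[OF that]],
    rule ab_res[OF oa(2)[OF that] oZ[OF that] sub(2)[OF that] mem(10)[OF that]])
  show ?thesis
  proof (rule cohomologousI[of Z "%u. \<sigma> (k u)" _ "%u. \<tau>' (t u)" _ b''])
   show "covering X Z"
   proof (rule coveringI)
    show "op u" if "u : Z" for u by (rule oZ[OF that])
    fix x assume x: "x : pts X"
    obtain w w' where "w : W" "w' : W'" "x : w" "x : w'"
     using coveringD(2)[OF W x] coveringD(2)[OF W' x] by auto
    then show "EX u:Z. x : u" by (intro bexI[of _ "w Int w'"]) (auto simp: Z_def)
   qed
   fix u assume u: "u : Z"
   show "\<sigma> (k u) : C & u <= \<sigma> (k u)" "\<tau>' (t u) : K & u <= \<tau>' (t u)" using mem[OF u] by auto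
   interpret g: comm_group "G u" by (rule ab_group[OF oZ[OF u]])
   show "b'' u : carrier (G u)" unfolding b''_def using bcl[OF u] by simp
   fix v assume v: "v : Z"
   let ?Y = "u Int v"
   interpret gv: comm_group "G v" by (rule ab_group[OF oZ[OF v]])
   have oY: "op ?Y" using oZ[OF u] oZ[OF v] by simp
   interpret gY: comm_group "G ?Y" by (rule ab_group[OF oY])
   have Y: "?Y <= u" "?Y <= v" by auto
   have YY: "?Y <= k u Int k v" "?Y <= t u Int t v" "op (k u Int k v)" "op (t u Int t v)"
    using sub[OF u] sub[OF v] oa[OF u] oa[OF v] by auto
   have sY: "?Y <= \<sigma> (k u)" "?Y <= \<sigma> (k v)" "?Y <= \<tau> (k u)" "?Y <= \<tau> (k v)"
    "?Y <= \<sigma>' (t u)" "?Y <= \<sigma>' (t v)" "?Y <= \<tau>' (t u)" "?Y <= \<tau>' (t v)"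
    using mem[OF u] mem[OF v] by auto
   let ?C = "r (\<sigma> (k u) Int \<sigma> (k v)) ?Y (c (\<sigma> (k u)) (\<sigma> (k v)))"
   let ?D1 = "r (\<tau> (k u) Int \<tau> (k v)) ?Y (d (\<tau> (k u)) (\<tau> (k v)))"
   let ?D2 = "r (\<sigma>' (t u) Int \<sigma>' (t v)) ?Y (d (\<sigma>' (t u)) (\<sigma>' (t v)))"
   let ?H = "r (\<tau>' (t u) Int \<tau>' (t v)) ?Y (h (\<tau>' (t u)) (\<tau>' (t v)))"
   let ?B = "r (k u) ?Y (b (k u))" and ?B' = "r (k v) ?Y (b (k v))"
   let ?F = "r (t u) ?Y (b' (t u))" and ?F' = "r (t v) ?Y (b' (t v))"
   let ?E = "r (\<tau> (k u) Int \<sigma>' (t u)) ?Y (d (\<tau> (k u)) (\<sigma>' (t u)))"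
   let ?E' = "r (\<tau> (k v) Int \<sigma>' (t v)) ?Y (d (\<tau> (k v)) (\<sigma>' (t v)))"
   let ?M = "r (\<tau> (k u) Int \<sigma>' (t v)) ?Y (d (\<tau> (k u)) (\<sigma>' (t v)))"
   have coc_cl: "r (P Int Q) ?Y (e P Q) : carrier (G ?Y)"
    if "cocycle X G r (S, e)" "P : S" "Q : S" "?Y <= P" "?Y <= Q" for S e P Q
    by (rule ab_res[OF _ oY _ cocycleD(2)[OF that(1-3)]])
     (use cocycle_op[OF that(1,2)] cocycle_op[OF that(1,3)] that in auto)
   have cl: "?C : carrier (G ?Y)" "?D1 : carrier (G ?Y)" "?D2 : carrier (G ?Y)" "?H : carrier (G ?Y)"
    "?E : carrier (G ?Y)" "?E' : carrier (G ?Y)" "?M : carrier (G ?Y)"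
    using coc_cl[OF z] coc_cl[OF z'] coc_cl[OF z''] mem[OF u] mem[OF v] sY by auto
   have bY: "r (k u) ?Y (b (k u)) : carrier (G ?Y)" "r (k v) ?Y (b (k v)) : carrier (G ?Y)"
    "r (t u) ?Y (b' (t u)) : carrier (G ?Y)" "r (t v) ?Y (b' (t v)) : carrier (G ?Y)"
    by (rule ab_res[OF _ oY]; use oa u v sub mem(9,10) in blast)+
   have comp: "r p ?Y x = r (p Int q) ?Y (r p (p Int q) x)" "r q ?Y y = r (p Int q) ?Y (r q (p Int q) y)"
    if "op p" "op q" "?Y <= p Int q" "x : carrier (G p)" "y : carrier (G q)" for p q x y
    using ab_res_res[OF that(1) _ oY that(3) _ that(4), symmetric] ab_res_res[OF that(2) _ oY that(3) _ that(5), symmetric]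
     that(1,2) by auto
   have r1: "?C *{(G ?Y)} ?B' = ?B *{(G ?Y)} ?D1"
   proof -
    let ?A = "k u Int k v"
    let ?c = "c (\<sigma> (k u)) (\<sigma> (k v))" and ?d = "d (\<tau> (k u)) (\<tau> (k v))"
    have cs: "op (\<sigma> (k u) Int \<sigma> (k v))" "?A <= \<sigma> (k u) Int \<sigma> (k v)" "?c : carrier (G (\<sigma> (k u) Int \<sigma> (k v)))"
     using cocycle_op[OF z mem(1)[OF u]] cocycle_op[OF z mem(1)[OF v]] aa[OF u] aa[OF v]
      cocycleD(2)[OF z mem(1)[OF u] mem(1)[OF v]] by auto
    have ds: "op (\<tau> (k u) Int \<tau> (k v))" "?A <= \<tau> (k u) Int \<tau> (k v)" "?d : carrier (G (\<tau> (k u) Int \<tau> (k v)))"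
     using cocycle_op[OF z' mem(2)[OF u]] cocycle_op[OF z' mem(2)[OF v]] aa[OF u] aa[OF v]
      cocycleD(2)[OF z' mem(2)[OF u] mem(2)[OF v]] by auto
    have bs: "r (k v) ?A (b (k v)) : carrier (G ?A)" "r (k u) ?A (b (k u)) : carrier (G ?A)"
     by (rule ab_res[OF oa(1)[OF v] YY(3) _ mem(9)[OF v]], simp, rule ab_res[OF oa(1)[OF u] YY(3) _ mem(9)[OF u]], simp)
    note e = eq[rule_format, OF ab(1)[OF u] ab(1)[OF v]]
    have "r ?A ?Y (r (\<sigma> (k u) Int \<sigma> (k v)) ?A ?c) *{(G ?Y)} r ?A ?Y (r (k v) ?A (b (k v))) =
      r ?A ?Y (r (k u) ?A (b (k u))) *{(G ?Y)} r ?A ?Y (r (\<tau> (k u) Int \<tau> (k v)) ?A ?d)"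
     using arg_cong[OF e, of "r ?A ?Y"] ab_res_mult[OF YY(3) oY YY(1) ab_res[OF cs(1) YY(3) cs(2,3)] bs(1)]
      ab_res_mult[OF YY(3) oY YY(1) bs(2) ab_res[OF ds(1) YY(3) ds(2,3)]] by simp
    then show ?thesis
     using ab_res_res[OF cs(1) YY(3) oY YY(1) cs(2,3)] ab_res_res[OF ds(1) YY(3) oY YY(1) ds(2,3)]
      comp[OF oa(1)[OF u] oa(1)[OF v] YY(1) mem(9)[OF u] mem(9)[OF v]] by simp
   qed
   have r2: "?D2 *{(G ?Y)} ?F' = ?F *{(G ?Y)} ?H"
   proof -
    let ?A = "t u Int t v"
    let ?c = "d (\<sigma>' (t u)) (\<sigma>' (t v))" and ?d = "h (\<tau>' (t u)) (\<tau>' (t v))"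
    have cs: "op (\<sigma>' (t u) Int \<sigma>' (t v))" "?A <= \<sigma>' (t u) Int \<sigma>' (t v)" "?c : carrier (G (\<sigma>' (t u) Int \<sigma>' (t v)))"
     using cocycle_op[OF z' mem(3)[OF u]] cocycle_op[OF z' mem(3)[OF v]] aa'[OF u] aa'[OF v]
      cocycleD(2)[OF z' mem(3)[OF u] mem(3)[OF v]] by auto
    have ds: "op (\<tau>' (t u) Int \<tau>' (t v))" "?A <= \<tau>' (t u) Int \<tau>' (t v)" "?d : carrier (G (\<tau>' (t u) Int \<tau>' (t v)))"
     using cocycle_op[OF z'' mem(4)[OF u]] cocycle_op[OF z'' mem(4)[OF v]] aa'[OF u] aa'[OF v]
      cocycleD(2)[OF z'' mem(4)[OF u] mem(4)[OF v]] by auto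
    have bs: "r (t v) ?A (b' (t v)) : carrier (G ?A)" "r (t u) ?A (b' (t u)) : carrier (G ?A)"
     by (rule ab_res[OF oa(2)[OF v] YY(4) _ mem(10)[OF v]], simp, rule ab_res[OF oa(2)[OF u] YY(4) _ mem(10)[OF u]], simp)
    note e = eq'[rule_format, OF ab(2)[OF u] ab(2)[OF v]]
    have "r ?A ?Y (r (\<sigma>' (t u) Int \<sigma>' (t v)) ?A ?c) *{(G ?Y)} r ?A ?Y (r (t v) ?A (b' (t v))) =
      r ?A ?Y (r (t u) ?A (b' (t u))) *{(G ?Y)} r ?A ?Y (r (\<tau>' (t u) Int \<tau>' (t v)) ?A ?d)"
     using arg_cong[OF e, of "r ?A ?Y"] ab_res_mult[OF YY(4) oY YY(2) ab_res[OF cs(1) YY(4) cs(2,3)] bs(1)]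
      ab_res_mult[OF YY(4) oY YY(2) bs(2) ab_res[OF ds(1) YY(4) ds(2,3)]] by simp
    then show ?thesis
     using ab_res_res[OF cs(1) YY(4) oY YY(2) cs(2,3)] ab_res_res[OF ds(1) YY(4) oY YY(2) ds(2,3)]
      comp[OF oa(2)[OF u] oa(2)[OF v] YY(2) mem(10)[OF u] mem(10)[OF v]] by simp
   qed
   \<comment> \<open>Here and in \<open>r4\<close> the value \<open>?M\<close> is the middle cocycle
     between the \<open>\<tau>\<close>-member belonging to \<open>u\<close> and the
     \<open>\<sigma>'\<close>-member belonging to \<open>v\<close>. This common value links the two
     given coboundary relations \<open>r1\<close> and \<open>r2\<close>.\<close>
   have r3: "?D1 *{(G ?Y)} ?E' = ?M"
    by (rule cocycle_restrict[OF z' mem(2)[OF u] mem(2)[OF v] mem(3)[OF v] oY sY(3,4,6)])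
   have r4: "?E *{(G ?Y)} ?D2 = ?M"
    by (rule cocycle_restrict[OF z' mem(2)[OF u] mem(3)[OF u] mem(3)[OF v] oY sY(3,5,6)])
   have bb: "r w ?Y (b'' w) = r (k w) ?Y (b (k w)) *{(G ?Y)}
     (r (\<tau> (k w) Int \<sigma>' (t w)) ?Y (d (\<tau> (k w)) (\<sigma>' (t w))) *{(G ?Y)} r (t w) ?Y (b' (t w)))"
    if w: "w : Z" and Yw: "?Y <= w" for w
   proof -
    interpret gw: comm_group "G w" by (rule ab_group[OF oZ[OF w]])
    have s: "w <= \<tau> (k w) Int \<sigma>' (t w)" using mem(6,7)[OF w] by blast
    show ?thesis unfolding b''_def
     using ab_res_mult[OF oZ[OF w] oY Yw] bcl[OF w]
      ab_res_res[OF oa(1)[OF w] oZ[OF w] oY Yw sub(1)[OF w] mem(9)[OF w]]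
      ab_res_res[OF oa(2)[OF w] oZ[OF w] oY Yw sub(2)[OF w] mem(10)[OF w]]
      ab_res_res[OF odd(1)[OF w w] oZ[OF w] oY Yw s odd(2)[OF w w]] by simp
   qed
   have "?C *{(G ?Y)} (?B' *{(G ?Y)} (?E' *{(G ?Y)} ?F')) = (?C *{(G ?Y)} ?B') *{(G ?Y)} (?E' *{(G ?Y)} ?F')"
    using cl bY by (simp add: gY.m_assoc)
   also have "\<dots> = ?B *{(G ?Y)} ((?D1 *{(G ?Y)} ?E') *{(G ?Y)} ?F')"
    unfolding r1 using cl bY by (simp add: gY.m_assoc)
   also have "\<dots> = ?B *{(G ?Y)} (?E *{(G ?Y)} (?D2 *{(G ?Y)} ?F'))"
    unfolding r3 r4[symmetric] using cl bY by (simp add: gY.m_assoc)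
   also have "\<dots> = (?B *{(G ?Y)} (?E *{(G ?Y)} ?F)) *{(G ?Y)} ?H"
    unfolding r2 using cl bY by (simp add: gY.m_assoc)
   finally show "?C *{(G ?Y)} r v ?Y (b'' v) = r u ?Y (b'' u) *{(G ?Y)} ?H"
    unfolding bb[OF u Y(1)] bb[OF v Y(2)] .
  qed
 qed
qed

lemma H1_class_eqI:
 assumes z: "cocycle X G r z" and z': "cocycle X G r z'" and c: "cohomologous X G r z z'"
 shows "H1_class X G r z = H1_class X G r z'"
proof -
 obtain C c' where zc: "z = (C, c')" by (cases z)
 obtain D d where zd: "z' = (D, d)" by (cases z')
 note zz = z[unfolded zc] z'[unfolded zd] c[unfolded zc zd]
 have sym: "cohomologous X G r (D, d) (C, c')" by (rule cohomologous_sym[OF zz])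
 show ?thesis unfolding H1_class_def zc zd
 proof (intro Collect_cong conj_cong refl)
  fix y assume y: "cocycle X G r y"
  obtain K h where yk: "y = (K, h)" by (cases y)
  show "cohomologous X G r (C, c') y \<longleftrightarrow> cohomologous X G r (D, d) y"
   using cohomologous_trans[OF zz(2,1) y[unfolded yk] sym] cohomologous_trans[OF zz(1,2) y[unfolded yk] zz(3)]
   unfolding yk by blast
 qed
qed

lemma H1_class_self: "cocycle X G r z ==> z : H1_class X G r z"
 using cohomologous_refl by (cases z) (simp add: H1_class_def)

lemma H1_class_H1: "cocycle X G r z ==> H1_class X G r z : H1 X G r"
 unfolding H1_def by blast

end

lemma madd_ab_presheaf:
 assumes M: "pmod M"
 shows "ab_presheaf X (madd M) (res M)"
 unfolding ab_presheaf_def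
proof (intro conjI allI impI ballI)
 fix U assume "op U"
 then interpret N: module "osec X U" "sec M U" by (rule pm_module[OF M])
 show "comm_group (madd M U)"
  by (rule comm_groupI) (auto simp: N.a_ac intro: N.add.l_inv_ex)
next
qed (use M in \<open>auto simp: hom_def\<close>)

lemma units_ab_presheaf: "ab_presheaf X (units X) (rs)"
 unfolding ab_presheaf_def
proof (intro conjI allI impI ballI)
 show "comm_group (units X U)" if "op U" for U
  using comm_monoid.units_comm_group[of "osec X U"] O_cring[OF that] by (simp add: cring_def)
 fix U V assume U: "op U & op V & V <= U"
 have u: "rs U V a : Units (osec X V)" if a: "a : Units (osec X U)" for a
 proof -
  obtain b where b: "a :<U>" "b :<U>"
   "b *<U> a = 1<U>" "a *<U> b = 1<U>"
   using a unfolding Units_def by blast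
  have "rs U V b *<V> rs U V a = 1<V>" "rs U V a *<V> rs U V b = 1<V>"
   using U b by (simp_all flip: O_res_mult)
  then show ?thesis using U b unfolding Units_def by auto
 qed
 show "rs U V : hom (units X U) (units X V)"
  unfolding hom_def using u U by (auto simp: units_of_def Units_def)
next
 fix U V W a assume "op U & op V & op W & W <= V & V <= U" "a : carrier (units X U)"
 then show "rs V W (rs U V a) = rs U W a" by (auto simp: units_of_def Units_def)
qed

text \<open>Applying \<open>f\<close> to a cochain that relates two cocycles relates their images,
  so the union in \<open>H1_map\<close> ranges over equal classes and may be computed at one
  representative.\<close>

lemma H1_map_class:
 assumes G: "ab_presheaf X G r" and M: "pmod M"
  and f: "!!U a. op U ==> a : carrier (G U) ==> f U a :<M U>"
  and f_mult: "!!U a b. op U ==> a : carrier (G U) ==> b : carrier (G U) ==> f U (a *{(G U)} b) = f U a +<M U> f U b"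
  and f_res: "!!U V a. op U ==> op V ==> V <= U ==> a : carrier (G U) ==> f V (r U V a) = res M U V (f U a)"
  and z: "cocycle X G r (C, c)"
 shows "cocycle X (madd M) (res M) (C, %U V. f (U Int V) (c U V))"
  "H1_map X M f (H1_class X G r (C, c)) = H1_mod_class X M (C, %U V. f (U Int V) (c U V))"
proof -
 note Mp = madd_ab_presheaf[OF M]
 have coc: "cocycle X (madd M) (res M) (D, %U V. f (U Int V) (d U V))" if z: "cocycle X G r (D, d)" for D d
  unfolding cocycle_def prod.case
 proof (intro conjI ballI)
  show "covering X D" by (rule cocycleD(1)[OF G z])
  fix U V assume U: "U : D" "V : D"
  note o = cocycle_op[OF G z U(1)] cocycle_op[OF G z U(2)]
  show "f (U Int V) (d U V) : carrier (madd M (U Int V))"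
   using f[of "U Int V" "d U V"] o cocycleD(2)[OF G z U] by simp
  fix W assume W: "W : D"
  note oW = cocycle_op[OF G z W]
  let ?Y = "U Int V Int W"
  have oY: "op ?Y" "op (U Int V)" "op (V Int W)" "op (U Int W)" and s: "?Y <= U Int V" "?Y <= V Int W" "?Y <= U Int W"
   using o oW by auto
  note m = cocycleD(2)[OF G z U] cocycleD(2)[OF G z U(2) W] cocycleD(2)[OF G z U(1) W]
  show "res M (U Int V) ?Y (f (U Int V) (d U V)) *{(madd M ?Y)} res M (V Int W) ?Y (f (V Int W) (d V W)) =
    res M (U Int W) ?Y (f (U Int W) (d U W))"
   using f_res[OF oY(2,1) s(1) m(1)] f_res[OF oY(3,1) s(2) m(2)] f_res[OF oY(4,1) s(3) m(3)]
    f_mult[OF oY(1) ab_res[OF G oY(2,1) s(1) m(1)] ab_res[OF G oY(3,1) s(2) m(2)]]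
    cocycleD(3)[OF G z U W] by simp
 qed
 have coh: "cohomologous X (madd M) (res M) (C, %U V. f (U Int V) (c U V)) (D, %U V. f (U Int V) (d U V))"
  if z': "cocycle X G r (D, d)" and cd: "cohomologous X G r (C, c) (D, d)" for D d
  using cd
 proof (rule cohomologousE[OF G])
  fix W \<sigma> \<tau> b
  assume W: "covering X W"
   and a: "ALL w:W. \<sigma> w : C & w <= \<sigma> w & \<tau> w : D & w <= \<tau> w & b w : carrier (G w)"
   and eq: "ALL w:W. ALL w':W.
    r (\<sigma> w Int \<sigma> w') (w Int w') (c (\<sigma> w) (\<sigma> w')) *{(G (w Int w'))} r w' (w Int w') (b w') =
    r w (w Int w') (b w) *{(G (w Int w'))} r (\<tau> w Int \<tau> w') (w Int w') (d (\<tau> w) (\<tau> w'))"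
  show ?thesis
  proof (rule cohomologousI[OF Mp, of W \<sigma> _ \<tau> _ "%w. f w (b w)", OF W])
   fix w assume w: "w : W"
   show "\<sigma> w : C & w <= \<sigma> w" "\<tau> w : D & w <= \<tau> w" using a w by auto
   note ow = coveringD(1)[OF W w]
   show "f w (b w) : carrier (madd M w)" using a w f[OF ow] by simp
   fix w' assume w': "w' : W"
   note ow' = coveringD(1)[OF W w']
   let ?Y = "w Int w'"
   have o: "op ?Y" "?Y <= w" "?Y <= w'" using ow ow' by auto
   have s: "\<sigma> w : C" "\<sigma> w' : C" "\<tau> w : D" "\<tau> w' : D" "?Y <= \<sigma> w Int \<sigma> w'" "?Y <= \<tau> w Int \<tau> w'"
    "b w : carrier (G w)" "b w' : carrier (G w')"
    using a w w' by auto
   have oo: "op (\<sigma> w Int \<sigma> w')" "op (\<tau> w Int \<tau> w')"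
    using cocycle_op[OF G z s(1)] cocycle_op[OF G z s(2)] cocycle_op[OF G z' s(3)] cocycle_op[OF G z' s(4)] by auto
   note m = cocycleD(2)[OF G z s(1,2)] cocycleD(2)[OF G z' s(3,4)]
   note cl = ab_res[OF G oo(1) o(1) s(5) m(1)] ab_res[OF G oo(2) o(1) s(6) m(2)]
     ab_res[OF G ow o(1,2) s(7)] ab_res[OF G ow' o(1,3) s(8)]
   show "res M (\<sigma> w Int \<sigma> w') ?Y (f (\<sigma> w Int \<sigma> w') (c (\<sigma> w) (\<sigma> w'))) *{(madd M ?Y)} res M w' ?Y (f w' (b w')) =
     res M w ?Y (f w (b w)) *{(madd M ?Y)} res M (\<tau> w Int \<tau> w') ?Y (f (\<tau> w Int \<tau> w') (d (\<tau> w) (\<tau> w')))"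
    using f_res[OF oo(1) o(1) s(5) m(1)] f_res[OF oo(2) o(1) s(6) m(2)]
     f_res[OF ow o(1,2) s(7)] f_res[OF ow' o(1,3) s(8)]
     f_mult[OF o(1) cl(1) cl(4)] f_mult[OF o(1) cl(3) cl(2)] eq[rule_format, OF w w'] by simp
  qed
 qed
 show coc0: "cocycle X (madd M) (res M) (C, %U V. f (U Int V) (c U V))" by (rule coc[OF z])
 show "H1_map X M f (H1_class X G r (C, c)) = H1_mod_class X M (C, %U V. f (U Int V) (c U V))"
  unfolding H1_map_def
 proof (rule UN_eq_const)
  show "H1_class X G r (C, c) ~= {}" using H1_class_self[OF G z] by blast
  fix y assume y: "y : H1_class X G r (C, c)"
  obtain D d where yd: "y = (D, d)" by (cases y)
  have y': "cocycle X G r (D, d)" "cohomologous X G r (C, c) (D, d)" using y unfolding H1_class_def yd by auto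
  show "(case y of (D, d) => H1_mod_class X M (D, %U V. f (U Int V) (d U V))) =
    H1_mod_class X M (C, %U V. f (U Int V) (c U V))"
   unfolding yd prod.case by (rule H1_class_eqI[OF Mp coc0 coc[OF y'(1)] coh[OF y'], symmetric])
 qed
qed

end

section \<open>Isomorphisms and extensions\<close>

context rsp
begin

lemma pm_telescope:
 assumes M: "pmod M" "op U" and m: "a :<M U>" "b :<M U>" "c :<M U>"
 shows "(b -<M U> a) +<M U> (c -<M U> b) = c -<M U> a"
proof -
 interpret M: module "osec X U" "sec M U" by (rule pm_module[OF M])
 have "(b +<M U> \<ominus>\<^bsub>sec M U\<^esub> a) +<M U> (c +<M U> \<ominus>\<^bsub>sec M U\<^esub> b) =
   (c +<M U> \<ominus>\<^bsub>sec M U\<^esub> a) +<M U> (b +<M U> \<ominus>\<^bsub>sec M U\<^esub> b)"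
  using m by (simp add: M.a_ac)
 then show ?thesis using m by (simp add: M.minus_eq M.r_neg)
qed

lemma mor_isoD:
 assumes "mor_iso X M N k"
 shows "k : mor X M N" "op V ==> bij_betw (k V) (mcar M V) (mcar N V)"
 using assms by (simp_all add: iso_over_def)

lemma mor_inv_apply: "op V ==> n :<N V> ==> mor_inv X M N k V n = inv_into (mcar M V) (k V) n"
 by (simp add: mor_inv_def)

lemma iso_closed: "mor_iso X M N k ==> op V ==> m :<M V> ==> k V m :<N V>"
 using homs_closed[OF mor_isoD(1)] by simp

lemma mor_inv_left: "mor_iso X M N k ==> op V ==> m :<M V> ==> mor_inv X M N k V (k V m) = m"
 using mor_isoD(2)[of M N k V] by (simp add: mor_inv_apply iso_closed bij_betw_inv_into_left)

lemma mor_inv_right: "mor_iso X M N k ==> op V ==> n :<N V> ==> k V (mor_inv X M N k V n) = n"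
 using mor_isoD(2)[of M N k V] by (simp add: mor_inv_apply bij_betw_inv_into_right)

lemma mor_inv_closed: "mor_iso X M N k ==> op V ==> n :<N V> ==> mor_inv X M N k V n :<M V>"
 using mor_isoD(2)[of M N k V] by (simp add: mor_inv_apply bij_betw_def inv_into_into)

lemma iso_inj: "mor_iso X M N k ==> op V ==> m :<M V> ==> n :<M V> ==> k V m = k V n ==> m = n"
 by (metis mor_inv_left)

lemma iso_if_inverse:
 assumes "k : mor X M N" "p : mor X N M"
  "!!V m. op V ==> m :<M V> ==> p V (k V m) = m"
  "!!V n. op V ==> n :<N V> ==> k V (p V n) = n"
 shows "mor_iso X M N k"
 unfolding iso_over_def
proof (intro conjI ballI)
 fix V assume "V : ops (pts X)"
 then have V: "op V" "V <= pts X" by auto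
 show "bij_betw (k V) (mcar M V) (mcar N V)"
  by (rule bij_betw_byWitness[of _ "p V"])
   (use assms(3,4)[OF V(1)] homs_closed[OF assms(1) V] homs_closed[OF assms(2) V] in auto)
qed (rule assms(1))

lemma mor_inv_mor:
 assumes M: "pmod M" and N: "pmod N" and p: "mor_iso X M N p"
 shows "mor_inv X M N p : mor X N M"
proof -
 let ?k = "mor_inv X M N p"
 note cl = mor_inv_closed[OF p] and R = mor_inv_right[OF p] and hom = mor_isoD(1)[OF p]
 have "fam' N (pts X) ?k : mor X N M"
 proof (rule homsI[OF N])
  fix V n assume V: "op V" "V <= pts X" and n: "n :<N V>"
  show "?k V n :<M V>" by (rule cl[OF V(1) n])
  show "?k V (n +<N V> n') = ?k V n +<M V> ?k V n'" if n': "n' :<N V>" for n'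
   by (rule iso_inj[OF p V(1)])
    (use V n n' M N in \<open>simp_all add: cl R homs_add[OF hom V]\<close>)
  show "?k V (a *<N V> n) = a *<M V> ?k V n" if a: "a :<V>" for a
   by (rule iso_inj[OF p V(1)])
    (use V n a M N in \<open>simp_all add: cl R homs_smult[OF hom V]\<close>)
  show "?k W (res N V W n) = res M V W (?k V n)" if W: "op W" "W <= V" for W
   by (rule iso_inj[OF p W(1)])
    (use V n W M N in \<open>simp_all add: cl R homs_res[OF hom V W]\<close>)
 qed
 moreover have "fam' N (pts X) ?k = ?k" unfolding mor_inv_def by (intro restrict_ext) simp
 ultimately show ?thesis by simp
qed

lemma mor_inv_iso:
 assumes "pmod M" "pmod N" "mor_iso X M N k"
 shows "mor_iso X N M (mor_inv X M N k)"
 by (rule iso_if_inverse[OF mor_inv_mor[OF assms] mor_isoD(1)[OF assms(3)]])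
  (simp_all add: mor_inv_left[OF assms(3)] mor_inv_right[OF assms(3)])

text \<open>Local inverses give injectivity on the sections over every open set; injectivity forces
  the local preimages of a section to agree on overlaps, and so they glue to a global
  preimage.\<close>

lemma local_iso:
 assumes M: "omod M" and N: "omod N" and f: "f : mor X M N"
  and loc: "!!x. x : pts X ==> \<exists>U g. op U & x : U & g : Hom N M U &
   (\<forall>V m. op V & V <= U & m :<M V> --> g V (f V m) = m) &
   (\<forall>V n. op V & V <= U & n :<N V> --> f V (g V n) = n)"
 shows "mor_iso X M N f"
 unfolding iso_over_def
proof (intro conjI ballI f)
 have M': "pmod M" and N': "pmod N" using M N by auto
 fix V assume "V : ops (pts X)"
 then have V: "op V" "V <= pts X" by auto
 have inj: "m = m'" if W: "op W" and m: "m :<M W>" "m' :<M W>" "f W m = f W m'" for W m m'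
 proof (rule sheaf_eqI[OF M W m(1,2)])
  fix x assume x: "x : W"
  obtain U g where U: "op U" "x : U"
   "\<forall>V m. op V & V <= U & m :<M V> --> g V (f V m) = m"
   using loc[OF op_inD[OF W x]] by blast
  let ?Y = "W Int U"
  have Y: "op ?Y" "?Y <= W" "?Y <= U" using W U by auto
  have "f ?Y (res M W ?Y m) = f ?Y (res M W ?Y m')"
   using homs_res[OF f W op_pts[OF W] Y(1,2)] m by simp
  moreover have "g ?Y (f ?Y (res M W ?Y k)) = res M W ?Y k" if "k :<M W>" for k
   using U(3) Y W M' that by simp
  ultimately have "res M W ?Y m = res M W ?Y m'" using m(1,2) by metis
  then show "\<exists>V. op V & x : V & V <= W & res M W V m = res M W V m'"
   using Y x U(2) by (intro exI[of _ ?Y]) auto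
 qed
 have surj: "EX m:mcar M V. f V m = n" if n: "n :<N V>" for n
 proof -
  define P where "P x U g \<longleftrightarrow> op U & x : U & g : Hom N M U &
   (\<forall>V n. op V & V <= U & n :<N V> --> f V (g V n) = n)" for x U g
  have "\<exists>q. P x (fst q) (snd q)" if "x : V" for x
  proof -
   from loc[OF op_inD[OF V(1) that]] obtain U g where "P x U g" unfolding P_def by blast
   then show ?thesis by (intro exI[of _ "(U, g)"]) simp
  qed
  then have "\<exists>q. ALL x:V. P x (fst (q x)) (snd (q x))" by metis
  then obtain q where q: "!!x. x : V ==> P x (fst (q x)) (snd (q x))" by blast
  define W where "W x = V Int fst (q x)" for x
  define s where "s x = snd (q x) (W x) (res N V (W x) n)" for x
  have W: "op (W x)" "x : W x" "W x <= V" "W x <= fst (q x)" if "x : V" for x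
   using q[OF that] that V by (auto simp: P_def W_def)
  have s: "s x :<M (W x)>" "f (W x) (s x) = res N V (W x) n" if x: "x : V" for x
  proof -
   have g: "snd (q x) : Hom N M (fst (q x))" using q[OF x] by (simp add: P_def)
   have rn: "res N V (W x) n :<N (W x)>" using W[OF x] V n N' by simp
   show "s x :<M (W x)>" unfolding s_def by (rule homs_closed[OF g W(1,4)[OF x] rn])
   show "f (W x) (s x) = res N V (W x) n"
    unfolding s_def using q[OF x] W[OF x] rn by (simp add: P_def)
  qed
  have UV: "(\<Union>x\<in>V. W x) = V" using W by blast
  obtain m where m: "m :<M (\<Union>x\<in>V. W x)>" "!!x. x : V ==> res M (\<Union>x\<in>V. W x) (W x) m = s x"
  proof (rule sheaf_glue[OF M, of V W s])
   show "op (W x)" "s x :<M (W x)>" if "x : V" for x using W s that by auto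
   fix x y assume x: "x : V" and y: "y : V"
   let ?Y = "W x Int W y"
   have Y: "op ?Y" "?Y <= W x" "?Y <= W y" using W x y by auto
   show "res M (W x) ?Y (s x) = res M (W y) ?Y (s y)"
   proof (rule inj[OF Y(1)])
    show "res M (W x) ?Y (s x) :<M ?Y>" "res M (W y) ?Y (s y) :<M ?Y>"
     using Y W(1)[OF x] W(1)[OF y] s(1)[OF x] s(1)[OF y] M' by auto
    have "f ?Y (res M (W x) ?Y (s x)) = res N V ?Y n" if "x : V" "?Y <= W x" for x
     using homs_res[OF f W(1)[OF that(1)] op_pts[OF W(1)[OF that(1)]] Y(1) that(2) s(1)[OF that(1)]]
      s(2)[OF that(1)] W(1,3)[OF that(1)] Y(1) that(2) V(1) n N' by simp
    from this[OF x Y(2)] this[OF y Y(3)]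
    show "f ?Y (res M (W x) ?Y (s x)) = f ?Y (res M (W y) ?Y (s y))" by simp
   qed
  qed (rule that; (assumption | simp))
  have mV: "m :<M V>" using m(1) UV by simp
  have "f V m = n"
  proof (rule sheaf_eqI[OF N V(1) homs_closed[OF f V mV] n])
   fix x assume x: "x : V"
   have "res N V (W x) (f V m) = f (W x) (s x)"
    using homs_res[OF f V W(1,3)[OF x] mV] m(2)[OF x] UV by simp
   then show "\<exists>W. op W & x : W & W <= V & res N V W (f V m) = res N V W n"
    using W[OF x] s(2)[OF x] by auto
  qed
  then show ?thesis using mV by blast
 qed
 show "bij_betw (f V) (mcar M V) (mcar N V)"
  unfolding bij_betw_def
 proof
  show "inj_on (f V) (mcar M V)" by (rule inj_onI) (rule inj[OF V(1)])
  show "f V ` mcar M V = mcar N V" using surj homs_closed[OF f V] by blast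
 qed
qed

subsection \<open>Locally split extensions\<close>

text \<open>A biproduct decomposition over \<open>U\<close>: a section \<open>s\<close>, a
  retraction \<open>r\<close> and the identity \<open>i r + s p = id\<close>. These are equations
  between morphisms and therefore survive tensoring, which exactness in general does not.\<close>

definition split_over :: "('x, 'r, 'b) omod => ('x, 'r, 'a) omod => ('x, 'r, 'e) omod => ('x, 'a, 'e) fam => ('x, 'e, 'b) fam =>
  'x set => ('x, 'b, 'e) fam => ('x, 'e, 'a) fam => bool"
 where "split_over B A E i p U s r \<longleftrightarrow> s : Hom B E U & r : Hom E A U &
  (\<forall>V. op V & V <= U --> (ALL a:mcar A V. r V (i V a) = a) & (ALL b:mcar B V. p V (s V b) = b) &
   (ALL e:mcar E V. i V (r V e) +<E V> s V (p V e) = e))"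

lemma split_overD:
 assumes "split_over B A E i p U s r"
 shows "s : Hom B E U" "r : Hom E A U"
  "op V ==> V <= U ==> a :<A V> ==> r V (i V a) = a"
  "op V ==> V <= U ==> b :<B V> ==> p V (s V b) = b"
  "op V ==> V <= U ==> e :<E V> ==> i V (r V e) +<E V> s V (p V e) = e"
 using assms by (simp_all add: split_over_def)

text \<open>Exactness is local, and locally the splitting yields it: \<open>r\<close> gives
  injectivity of \<open>i\<close>, \<open>s\<close> gives lifts, and \<open>i r + s p = id\<close>
  shows that an element killed by \<open>p\<close> is \<open>i\<close> of its retraction. The local
  preimages so obtained glue because \<open>i\<close> is injective.\<close>

lemma extensionI_split:
 assumes A: "omod A" and B: "omod B" and E: "omod E"
  and i: "i : mor X A E" and p: "p : mor X E B"
  and pi: "!!V a. op V ==> a :<A V> ==> p V (i V a) = 0<B V>"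
  and split: "!!x. x : pts X ==> \<exists>U s r. op U & x : U & split_over B A E i p U s r"
 shows "extension X B A (E, i, p)"
 unfolding extension_def prod.case
proof (intro conjI ballI E i p)
 have A': "pmod A" and B': "pmod B" and E': "pmod E" using A B E by auto
 have inj: "a = a'" if W: "op W" and a: "a :<A W>" "a' :<A W>" "i W a = i W a'" for W a a'
 proof (rule sheaf_eqI[OF A W a(1,2)])
  fix x assume x: "x : W"
  obtain U s r where U: "op U" "x : U" "split_over B A E i p U s r"
   using split[OF op_inD[OF W x]] by blast
  let ?Y = "W Int U"
  have Y: "op ?Y" "?Y <= W" "?Y <= U" using W U by auto
  have "i ?Y (res A W ?Y a) = i ?Y (res A W ?Y a')"
   using homs_res[OF i W op_pts[OF W] Y(1,2)] a by simp
  moreover have "r ?Y (i ?Y (res A W ?Y k)) = res A W ?Y k" if "k :<A W>" for k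
   by (rule split_overD(3)[OF U(3) Y(1,3)]) (use that Y W A' in simp)
  ultimately have "res A W ?Y a = res A W ?Y a'" using a(1,2) by metis
  then show "\<exists>V. op V & x : V & V <= W & res A W V a = res A W V a'"
   using Y x U(2) by (intro exI[of _ ?Y]) auto
 qed
 fix V assume "V : ops (pts X)"
 then have V: "op V" "V <= pts X" by auto
 show "inj_on (i V) (mcar A V)" by (rule inj_onI) (rule inj[OF V(1)])
 show "i V ` mcar A V = {e : mcar E V. p V e = 0<B V>}"
 proof
  show "i V ` mcar A V <= {e : mcar E V. p V e = 0<B V>}"
   using pi[OF V(1)] homs_closed[OF i V] by auto
  show "{e : mcar E V. p V e = 0<B V>} <= i V ` mcar A V"
  proof
   fix e assume "e : {e : mcar E V. p V e = 0<B V>}"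
   then have e: "e :<E V>" "p V e = 0<B V>" by auto
   have "\<exists>q. op (fst q) & x : fst q & fst q <= V & snd q :<A (fst q)> & i (fst q) (snd q) = res E V (fst q) e"
    if x: "x : V" for x
   proof -
    obtain U s r where U: "op U" "x : U" "split_over B A E i p U s r"
     using split[OF op_inD[OF V(1) x]] by blast
    let ?Y = "V Int U"
    have Y: "op ?Y" "?Y <= V" "?Y <= U" using V U by auto
    have re: "res E V ?Y e :<E ?Y>" using e V Y E' by simp
    have "p ?Y (res E V ?Y e) = 0<B ?Y>" using homs_res[OF p V Y(1,2) e(1)] e(2) V Y B' by simp
    then have "i ?Y (r ?Y (res E V ?Y e)) = res E V ?Y e"
     using split_overD(5)[OF U(3) Y(1,3) re] homs_zero[OF split_overD(1)[OF U(3)] Y(1,3) B' E']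
      homs_closed[OF i Y(1) op_pts[OF Y(1)] homs_closed[OF split_overD(2)[OF U(3)] Y(1,3) re]] E' Y by simp
    then show ?thesis
     using Y x U(2) homs_closed[OF split_overD(2)[OF U(3)] Y(1,3) re]
     by (intro exI[of _ "(?Y, r ?Y (res E V ?Y e))"]) auto
   qed
   then have "\<exists>q. ALL x:V. op (fst (q x)) & x : fst (q x) & fst (q x) <= V & snd (q x) :<A (fst (q x))> &
     i (fst (q x)) (snd (q x)) = res E V (fst (q x)) e" by metis
   then obtain q where q: "!!x. x : V ==> op (fst (q x)) & x : fst (q x) & fst (q x) <= V & snd (q x) :<A (fst (q x))> &
     i (fst (q x)) (snd (q x)) = res E V (fst (q x)) e" by blast
   let ?W = "%x. fst (q x)" and ?s = "%x. snd (q x)"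
   have UV: "(\<Union>x\<in>V. ?W x) = V" using q by blast
   obtain a where a: "a :<A (\<Union>x\<in>V. ?W x)>" "!!x. x : V ==> res A (\<Union>x\<in>V. ?W x) (?W x) a = ?s x"
   proof (rule sheaf_glue[OF A, of V ?W ?s])
    show "op (?W x)" "?s x :<A (?W x)>" if "x : V" for x using q that by auto
    fix x y assume x: "x : V" and y: "y : V"
    let ?Y = "?W x Int ?W y"
    have Y: "op ?Y" "?Y <= ?W x" "?Y <= ?W y" using q[OF x] q[OF y] by auto
    show "res A (?W x) ?Y (?s x) = res A (?W y) ?Y (?s y)"
    proof (rule inj[OF Y(1)])
     show "res A (?W x) ?Y (?s x) :<A ?Y>" "res A (?W y) ?Y (?s y) :<A ?Y>"
      using Y q[OF x] q[OF y] A' by auto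
     have "i ?Y (res A (?W x) ?Y (?s x)) = res E V ?Y e" if x: "x : V" "?Y <= ?W x" for x
     proof -
      have o: "op (?W x)" "?W x <= V" "?s x :<A (?W x)>" "i (?W x) (?s x) = res E V (?W x) e" using q[OF x(1)] by auto
      show ?thesis using homs_res[OF i o(1) op_pts[OF o(1)] Y(1) x(2) o(3)] o Y(1) x(2) V(1) e E' by simp
     qed
     from this[OF x Y(2)] this[OF y Y(3)]
     show "i ?Y (res A (?W x) ?Y (?s x)) = i ?Y (res A (?W y) ?Y (?s y))" by simp
    qed
   qed (rule that; (assumption | simp))
   have aV: "a :<A V>" using a(1) UV by simp
   have "i V a = e"
   proof (rule sheaf_eqI[OF E V(1) homs_closed[OF i V aV] e(1)])
    fix x assume x: "x : V"
    have o: "op (?W x)" "x : ?W x" "?W x <= V" "i (?W x) (?s x) = res E V (?W x) e" using q[OF x] by auto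
    have "res E V (?W x) (i V a) = res E V (?W x) e"
     using homs_res[OF i V o(1,3) aV] a(2)[OF x] UV o(4) by simp
    then show "\<exists>W. op W & x : W & W <= V & res E V W (i V a) = res E V W e" using o by auto
   qed
   then show "e : i V ` mcar A V" using aV by blast
  qed
 qed
 fix b x assume b: "b :<B V>" and x: "x : V"
 obtain U s r where U: "op U" "x : U" "split_over B A E i p U s r"
  using split[OF op_inD[OF V(1) x]] by blast
 let ?Y = "V Int U"
 have Y: "op ?Y" "?Y <= V" "?Y <= U" using V U by auto
 have rb: "res B V ?Y b :<B ?Y>" using b V Y B' by simp
 show "EX W:ops V. x : W & (EX e:mcar E W. p W e = res B V W b)"
 proof (intro bexI conjI)
  show "x : ?Y" using x U by simp
  show "p ?Y (s ?Y (res B V ?Y b)) = res B V ?Y b" by (rule split_overD(4)[OF U(3) Y(1,3) rb])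
  show "s ?Y (res B V ?Y b) :<E ?Y>" by (rule homs_closed[OF split_overD(1)[OF U(3)] Y(1,3) rb])
  show "?Y : ops V" using Y by simp
 qed
qed

lemma extensionD:
 assumes "extension X B A (E, i, p)"
 shows "omod E" "i : mor X A E" "p : mor X E B"
  "op U ==> inj_on (i U) (mcar A U)"
  "op U ==> i U ` mcar A U = {e : mcar E U. p U e = 0<B U>}"
  "op U ==> b :<B U> ==> x : U ==> EX V:ops U. x : V & (EX e:mcar E V. p V e = res B U V b)"
 using assms unfolding extension_def prod.case by auto

text \<open>Stated with a set comprehension rather than with \<open>ext_class\<close>, because the
  latter fixes the type of the middle term, whereas \<open>E'\<close> may have sections of any
  type.\<close>

lemma ext_transfer:
 assumes x: "extension X B A (E, i, p)" and A: "pmod A" and B: "pmod B" and E': "omod E'"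
  and k: "mor_iso X E E' k"
 shows "(E', mor_comp X A k i, mor_comp X E' p (mor_inv X E E' k)) \<in>
  {\<epsilon>. extension X B A \<epsilon> & ext_equiv X B A (E, i, p) \<epsilon>}"
proof -
 note xx = extensionD[OF x]
 have E: "pmod E" "pmod E'" using xx(1) E' by auto
 let ?q = "mor_inv X E E' k"
 note q = mor_inv_mor[OF E k] and kh = mor_isoD(1)[OF k]
 have i': "mor_comp X A k i : mor X A E'" by (rule mor_comp_hom[OF xx(2) kh A])
 have p': "mor_comp X E' p ?q : mor X E' B" by (rule mor_comp_hom[OF q xx(3) E(2)])
 have icl: "i U a :<E U>" if "op U" "a :<A U>" for U a
  by (rule homs_closed[OF xx(2) that(1) op_pts[OF that(1)] that(2)])
 have "extension X B A (E', mor_comp X A k i, mor_comp X E' p ?q)"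
  unfolding extension_def prod.case
 proof (intro conjI ballI E' i' p')
  fix U assume "U : ops (pts X)"
  then have U: "op U" by simp
  show "inj_on (mor_comp X A k i U) (mcar A U)"
  proof (rule inj_onI)
   fix a a' assume a: "a :<A U>" "a' :<A U>" "mor_comp X A k i U a = mor_comp X A k i U a'"
   then have "i U a = i U a'" using iso_inj[OF k U icl[OF U a(1)] icl[OF U a(2)]] U by simp
   then show "a = a'" using inj_onD[OF xx(4)[OF U]] a by blast
  qed
  have pcl: "mor_comp X E' p ?q U (k U e) = p U e" if "e :<E U>" for e
   using that U iso_closed[OF k U that] by (simp add: mor_inv_left[OF k])
  show "mor_comp X A k i U ` mcar A U = {e : mcar E' U. mor_comp X E' p ?q U e = 0<B U>}"
  proof
   show "mor_comp X A k i U ` mcar A U <= {e : mcar E' U. mor_comp X E' p ?q U e = 0<B U>}"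
   proof
    fix e assume "e : mor_comp X A k i U ` mcar A U"
    then obtain a where a: "a :<A U>" "e = k U (i U a)" using U by auto
    have "p U (i U a) = 0<B U>" using xx(5)[OF U] a(1) by blast
    then show "e : {e : mcar E' U. mor_comp X E' p ?q U e = 0<B U>}"
     using pcl[OF icl[OF U a(1)]] iso_closed[OF k U icl[OF U a(1)]] a(2) by simp
   qed
   show "{e : mcar E' U. mor_comp X E' p ?q U e = 0<B U>} <= mor_comp X A k i U ` mcar A U"
   proof
    fix e assume "e : {e : mcar E' U. mor_comp X E' p ?q U e = 0<B U>}"
    then have e: "e :<E' U>" "p U (?q U e) = 0<B U>" using U by auto
    then have "?q U e : i U ` mcar A U" using xx(5)[OF U] mor_inv_closed[OF k U e(1)] by blast
    then obtain a where a: "a :<A U>" "?q U e = i U a" by blast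
    then have "e = mor_comp X A k i U a" using mor_inv_right[OF k U e(1)] U by simp
    then show "e : mor_comp X A k i U ` mcar A U" using a(1) by blast
   qed
  qed
  fix b x assume "b :<B U>" "x : U"
  from xx(6)[OF U this] obtain V e where V: "op V" "V <= U" "x : V" "e :<E V>" "p V e = res B U V b" by auto
  show "EX V:ops U. x : V & (EX e:mcar E' V. mor_comp X E' p ?q V e = res B U V b)"
  proof (intro bexI conjI)
   show "k V e :<E' V>" by (rule iso_closed[OF k V(1,4)])
   then show "mor_comp X E' p ?q V (k V e) = res B U V b"
    using V by (simp add: mor_inv_left[OF k])
  qed (use V in auto)
 qed
 moreover have "mor_comp X E (mor_comp X E' p ?q) k = p"
  by (rule homs_eqI[OF mor_comp_hom[OF kh p' E(1)] xx(3)])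
   (simp add: iso_closed[OF k] mor_inv_left[OF k])
 ultimately show ?thesis using k unfolding ext_equiv_def prod.case by blast
qed

subsection \<open>Transport of structure\<close>

text \<open>Transport of structure along injections \<open>k U\<close>: the image sets become a
  module isomorphic to \<open>E\<close> whose sections have another type.\<close>

definition transp :: "('x, 'r, 'e) omod => ('x set => 'e => 'k) => ('x, 'r, 'k) omod"
 where "transp E k = \<lparr>
  sec = (%U. let j = inv_into (mcar E U) (k U) in
   \<lparr>carrier = k U ` mcar E U, mult = undefined, one = undefined, zero = k U 0<E U>,
   add = (%x y. k U (j x +<E U> j y)), smult = (%a x. k U (a *<E U> j x))\<rparr>),
  res = (%U V x. k V (res E U V (inv_into (mcar E U) (k U) x)))\<rparr>"

lemma transp_iso:
 assumes E: "omod E" and k: "!!U. op U ==> inj_on (k U) (mcar E U)"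
 shows "omod (transp E k)" "mor_iso X E (transp E k) (fam' E (pts X) k)"
proof -
 have E': "pmod E" using E by simp
 let ?T = "transp E k"
 have c: "mcar ?T U = k U ` mcar E U" and z: "0<?T U> = k U 0<E U>" for U
  by (simp_all add: transp_def Let_def)
 have add: "k U m +<?T U> k U n = k U (m +<E U> n)" if "op U" "m :<E U>" "n :<E U>" for U m n
  using that inv_into_f_f[OF k[OF that(1)]] by (simp add: transp_def Let_def)
 have sm: "a *<?T U> k U m = k U (a *<E U> m)" if "op U" "m :<E U>" for U m a
  using that inv_into_f_f[OF k[OF that(1)]] by (simp add: transp_def Let_def)
 have rs: "res ?T U V (k U m) = k V (res E U V m)" if "op U" "m :<E U>" for U V m
  using that inv_into_f_f[OF k[OF that(1)]] by (simp add: transp_def Let_def)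
 have kD: "m = n" if "k U m = k U n" "op U" "m :<E U>" "n :<E U>" for U m n
  using inj_onD[OF k[OF that(2)] that(1,3,4)] .
 have presh: "presheaf_on (tsp X) (mcar ?T) (res ?T)"
  unfolding presheaf_on_def
 proof (intro conjI allI impI funcsetI ballI)
  show "res ?T U V x :<?T V>" if "op U & op V & V <= U" "x :<?T U>" for U V x
   using that E' by (auto simp: c rs)
  show "res ?T U U x = x" if "op U" "x :<?T U>" for U x
   using that E' by (auto simp: c rs)
  show "res ?T V W (res ?T U V x) = res ?T U W x" if "op U & op V & op W & W <= V & V <= U" "x :<?T U>" for U V W x
   using that E' by (auto simp: c rs)
 qed
 have mod: "module (osec X U) (sec ?T U)" if U: "op U" for U
 proof -
  interpret M: module "osec X U" "sec E U" by (rule pm_module[OF E' U])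
  note s = c z add[OF U] sm[OF U]
  show ?thesis
  proof (intro moduleI abelian_groupI O_cring[OF U])
   show "0<?T U> :<?T U>" by (simp add: s)
   fix x assume "x :<?T U>"
   then obtain m where m: "m :<E U>" "x = k U m" by (auto simp: s)
   show "0<?T U> +<?T U> x = x" "1<U> *<?T U> x = x" using m by (simp_all add: s)
   show "EX y:mcar ?T U. y +<?T U> x = 0<?T U>"
    using m by (intro bexI[of _ "k U (\<ominus>\<^bsub>sec E U\<^esub> m)"]) (simp_all add: s M.l_neg)
   {
    fix a assume a: "a :<U>"
    show "a *<?T U> x :<?T U>" using a m by (simp add: s)
    fix b assume b: "b :<U>"
    show "(a +<U> b) *<?T U> x = a *<?T U> x +<?T U> b *<?T U> x"
     "(a *<U> b) *<?T U> x = a *<?T U> (b *<?T U> x)"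
     using a b m by (simp_all add: s M.smult_l_distr M.smult_assoc1)
   }
   fix y assume "y :<?T U>"
   then obtain n where n: "n :<E U>" "y = k U n" by (auto simp: s)
   show "x +<?T U> y :<?T U>" "x +<?T U> y = y +<?T U> x"
    using m n by (simp_all add: s M.a_comm)
   show "a *<?T U> (x +<?T U> y) = a *<?T U> x +<?T U> a *<?T U> y"
    if "a :<U>" for a using that m n by (simp add: s M.smult_r_distr)
   fix w assume "w :<?T U>"
   then obtain l where l: "l :<E U>" "w = k U l" by (auto simp: s)
   show "x +<?T U> y +<?T U> w = x +<?T U> (y +<?T U> w)"
    using m n l by (simp add: s M.a_assoc)
  qed
 qed
 have pm: "pmod ?T"
  unfolding pmodule_def
 proof (intro conjI allI impI ballI presh mod)
  fix U V x assume "op U & V : ops U" and x: "x :<?T U>"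
  then have U: "op U" "op V" "V <= U" by auto
  obtain m where m: "m :<E U>" "x = k U m" using x by (auto simp: c)
  show "res ?T U V (x +<?T U> y) = res ?T U V x +<?T V> res ?T U V y" if "y :<?T U>" for y
   using that m U E' by (auto simp: c add rs)
  show "res ?T U V (a *<?T U> x) = rs U V a *<?T V> res ?T U V x" if "a :<U>" for a
   using that m U E' by (auto simp: c sm rs)
 qed
 show "omod ?T"
  unfolding O_module_iff
 proof (intro conjI pm sheaf_onI presh)
  fix C s assume C: "!!V. V : C ==> op V" and s: "!!V. V : C ==> s V :<?T V>"
   and agree: "!!V W. V : C ==> W : C ==> res ?T V (V Int W) (s V) = res ?T W (V Int W) (s W)"
  define s' where "s' V = inv_into (mcar E V) (k V) (s V)" for V
  have s': "s' V :<E V>" "k V (s' V) = s V" if "V : C" for V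
   using s[OF that] unfolding c s'_def by (auto intro: inv_into_into f_inv_into_f)
  obtain t where t: "t :<E (\<Union>V\<in>C. V)>" "!!V. V : C ==> res E (\<Union>V\<in>C. V) V t = s' V"
  proof (rule sheaf_glue[OF E, of C "%V. V" s'])
   fix V W assume V: "V : C" and W: "W : C"
   show "res E V (V Int W) (s' V) = res E W (V Int W) (s' W)"
   proof (rule kD[of "V Int W"])
    show "k (V Int W) (res E V (V Int W) (s' V)) = k (V Int W) (res E W (V Int W) (s' W))"
     using agree[OF V W] rs[OF C[OF V] s'(1)[OF V], of "V Int W"] rs[OF C[OF W] s'(1)[OF W], of "V Int W"]
      s'(2)[OF V] s'(2)[OF W] by simp
   qed (use C[OF V] C[OF W] s'(1)[OF V] s'(1)[OF W] E' in auto)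
  qed (use C s'(1) in \<open>auto intro: that\<close>)
  have oU: "op (\<Union>C)" using C by blast
  show "EX t:mcar ?T (\<Union>C). ALL V:C. res ?T (\<Union>C) V t = s V"
  proof (intro bexI ballI)
   show "k (\<Union>C) t :<?T (\<Union>C)>" using t(1) by (simp add: c)
   show "res ?T (\<Union>C) V (k (\<Union>C) t) = s V" if "V : C" for V
    using rs[OF oU, of t V] t that s'(2)[OF that] by simp
  qed
 next
  fix C t t' assume C: "!!V. V : C ==> op V" and t: "t :<?T (\<Union>C)>" "t' :<?T (\<Union>C)>"
   and agree: "!!V. V : C ==> res ?T (\<Union>C) V t = res ?T (\<Union>C) V t'"
  have oU: "op (\<Union>C)" using C by blast
  obtain m n where m: "m :<E (\<Union>C)>" "t = k (\<Union>C) m" "n :<E (\<Union>C)>" "t' = k (\<Union>C) n"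
   using t by (auto simp: c)
  have "m = n"
  proof (rule sheaf_eqI[OF E oU m(1,3)])
   fix x assume "x : \<Union>C"
   then obtain V where V: "V : C" "x : V" by blast
   have Vs: "V <= \<Union>C" using V by blast
   have "res E (\<Union>C) V m = res E (\<Union>C) V n"
    by (rule kD[OF _ C[OF V(1)]])
     (use agree[OF V(1)] rs[OF oU m(1), of V] rs[OF oU m(3), of V] m oU C[OF V(1)] Vs E' in auto)
   then show "\<exists>V. op V & x : V & V <= \<Union>C & res E (\<Union>C) V m = res E (\<Union>C) V n"
    using V C Vs by blast
  qed
  then show "t = t'" using m by simp
 qed
 show "mor_iso X E ?T (fam' E (pts X) k)"
  unfolding iso_over_def
 proof (intro conjI ballI)
  show "fam' E (pts X) k : mor X E ?T"
   by (rule homsI[OF E']) (auto simp: c add sm rs)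
  fix V assume "V : ops (pts X)"
  then have V: "op V" "V <= pts X" by auto
  have "bij_betw (k V) (mcar E V) (mcar ?T V)" using k[OF V(1)] by (simp add: bij_betw_def c)
  then show "bij_betw (fam' E (pts X) k V) (mcar E V) (mcar ?T V)"
   using V by (subst bij_betw_cong[where g = "k V"]) auto
 qed
qed

text \<open>The class admits only extensions whose middle term has sections of a prescribed product
  type, so it does not obviously contain a copy of the given one. An injection of the sections into
  pairs, followed by transport of structure, produces such a copy.\<close>

lemma ext_class_nonempty:
 assumes A: "pmod A" and B: "pmod B" and x: "extension X B A (E, i, p)"
 shows "ext_class X B A (E, i, p) ~= {}"
proof -
 note xx = extensionD[OF x]
 have E: "pmod E" using xx(1) by simp
 define sel where "sel U b = (SOME e. e :<E U> & p U e = b)" for U b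
 \<comment> \<open>A section of \<open>E\<close> is determined by its image under \<open>p\<close>
   and by its difference from a fixed element \<open>sel\<close> of the same fibre; that difference
   is killed by \<open>p\<close>, hence comes from a unique section of \<open>A\<close>.\<close>
 define k where "k U e = (inv_into (mcar A U) (i U) (e -<E U> sel U (p U e)), p U e)" for U e
 have k: "inj_on (k U) (mcar E U)" if U: "op U" for U
 proof (rule inj_onI)
  fix e e' assume e: "e :<E U>" "e' :<E U>" "k U e = k U e'"
  have pe: "p U e = p U e'" using e(3) by (simp add: k_def)
  have sel: "sel U (p U e) :<E U> & p U (sel U (p U e)) = p U e"
   unfolding sel_def by (rule someI[of _ e]) (use e(1) in simp)
  have im: "d -<E U> sel U (p U e) : i U ` mcar A U" if d: "d :<E U>" "p U d = p U e" for d
   using xx(5)[OF U] homs_minus[OF xx(3) U op_pts[OF U] E B d(1)] sel d E U B homs_closed[OF xx(3) U op_pts[OF U]] e(1) by simp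
  have "inv_into (mcar A U) (i U) (e -<E U> sel U (p U e)) =
    inv_into (mcar A U) (i U) (e' -<E U> sel U (p U e))"
   using e(3) pe by (simp add: k_def)
  then have "e -<E U> sel U (p U e) = e' -<E U> sel U (p U e)"
   using f_inv_into_f[OF im[OF e(1) refl]] f_inv_into_f[OF im[OF e(2) pe[symmetric]]] by metis
  then show "e = e'"
   using pm_minus_add[OF E U e(1), of "sel U (p U e)"] pm_minus_add[OF E U e(2), of "sel U (p U e)"] sel by metis
 qed
 note T = transp_iso[OF xx(1) k]
 have "(transp E k, mor_comp X A (fam' E (pts X) k) i,
   mor_comp X (transp E k) p (mor_inv X E (transp E k) (fam' E (pts X) k))) : ext_class X B A (E, i, p)"
  unfolding ext_class_def by (rule ext_transfer[OF x A B T])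
 then show ?thesis by blast
qed

text \<open>Along an isomorphism the pushout keeps the middle term and merely relabels the
  subobject, by composing the inclusion with the inverse.\<close>

lemma push_extension:
 assumes x: "extension X B A (E, i, p)" and A: "pmod A" and A': "pmod A'" and f: "mor_iso X A A' f"
 shows "extension X B A' (E, mor_comp X A' i (mor_inv X A A' f), p)"
 unfolding extension_def prod.case
proof (intro conjI ballI)
 note xx = extensionD[OF x]
 let ?g = "mor_inv X A A' f"
 show "omod E" "p : mor X E B" by (rule xx(1), rule xx(3))
 show "mor_comp X A' i ?g : mor X A' E" by (rule mor_comp_hom[OF mor_inv_mor[OF A A' f] xx(2) A'])
 fix U assume "U : ops (pts X)"
 then have U: "op U" by simp
 have g: "?g U ` mcar A' U = mcar A U"
  using mor_isoD(2)[OF mor_inv_iso[OF A A' f] U] by (simp add: bij_betw_def)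
 show "inj_on (mor_comp X A' i ?g U) (mcar A' U)"
 proof (rule inj_onI)
  fix a b assume a: "a :<A' U>" "b :<A' U>" "mor_comp X A' i ?g U a = mor_comp X A' i ?g U b"
  then have "?g U a = ?g U b"
   using inj_onD[OF xx(4)[OF U], of "?g U a" "?g U b"] U mor_inv_closed[OF f U] by simp
  then show "a = b" using mor_inv_right[OF f U a(1)] mor_inv_right[OF f U a(2)] by metis
 qed
 have "mor_comp X A' i ?g U ` mcar A' U = i U ` (?g U ` mcar A' U)"
  unfolding image_image by (rule image_cong) (use U in auto)
 then show "mor_comp X A' i ?g U ` mcar A' U = {e : mcar E U. p U e = 0<B U>}"
  unfolding g xx(5)[OF U] .
 show "EX V:ops U. x : V & (EX e:mcar E V. p V e = res B U V b)" if "b :<B U>" "x : U" for b x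
  by (rule xx(6)[OF U that])
qed

subsection \<open>Cocycles of extensions of the structure sheaf\<close>

text \<open>The condition on the cochain in \<open>ext_to_H1\<close>, isolated so that one cocycle
  can be followed while the extension changes.\<close>

definition ext_cocycle :: "('x, 'r, 'n) omod => ('x, 'r, 'n, 'e, 'r) ext => ('x, 'n) cech => bool"
 where "ext_cocycle G = (\<lambda>(E, i, p) (C, c). covering X C & (\<exists>e.
  (ALL U:C. e U :<E U> & p U (e U) = 1<U>) &
  (ALL U:C. ALL V:C. c U V :<G (U Int V)> &
   i (U Int V) (c U V) = res E V (U Int V) (e V) -<E (U Int V)> res E U (U Int V) (e U))))"

text \<open>An equivalence carries lifts of 1 to lifts of 1 and is compatible with the inclusions of
  \<open>G\<close>, so the cocycle itself, and not only its class, is unchanged.\<close>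

lemma ext_cocycle_equiv:
 assumes x: "extension X (ox X) G (E, i, p)" and x': "extension X (ox X) G (E', i', p')"
  and eq: "ext_equiv X (ox X) G (E, i, p) (E', i', p')" and z: "ext_cocycle G (E, i, p) (C, c)"
 shows "ext_cocycle G (E', i', p') (C, c)"
proof -
 note xx = extensionD[OF x] and xx' = extensionD[OF x']
 have E: "pmod E" "pmod E'" using xx(1) xx'(1) by auto
 from eq obtain k where k: "mor_iso X E E' k" "mor_comp X G k i = i'" "mor_comp X E p' k = p"
  unfolding ext_equiv_def prod.case by blast
 note kh = mor_isoD(1)[OF k(1)]
 from z obtain e where C: "covering X C" and e: "!!U. U : C ==> e U :<E U> & p U (e U) = 1<U>"
  and c: "!!U V. U : C ==> V : C ==> c U V :<G (U Int V)> &
   i (U Int V) (c U V) = res E V (U Int V) (e V) -<E (U Int V)> res E U (U Int V) (e U)"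
  unfolding ext_cocycle_def prod.case by blast
 show ?thesis unfolding ext_cocycle_def prod.case
 proof (intro conjI exI[of _ "%U. k U (e U)"] ballI C)
  fix U assume U: "U : C"
  note oU = coveringD(1)[OF C U]
  show "k U (e U) :<E' U>" using iso_closed[OF k(1) oU] e[OF U] by simp
  have "mor_comp X E p' k U (e U) = p' U (k U (e U))" using e[OF U] oU by simp
  then show "p' U (k U (e U)) = 1<U>" using e[OF U] k(3) by simp
  fix V assume V: "V : C"
  note oV = coveringD(1)[OF C V]
  have Y: "op (U Int V)" "U Int V <= U" "U Int V <= V" using oU oV by auto
  show "c U V :<G (U Int V)>" using c[OF U V] by simp
  have "i' (U Int V) (c U V) = k (U Int V) (res E V (U Int V) (e V) -<E (U Int V)> res E U (U Int V) (e U))"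
   using c[OF U V] mor_comp_apply[of "U Int V" "c U V" G k i] Y(1) k(2) by simp
  also have "\<dots> = res E' V (U Int V) (k V (e V)) -<E' (U Int V)> res E' U (U Int V) (k U (e U))"
   using homs_minus[OF kh Y(1) op_pts[OF Y(1)] E] homs_res[OF kh oV op_pts[OF oV] Y(1,3)]
    homs_res[OF kh oU op_pts[OF oU] Y(1,2)] e[OF U] e[OF V] E oU oV Y by simp
  finally show "i' (U Int V) (c U V) = res E' V (U Int V) (k V (e V)) -<E' (U Int V)> res E' U (U Int V) (k U (e U))" .
 qed
qed

lemma ext_cocycle_push:
 assumes f: "mor_iso X A A' f" and z: "ext_cocycle A (E, i, p) (C, c)"
 shows "ext_cocycle A' (E, mor_comp X A' i (mor_inv X A A' f), p) (C, %U V. f (U Int V) (c U V))"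
proof -
 from z obtain e where C: "covering X C" and e: "ALL U:C. e U :<E U> & p U (e U) = 1<U>"
  and c: "!!U V. U : C ==> V : C ==> c U V :<A (U Int V)> &
   i (U Int V) (c U V) = res E V (U Int V) (e V) -<E (U Int V)> res E U (U Int V) (e U)"
  unfolding ext_cocycle_def prod.case by blast
 show ?thesis unfolding ext_cocycle_def prod.case
 proof (intro conjI exI[of _ e] ballI C)
  fix U assume U: "U : C"
  show "e U :<E U>" "p U (e U) = 1<U>" using e U by auto
  fix V assume V: "V : C"
  have Y: "op (U Int V)" using coveringD(1)[OF C U] coveringD(1)[OF C V] by simp
  show "f (U Int V) (c U V) :<A' (U Int V)>" using iso_closed[OF f Y] c[OF U V] by simp
  then show "mor_comp X A' i (mor_inv X A A' f) (U Int V) (f (U Int V) (c U V)) =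
    res E V (U Int V) (e V) -<E (U Int V)> res E U (U Int V) (e U)"
   using Y c[OF U V] mor_inv_left[OF f Y] by simp
 qed
qed

text \<open>The differences of lifts telescope in \<open>E\<close>, and \<open>i\<close> is
  injective.\<close>

lemma ext_cocycle_cocycle:
 assumes G: "pmod G" and x: "extension X (ox X) G (E, i, p)" and z: "ext_cocycle G (E, i, p) (C, c)"
 shows "cocycle X (madd G) (res G) (C, c)"
proof -
 note xx = extensionD[OF x]
 have E: "pmod E" using xx(1) by simp
 from z obtain e where C: "covering X C" and e: "!!U. U : C ==> e U :<E U>"
  and c: "!!U V. U : C ==> V : C ==> c U V :<G (U Int V)>"
   "!!U V. U : C ==> V : C ==> i (U Int V) (c U V) = res E V (U Int V) (e V) -<E (U Int V)> res E U (U Int V) (e U)"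
  unfolding ext_cocycle_def prod.case by blast
 show ?thesis unfolding cocycle_def prod.case
 proof (intro conjI ballI C)
  fix U V assume U: "U : C" and V: "V : C"
  show "c U V : carrier (madd G (U Int V))" using c(1)[OF U V] by simp
  fix W assume W: "W : C"
  note o = coveringD(1)[OF C U] coveringD(1)[OF C V] coveringD(1)[OF C W]
  let ?Y = "U Int V Int W"
  have Y: "op ?Y" "?Y <= U" "?Y <= V" "?Y <= W" using o by auto
  interpret M: module "osec X ?Y" "sec E ?Y" by (rule pm_module[OF E Y(1)])
  have ic: "i ?Y (res G (S Int T) ?Y (c S T)) = res E T ?Y (e T) -<E ?Y> res E S ?Y (e S)" and
   cl: "res G (S Int T) ?Y (c S T) :<G ?Y>"
   if S: "S : C" "T : C" "?Y <= S" "?Y <= T" for S T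
  proof -
   have oo: "op (S Int T)" "?Y <= S Int T" "op S" "op T" using coveringD(1)[OF C S(1)] coveringD(1)[OF C S(2)] S by auto
   show "i ?Y (res G (S Int T) ?Y (c S T)) = res E T ?Y (e T) -<E ?Y> res E S ?Y (e S)"
    using homs_res[OF xx(2) oo(1) op_pts[OF oo(1)] Y(1) oo(2) c(1)[OF S(1,2)]] c(2)[OF S(1,2)]
     e[OF S(1)] e[OF S(2)] oo Y(1) E by simp
   show "res G (S Int T) ?Y (c S T) :<G ?Y>" using c(1)[OF S(1,2)] oo Y(1) G by simp
  qed
  note cls = cl[OF U V Y(2,3)] cl[OF V W Y(3,4)] cl[OF U W Y(2,4)]
  have re: "res E U ?Y (e U) :<E ?Y>" "res E V ?Y (e V) :<E ?Y>" "res E W ?Y (e W) :<E ?Y>"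
   using e U V W o Y E by auto
  have "i ?Y (res G (U Int V) ?Y (c U V) +<G ?Y> res G (V Int W) ?Y (c V W)) = i ?Y (res G (U Int W) ?Y (c U W))"
   unfolding homs_add[OF xx(2) Y(1) op_pts[OF Y(1)] cls(1,2)] ic[OF U V Y(2,3)] ic[OF V W Y(3,4)] ic[OF U W Y(2,4)]
   by (rule pm_telescope[OF E Y(1) re])
  then show "res G (U Int V) ?Y (c U V) *{(madd G ?Y)} res G (V Int W) ?Y (c V W) = res G (U Int W) ?Y (c U W)"
   using inj_onD[OF xx(4)[OF Y(1)]] cls G Y(1) by simp
 qed
qed

text \<open>Two systems of lifts of 1 differ, on a common refinement, by elements in the kernel of
  \<open>p\<close>, that is, by the image of a cochain \<open>b\<close> in \<open>G\<close>. Both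
  sides of the coboundary relation become the lift \<open>e'\<close> at \<open>v\<close> minus the
  lift \<open>e\<close> at \<open>u\<close>, and \<open>i\<close> is injective.\<close>

lemma ext_cocycle_cohomologous:
 assumes G: "pmod G" and x: "extension X (ox X) G (E, i, p)"
  and z: "ext_cocycle G (E, i, p) (C, c)" and z': "ext_cocycle G (E, i, p) (D, d)"
 shows "cohomologous X (madd G) (res G) (C, c) (D, d)"
proof -
 note xx = extensionD[OF x]
 have E: "pmod E" using xx(1) by simp
 from z obtain e where C: "covering X C" and e: "!!U. U : C ==> e U :<E U>" "!!U. U : C ==> p U (e U) = 1<U>"
  and c: "!!U V. U : C ==> V : C ==> c U V :<G (U Int V)>"
   "!!U V. U : C ==> V : C ==> i (U Int V) (c U V) = res E V (U Int V) (e V) -<E (U Int V)> res E U (U Int V) (e U)"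
  unfolding ext_cocycle_def prod.case by blast
 from z' obtain e' where D: "covering X D" and e': "!!U. U : D ==> e' U :<E U>" "!!U. U : D ==> p U (e' U) = 1<U>"
  and d: "!!U V. U : D ==> V : D ==> d U V :<G (U Int V)>"
   "!!U V. U : D ==> V : D ==> i (U Int V) (d U V) = res E V (U Int V) (e' V) -<E (U Int V)> res E U (U Int V) (e' U)"
  unfolding ext_cocycle_def prod.case by blast
 define Z where "Z = {w Int w' | w w'. w : C & w' : D}"
 define pr where "pr u = (SOME q. fst q : C & snd q : D & u = fst q Int snd q)" for u
 define \<sigma> where "\<sigma> u = fst (pr u)" for u
 define \<tau> where "\<tau> u = snd (pr u)" for u
 have st: "\<sigma> u : C" "\<tau> u : D" "u = \<sigma> u Int \<tau> u" if "u : Z" for u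
 proof -
  have "\<exists>q. fst q : C & snd q : D & u = fst q Int snd q" using that by (force simp: Z_def)
  from someI_ex[OF this] show "\<sigma> u : C" "\<tau> u : D" "u = \<sigma> u Int \<tau> u"
   unfolding \<sigma>_def \<tau>_def pr_def[symmetric] by auto
 qed
 have oa: "op (\<sigma> u)" "op (\<tau> u)" if "u : Z" for u
  using coveringD(1)[OF C st(1)[OF that]] coveringD(1)[OF D st(2)[OF that]] by auto
 have oZ: "op u" if "u : Z" for u using oa[OF that] st(3)[OF that] op_Int by metis
 have sub: "u <= \<sigma> u" "u <= \<tau> u" if "u : Z" for u using st(3)[OF that] by auto
 define dl where "dl u = res E (\<tau> u) u (e' (\<tau> u)) -<E u> res E (\<sigma> u) u (e (\<sigma> u))" for u
 define b where "b u = inv_into (mcar G u) (i u) (dl u)" for u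
 have dl: "dl u : i u ` mcar G u" if u: "u : Z" for u
 proof -
  note ou = oZ[OF u] and o = oa[OF u] and s = sub[OF u]
  have m: "res E (\<tau> u) u (e' (\<tau> u)) :<E u>" "res E (\<sigma> u) u (e (\<sigma> u)) :<E u>"
   using e(1)[OF st(1)[OF u]] e'(1)[OF st(2)[OF u]] o s ou E by auto
  have "p u (res E (\<tau> u) u (e' (\<tau> u))) = 1<u>"
   using homs_res[OF xx(3) o(2) op_pts[OF o(2)] ou s(2) e'(1)[OF st(2)[OF u]]] e'(2)[OF st(2)[OF u]] o ou s by simp
  moreover have "p u (res E (\<sigma> u) u (e (\<sigma> u))) = 1<u>"
   using homs_res[OF xx(3) o(1) op_pts[OF o(1)] ou s(1) e(1)[OF st(1)[OF u]]] e(2)[OF st(1)[OF u]] o ou s by simp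
  ultimately have "p u (dl u) = 0<(ox X) u>"
   unfolding dl_def using homs_minus[OF xx(3) ou op_pts[OF ou] E _ m]
    pm_simps(6)[of "ox X" u "1<u>"] ou by simp
  then show ?thesis using xx(5)[OF ou] m E ou by (simp add: dl_def)
 qed
 have b: "b u :<G u>" "i u (b u) = dl u" if "u : Z" for u
  unfolding b_def using inv_into_into[OF dl[OF that]] f_inv_into_f[OF dl[OF that]] by auto
 show ?thesis
 proof (rule cohomologousI[OF madd_ab_presheaf[OF G], of Z \<sigma> _ \<tau> _ b])
  show "covering X Z"
  proof (rule coveringI)
   show "op u" if "u : Z" for u by (rule oZ[OF that])
   fix x assume x: "x : pts X"
   obtain w w' where "w : C" "w' : D" "x : w" "x : w'"
    using coveringD(2)[OF C x] coveringD(2)[OF D x] by auto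
   then show "EX u:Z. x : u" by (intro bexI[of _ "w Int w'"]) (auto simp: Z_def)
  qed
  fix u assume u: "u : Z"
  show "\<sigma> u : C & u <= \<sigma> u" "\<tau> u : D & u <= \<tau> u" using st[OF u] by auto
  show "b u : carrier (madd G u)" using b[OF u] by simp
  fix v assume v: "v : Z"
  let ?Y = "u Int v"
  have Y: "op ?Y" "?Y <= u" "?Y <= v" using oZ[OF u] oZ[OF v] by auto
  have Yc: "?Y <= \<sigma> u" "?Y <= \<sigma> v" "?Y <= \<tau> u" "?Y <= \<tau> v" using sub[OF u] sub[OF v] by auto
  interpret M: module "osec X ?Y" "sec E ?Y" by (rule pm_module[OF E Y(1)])
  have bY: "res G w ?Y (b w) :<G ?Y>"
   "i ?Y (res G w ?Y (b w)) = res E (\<tau> w) ?Y (e' (\<tau> w)) -<E ?Y> res E (\<sigma> w) ?Y (e (\<sigma> w))"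
   if w: "w : Z" "?Y <= w" for w
  proof -
   note ow = oZ[OF w(1)] and o = oa[OF w(1)] and s = sub[OF w(1)]
   show "res G w ?Y (b w) :<G ?Y>" using b(1)[OF w(1)] ow w(2) Y(1) G by simp
   show "i ?Y (res G w ?Y (b w)) = res E (\<tau> w) ?Y (e' (\<tau> w)) -<E ?Y> res E (\<sigma> w) ?Y (e (\<sigma> w))"
    using homs_res[OF xx(2) ow op_pts[OF ow] Y(1) w(2) b(1)[OF w(1)]] b(2)[OF w(1)]
     e(1)[OF st(1)[OF w(1)]] e'(1)[OF st(2)[OF w(1)]] o s ow Y(1) w(2) E by (simp add: dl_def)
  qed
  let ?c = "res G (\<sigma> u Int \<sigma> v) ?Y (c (\<sigma> u) (\<sigma> v))" and ?d = "res G (\<tau> u Int \<tau> v) ?Y (d (\<tau> u) (\<tau> v))"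
  have oo: "op (\<sigma> u Int \<sigma> v)" "op (\<tau> u Int \<tau> v)" "?Y <= \<sigma> u Int \<sigma> v" "?Y <= \<tau> u Int \<tau> v" using oa[OF u] oa[OF v] Yc by auto
  note cc = c[OF st(1)[OF u] st(1)[OF v]] and dd = d[OF st(2)[OF u] st(2)[OF v]]
  have ic: "i ?Y ?c = res E (\<sigma> v) ?Y (e (\<sigma> v)) -<E ?Y> res E (\<sigma> u) ?Y (e (\<sigma> u))"
   using homs_res[OF xx(2) oo(1) op_pts[OF oo(1)] Y(1) oo(3) cc(1)] cc(2)
    e(1)[OF st(1)[OF u]] e(1)[OF st(1)[OF v]] oo oa[OF u] oa[OF v] Y(1) E by simp
  have idd: "i ?Y ?d = res E (\<tau> v) ?Y (e' (\<tau> v)) -<E ?Y> res E (\<tau> u) ?Y (e' (\<tau> u))"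
   using homs_res[OF xx(2) oo(2) op_pts[OF oo(2)] Y(1) oo(4) dd(1)] dd(2)
    e'(1)[OF st(2)[OF u]] e'(1)[OF st(2)[OF v]] oo oa[OF u] oa[OF v] Y(1) E by simp
  have cdY: "?c :<G ?Y>" "?d :<G ?Y>" using cc dd oo Y(1) G by auto
  have re: "res E (\<sigma> u) ?Y (e (\<sigma> u)) :<E ?Y>" "res E (\<sigma> v) ?Y (e (\<sigma> v)) :<E ?Y>"
   "res E (\<tau> u) ?Y (e' (\<tau> u)) :<E ?Y>" "res E (\<tau> v) ?Y (e' (\<tau> v)) :<E ?Y>"
   using e(1)[OF st(1)[OF u]] e(1)[OF st(1)[OF v]] e'(1)[OF st(2)[OF u]] e'(1)[OF st(2)[OF v]]
    oa[OF u] oa[OF v] Y(1) Yc E by auto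
  have alg: "(x2 -<E ?Y> x1) +<E ?Y> (y2 -<E ?Y> x2) = (y1 -<E ?Y> x1) +<E ?Y> (y2 -<E ?Y> y1)"
   if "x1 :<E ?Y>" "x2 :<E ?Y>" "y1 :<E ?Y>" "y2 :<E ?Y>" for x1 x2 y1 y2
   using pm_telescope[OF E Y(1) that(1,2,4)] pm_telescope[OF E Y(1) that(1,3,4)] by simp
  have "i ?Y (?c +<G ?Y> res G v ?Y (b v)) = i ?Y (res G u ?Y (b u) +<G ?Y> ?d)"
   unfolding homs_add[OF xx(2) Y(1) op_pts[OF Y(1)] cdY(1) bY(1)[OF v Y(3)]]
    homs_add[OF xx(2) Y(1) op_pts[OF Y(1)] bY(1)[OF u Y(2)] cdY(2)] ic idd bY(2)[OF v Y(3)] bY(2)[OF u Y(2)]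
   by (rule alg[OF re])
  then show "?c *{(madd G ?Y)} res G v ?Y (b v) = res G u ?Y (b u) *{(madd G ?Y)} ?d"
   using inj_onD[OF xx(4)[OF Y(1)]] cdY bY(1)[OF u Y(2)] bY(1)[OF v Y(3)] G Y(1) by simp
 qed
qed

text \<open>The invariant carried along the maps that compose \<open>psi\<close>: whichever member
  of the set is used, the same cocycle \<open>z\<close> arises. Nonemptiness keeps the unions over
  the set from degenerating to the empty set.\<close>

definition represents :: "('x, 'r, 'n) omod => ('x, 'r, 'n, 'n \<times> 'r, 'r) ext set => ('x, 'n) cech => bool"
 where "represents G k z \<longleftrightarrow> k ~= {} & (\<forall>\<epsilon>\<in>k. extension X (ox X) G \<epsilon> & ext_cocycle G \<epsilon> z)"

lemma represents_ext_class:
 assumes G: "pmod G" and x: "extension X (ox X) G \<epsilon>" and z: "ext_cocycle G \<epsilon> z"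
 shows "represents G (ext_class X (ox X) G \<epsilon>) z"
 unfolding represents_def
proof (intro conjI ballI)
 obtain E i p where \<epsilon>: "\<epsilon> = (E, i, p)" by (cases \<epsilon>)
 obtain C c where zc: "z = (C, c)" by (cases z)
 show "ext_class X (ox X) G \<epsilon> ~= {}" unfolding \<epsilon>
  by (rule ext_class_nonempty[OF G _ x[unfolded \<epsilon>]]) simp
 fix k assume k: "k : ext_class X (ox X) G \<epsilon>"
 obtain E' i' p' where d: "k = (E', i', p')" by (cases k)
 show x': "extension X (ox X) G k" using k by (simp add: ext_class_def)
 show "ext_cocycle G k z"
  unfolding d zc by (rule ext_cocycle_equiv[OF x[unfolded \<epsilon>] x'[unfolded d] _ z[unfolded \<epsilon> zc]])
   (use k in \<open>simp add: ext_class_def \<epsilon> d\<close>)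
qed

lemma represents_UN:
 assumes "S ~= {}" "!!s. s : S ==> represents G (F s) z"
 shows "represents G (\<Union>s\<in>S. F s) z"
 using assms unfolding represents_def by blast

lemma represents_push:
 assumes A: "pmod A" and A': "pmod A'" and f: "mor_iso X A A' f" and k: "represents A k (C, c)"
 shows "represents A' (ext_push X (ox X) A A' f k) (C, %U V. f (U Int V) (c U V))"
 unfolding ext_push_def
proof (rule represents_UN)
 show "k ~= {}" using k by (simp add: represents_def)
 fix \<epsilon> assume "\<epsilon> : k"
 then have e: "extension X (ox X) A \<epsilon>" "ext_cocycle A \<epsilon> (C, c)" using k by (auto simp: represents_def)
 obtain E i p where \<epsilon>: "\<epsilon> = (E, i, p)" by (cases \<epsilon>)
 show "represents A' (case \<epsilon> of (E, i, p) => ext_class X (ox X) A' (E, mor_comp X A' i (mor_inv X A A' f), p))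
   (C, %U V. f (U Int V) (c U V))"
  unfolding \<epsilon> prod.case
  by (rule represents_ext_class[OF A' push_extension[OF e(1)[unfolded \<epsilon>] A A' f] ext_cocycle_push[OF f e(2)[unfolded \<epsilon>]]])
qed

text \<open>All cocycles obtained from one extension are cohomologous, so the inner union is over a
  single class, and for every extension in the set this is the class of \<open>z\<close>.\<close>

lemma represents_H1:
 assumes G: "pmod G" and k: "represents G k z"
 shows "ext_to_H1 X G k = H1_mod_class X G z"
 unfolding ext_to_H1_def
proof (rule UN_eq_const)
 show "k ~= {}" using k by (simp add: represents_def)
 fix \<epsilon> assume "\<epsilon> : k"
 then have e: "extension X (ox X) G \<epsilon>" "ext_cocycle G \<epsilon> z" using k by (auto simp: represents_def)
 obtain E i p where \<epsilon>: "\<epsilon> = (E, i, p)" by (cases \<epsilon>)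
 obtain C c where zc: "z = (C, c)" by (cases z)
 note e' = e[unfolded \<epsilon> zc]
 note Mp = madd_ab_presheaf[OF G]
 let ?S = "{H1_mod_class X G (D, d) | D e d. covering X D &
  (ALL U:D. e U :<E U> & p U (e U) = 1<U>) &
  (ALL U:D. ALL V:D. d U V :<G (U Int V)> &
   i (U Int V) (d U V) = res E V (U Int V) (e V) -<E (U Int V)> res E U (U Int V) (e U))}"
 have S: "?S = {H1_mod_class X G (D, d) | D d. ext_cocycle G (E, i, p) (D, d)}"
  unfolding ext_cocycle_def prod.case by blast
 have "H1_mod_class X G (D, d) = H1_mod_class X G (C, c)" if d: "ext_cocycle G (E, i, p) (D, d)" for D d
  by (rule H1_class_eqI[OF Mp ext_cocycle_cocycle[OF G e'(1) d] ext_cocycle_cocycle[OF G e'] ext_cocycle_cohomologous[OF G e'(1) d e'(2)]])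
 then have "{H1_mod_class X G (D, d) | D d. ext_cocycle G (E, i, p) (D, d)} = {H1_mod_class X G (C, c)}"
  using e'(2) by blast
 then have "\<Union>?S = H1_mod_class X G (C, c)" unfolding S by simp
 then show "(case \<epsilon> of (E, i, p) => \<Union>{H1_mod_class X G (D, d) | D e d. covering X D &
  (ALL U:D. e U :<E U> & p U (e U) = 1<U>) &
  (ALL U:D. ALL V:D. d U V :<G (U Int V)> &
   i (U Int V) (d U V) = res E V (U Int V) (e V) -<E (U Int V)> res E U (U Int V) (e U))}) = H1_mod_class X G z"
  unfolding \<epsilon> zc prod.case .
qed

end

section \<open>Tensoring and pulling back extensions\<close>

context rsp
begin

lemma pt_zero_l:
 assumes "pmod M" "pmod N" "op U" "n :<N U>"
 shows "pt M N U 0<M U> n = 0<(tens M N) U>"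
 using bilinD(4)[OF pt_bilin[OF assms(1,2)] assms(3) order_refl _ assms(4), of "0<M U>" "0<U>"] assms by simp

text \<open>Section and retraction are tensored with the identity of \<open>N\<close>. The splitting
  equations hold on pure tensors, hence everywhere. The value of the new section on pure tensors is
  recorded for the later comparison of two splittings.\<close>

lemma split_over_tensor:
 assumes A: "pmod A" and B: "pmod B" and E: "pmod E" and N: "pmod N" and U: "op U"
  and i: "i : mor X A E" and p: "p : mor X E B" and sp: "split_over B A E i p U s r"
 obtains s' r' where
  "split_over (tens B N) (tens A N) (tens E N) (tensor_map X A N E N i (mor_id X N)) (tensor_map X E N B N p (mor_id X N)) U s' r'"
  "!!V b n. op V ==> V <= U ==> b :<B V> ==> n :<N V> ==>
   s' V (pt B N V b n) = pt E N V (s V b) n"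
proof -
 note s = split_overD(1)[OF sp] and r = split_overD(2)[OF sp]
 note TA = tensor_O_module[OF A N] and TB = tensor_O_module[OF B N] and TE = tensor_O_module[OF E N]
 note TA' = omod_pmod[OF TA] and TB' = omod_pmod[OF TB] and TE' = omod_pmod[OF TE]
 let ?i = "tensor_map X A N E N i (mor_id X N)" and ?p = "tensor_map X E N B N p (mor_id X N)"
 note im = tensor_map_props[OF A N E N i mor_id_hom[OF N]] and pm = tensor_map_props[OF E N B N p mor_id_hom[OF N]]
 have idU: "fam' N U (%V m. m) : Hom N N U" by (rule homs_id[OF N])
 obtain s' where s': "s' : Hom (tens B N) (tens E N) U"
  "!!V m n. op V ==> V <= U ==> m :<B V> ==> n :<N V> ==>
   s' V (pt B N V m n) = pt E N V (s V m) (fam' N U (%V m. m) V n)"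
  by (rule tensor_map_ex[OF B N E N U s idU]) (rule that; (assumption | simp))
 obtain r' where r': "r' : Hom (tens E N) (tens A N) U"
  "!!V m n. op V ==> V <= U ==> m :<E V> ==> n :<N V> ==>
   r' V (pt E N V m n) = pt A N V (r V m) (fam' N U (%V m. m) V n)"
  by (rule tensor_map_ex[OF E N A N U r idU]) (rule that; (assumption | simp))
 have sp': "s' V (pt B N V m n) = pt E N V (s V m) n"
  if "op V" "V <= U" "m :<B V>" "n :<N V>" for V m n using s'(2)[OF that] that by simp
 have rp': "r' V (pt E N V m n) = pt A N V (r V m) n"
  if "op V" "V <= U" "m :<E V>" "n :<N V>" for V m n using r'(2)[OF that] that by simp
 have ip: "?i V (pt A N V a n) = pt E N V (i V a) n"
  if "op V" "a :<A V>" "n :<N V>" for V a n using im(2)[OF that] that by simp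
 have pp: "?p V (pt E N V e n) = pt B N V (p V e) n"
  if "op V" "e :<E V>" "n :<N V>" for V e n using pm(2)[OF that] that by simp
 note iU = homs_restrict[OF im(1) U op_pts[OF U]] and pU = homs_restrict[OF pm(1) U op_pts[OF U]]
 note icl = homs_closed[OF i _ op_pts] and pcl = homs_closed[OF p _ op_pts]
 have 1: "fam' (tens A N) U (%V m. r' V (restrict ?i (ops U) V m)) = fam' (tens A N) U (%V m. m)"
 proof (rule tensor_hom_eqI[OF A N TA U homs_comp[OF iU r'(1) TA'] homs_id[OF TA']])
  fix V m n assume V: "op V" "V <= U" and m: "m :<A V>" "n :<N V>"
  show "fam' (tens A N) U (%V m. r' V (restrict ?i (ops U) V m)) V (pt A N V m n) =
    fam' (tens A N) U (%V m. m) V (pt A N V m n)"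
   using V m A N icl[OF V(1) V(1) m(1)] split_overD(3)[OF sp V m(1)] by (simp add: ip rp')
 qed
 have 2: "fam' (tens B N) U (%V m. restrict ?p (ops U) V (s' V m)) = fam' (tens B N) U (%V m. m)"
 proof (rule tensor_hom_eqI[OF B N TB U homs_comp[OF s'(1) pU TB'] homs_id[OF TB']])
  fix V m n assume V: "op V" "V <= U" and m: "m :<B V>" "n :<N V>"
  show "fam' (tens B N) U (%V m. restrict ?p (ops U) V (s' V m)) V (pt B N V m n) =
    fam' (tens B N) U (%V m. m) V (pt B N V m n)"
   using V m B N homs_closed[OF s V m(1)] split_overD(4)[OF sp V m(1)] by (simp add: pp sp')
 qed
 let ?f = "fam' (tens E N) U (%V m. restrict ?i (ops U) V (r' V m))"
 let ?g = "fam' (tens E N) U (%V m. s' V (restrict ?p (ops U) V m))"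
 have f: "?f : Hom (tens E N) (tens E N) U" by (rule homs_comp[OF r'(1) iU TE'])
 have g: "?g : Hom (tens E N) (tens E N) U" by (rule homs_comp[OF pU s'(1) TE'])
 have 3: "fam' (tens E N) U (%V m. ?f V m +<(tens E N) V> ?g V m) = fam' (tens E N) U (%V m. m)"
 proof (rule tensor_hom_eqI[OF E N TE U homs_sum[OF f g TE' TE'] homs_id[OF TE']])
  fix V m n assume V: "op V" "V <= U" and m: "m :<E V>" "n :<N V>"
  note rc = homs_closed[OF r V m(1)] and pc = pcl[OF V(1) V(1) m(1)]
  note sc = homs_closed[OF s V pc] and ic = icl[OF V(1) V(1) rc]
  have "pt E N V (i V (r V m)) n +<(tens E N) V> pt E N V (s V (p V m)) n =
    pt E N V m n"
   using bilinD(2)[OF pt_bilin[OF E N] V(1) order_refl ic m(2) sc] split_overD(5)[OF sp V m(1)] by simp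
  then show "fam' (tens E N) U (%V m. ?f V m +<(tens E N) V> ?g V m) V (pt E N V m n) =
    fam' (tens E N) U (%V m. m) V (pt E N V m n)"
   using V m E N rc pc sc ic by (simp add: pp sp' ip rp')
 qed
 show thesis
 proof (rule that[of s' r'])
  show "split_over (tens B N) (tens A N) (tens E N) ?i ?p U s' r'"
   unfolding split_over_def
  proof (intro conjI s'(1) r'(1) allI impI ballI)
   fix V assume V: "op V & V <= U"
   show "r' V (?i V a) = a" if "a :<(tens A N) V>" for a
    using fun_cong[OF fun_cong[OF 1], of V a] V that by simp
   show "?p V (s' V b) = b" if "b :<(tens B N) V>" for b
    using fun_cong[OF fun_cong[OF 2], of V b] V that by simp
   show "?i V (r' V e) +<(tens E N) V> s' V (?p V e) = e" if "e :<(tens E N) V>" for e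
    using fun_cong[OF fun_cong[OF 3], of V e] V that by simp
  qed
 qed (rule sp')
qed

text \<open>Tensoring is not exact in general; the local splittings are preserved by it and restore
  exactness.\<close>

lemma tensor_extension:
 assumes A: "pmod A" and B: "pmod B" and N: "pmod N" and x: "extension X B A (E, i, p)"
  and split: "!!x. x : pts X ==> \<exists>U s r. op U & x : U & split_over B A E i p U s r"
 shows "extension X (tens B N) (tens A N) (ext_tensor X B A N (E, i, p))"
proof -
 note xx = extensionD[OF x]
 have E: "pmod E" using xx(1) by simp
 note i = xx(2) and p = xx(3)
 let ?i = "tensor_map X A N E N i (mor_id X N)" and ?p = "tensor_map X E N B N p (mor_id X N)"
 note im = tensor_map_props[OF A N E N i mor_id_hom[OF N]] and pm = tensor_map_props[OF E N B N p mor_id_hom[OF N]]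
 note TA = tensor_O_module[OF A N] and TB = tensor_O_module[OF B N] and TE = tensor_O_module[OF E N]
 note TA' = omod_pmod[OF TA] and TB' = omod_pmod[OF TB] and TE' = omod_pmod[OF TE]
 have c: "mor_comp X (tens A N) ?p ?i = fam' (tens A N) (pts X) (%V m. 0<(tens B N) V>)"
 proof (rule tensor_hom_eqI[OF A N TB openin_topspace mor_comp_hom[OF im(1) pm(1) TA'] homs_zero_fam[OF TA' TB']])
  fix V a n assume V: "op V" and a: "a :<A V>" and n: "n :<N V>"
  note ic = homs_closed[OF i V op_pts[OF V] a]
  have "p V (i V a) = 0<B V>" using xx(5)[OF V] a by blast
  then show "mor_comp X (tens A N) ?p ?i V (pt A N V a n) =
    fam' (tens A N) (pts X) (%V m. 0<(tens B N) V>) V (pt A N V a n)"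
   using V a n A N ic im(2)[OF V a n] pm(2)[OF V ic n] by (simp add: pt_zero_l[OF B N])
 qed
 have pi: "?p V (?i V a) = 0<(tens B N) V>" if "op V" "a :<(tens A N) V>" for V a
  using fun_cong[OF fun_cong[OF c], of V a] that by simp
 show ?thesis
  unfolding ext_tensor_def prod.case
 proof (rule extensionI_split[OF TA TB TE im(1) pm(1)])
  show "?p V (?i V a) = 0<(tens B N) V>" if "op V" "a :<(tens A N) V>" for V a
   by (rule pi[OF that])
  fix x assume "x : pts X"
  then obtain U s r where U: "op U" "x : U" "split_over B A E i p U s r" using split by blast
  obtain s' r' where "split_over (tens B N) (tens A N) (tens E N) ?i ?p U s' r'"
   by (rule split_over_tensor[OF A B E N U(1) i p U(3)]) (rule that; (assumption | simp))
  then show "\<exists>U s r. op U & x : U & split_over (tens B N) (tens A N) (tens E N) ?i ?p U s r"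
   using U by blast
 qed
qed

text \<open>The fibre product that \<open>ext_pullback\<close> builds in place; with a name its
  sheaf property can be stated.\<close>

definition pb :: "('x, 'r, 'e) omod => ('x, 'r, 'c) omod => ('x, 'e, 'b) fam => ('x, 'c, 'b) fam => ('x, 'r, 'e \<times> 'c) omod"
 where "pb E C p g = \<lparr>sec = (%U. \<lparr>carrier = {(e, c). e :<E U> & c :<C U> & p U e = g U c},
    mult = undefined, one = undefined,
    zero = (0<E U>, 0<C U>),
    add = (\<lambda>(e, c) (e', c'). (e +<E U> e', c +<C U> c')),
    smult = (\<lambda>a (e, c). (a *<E U> e, a *<C U> c))\<rparr>),
   res = (%U V. map_prod (res E U V) (res C U V))\<rparr>"

lemma pb_simps:
 "(e, c) :<(pb E C p g) U> \<longleftrightarrow> e :<E U> & c :<C U> & p U e = g U c"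
 "0<(pb E C p g) U> = (0<E U>, 0<C U>)"
 "(e, c) +<(pb E C p g) U> (e', c') = (e +<E U> e', c +<C U> c')"
 "a *<(pb E C p g) U> (e, c) = (a *<E U> e, a *<C U> c)"
 "res (pb E C p g) U V (e, c) = (res E U V e, res C U V c)"
 by (simp_all add: pb_def)

lemma ext_pullback_pb:
 "ext_pullback X C A g (E, i, p) = (pb E C p g, fam' A (pts X) (%U a. (i U a, 0<C U>)),
  fam' (pb E C p g) (pts X) (%U z. snd z))"
 by (simp add: ext_pullback_def pb_def Let_def)

lemma pb_O_module:
 assumes E: "omod E" and C: "omod C" and B: "omod B" and p: "p : mor X E B" and g: "g : mor X C B"
 shows "omod (pb E C p g)"
proof -
 have E': "pmod E" and C': "pmod C" and B': "pmod B" using E C B by auto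
 let ?P = "pb E C p g"
 note h = homs_add[OF p _ op_pts] homs_add[OF g _ op_pts] homs_smult[OF p _ op_pts] homs_smult[OF g _ op_pts]
  homs_res[OF p _ op_pts] homs_res[OF g _ op_pts]
 have presh: "presheaf_on (tsp X) (mcar ?P) (res ?P)"
  unfolding presheaf_on_def
 proof (intro conjI allI impI funcsetI ballI)
  show "res ?P U V z :<?P V>" if "op U & op V & V <= U" "z :<?P U>" for U V z
   using that E' C' by (cases z) (simp add: pb_simps h)
  show "res ?P U U z = z" if "op U" "z :<?P U>" for U z
   using that E' C' by (cases z) (simp add: pb_simps)
  show "res ?P V W (res ?P U V z) = res ?P U W z" if "op U & op V & op W & W <= V & V <= U" "z :<?P U>" for U V W z
   using that E' C' by (cases z) (simp add: pb_simps)
 qed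
 have mod: "module (osec X U) (sec ?P U)" if U: "op U" for U
 proof -
  interpret ME: module "osec X U" "sec E U" by (rule pm_module[OF E' U])
  interpret MC: module "osec X U" "sec C U" by (rule pm_module[OF C' U])
  show ?thesis
  proof (intro moduleI abelian_groupI O_cring[OF U])
   show "0<?P U> :<?P U>"
    using homs_zero[OF p U op_pts[OF U] E' B'] homs_zero[OF g U op_pts[OF U] C' B'] by (simp add: pb_simps)
   fix x assume "x :<?P U>"
   then obtain e c where x: "x = (e, c)" "e :<E U>" "c :<C U>" "p U e = g U c"
    by (cases x) (simp add: pb_simps)
   show "0<?P U> +<?P U> x = x" "1<U> *<?P U> x = x"
    using x by (simp_all add: pb_simps)
   show "EX y:mcar ?P U. y +<?P U> x = 0<?P U>"
    using x homs_neg[OF p U op_pts[OF U] E' B' x(2)] homs_neg[OF g U op_pts[OF U] C' B' x(3)]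
    by (intro bexI[of _ "(\<ominus>\<^bsub>sec E U\<^esub> e, \<ominus>\<^bsub>sec C U\<^esub> c)"]) (simp_all add: pb_simps ME.l_neg MC.l_neg)
   {
    fix a assume a: "a :<U>"
    show "a *<?P U> x :<?P U>" using a x U by (simp add: pb_simps h)
    fix b assume b: "b :<U>"
    show "(a +<U> b) *<?P U> x = a *<?P U> x +<?P U> b *<?P U> x"
     "(a *<U> b) *<?P U> x = a *<?P U> (b *<?P U> x)"
     using a b x by (simp_all add: pb_simps ME.smult_l_distr MC.smult_l_distr ME.smult_assoc1 MC.smult_assoc1)
   }
   fix y assume "y :<?P U>"
   then obtain e' c' where y: "y = (e', c')" "e' :<E U>" "c' :<C U>" "p U e' = g U c'"
    by (cases y) (simp add: pb_simps)
   show "x +<?P U> y :<?P U>" using x y U by (simp add: pb_simps h)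
   show "x +<?P U> y = y +<?P U> x" using x y by (simp add: pb_simps ME.a_comm MC.a_comm)
   show "a *<?P U> (x +<?P U> y) = a *<?P U> x +<?P U> a *<?P U> y"
    if "a :<U>" for a using that x y by (simp add: pb_simps ME.smult_r_distr MC.smult_r_distr)
   fix z assume "z :<?P U>"
   then obtain e'' c'' where z: "z = (e'', c'')" "e'' :<E U>" "c'' :<C U>"
    by (cases z) (simp add: pb_simps)
   show "x +<?P U> y +<?P U> z = x +<?P U> (y +<?P U> z)"
    using x y z by (simp add: pb_simps ME.a_assoc MC.a_assoc)
  qed
 qed
 have pm: "pmod ?P"
  unfolding pmodule_def
 proof (intro conjI allI impI ballI presh mod)
  fix U V x assume "op U & V : ops U" and x: "x :<?P U>"
  then have U: "op U" "op V" "V <= U" by auto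
  show "res ?P U V (x +<?P U> y) = res ?P U V x +<?P V> res ?P U V y" if "y :<?P U>" for y
   using that x U E' C' by (cases x; cases y) (simp add: pb_simps)
  show "res ?P U V (a *<?P U> x) = rs U V a *<?P V> res ?P U V x" if "a :<U>" for a
   using that x U E' C' by (cases x) (simp add: pb_simps)
 qed
 show ?thesis
  unfolding O_module_iff
 proof (intro conjI pm sheaf_onI presh)
  fix K s assume K: "!!V. V : K ==> op V" and s: "!!V. V : K ==> s V :<?P V>"
   and agree: "!!V W. V : K ==> W : K ==> res ?P V (V Int W) (s V) = res ?P W (V Int W) (s W)"
  have s': "fst (s V) :<E V>" "snd (s V) :<C V>" "p V (fst (s V)) = g V (snd (s V))" if "V : K" for V
   using s[OF that] by (cases "s V"; simp add: pb_simps)+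
  have agree': "res E V (V Int W) (fst (s V)) = res E W (V Int W) (fst (s W))"
   "res C V (V Int W) (snd (s V)) = res C W (V Int W) (snd (s W))" if "V : K" "W : K" for V W
   using agree[OF that] by (cases "s V"; cases "s W"; simp add: pb_simps)+
  have oU: "op (\<Union>K)" using K by blast
  obtain e where e: "e :<E (\<Union>V\<in>K. V)>" "!!V. V : K ==> res E (\<Union>V\<in>K. V) V e = fst (s V)"
   by (rule sheaf_glue[OF E, of K "%V. V" "%V. fst (s V)"]) (use K s' agree' in \<open>auto intro: that\<close>)
  obtain c where c: "c :<C (\<Union>V\<in>K. V)>" "!!V. V : K ==> res C (\<Union>V\<in>K. V) V c = snd (s V)"
   by (rule sheaf_glue[OF C, of K "%V. V" "%V. snd (s V)"]) (use K s' agree' in \<open>auto intro: that\<close>)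
  have e': "e :<E (\<Union>K)>" and c': "c :<C (\<Union>K)>" using e c by simp_all
  \<comment> \<open>The two components have been glued separately. The fibre condition holds over
    each member of the cover and hence globally, because \<open>B\<close> is a sheaf.\<close>
  have "p (\<Union>K) e = g (\<Union>K) c"
  proof (rule sheaf_eqI[OF B oU homs_closed[OF p oU op_pts[OF oU] e'] homs_closed[OF g oU op_pts[OF oU] c']])
   fix x assume "x : \<Union>K"
   then obtain V where V: "V : K" "x : V" by blast
   have sub: "V <= \<Union>K" using V by blast
   have "res B (\<Union>K) V (p (\<Union>K) e) = res B (\<Union>K) V (g (\<Union>K) c)"
    using homs_res[OF p oU op_pts[OF oU] K[OF V(1)] sub e'] homs_res[OF g oU op_pts[OF oU] K[OF V(1)] sub c']
     e(2)[OF V(1)] c(2)[OF V(1)] s'(3)[OF V(1)] by simp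
   then show "\<exists>V. op V & x : V & V <= \<Union>K & res B (\<Union>K) V (p (\<Union>K) e) = res B (\<Union>K) V (g (\<Union>K) c)"
    using K V sub by blast
  qed
  then show "EX t:mcar ?P (\<Union>K). ALL V:K. res ?P (\<Union>K) V t = s V"
   using e' c' e(2) c(2) by (intro bexI[of _ "(e, c)"]) (simp_all add: pb_simps)
 next
  fix K t t' assume K: "!!V. V : K ==> op V" and t: "t :<?P (\<Union>K)>" "t' :<?P (\<Union>K)>"
   and agree: "!!V. V : K ==> res ?P (\<Union>K) V t = res ?P (\<Union>K) V t'"
  have oU: "op (\<Union>K)" using K by blast
  obtain e c e' c' where tt: "t = (e, c)" "t' = (e', c')" by (cases t; cases t')
  have m: "e :<E (\<Union>K)>" "c :<C (\<Union>K)>" "e' :<E (\<Union>K)>" "c' :<C (\<Union>K)>"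
   using t by (simp_all add: tt pb_simps)
  have "e = e'"
   by (rule sheaf_eqI[OF E oU m(1,3)]) (use K agree in \<open>auto simp: tt pb_simps\<close>)
  moreover have "c = c'"
   by (rule sheaf_eqI[OF C oU m(2,4)]) (use K agree in \<open>auto simp: tt pb_simps\<close>)
  ultimately show "t = t'" by (simp add: tt)
 qed
qed

text \<open>A local lift of a section \<open>c\<close> is a pair: a local preimage under
  \<open>p\<close> of \<open>g c\<close>, together with the restriction of \<open>c\<close>. The
  kernel consists of the pairs with second entry 0, which is a copy of the kernel of
  \<open>p\<close>.\<close>

lemma pullback_extension:
 assumes A: "omod A" and B: "omod B" and C: "omod C"
  and x: "extension X B A (E, i, p)" and g: "g : mor X C B"
 shows "extension X C A (ext_pullback X C A g (E, i, p))"
 unfolding ext_pullback_pb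
proof -
 note xx = extensionD[OF x]
 have E': "pmod E" and C': "pmod C" and B': "pmod B" and A': "pmod A" using xx(1) C B A by auto
 let ?P = "pb E C p g" and ?i = "fam' A (pts X) (%U a. (i U a, 0<C U>))" and ?p = "fam' (pb E C p g) (pts X) (%U z. snd z)"
 note P = pb_O_module[OF xx(1) C B xx(3) g]
 note P' = omod_pmod[OF P]
 have pi: "p U (i U a) = 0<B U>" if "op U" "a :<A U>" for U a using xx(5)[OF that(1)] that(2) by blast
 have ic: "i U a :<E U>" if "op U" "a :<A U>" for U a by (rule homs_closed[OF xx(2) that(1) op_pts[OF that(1)] that(2)])
 have gz: "g U 0<C U> = 0<B U>" if "op U" for U by (rule homs_zero[OF g that op_pts[OF that] C' B'])
 show "extension X C A (?P, ?i, ?p)"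
  unfolding extension_def prod.case
 proof (intro conjI ballI P)
  show "?i : mor X A ?P"
   by (rule homsI[OF A'])
    (use C' in \<open>simp_all add: pb_simps pi ic gz homs_add[OF xx(2)] homs_smult[OF xx(2)] homs_res[OF xx(2)]\<close>)
  show "?p : mor X ?P C"
  proof (rule homsI[OF P'])
   fix V z assume V: "op V" and z: "z :<?P V>"
   show "snd z :<C V>" using z by (cases z) (simp add: pb_simps)
   show "snd (z +<?P V> w) = snd z +<C V> snd w" for w by (cases z; cases w) (simp add: pb_simps)
   show "snd (a *<?P V> z) = a *<C V> snd z" for a by (cases z) (simp add: pb_simps)
   show "snd (res ?P V W z) = res C V W (snd z)" for W by (cases z) (simp add: pb_simps)
  qed
  fix U assume "U : ops (pts X)"
  then have U: "op U" "U <= pts X" by auto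
  show "inj_on (?i U) (mcar A U)"
   by (rule inj_onI) (use inj_onD[OF xx(4)[OF U(1)]] U in auto)
  show "?i U ` mcar A U = {e : mcar ?P U. ?p U e = 0<C U>}"
  proof
   show "?i U ` mcar A U <= {e : mcar ?P U. ?p U e = 0<C U>}"
    using U ic pi gz C' by (auto simp: pb_simps)
   show "{e : mcar ?P U. ?p U e = 0<C U>} <= ?i U ` mcar A U"
   proof
    fix z assume "z : {e : mcar ?P U. ?p U e = 0<C U>}"
    then have z: "z :<?P U>" "snd z = 0<C U>" using U by auto
    then obtain e where e: "z = (e, 0<C U>)" "e :<E U>" "p U e = 0<B U>"
     using gz[OF U(1)] by (cases z) (auto simp: pb_simps)
    then obtain a where "a :<A U>" "e = i U a" using xx(5)[OF U(1)] by blast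
    then show "z : ?i U ` mcar A U" using e U by (intro image_eqI[of _ _ a]) auto
   qed
  qed
  fix c x assume c: "c :<C U>" and x: "x : U"
  from xx(6)[OF U(1) homs_closed[OF g U c] x]
  obtain V e where V: "op V" "V <= U" "x : V" "e :<E V>" "p V e = res B U V (g U c)" by auto
  have m: "(e, res C U V c) :<?P V>"
   using V U c C' homs_res[OF g U V(1,2) c] by (simp add: pb_simps)
  show "EX V:ops U. x : V & (EX e:mcar ?P V. ?p V e = res C U V c)"
   using V m by (intro bexI[of _ V] conjI bexI[of _ "(e, res C U V c)"]) auto
 qed
qed

section \<open>Duals and endomorphisms\<close>

subsection \<open>The contraction isomorphism\<close>

lemma pm_res_finsum:
 assumes M: "pmod M" and U: "op U" "op V" "V <= U" and A: "finite A" "f : A \<rightarrow> mcar M U"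
 shows "res M U V (finsum (sec M U) f A) = finsum (sec M V) (%j. res M U V (f j)) A"
proof -
 interpret M: module "osec X U" "sec M U" by (rule pm_module[OF M U(1)])
 interpret N: module "osec X V" "sec M V" by (rule pm_module[OF M U(2)])
 show ?thesis using A
 proof (induction A)
  case (insert x F)
  then have "(%j. res M U V (f j)) : F \<rightarrow> mcar M V" using M U by (auto simp: Pi_iff)
  with insert show ?case using M U by simp
 qed (use M U in simp)
qed

lemma pt_finsum_r:
 assumes M: "pmod M" and N: "pmod N" and U: "op U" and m: "m :<M U>" and A: "finite A" "f : A \<rightarrow> mcar N U"
 shows "pt M N U m (finsum (sec N U) f A) = finsum (sec (tens M N) U) (%j. pt M N U m (f j)) A"
proof -
 note T = omod_pmod[OF tensor_O_module[OF M N]]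
 interpret N: module "osec X U" "sec N U" by (rule pm_module[OF N U])
 interpret T: module "osec X U" "sec (tens M N) U" by (rule pm_module[OF T U])
 note b = bilinD[OF pt_bilin[OF M N] U order_refl m]
 show ?thesis using A
 proof (induction A)
  case empty
  show ?case using b(5)[OF N.zero_closed, of "0<U>"] M N U m by simp
 next
  case (insert x F)
  have fx: "f x :<N U>" "f : F \<rightarrow> mcar N U" using insert by auto
  then have "(%j. pt M N U m (f j)) : F \<rightarrow> mcar (tens M N) U" using M N U m by (auto simp: Pi_iff)
  then show ?case using insert fx M N U m b(3)[OF fx(1), of "finsum (sec N U) f F"] by simp
 qed
qed

lemma hom_finsum_apply:
 assumes M: "pmod M" and N: "pmod N" and U: "op U" and V: "op V" "V <= U" and m: "m :<M V>"
  and A: "finite A" "f : A \<rightarrow> Hom M N U"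
 shows "(finsum (sec (hom_sheaf X M N) U) f A) V m = finsum (sec N V) (%j. f j V m) A"
proof -
 interpret N: module "osec X V" "sec N V" by (rule pm_module[OF N V(1)])
 interpret H: module "osec X U" "sec (hom_sheaf X M N) U" by (rule pm_module[OF hom_sheaf_pmodule[OF M N] U])
 show ?thesis using A
 proof (induction A)
  case empty
  show ?case using V m by (simp only: H.finsum_empty N.finsum_empty) simp
 next
  case (insert x F)
  have fx: "f x :<(hom_sheaf X M N) U>" "f : F \<rightarrow> mcar (hom_sheaf X M N) U" using insert by auto
  have c: "(%j. f j V m) : F \<rightarrow> mcar N V" "f x V m :<N V>"
   using insert.prems homs_closed[OF _ V m] by (auto simp: Pi_def)
  have "(finsum (sec (hom_sheaf X M N) U) f (insert x F)) V m =
    (f x +<(hom_sheaf X M N) U> finsum (sec (hom_sheaf X M N) U) f F) V m"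
   using H.finsum_insert[OF insert.hyps fx(2,1)] by simp
  also have "\<dots> = f x V m +<N V> (finsum (sec (hom_sheaf X M N) U) f F) V m" using V m by simp
  also have "\<dots> = finsum (sec N V) (%j. f j V m) (insert x F)"
   using insert N.finsum_insert[OF insert.hyps c] by auto
  finally show ?case .
 qed
qed

text \<open>A dual basis over a trivializing open set: \<open>v j\<close> is the image of the j-th
  unit vector and \<open>q j\<close> is the j-th coordinate of the inverse of the
  trivialization.\<close>

lemma local_basis:
 assumes B: "locally_free X B" and x: "x : pts X"
 obtains U n v q where "op U" "x : U" "\<forall>j<n::nat. v j :<B U>" "\<forall>j<n. q j : Hom B (ox X) U"
  "\<forall>V w. op V & V <= U & w :<B V> --> w = finsum (sec B V) (%j. q j V w *<B V> res B U V (v j)) {..<n}"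
proof -
 have B': "pmod B" using B by (simp add: locally_free_def)
 obtain U n p where U: "op U" "x : U" and p: "iso_over X (free_sheaf X n) B U p"
  using B x unfolding locally_free_def by blast
 let ?F = "free_sheaf X n"
 have ph: "p : Hom ?F B U" and bij: "!!V. op V ==> V <= U ==> bij_betw (p V) (mcar ?F V) (mcar B V)"
  using p by (auto simp: iso_over_def)
 have Fc: "mcar ?F V = {..<n} \<rightarrow>\<^sub>E \<O> V" for V by (simp add: free_sheaf_def)
 have Fadd: "f +<?F V> g = (\<lambda>i\<in>{..<n}. f i +<V> g i)" for f g V by (simp add: free_sheaf_def)
 have Fsm: "a *<?F V> f = (\<lambda>i\<in>{..<n}. a *<V> f i)" for a f V by (simp add: free_sheaf_def)
 have Fres: "res ?F V W f = (\<lambda>i\<in>{..<n}. rs V W (f i))" for f V W by (simp add: free_sheaf_def)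
 define dl where "dl V j = (\<lambda>i\<in>{..<n}. if i = j then 1<V> else 0<V>)" for V and j :: nat
 have dlF: "dl V j :<?F V>" if "op V" for V j using that by (auto simp: Fc dl_def)
 have dlr: "res ?F U V (dl U j) = dl V j" if "op V" "V <= U" for V j
  unfolding Fres dl_def by (intro restrict_ext) (use that U in auto)
 define v where "v j = p U (dl U j)" for j
 define J where "J V = inv_into (mcar ?F V) (p V)" for V
 have J: "J V w :<?F V>" "p V (J V w) = w" if "op V" "V <= U" "w :<B V>" for V w
  using bij[OF that(1,2)] that(3) unfolding J_def by (auto simp: bij_betw_def inv_into_into f_inv_into_f)
 have Juniq: "J V w = f" if "op V" "V <= U" "f :<?F V>" "p V f = w" for V w f
  using bij[OF that(1,2)] that(3,4) unfolding J_def by (auto simp: bij_betw_def)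
 have Jc: "J V w i :<V>" if "op V" "V <= U" "w :<B V>" "i < n" for V w i
  using J(1)[OF that(1-3)] that(4) by (auto simp: Fc)
 define q where "q j = fam' B U (%V w. J V w j)" for j
 have q: "q j : Hom B (ox X) U" if j: "j < n" for j
  unfolding q_def
 proof (rule homsI[OF B'])
  fix V w assume V: "op V" "V <= U" and w: "w :<B V>"
  show "J V w j :<(ox X) V>" using Jc[OF V w j] by simp
  show "J V (w +<B V> w') j = J V w j +<(ox X) V> J V w' j" if w': "w' :<B V>" for w'
  proof -
   have "J V (w +<B V> w') = J V w +<?F V> J V w'"
    by (rule Juniq[OF V]) (use V w w' homs_add[OF ph V J(1)[OF V w] J(1)[OF V w']] J(2)[OF V] Jc[OF V] in \<open>auto simp: Fadd Fc\<close>)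
   then show ?thesis using j by (simp add: Fadd)
  qed
  show "J V (a *<B V> w) j = a *<(ox X) V> J V w j" if a: "a :<V>" for a
  proof -
   have "J V (a *<B V> w) = a *<?F V> J V w"
    by (rule Juniq[OF V]) (use V w a homs_smult[OF ph V a J(1)[OF V w]] J(2)[OF V] Jc[OF V] in \<open>auto simp: Fsm Fc\<close>)
   then show ?thesis using j by (simp add: Fsm)
  qed
  show "J W (res B V W w) j = res (ox X) V W (J V w j)" if W: "op W" "W <= V" for W
  proof -
   have WU: "W <= U" using W V by blast
   have "J W (res B V W w) = res ?F V W (J V w)"
    by (rule Juniq[OF W(1) WU]) (use V w W homs_res[OF ph V W J(1)[OF V w]] J(2)[OF V] Jc[OF V] in \<open>auto simp: Fres Fc\<close>)
   then show ?thesis using j by (simp add: Fres)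
  qed
 qed
 have "w = finsum (sec B V) (%j. q j V w *<B V> res B U V (v j)) {..<n}"
  if V: "op V" "V <= U" and w: "w :<B V>" for V w
 proof -
  interpret M: module "osec X V" "sec B V" by (rule pm_module[OF B' V(1)])
  let ?f = "J V w"
  have fi: "?f i :<V>" if "i < n" for i by (rule Jc[OF V w that])
  have vr: "res B U V (v j) = p V (dl V j)" for j
   using homs_res[OF ph U(1) order_refl V dlF[OF U(1)], of j] dlr[OF V] by (simp add: v_def)
  have vB: "p V (dl V j) :<B V>" for j by (rule homs_closed[OF ph V dlF[OF V(1)]])
  \<comment> \<open>Truncations of the coordinate vector. The basis expansion is proved by induction
    on their length with sums formed inside \<open>B\<close>, so no finite sums in
    \<open>free_sheaf\<close> have to be set up. At \<open>k = n\<close> the truncation is the whole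
    vector.\<close>
  define tr where "tr k = (\<lambda>i\<in>{..<n}. if i < k then ?f i else 0<V>)" for k
  have trF: "tr k :<?F V>" for k using fi V by (auto simp: tr_def Fc)
  have "p V (tr k) = finsum (sec B V) (%j. ?f j *<B V> p V (dl V j)) {..<k}" if "k \<le> n" for k
   using that
  proof (induction k)
   case 0
   have "0<V> *<?F V> tr 0 = tr 0" unfolding Fsm tr_def by (intro restrict_ext) (use V in auto)
   then have "p V (tr 0) = 0<B V>"
    using homs_smult[OF ph V _ trF, of "0<V>" 0] homs_closed[OF ph V trF] by simp
   then show ?case by simp
  next
   case (Suc k)
   have k: "k < n" using Suc by simp
   have "tr (Suc k) = tr k +<?F V> (?f k *<?F V> dl V k)"
    unfolding Fadd Fsm tr_def dl_def by (intro restrict_ext) (use fi k V in \<open>auto simp: less_Suc_eq\<close>)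
   moreover have "?f k *<?F V> dl V k :<?F V>" using fi[OF k] V by (auto simp: Fsm Fc dl_def)
   ultimately have "p V (tr (Suc k)) = p V (tr k) +<B V> ?f k *<B V> p V (dl V k)"
    using homs_add[OF ph V trF] homs_smult[OF ph V fi[OF k] dlF[OF V(1)]] by simp
   also have "\<dots> = finsum (sec B V) (%j. ?f j *<B V> p V (dl V j)) {..<Suc k}"
   proof -
    have "(%j. ?f j *<B V> p V (dl V j)) : {..<k} \<rightarrow> mcar B V" using fi k vB by auto
    moreover have "?f k *<B V> p V (dl V k) :<B V>" using fi[OF k] vB by simp
    ultimately show ?thesis using Suc k by (simp add: lessThan_Suc M.a_comm M.finsum_closed)
   qed
   finally show ?case .
  qed
  moreover have "tr n = ?f"
   using J(1)[OF V w] unfolding tr_def Fc PiE_def by (auto simp: fun_eq_iff extensional_def)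
  ultimately have e: "w = finsum (sec B V) (%j. ?f j *<B V> p V (dl V j)) {..<n}"
   using J(2)[OF V w] by (metis order_refl)
  have "finsum (sec B V) (%j. ?f j *<B V> p V (dl V j)) {..<n} =
    finsum (sec B V) (%j. q j V w *<B V> res B U V (v j)) {..<n}"
  proof (rule M.finsum_cong')
   show "(%j. q j V w *<B V> res B U V (v j)) : {..<n} \<rightarrow> mcar B V"
    unfolding vr using fi vB V w by (auto simp: q_def)
   show "?f j *<B V> p V (dl V j) = q j V w *<B V> res B U V (v j)" if "j : {..<n}" for j
    unfolding vr using V w by (simp add: q_def)
  qed simp
  with e show ?thesis by simp
 qed
 moreover have "v j :<B U>" for j unfolding v_def by (rule homs_closed[OF ph U(1) order_refl dlF[OF U(1)]])
 ultimately show thesis using q by (intro that[OF U, of n v q]) auto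
qed

lemma contraction_bilin:
 assumes B: "pmod B"
 shows "bilin B (dual X B) (End B) U (%U v l. fam' B U (%W w. l W w *<B W> res B U W v))"
proof (rule bilinI)
 fix V v l assume V: "op V" and v: "v :<B V>" and "l :<(dual X B) V>"
 then have l: "l : Hom B (ox X) V" by simp
 have lc: "l W w :<W>" if "op W" "W <= V" "w :<B W>" for W w
  using homs_closed[OF l that] by simp
 have "fam' B V (%W w. l W w *<B W> res B V W v) : Hom B B V"
 proof (rule homsI[OF B])
  fix W w assume W: "op W" "W <= V" and w: "w :<B W>"
  have vW: "res B V W v :<B W>" using v V W B by simp
  show "l W w *<B W> res B V W v :<B W>" using lc[OF W w] vW B W by simp
  show "l W (w +<B W> w') *<B W> res B V W v =
    l W w *<B W> res B V W v +<B W> l W w' *<B W> res B V W v" if "w' :<B W>" for w'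
   using homs_add[OF l W w that] lc[OF W w] lc[OF W that] vW B W by (simp add: pm_smult_add)
  show "l W (a *<B W> w) *<B W> res B V W v = a *<B W> (l W w *<B W> res B V W v)"
   if "a :<W>" for a
   using homs_smult[OF l W that w] lc[OF W w] that vW B W by (simp add: pm_smult_smult)
  show "l Y (res B W Y w) *<B Y> res B V Y v = res B W Y (l W w *<B W> res B V W v)"
   if Y: "op Y" "Y <= W" for Y
   using homs_res[OF l W Y w] lc[OF W w] vW B W Y V v by simp
 qed
 then show "fam' B V (%W w. l W w *<B W> res B V W v) :<(End B) V>" by simp
 show "fam' B V (%W w. l W w *<B W> res B V W (v +<B V> v')) =
   fam' B V (%W w. l W w *<B W> res B V W v) +<(End B) V>
   fam' B V (%W w. l W w *<B W> res B V W v')" if v': "v' :<B V>" for v'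
  unfolding hom_simps by (intro restrict_ext) (use V v v' B lc in \<open>simp add: pm_smult_add\<close>)
 show "fam' B V (%W w. (l +<(dual X B) V> l') W w *<B W> res B V W v) =
   fam' B V (%W w. l W w *<B W> res B V W v) +<(End B) V>
   fam' B V (%W w. l' W w *<B W> res B V W v)" if "l' :<(dual X B) V>" for l'
 proof -
  have l': "l' W w :<W>" if "op W" "W <= V" "w :<B W>" for W w
   using homs_closed[of l' B "ox X" V W w] that \<open>l' :<(dual X B) V>\<close> by simp
  show ?thesis unfolding hom_simps by (intro restrict_ext) (use V v B lc l' in \<open>simp add: pm_smult_add\<close>)
 qed
 fix a assume a: "a :<V>"
 show "fam' B V (%W w. l W w *<B W> res B V W (a *<B V> v)) =
   a *<(End B) V> fam' B V (%W w. l W w *<B W> res B V W v)"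
  unfolding hom_simps by (intro restrict_ext) (use V v B lc a in \<open>simp add: pm_smult_commute\<close>)
 show "fam' B V (%W w. (a *<(dual X B) V> l) W w *<B W> res B V W v) =
   a *<(End B) V> fam' B V (%W w. l W w *<B W> res B V W v)"
  unfolding hom_simps by (intro restrict_ext) (use V v B lc a in \<open>simp add: pm_smult_smult\<close>)
next
 fix V W v l assume V: "op V" and W: "op W" "W <= V" and v: "v :<B V>"
 have s: "Y <= V" if "Y : ops W" for Y using that W by auto
 show "fam' B W (%Y w. res (dual X B) V W l Y w *<B Y> res B W Y (res B V W v)) =
   res (End B) V W (fam' B V (%Y w. l Y w *<B Y> res B V Y v))"
  unfolding hom_simps restrict_restrict opens_Int_subset[OF W(2)]
  by (intro restrict_ext) (use V W v B s in simp)
qed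

lemma end_contraction_props:
 assumes B: "pmod B" "omod B"
 shows "end_contraction X B : mor X (tens B (dual X B)) (End B)"
  "!!V v l. op V ==> v :<B V> ==> l : Hom B (ox X) V ==>
   end_contraction X B V (pt B (dual X B) V v l) = fam' B V (%W w. l W w *<B W> res B V W v)"
proof -
 have D: "pmod (dual X B)" by (intro hom_sheaf_pmodule B) simp
 note t = tensor_lift_props[OF B(1) D hom_sheaf_O_module[OF B] contraction_bilin[OF B(1)], folded end_contraction_def]
 show "end_contraction X B : mor X (tens B (dual X B)) (End B)" by (rule t(1))
 show "end_contraction X B V (pt B (dual X B) V v l) = fam' B V (%W w. l W w *<B W> res B V W v)"
  if "op V" "v :<B V>" "l : Hom B (ox X) V" for V v l
  by (rule t(2)[OF that(1,2)]) (use that in simp)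
qed

end

context rsp
begin

text \<open>With a dual basis \<open>v j\<close>, \<open>d j\<close> over \<open>U\<close> the
  inverse sends an endomorphism \<open>p\<close> to the sum of the tensors
  \<open>p(v j) \<otimes> d j\<close>. That such inverses exist near every point suffices by
  \<open>local_iso\<close>.\<close>

lemma end_contraction_iso:
 assumes lf: "locally_free X B"
 shows "mor_iso X (tens B (dual X B)) (End B) (end_contraction X B)"
proof -
 have BO: "omod B" using lf by (simp add: locally_free_def)
 then have B: "pmod B" by simp
 have D: "pmod (dual X B)" by (intro hom_sheaf_pmodule B) simp
 have EB: "omod (End B)" by (rule hom_sheaf_O_module[OF B BO])
 let ?T = "tens B (dual X B)" and ?q = "end_contraction X B"
 note T = tensor_O_module[OF B D]
 note T' = omod_pmod[OF T] and EB' = omod_pmod[OF EB]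
 note q = end_contraction_props[OF B BO]
 show ?thesis
 proof (rule local_iso[OF T EB q(1)])
  fix x assume x: "x : pts X"
  obtain U n v d where U: "op U" "x : U" and v: "\<forall>j<n::nat. v j :<B U>" and d: "\<forall>j<n. d j : Hom B (ox X) U"
   and basis: "\<forall>V w. op V & V <= U & w :<B V> --> w = finsum (sec B V) (%j. d j V w *<B V> res B U V (v j)) {..<n}"
   by (rule local_basis[OF lf x])
  define d' where "d' V j = restrict (d j) (ops V)" for V j
  define v' where "v' V j = res B U V (v j)" for V j
  have d': "d' V j : Hom B (ox X) V" if "op V" "V <= U" "j < n" for V j
   unfolding d'_def using homs_restrict[of "d j" B "ox X" U V] d that by simp
  have d'c: "d' V j W w :<W>" if "op V" "V <= U" "j < n" "op W" "W <= V" "w :<B W>" for V j W w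
   using homs_closed[OF d'[OF that(1-3)] that(4-6)] by simp
  have v': "v' V j :<B V>" if "op V" "V <= U" "j < n" for V j
   unfolding v'_def using v U B that by simp
  have v'r: "res B V W (v' V j) = v' W j" if "op V" "V <= U" "op W" "W <= V" "j < n" for V W j
   unfolding v'_def using v U B that by simp
  have basis': "finsum (sec B W) (%j. d' V j W w *<B W> v' W j) {..<n} = w"
   if V: "op V" "V <= U" and W: "op W" "W <= V" "w :<B W>" for V W w
  proof -
   have "W <= U" using V W by blast
   then show ?thesis using basis[rule_format, of W w] W by (simp add: d'_def v'_def)
  qed
  define pr where "pr V p j = pt B (dual X B) V (p V (v' V j)) (d' V j)" for V p j
  have pr: "pr V p j :<?T V>" if "op V" "V <= U" "p : Hom B B V" "j < n" for V p j
   unfolding pr_def using pt_closed[OF B D that(1), of "p V (v' V j)" "d' V j"] homs_closed[OF that(3,1) order_refl v'[OF that(1,2,4)]]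
    d'[OF that(1,2,4)] by simp
  define z where "z V p = finsum (sec ?T V) (pr V p) {..<n}" for V p
  have prF: "pr V p : {..<n} \<rightarrow> mcar ?T V" if "op V" "V <= U" "p : Hom B B V" for V p
   using pr[OF that] by simp
  have z: "fam' (End B) U z : Hom (End B) ?T U"
  proof (rule homsI[OF EB'])
   fix V p assume V: "op V" "V <= U" and "p :<(End B) V>"
   then have p: "p : Hom B B V" by simp
   interpret TV: module "osec X V" "sec ?T V" by (rule pm_module[OF T' V(1)])
   note bil = bilinD[OF pt_bilin[OF B D] V(1) order_refl homs_closed[OF p V(1) order_refl]]
   show "z V p :<?T V>" unfolding z_def by (rule TV.finsum_closed[OF prF[OF V p]])
   show "z V (p +<(End B) V> f) = z V p +<?T V> z V f" if "f :<(End B) V>" for f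
   proof -
    have f: "f : Hom B B V" using that by simp
    have "z V (p +<(End B) V> f) = finsum (sec ?T V) (%j. pr V p j +<?T V> pr V f j) {..<n}"
     unfolding z_def
    proof (rule TV.finsum_cong')
     show "pr V (p +<(End B) V> f) j = pr V p j +<?T V> pr V f j" if "j : {..<n}" for j
     proof -
      have j: "j < n" using that by simp
      have "d' V j :<(dual X B) V>" using d'[OF V j] by simp
      from bil(2)[OF v'[OF V j] this homs_closed[OF f V(1) order_refl v'[OF V j]]]
      show ?thesis using V v'[OF V j] by (simp add: pr_def)
     qed
    qed (use prF[OF V p] prF[OF V f] in \<open>auto simp: Pi_iff\<close>)
    also have "\<dots> = z V p +<?T V> z V f"
     unfolding z_def by (rule TV.finsum_addf[OF prF[OF V p] prF[OF V f]])
    finally show ?thesis .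
   qed
   show "z V (a *<(End B) V> p) = a *<?T V> z V p" if a: "a :<V>" for a
   proof -
    have "z V (a *<(End B) V> p) = finsum (sec ?T V) (%j. a *<?T V> pr V p j) {..<n}"
     unfolding z_def
    proof (rule TV.finsum_cong')
     show "pr V (a *<(End B) V> p) j = a *<?T V> pr V p j" if "j : {..<n}" for j
     proof -
      have j: "j < n" using that by simp
      have "d' V j :<(dual X B) V>" using d'[OF V j] by simp
      from bil(4)[OF v'[OF V j] this a]
      show ?thesis using V v'[OF V j] a by (simp add: pr_def)
     qed
    qed (use prF[OF V p] a in \<open>auto simp: Pi_iff\<close>)
    also have "\<dots> = a *<?T V> z V p"
     unfolding z_def by (rule TV.finsum_smult_ldistr[OF _ a prF[OF V p], symmetric]) simp
    finally show ?thesis .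
   qed
   fix W assume W: "op W" "W <= V"
   then have WU: "W <= U" using V by blast
   interpret TW: module "osec X W" "sec ?T W" by (rule pm_module[OF T' W(1)])
   have pW: "restrict p (ops W) : Hom B B W" by (rule homs_restrict[OF p W])
   have "res ?T V W (z V p) = finsum (sec ?T W) (%j. res ?T V W (pr V p j)) {..<n}"
    unfolding z_def by (rule pm_res_finsum[OF T' V(1) W _ prF[OF V p]]) simp
   also have "\<dots> = z W (restrict p (ops W))"
    unfolding z_def
   proof (rule TW.finsum_cong'[OF refl prF[OF W(1) WU pW]])
    fix j assume "j : {..<n}"
    then have j: "j < n" by simp
    note pv = homs_closed[OF p V(1) order_refl v'[OF V j]]
    have x: "d' V j :<(dual X B) V>" using d'[OF V j] by simp
    have "res (dual X B) V W (d' V j) = d' W j"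
     by (simp add: d'_def restrict_restrict opens_Int_subset[OF W(2)])
    moreover have "res B V W (p V (v' V j)) = p W (v' W j)"
     using homs_res[OF p V(1) order_refl W v'[OF V j]] v'r[OF V W j] by simp
    ultimately show "res ?T V W (pr V p j) = pr W (restrict p (ops W)) j"
     using bil(6)[OF v'[OF V j] x W] W by (simp add: pr_def)
   qed
   finally show "z W (res (End B) V W p) = res ?T V W (z V p)" by simp
  qed
  note qU = homs_restrict[OF q(1) U(1) op_pts[OF U(1)]]
  let ?z = "fam' (End B) U z"
  \<comment> \<open>On a pure tensor of \<open>w\<close> and \<open>l\<close> the composite gives
    the sum of the \<open>l(v j) w \<otimes> d j\<close>, which is \<open>w\<close> tensored with
    the sum of the \<open>l(v j) d j\<close>. The latter sum is \<open>l\<close>, as one sees by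
    applying \<open>l\<close> to the basis expansion.\<close>
  have zq: "fam' ?T U (%V t. ?z V (restrict ?q (ops U) V t)) = fam' ?T U (%V t. t)"
  proof (rule tensor_hom_eqI[OF B D T U(1) homs_comp[OF qU z T'] homs_id[OF T']])
   fix V w l assume V: "op V" "V <= U" and w: "w :<B V>" and "l :<(dual X B) V>"
   then have l: "l : Hom B (ox X) V" by simp
   interpret TV: module "osec X V" "sec ?T V" by (rule pm_module[OF T' V(1)])
   interpret DV: module "osec X V" "sec (dual X B) V" by (rule pm_module[OF D V(1)])
   have pt: "pt B (dual X B) V w l :<?T V>" using pt_closed[OF B D V(1) w] l by simp
   let ?k = "?q V (pt B (dual X B) V w l)"
   note k = q(2)[OF V(1) w l]
   have kh: "?k : Hom B B V" using homs_closed[OF q(1) V(1) op_pts[OF V(1)] pt] by simp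
   have lc: "l V (v' V j) :<V>" if "j < n" for j
    using homs_closed[OF l V(1) order_refl v'[OF V that]] by simp
   let ?t = "%j. l V (v' V j) *<(dual X B) V> d' V j"
   have th: "?t : {..<n} \<rightarrow> Hom B (ox X) V"
   proof
    fix j assume "j : {..<n}"
    then have j: "j < n" by simp
    have "?t j :<(dual X B) V>" by (rule DV.smult_closed[OF lc[OF j]]) (use d'[OF V j] in simp)
    then show "?t j : Hom B (ox X) V" by simp
   qed
   have "finsum (sec (dual X B) V) ?t {..<n} = l"
   proof (rule homs_eqI[OF _ l])
    have "finsum (sec (dual X B) V) ?t {..<n} :<(dual X B) V>"
     by (rule DV.finsum_closed) (use th in simp)
    then show "finsum (sec (dual X B) V) ?t {..<n} : Hom B (ox X) V" by simp
    fix W y assume W: "op W" "W <= V" and y: "y :<B W>"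
    have WU: "W <= U" using V W by blast
    interpret R: cring "osec X W" by (rule O_cring[OF W(1)])
    have "(finsum (sec (dual X B) V) ?t {..<n}) W y = finsum (sec (ox X) W) (%j. ?t j W y) {..<n}"
     by (rule hom_finsum_apply[OF B _ V(1) W y _ th]) simp_all
    also have "\<dots> = finsum (osec X W) (%j. l W (d' V j W y *<B W> v' W j)) {..<n}"
     unfolding ox_finsum
    proof (rule R.finsum_cong')
     fix j assume "j : {..<n}"
     then have j: "j < n" by simp
     have "rs V W (l V (v' V j)) = l W (v' W j)"
      using homs_res[OF l V(1) order_refl W v'[OF V j]] v'r[OF V W j] by simp
     then have "?t j W y = l W (v' W j) *<W> d' V j W y" using W y by simp
     also have "\<dots> = d' V j W y *<W> l W (v' W j)"
      using homs_closed[OF l W v'[OF W(1) WU j]] d'c[OF V j W y] by (simp add: R.m_comm)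
     also have "\<dots> = l W (d' V j W y *<B W> v' W j)"
      using homs_smult[OF l W d'c[OF V j W y] v'[OF W(1) WU j]] by simp
     finally show "?t j W y = l W (d' V j W y *<B W> v' W j)" .
    next
     show "(%j. l W (d' V j W y *<B W> v' W j)) : {..<n} \<rightarrow> \<O> W"
      using homs_closed[OF l W] d'c[OF V _ W y] v'[OF W(1) WU] B W(1) by auto
    qed simp
    also have "\<dots> = l W (finsum (sec B W) (%j. d' V j W y *<B W> v' W j) {..<n})"
     using homs_finsum[OF l W B _ _, of "{..<n}" "%j. d' V j W y *<B W> v' W j"] d'c[OF V _ W y] v'[OF W(1) WU] B W(1) by auto
    also have "\<dots> = l W y" unfolding basis'[OF V W y] ..
    finally show "(finsum (sec (dual X B) V) ?t {..<n}) W y = l W y" .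
   qed
   then have "pt B (dual X B) V w l = finsum (sec ?T V) (%j. pt B (dual X B) V w (?t j)) {..<n}"
    using pt_finsum_r[OF B D V(1) w, of "{..<n}" ?t] th by simp
   also have "\<dots> = z V ?k"
    unfolding z_def
   proof (rule TV.finsum_cong'[OF refl prF[OF V kh]])
    fix j assume "j : {..<n}"
    then have j: "j < n" by simp
    have x: "d' V j :<(dual X B) V>" using d'[OF V j] by simp
    have "?k V (v' V j) = l V (v' V j) *<B V> w" using V v'[OF V j] w B by (simp add: k)
    then show "pt B (dual X B) V w (?t j) = pr V ?k j"
     using bilinD(4)[OF pt_bilin[OF B D] V(1) order_refl w x lc[OF j]]
      bilinD(5)[OF pt_bilin[OF B D] V(1) order_refl w x lc[OF j]] by (simp add: pr_def del: hom_simps)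
   qed
   finally show "fam' ?T U (%V t. ?z V (restrict ?q (ops U) V t)) V (pt B (dual X B) V w l) =
     fam' ?T U (%V t. t) V (pt B (dual X B) V w l)"
    using V pt kh by simp
  qed
  \<comment> \<open>The composite sends \<open>p\<close> to the endomorphism mapping
    \<open>y\<close> to the sum of the \<open>d j(y) p(v j)\<close>, and this is \<open>p\<close>
    applied to the basis expansion of \<open>y\<close>.\<close>
  have qz: "?q V (z V p) = p" if V: "op V" "V <= U" and p: "p : Hom B B V" for V p
  proof -
   interpret EV: module "osec X V" "sec (End B) V" by (rule pm_module[OF EB' V(1)])
   have "?q V (z V p) = finsum (sec (End B) V) (%j. ?q V (pr V p j)) {..<n}"
    unfolding z_def by (rule homs_finsum[OF q(1) V(1) op_pts[OF V(1)] T' EB' _ prF[OF V p]]) simp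
   moreover have qh: "(%j. ?q V (pr V p j)) : {..<n} \<rightarrow> Hom B B V"
    using homs_closed[OF q(1) V(1) op_pts[OF V(1)]] pr[OF V p] by auto
   moreover have "finsum (sec (End B) V) (%j. ?q V (pr V p j)) {..<n} = p"
   proof (rule homs_eqI[OF _ p])
    have "finsum (sec (End B) V) (%j. ?q V (pr V p j)) {..<n} :<(End B) V>"
     by (rule EV.finsum_closed) (use qh in simp)
    then show "finsum (sec (End B) V) (%j. ?q V (pr V p j)) {..<n} : Hom B B V" by simp
    fix W y assume W: "op W" "W <= V" and y: "y :<B W>"
    have WU: "W <= U" using V W by blast
    interpret BW: module "osec X W" "sec B W" by (rule pm_module[OF B W(1)])
    have F: "(%j. d' V j W y *<B W> v' W j) : {..<n} \<rightarrow> mcar B W"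
     using d'c[OF V _ W y] v'[OF W(1) WU] B W(1) by auto
    have "(finsum (sec (End B) V) (%j. ?q V (pr V p j)) {..<n}) W y =
      finsum (sec B W) (%j. ?q V (pr V p j) W y) {..<n}"
     by (rule hom_finsum_apply[OF B B V(1) W y _ qh]) simp
    also have "\<dots> = finsum (sec B W) (%j. p W (d' V j W y *<B W> v' W j)) {..<n}"
    proof (rule BW.finsum_cong')
     fix j assume "j : {..<n}"
     then have j: "j < n" by simp
     have "?q V (pr V p j) W y = d' V j W y *<B W> res B V W (p V (v' V j))"
      unfolding pr_def q(2)[OF V(1) homs_closed[OF p V(1) order_refl v'[OF V j]] d'[OF V j]] using W y by simp
     also have "res B V W (p V (v' V j)) = p W (v' W j)"
      using homs_res[OF p V(1) order_refl W v'[OF V j]] v'r[OF V W j] by simp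
     also have "d' V j W y *<B W> p W (v' W j) = p W (d' V j W y *<B W> v' W j)"
      using homs_smult[OF p W d'c[OF V j W y] v'[OF W(1) WU j]] by simp
     finally show "?q V (pr V p j) W y = p W (d' V j W y *<B W> v' W j)" .
    next
     show "(%j. p W (d' V j W y *<B W> v' W j)) : {..<n} \<rightarrow> mcar B W"
      using homs_closed[OF p W] F by auto
    qed simp
    also have "\<dots> = p W (finsum (sec B W) (%j. d' V j W y *<B W> v' W j) {..<n})"
     using homs_finsum[OF p W B B _ F] by simp
    also have "\<dots> = p W y" unfolding basis'[OF V W y] ..
    finally show "(finsum (sec (End B) V) (%j. ?q V (pr V p j)) {..<n}) W y = p W y" .
   qed
   ultimately show ?thesis by simp
  qed
  show "\<exists>U g. op U & x : U & g : Hom (End B) ?T U &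
   (\<forall>V m. op V & V <= U & m :<?T V> --> g V (?q V m) = m) &
   (\<forall>V n. op V & V <= U & n :<(End B) V> --> ?q V (g V n) = n)"
  proof (intro exI[of _ U] exI[of _ ?z] conjI U z allI impI)
   fix V t assume "op V & V <= U & t :<?T V>"
   then show "?z V (?q V t) = t" using fun_cong[OF fun_cong[OF zq], of V t] by simp
  next
   fix V p assume "op V & V <= U & p :<(End B) V>"
   then show "?q V (?z V p) = p" using qz[of V p] by simp
  qed
 qed
qed

subsection \<open>Homotheties and coevaluation\<close>

lemma homothety_hom:
 assumes M: "pmod M"
 shows "homothety X M : mor X (ox X) (End M)"
proof -
 have h: "fam' M V (%W m. rs V W a *<M W> m) : Hom M M V" if V: "op V" and a: "a :<V>" for V a
  by (rule homsI[OF M]) (use V a M in \<open>auto simp: pm_smult_add pm_smult_commute\<close>)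
 have e: "homothety X M = fam' (ox X) (pts X) (%V a. fam' M V (%W m. rs V W a *<M W> m))"
  unfolding homothety_def by simp
 show ?thesis unfolding e
 proof (rule homsI)
  show "pmod (ox X)" by simp
  fix V a assume V: "op V" and "a :<(ox X) V>"
  then have a: "a :<V>" by simp
  show "fam' M V (%W m. rs V W a *<M W> m) :<(End M) V>" using h[OF V a] by simp
  show "fam' M V (%W m. rs V W (a +<(ox X) V> b) *<M W> m) =
    fam' M V (%W m. rs V W a *<M W> m) +<(End M) V> fam' M V (%W m. rs V W b *<M W> m)"
   if "b :<(ox X) V>" for b
   unfolding hom_simps by (intro restrict_ext) (use V a M that in \<open>simp add: pm_smult_add\<close>)
  show "fam' M V (%W m. rs V W (b *<(ox X) V> a) *<M W> m) =
    b *<(End M) V> fam' M V (%W m. rs V W a *<M W> m)"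
   if "b :<V>" for b
   unfolding hom_simps by (intro restrict_ext) (use V a M that in \<open>simp add: pm_smult_smult\<close>)
  fix Y assume Y: "op Y" "Y <= V"
  have s: "Z <= V" if "Z : ops Y" for Z using that Y by auto
  show "fam' M Y (%W m. rs Y W (res (ox X) V Y a) *<M W> m) =
    res (End M) V Y (fam' M V (%W m. rs V W a *<M W> m))"
   unfolding hom_simps restrict_restrict opens_Int_subset[OF Y(2)]
   by (intro restrict_ext) (use V Y a M s in simp)
 qed
qed

lemma homothety_apply: "op V ==> a :<V> ==> op W ==> W <= V ==> m :<M W> ==>
  homothety X M V a W m = rs V W a *<M W> m"
 by (simp add: homothety_def)

text \<open>Characterizes the coevaluation by its contraction. At 1 the contraction is the identity,
  which replaces an explicit formula for the coevaluation in the later computation.\<close>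

lemma coev_props:
 assumes lf: "locally_free X B"
 shows "coev X B : mor X (ox X) (tens B (dual X B))"
  "!!V a. op V ==> a :<V> ==> end_contraction X B V (coev X B V a) = homothety X B V a"
proof -
 have BO: "omod B" using lf by (simp add: locally_free_def)
 then have B: "pmod B" by simp
 have D: "pmod (dual X B)" by (intro hom_sheaf_pmodule B) simp
 note T' = omod_pmod[OF tensor_O_module[OF B D]] and EB' = hom_sheaf_pmodule[OF B B]
 note iso = end_contraction_iso[OF lf]
 show "coev X B : mor X (ox X) (tens B (dual X B))"
  unfolding coev_def by (rule mor_comp_hom[OF homothety_hom[OF B] mor_inv_mor[OF T' EB' iso]]) simp
 fix V a assume V: "op V" and a: "a :<V>"
 have "homothety X B V a :<(End B) V>"
  by (rule homs_closed[OF homothety_hom[OF B] V op_pts[OF V]]) (use a in simp)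
 then show "end_contraction X B V (coev X B V a) = homothety X B V a"
  unfolding coev_def using V a mor_inv_right[OF iso V] by simp
qed

subsection \<open>Line bundles\<close>

text \<open>Worded as in \<open>pic_class\<close>, so that both unfold to the same formula.\<close>

definition generates :: "('x, 'r, 'm) omod => 'x set => 'm => bool"
 where "generates L U e \<longleftrightarrow> e :<L U> &
  (ALL V:ops U. bij_betw (%a. a *<L V> res L U V e) (\<O> V) (mcar L V))"

lemma line_bundle_generator:
 assumes L: "line_bundle X L" and x: "x : pts X"
 obtains U e where "op U" "x : U" "generates L U e"
proof -
 obtain U \<theta> where U: "op U" "x : U" and \<theta>: "iso_over X (ox X) L U \<theta>"
  using L x unfolding line_bundle_def by blast
 have \<theta>h: "\<theta> : Hom (ox X) L U" and b: "!!V. V : ops U ==> bij_betw (\<theta> V) (mcar (ox X) V) (mcar L V)"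
  using \<theta> by (auto simp: iso_over_def)
 let ?e = "\<theta> U 1<U>"
 have "generates L U ?e" unfolding generates_def
 proof (intro conjI ballI)
  show "?e :<L U>" by (rule homs_closed[OF \<theta>h U(1) order_refl]) (use U in simp)
  fix V assume V: "V : ops U"
  have "a *<L V> res L U V ?e = \<theta> V a" if "a :<V>" for a
  proof -
   have "res L U V ?e = \<theta> V 1<V>"
    using homs_res[OF \<theta>h U(1) order_refl, of V "1<U>"] V U by simp
   then show ?thesis using homs_smult[OF \<theta>h, of V a "1<V>"] V that by simp
  qed
  then show "bij_betw (%a. a *<L V> res L U V ?e) (\<O> V) (mcar L V)"
   using b[OF V] by (subst bij_betw_cong[where g = "\<theta> V"]) auto
 qed
 then show thesis using that U by blast
qed

definition coef :: "('x, 'r, 'm) omod => 'x set => 'm => 'x set => 'm => 'r"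
 where "coef L U e V m = inv_into (\<O> V) (%a. a *<L V> res L U V e) m"

context
 fixes L :: "('x, 'r, 'm) omod" and U e
 assumes L: "pmod L" and U: "op U" and gen: "generates L U e"
begin

lemma gen_closed: "e :<L U>"
 using gen by (simp add: generates_def)

lemma gen_res: "op V ==> V <= U ==> res L U V e :<L V>"
 using gen_closed L U by simp

lemma coef_closed: "op V ==> V <= U ==> m :<L V> ==> coef L U e V m :<V>"
 using gen unfolding generates_def coef_def bij_betw_def by (auto intro!: inv_into_into)

lemma coef_eq: "op V ==> V <= U ==> m :<L V> ==> coef L U e V m *<L V> res L U V e = m"
 using gen bij_betw_inv_into_right[of "%a. a *<L V> res L U V e" "\<O> V" "mcar L V" m]
 by (simp add: generates_def coef_def)

lemma coef_unique: "op V ==> V <= U ==> a :<V> ==> coef L U e V (a *<L V> res L U V e) = a"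
 using gen bij_betw_inv_into_left[of "%a. a *<L V> res L U V e" "\<O> V" "mcar L V" a]
 by (simp add: generates_def coef_def)

lemma gen_inj:
 assumes "op V" "V <= U" "a :<V>" "b :<V>"
  "a *<L V> res L U V e = b *<L V> res L U V e"
 shows "a = b"
 using coef_unique[OF assms(1-3)] coef_unique[OF assms(1,2,4)] assms(5) by metis

lemma coef_add:
 assumes V: "op V" "V <= U" and m: "m :<L V>" "n :<L V>"
 shows "coef L U e V (m +<L V> n) = coef L U e V m +<V> coef L U e V n"
proof (rule gen_inj[OF V])
 show "coef L U e V (m +<L V> n) *<L V> res L U V e =
   (coef L U e V m +<V> coef L U e V n) *<L V> res L U V e"
  using coef_closed[OF V] coef_eq[OF V] V m L gen_res[OF V] by (simp add: pm_smult_add)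
qed (use coef_closed[OF V] m L V in simp_all)

lemma coef_smult:
 assumes V: "op V" "V <= U" and m: "m :<L V>" and a: "a :<V>"
 shows "coef L U e V (a *<L V> m) = a *<V> coef L U e V m"
proof (rule gen_inj[OF V])
 show "coef L U e V (a *<L V> m) *<L V> res L U V e =
   (a *<V> coef L U e V m) *<L V> res L U V e"
  using pm_smult_smult[OF L V(1) a coef_closed[OF V m] gen_res[OF V]] coef_eq[OF V m]
   coef_eq[OF V, of "a *<L V> m"] V m a L by (metis pm_closed(4))
qed (use coef_closed[OF V] m a L V in simp_all)

lemma coef_res:
 assumes V: "op V" "V <= U" and W: "op W" "W <= V" and m: "m :<L V>"
 shows "coef L U e W (res L V W m) = rs V W (coef L U e V m)"
proof -
 have WU: "W <= U" using V W by blast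
 have "res L V W m = res L V W (coef L U e V m *<L V> res L U V e)" using coef_eq[OF V m] by simp
 also have "\<dots> = rs V W (coef L U e V m) *<L W> res L U W e"
  using coef_closed[OF V m] gen_res[OF V] V W U L gen_closed by simp
 finally show ?thesis using coef_unique[OF W(1) WU, of "rs V W (coef L U e V m)"] coef_closed[OF V m] V W by simp
qed

end

text \<open>Over an open set with generator \<open>e\<close> an endomorphism \<open>k\<close> is
  determined by \<open>k(e)\<close>, and it is multiplication by the coefficient of
  \<open>k(e)\<close>. These coefficients form the local inverse.\<close>

lemma homothety_iso:
 assumes L: "line_bundle X L"
 shows "mor_iso X (ox X) (End L) (homothety X L)"
proof -
 have LO: "omod L" using L by (simp add: line_bundle_def)
 then have L': "pmod L" by simp
 show ?thesis
 proof (rule local_iso[OF ox_O_module hom_sheaf_O_module[OF L' LO] homothety_hom[OF L']])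
  fix x assume "x : pts X"
  then obtain U e where U: "op U" "x : U" and g: "generates L U e" by (rule line_bundle_generator[OF L])
  note cf = coef_closed[OF L' U(1) g] and re = gen_res[OF L' U(1) g] and ce = coef_eq[OF L' U(1) g] and cu = coef_unique[OF L' U(1) g]
  let ?g = "fam' (End L) U (%V k. coef L U e V (k V (res L U V e)))"
  have ke: "k V (res L U V e) :<L V>" if "k : Hom L L V" "op V" "V <= U" for k V
   by (rule homs_closed[OF that(1,2) order_refl re[OF that(2,3)]])
  have gh: "?g : Hom (End L) (ox X) U"
  proof (rule homsI[OF hom_sheaf_pmodule[OF L' L']])
   fix V k assume V: "op V" "V <= U" and "k :<(End L) V>"
   then have k: "k : Hom L L V" by simp
   show "coef L U e V (k V (res L U V e)) :<(ox X) V>" using cf[OF V ke[OF k V]] by simp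
   show "coef L U e V ((k +<(End L) V> p) V (res L U V e)) =
     coef L U e V (k V (res L U V e)) +<(ox X) V> coef L U e V (p V (res L U V e))"
    if "p :<(End L) V>" for p
    using V re[OF V] coef_add[OF L' U(1) g V ke[OF k V], of "p V (res L U V e)"] ke[OF _ V] that by simp
   show "coef L U e V ((a *<(End L) V> k) V (res L U V e)) =
     a *<(ox X) V> coef L U e V (k V (res L U V e))" if "a :<V>" for a
    using V re[OF V] coef_smult[OF L' U(1) g V ke[OF k V] that] that by simp
   fix W assume W: "op W" "W <= V"
   have "k W (res L U W e) = res L V W (k V (res L U V e))"
    using homs_res[OF k V(1) order_refl W re[OF V]] V W U gen_closed[OF L' U(1) g] L' by simp
   then show "coef L U e W (res (End L) V W k W (res L U W e)) = res (ox X) V W (coef L U e V (k V (res L U V e)))"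
    using coef_res[OF L' U(1) g V W ke[OF k V]] W by simp
  qed
  show "\<exists>U g. op U & x : U & g : Hom (End L) (ox X) U &
   (\<forall>V m. op V & V <= U & m :<(ox X) V> --> g V (homothety X L V m) = m) &
   (\<forall>V n. op V & V <= U & n :<(End L) V> --> homothety X L V (g V n) = n)"
  proof (intro exI[of _ U] exI[of _ ?g] conjI U gh allI impI)
   fix V a assume "op V & V <= U & a :<(ox X) V>"
   then have V: "op V" "V <= U" and a: "a :<V>" by auto
   have "homothety X L V a : Hom L L V"
    using homs_closed[OF homothety_hom[OF L'] V(1) op_pts[OF V(1)], of a] a by simp
   then show "?g V (homothety X L V a) = a"
    using V a cu[OF V a] homothety_apply[OF V(1) a V(1) order_refl re[OF V]] by simp
  next
   fix V k assume "op V & V <= U & k :<(End L) V>"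
   then have V: "op V" "V <= U" and k: "k : Hom L L V" by auto
   let ?a = "coef L U e V (k V (res L U V e))"
   have a: "?a :<V>" by (rule cf[OF V ke[OF k V]])
   have ha: "homothety X L V ?a : Hom L L V"
    using homs_closed[OF homothety_hom[OF L'] V(1) op_pts[OF V(1)], of ?a] a by simp
   have "homothety X L V ?a = k"
   proof (rule homs_eqI[OF ha k])
    fix W m assume W: "op W" "W <= V" and m: "m :<L W>"
    have WU: "W <= U" using V W by blast
    let ?b = "coef L U e W m"
    have b: "?b :<W>" by (rule cf[OF W(1) WU m])
    have "k W m = k W (?b *<L W> res L U W e)" using ce[OF W(1) WU m] by simp
    also have "\<dots> = ?b *<L W> k W (res L U W e)" by (rule homs_smult[OF k W b re[OF W(1) WU]])
    also have "k W (res L U W e) = res L V W (k V (res L U V e))"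
     using homs_res[OF k V(1) order_refl W re[OF V]] V W U gen_closed[OF L' U(1) g] L' by simp
    also have "k V (res L U V e) = ?a *<L V> res L U V e" using ce[OF V ke[OF k V]] by simp
    also have "res L V W (?a *<L V> res L U V e) = rs V W ?a *<L W> res L U W e"
     using V W a U gen_closed[OF L' U(1) g] L' by simp
    also have "?b *<L W> (rs V W ?a *<L W> res L U W e) = rs V W ?a *<L W> m"
     using pm_smult_commute[OF L' W(1) b, of "rs V W ?a" "res L U W e"] a V W re[OF W(1) WU] ce[OF W(1) WU m] by simp
    finally show "homothety X L V ?a W m = k W m"
     using homothety_apply[OF V(1) a W m] by simp
   qed
   then show "homothety X L V (?g V k) = k" using V k by simp
  qed
 qed
qed

lemma end_tensor_iso_props:
 assumes L: "line_bundle X L" and G: "omod G"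
 shows "mor_iso X (tens (End L) G) G (end_tensor_iso X L G)"
  "!!V p y. op V ==> p : Hom L L V ==> y :<G V> ==>
   end_tensor_iso X L G V (pt (End L) G V p y) =
   mor_inv X (ox X) (End L) (homothety X L) V p *<G V> y"
proof -
 have L': "pmod L" using L by (simp add: line_bundle_def)
 have G': "pmod G" using G by simp
 let ?A = "End L" and ?h = "homothety X L"
 have A: "pmod ?A" by (rule hom_sheaf_pmodule[OF L' L'])
 note T = tensor_O_module[OF A G']
 note iso = homothety_iso[OF L]
 let ?k = "mor_inv X (ox X) ?A ?h"
 have k: "?k : mor X ?A (ox X)" by (rule mor_inv_mor[OF _ A iso]) simp
 have kc: "?k V p :<V>" if "op V" "p :<?A V>" for V p
  using homs_closed[OF k that(1) op_pts[OF that(1)] that(2)] by simp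
 have bil: "bilin ?A G G (pts X) (%U p y. ?k U p *<G U> y)"
 proof (rule bilinI)
  fix V p y assume V: "op V" "V <= pts X" and p: "p :<?A V>" and y: "y :<G V>"
  show "?k V p *<G V> y :<G V>" using kc[OF V(1) p] y G' V by simp
  show "?k V (p +<?A V> p') *<G V> y = ?k V p *<G V> y +<G V> ?k V p' *<G V> y" if "p' :<?A V>" for p'
   unfolding homs_add[OF k V p that] using kc[OF V(1) p] kc[OF V(1) that] y G' V by (simp add: pm_smult_add)
  show "?k V p *<G V> (y +<G V> y') = ?k V p *<G V> y +<G V> ?k V p *<G V> y'" if "y' :<G V>" for y'
   using kc[OF V(1) p] that y G' V by (simp add: pm_smult_add)
  show "?k V (a *<?A V> p) *<G V> y = a *<G V> (?k V p *<G V> y)" if "a :<V>" for a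
   unfolding homs_smult[OF k V that p] using kc[OF V(1) p] that y G' V by (simp add: pm_smult_smult)
  show "?k V p *<G V> (a *<G V> y) = a *<G V> (?k V p *<G V> y)" if "a :<V>" for a
   using kc[OF V(1) p] that y G' V by (simp add: pm_smult_commute)
  show "?k W (res ?A V W p) *<G W> res G V W y = res G V W (?k V p *<G V> y)" if W: "op W" "W <= V" for W
   unfolding homs_res[OF k V W p] using kc[OF V(1) p] y G' V W by simp
 qed
 let ?t = "end_tensor_iso X L G"
 note t = tensor_lift_props[OF A G' G bil, folded end_tensor_iso_def]
 show val: "?t V (pt ?A G V p y) = ?k V p *<G V> y"
  if "op V" "p : Hom L L V" "y :<G V>" for V p y
  by (rule t(2)[OF that(1) _ that(3)]) (use that in simp)
 \<comment> \<open>The identity endomorphism. Tensoring with it,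
   \<open>y \<mapsto> id \<otimes> y\<close>, is the inverse: a pure tensor of an endomorphism and
   \<open>y\<close> has its scalar moved to the second factor.\<close>
 let ?one = "%V. ?h V 1<V>"
 have one: "?one V :<?A V>" if "op V" for V
  by (rule homs_closed[OF homothety_hom[OF L'] that op_pts[OF that]]) (use that in simp)
 let ?s = "%V y. pt ?A G V (?one V) y"
 note ptb = bilinD[OF pt_bilin[OF A G'] _ order_refl]
 have s: "fam' G (pts X) ?s : mor X G (tens ?A G)"
 proof (rule homsI[OF G'])
  fix V y assume V: "op V" and y: "y :<G V>"
  note o = one[OF V]
  show "?s V y :<(tens ?A G) V>" by (rule ptb(1)[OF V o y])
  show "?s V (y +<G V> y') = ?s V y +<(tens ?A G) V> ?s V y'" if "y' :<G V>" for y'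
   by (rule ptb(3)[OF V o y that])
  show "?s V (a *<G V> y) = a *<(tens ?A G) V> ?s V y" if "a :<V>" for a
   by (rule ptb(5)[OF V o y that])
  fix W assume W: "op W" "W <= V"
  have "?one W = res ?A V W (?one V)"
   using homs_res[OF homothety_hom[OF L'] V op_pts[OF V] W, of "1<V>"] V W by simp
  then show "?s W (res G V W y) = res (tens ?A G) V W (?s V y)" using ptb(6)[OF V o y W] by simp
 qed
 show "mor_iso X (tens ?A G) G ?t"
 proof (rule iso_if_inverse[OF t(1) s])
  fix V y assume V: "op V" and y: "y :<G V>"
  have "?k V (?one V) = 1<V>" using mor_inv_left[OF iso V, of "1<V>"] V by simp
  then show "?t V (fam' G (pts X) ?s V y) = y" using V y one[OF V] val[OF V _ y] G' by simp
 next
  note T' = omod_pmod[OF T]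
  have st: "mor_comp X (tens ?A G) (fam' G (pts X) ?s) ?t = mor_id X (tens ?A G)"
  proof (rule tensor_hom_eqI[OF A G' T openin_topspace mor_comp_hom[OF t(1) s T'] mor_id_hom[OF T']])
   fix V p y assume V: "op V" and p: "p :<?A V>" and y: "y :<G V>"
   note c = kc[OF V p]
   have "?k V p *<?A V> ?one V = ?h V (?k V p)"
    using homs_smult[OF homothety_hom[OF L'] V op_pts[OF V] c, of "1<V>"] V c by simp
   also have "\<dots> = p" by (rule mor_inv_right[OF iso V p])
   finally have "?s V (?k V p *<G V> y) = pt ?A G V p y"
    using ptb(5)[OF V one[OF V] y c] ptb(4)[OF V one[OF V] y c] by simp
   then show "mor_comp X (tens ?A G) (fam' G (pts X) ?s) ?t V (pt ?A G V p y) =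
     mor_id X (tens ?A G) V (pt ?A G V p y)"
    using V p y c ptb(1)[OF V p y] val[OF V _ y] G' by simp
  qed
  fix V m assume V: "op V" and m: "m :<(tens ?A G) V>"
  show "fam' G (pts X) ?s V (?t V m) = m"
   using fun_cong[OF fun_cong[OF st], of V m] V m by simp
 qed
qed

end

text \<open>For \<open>lr_sheaf\<close>, whose sections and restrictions are componentwise although
  its scalar multiplication is not.\<close>

lemma sheaf_on_Times:
 assumes "sheaf_on T S r" "sheaf_on T S' r'"
 shows "sheaf_on T (%U. S U \<times> S' U) (%U V. map_prod (r U V) (r' U V))"
proof (rule sheaf_onI)
 show "presheaf_on T (%U. S U \<times> S' U) (%U V. map_prod (r U V) (r' U V))"
  unfolding presheaf_on_def
 proof (intro conjI allI impI funcsetI ballI)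
  have pre: "presheaf_on T S r" "presheaf_on T S' r'" using assms by (simp_all add: sheaf_on_def)
  fix U x assume x: "x : S U \<times> S' U"
  show "map_prod (r U V) (r' U V) x : S V \<times> S' V" if "openin T U & openin T V & V <= U" for V
   using pre that x unfolding presheaf_on_def by (metis funcset_mem mem_Times_iff fst_map_prod snd_map_prod)
  show "map_prod (r U U) (r' U U) x = x" if "openin T U"
   using pre that x unfolding presheaf_on_def by (metis mem_Times_iff prod_eqI fst_map_prod snd_map_prod)
  show "map_prod (r V W) (r' V W) (map_prod (r U V) (r' U V) x) = map_prod (r U W) (r' U W) x"
   if "openin T U & openin T V & openin T W & W <= V & V <= U" for V W
   using pre that x unfolding presheaf_on_def by (metis mem_Times_iff prod_eqI fst_map_prod snd_map_prod)
 qed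
next
 fix C s assume C: "!!V. V : C ==> openin T V" and s: "!!V. V : C ==> s V : S V \<times> S' V"
  and agree: "!!V W. V : C ==> W : C ==>
   map_prod (r V (V Int W)) (r' V (V Int W)) (s V) = map_prod (r W (V Int W)) (r' W (V Int W)) (s W)"
 have s': "fst (s V) : S V" "snd (s V) : S' V" if "V : C" for V using s[OF that] by auto
 have ag: "r V (V Int W) (fst (s V)) = r W (V Int W) (fst (s W))" "r' V (V Int W) (snd (s V)) = r' W (V Int W) (snd (s W))"
  if "V : C" "W : C" for V W using agree[OF that] by (metis fst_map_prod, metis snd_map_prod)
 obtain t where t: "t : S (\<Union>C)" "ALL V:C. r (\<Union>C) V t = fst (s V)"
  using sheaf_on_ex1[OF assms(1) C, of C "%V. fst (s V)"] s' ag by blast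
 obtain t' where t': "t' : S' (\<Union>C)" "ALL V:C. r' (\<Union>C) V t' = snd (s V)"
  using sheaf_on_ex1[OF assms(2) C, of C "%V. snd (s V)"] s' ag by blast
 show "EX t:S (\<Union>C) \<times> S' (\<Union>C). ALL V:C. map_prod (r (\<Union>C) V) (r' (\<Union>C) V) t = s V"
  using t t' by (intro bexI[of _ "(t, t')"]) auto
next
 fix C t u assume C: "!!V. V : C ==> openin T V" and t: "t : S (\<Union>C) \<times> S' (\<Union>C)" "u : S (\<Union>C) \<times> S' (\<Union>C)"
  and eq: "!!V. V : C ==> map_prod (r (\<Union>C) V) (r' (\<Union>C) V) t = map_prod (r (\<Union>C) V) (r' (\<Union>C) V) u"
 have op: "openin T (\<Union>C)" using C by blast
 have key: "a = b" if sh: "sheaf_on T Q q" and ab: "a : Q (\<Union>C)" "b : Q (\<Union>C)" "!!V. V : C ==> q (\<Union>C) V a = q (\<Union>C) V b" for Q q a b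
 proof -
  have psh: "presheaf_on T Q q" using sh by (simp add: sheaf_on_def)
  have pre: "q V W (q U V x) = q U W x" if "openin T U" "openin T V" "openin T W" "W <= V" "V <= U" "x : Q U" for U V W x
   using psh that unfolding presheaf_on_def by metis
  have cl: "q (\<Union>C) V a : Q V" if "V : C" for V
   using psh ab(1) C[OF that] op that unfolding presheaf_on_def by (metis Union_upper funcset_mem)
  have "\<exists>!t. t : Q (\<Union>C) & (ALL V:C. q (\<Union>C) V t = q (\<Union>C) V a)"
  proof (rule sheaf_on_ex1[OF sh C cl])
   fix V W assume VW: "V : C" "W : C"
   have i: "openin T (V Int W)" using C VW by blast
   have "q V (V Int W) (q (\<Union>C) V a) = q (\<Union>C) (V Int W) a" by (rule pre[OF op C[OF VW(1)] i]) (use VW ab in auto)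
   moreover have "q W (V Int W) (q (\<Union>C) W a) = q (\<Union>C) (V Int W) a" by (rule pre[OF op C[OF VW(2)] i]) (use VW ab in auto)
   ultimately show "q V (V Int W) (q (\<Union>C) V a) = q W (V Int W) (q (\<Union>C) W a)" by simp
  qed
  then show ?thesis using ab by metis
 qed
 have "fst t = fst u"
 proof (rule key[OF assms(1)])
  show "r (\<Union>C) V (fst t) = r (\<Union>C) V (fst u)" if "V : C" for V using eq[OF that] by (metis fst_map_prod)
 qed (use t in auto)
 moreover have "snd t = snd u"
 proof (rule key[OF assms(2)])
  show "r' (\<Union>C) V (snd t) = r' (\<Union>C) V (snd u)" if "V : C" for V using eq[OF that] by (metis snd_map_prod)
 qed (use t in auto)
 ultimately show "t = u" by (rule prod_eqI)
qed

section \<open>Lifts of derivations and the Kodaira-Spencer sheaf\<close>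

context fsp
begin

context
 fixes L :: "('x, 'r, 'm) omod"
 assumes L: "pmod L"
begin

lemma f_homsI:
 assumes cl: "!!V m. op V ==> V <= U ==> m :<L V> ==> T V m :<L V>"
  and add: "!!V m n. op V ==> V <= U ==> m :<L V> ==> n :<L V> ==>
   T V (m +<L V> n) = T V m +<L V> T V n"
  and restr: "!!V W m. op V ==> V <= U ==> op W ==> W <= V ==> m :<L V> ==>
   T W (res L V W m) = res L V W (T V m)"
  and scal: "!!V c m. op V ==> V <= U ==> c : carrier (base X) ==> m :<L V> ==>
   T V (scal X V c *<L V> m) = scal X V c *<L V> T V m"
 shows "fam' L U T : f_homs X L L U"
proof -
 have t: "W <= U" if "W : ops V" "V : ops U" for V W using that by auto
 show ?thesis
  unfolding f_homs_def add_fams_def using assms L by (simp add: PiE_iff) (blast dest: t)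
qed

lemma f_homsD:
 assumes "T : f_homs X L L U"
 shows "T : fams L L U"
  "op V ==> V <= U ==> m :<L V> ==> T V m :<L V>"
  "op V ==> V <= U ==> m :<L V> ==> n :<L V> ==> T V (m +<L V> n) = T V m +<L V> T V n"
  "op V ==> V <= U ==> op W ==> W <= V ==> m :<L V> ==> T W (res L V W m) = res L V W (T V m)"
  "op V ==> V <= U ==> c : carrier (base X) ==> m :<L V> ==>
   T V (scal X V c *<L V> m) = scal X V c *<L V> T V m"
proof -
 show f: "T : fams L L U" using assms add_fams_fams unfolding f_homs_def by blast
 show "op V ==> V <= U ==> m :<L V> ==> T V m :<L V>" by (rule fams_closed[OF f])
qed (use assms in \<open>simp_all add: f_homs_def add_fams_def\<close>)

lemma f_end_pmodule: "pmod (f_end_sheaf X L)"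
 unfolding f_end_sheaf_def
proof (rule fam_sheaf_pmodule[OF L])
 fix U assume U: "op U"
 show "f_homs X L L U <= fams L L U" using f_homsD(1) by blast
 show "fam' L U (%V m. 0<L V>) : f_homs X L L U" by (rule f_homsI) (use L in simp_all)
 fix T assume T: "T : f_homs X L L U"
 note t = f_homsD[OF T]
 show "fam' L U (%V m. T V m +<L V> T' V m) : f_homs X L L U" if T': "T' : f_homs X L L U" for T'
 proof -
  note t' = f_homsD[OF T']
  show ?thesis
  proof (rule f_homsI)
   fix V m assume V: "op V" "V <= U" and m: "m :<L V>"
   note c = t(2)[OF V] t'(2)[OF V]
   show "T V m +<L V> T' V m :<L V>" using c m L V by simp
   show "T V (m +<L V> n) +<L V> T' V (m +<L V> n) =
     (T V m +<L V> T' V m) +<L V> (T V n +<L V> T' V n)" if n: "n :<L V>" for n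
    unfolding t(3)[OF V m n] t'(3)[OF V m n] by (rule pm_add_swap[OF L V(1)]) (use c m n in simp_all)
   show "T W (res L V W m) +<L W> T' W (res L V W m) = res L V W (T V m +<L V> T' V m)" if W: "op W" "W <= V" for W
    unfolding t(4)[OF V W m] t'(4)[OF V W m] using c m L V W by simp
   show "T V (scal X V k *<L V> m) +<L V> T' V (scal X V k *<L V> m) =
     scal X V k *<L V> (T V m +<L V> T' V m)" if k: "k : carrier (base X)" for k
    unfolding t(5)[OF V k m] t'(5)[OF V k m] using pm_smult_add(1)[OF L V(1)] c m V k by simp
  qed
 qed
 show "fam' L U (%V m. rs U V a *<L V> T V m) : f_homs X L L U" if a: "a :<U>" for a
 proof (rule f_homsI)
  fix V m assume V: "op V" "V <= U" and m: "m :<L V>"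
  note c = t(2)[OF V]
  have aV: "rs U V a :<V>" using a U V by simp
  show "rs U V a *<L V> T V m :<L V>" using c m aV L V by simp
  show "rs U V a *<L V> T V (m +<L V> n) =
    rs U V a *<L V> T V m +<L V> rs U V a *<L V> T V n" if n: "n :<L V>" for n
   unfolding t(3)[OF V m n] by (rule pm_smult_add(1)[OF L V(1) aV]) (use c m n in simp_all)
  show "rs U W a *<L W> T W (res L V W m) = res L V W (rs U V a *<L V> T V m)" if W: "op W" "W <= V" for W
   unfolding t(4)[OF V W m] using c m L V W U a by simp
  show "rs U V a *<L V> T V (scal X V k *<L V> m) =
    scal X V k *<L V> (rs U V a *<L V> T V m)" if k: "k : carrier (base X)" for k
   unfolding t(5)[OF V k m] by (rule pm_smult_commute[OF L V(1) aV]) (use c m V k in simp_all)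
 qed
 show "restrict T (ops V) : f_homs X L L V" if V: "op V" "V <= U" for V
 proof -
  have s: "W <= U" if "W <= V" for W using that V by blast
  have "fam' L V T : f_homs X L L V"
  proof (rule f_homsI)
   fix W m assume W: "op W" "W <= V" and m: "m :<L W>"
   note W' = W(1) s[OF W(2)]
   show "T W m :<L W>" by (rule t(2)[OF W' m])
   show "T W (m +<L W> n) = T W m +<L W> T W n" if "n :<L W>" for n by (rule t(3)[OF W' m that])
   show "T Y (res L W Y m) = res L W Y (T W m)" if "op Y" "Y <= W" for Y by (rule t(4)[OF W' that m])
   show "T W (scal X W k *<L W> m) = scal X W k *<L W> T W m" if "k : carrier (base X)" for k
    by (rule t(5)[OF W' that m])
  qed
  moreover have "fam' L V T = restrict T (ops V)"
   by (subst (2) fams_extensional[OF t(1), symmetric]) (simp add: restrict_restrict opens_Int_subset[OF V(2)])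
  ultimately show ?thesis by simp
 qed
qed

text \<open>Subtraction in a module refers to the abstract additive inverse; computing that inverse
  as the multiple by -1 gives the pointwise formula by which \<open>defect\<close> is
  unfolded.\<close>

lemma f_end_minus:
 assumes U: "op U" and T: "T : f_homs X L L U" "T' : f_homs X L L U"
 shows "T -<(f_end_sheaf X L) U> T' = fam' L U (%V m. T V m -<L V> T' V m)"
proof -
 have car: "T' :<(f_end_sheaf X L) U>" using T by (simp add: f_end_sheaf_def)
 have "rs U V (\<ominus>\<^bsub>osec X U\<^esub> 1<U>) = \<ominus>\<^bsub>osec X V\<^esub> 1<V>" if "op V" "V <= U" for V
  using that U pm_res_neg[of "ox X" U V "1<U>"] by simp
 then show ?thesis
  unfolding pm_minus_eq[OF f_end_pmodule U] pm_neg_eq[OF f_end_pmodule U car, symmetric]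
  unfolding f_end_sheaf_def fam_sheaf_simps
  by (intro restrict_ext) (use T f_homsD(2)[OF T(2)] L in \<open>simp add: pm_neg_eq pm_minus_eq\<close>)
qed

text \<open>Linearity over the base field is obtained from the Leibniz rule \<open>leib\<close>,
  since derivations vanish on scalars.\<close>

lemma liftsI:
 assumes D: "D : ders X U"
  and cl: "!!V m. op V ==> V <= U ==> m :<L V> ==> T V m :<L V>"
  and add: "!!V m n. op V ==> V <= U ==> m :<L V> ==> n :<L V> ==>
   T V (m +<L V> n) = T V m +<L V> T V n"
  and restr: "!!V W m. op V ==> V <= U ==> op W ==> W <= V ==> m :<L V> ==>
   T W (res L V W m) = res L V W (T V m)"
  and leib: "!!V s m. op V ==> V <= U ==> s :<V> ==> m :<L V> ==>
   T V (s *<L V> m) = s *<L V> T V m +<L V> D V s *<L V> m"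
 shows "lifts X L U D (fam' L U T)"
 unfolding lifts_def
proof (intro conjI ballI)
 show "fam' L U T : f_homs X L L U"
 proof (rule f_homsI[OF cl add restr])
  fix V c m assume V: "op V" "V <= U" and c: "c : carrier (base X)" and m: "m :<L V>"
  show "T V (scal X V c *<L V> m) = scal X V c *<L V> T V m"
   using leib[OF V, of "scal X V c" m] der_scal[OF D V c] V c m L cl[OF V m] by simp
 qed
 fix V s m assume "V : ops U" "s :<V>" "m :<L V>"
 then show "fam' L U T V (s *<L V> m) = s *<L V> fam' L U T V m +<L V> D V s *<L V> m"
  using leib L by simp
qed

lemma liftsD:
 assumes "lifts X L U D T"
 shows "T : f_homs X L L U"
  "op V ==> V <= U ==> s :<V> ==> m :<L V> ==>
   T V (s *<L V> m) = s *<L V> T V m +<L V> D V s *<L V> m"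
 using assms by (simp_all add: lifts_def)

text \<open>The terms \<open>D(a) m\<close> of the two Leibniz rules cancel, so two lifts of one
  derivation differ by a map linear over the structure sheaf. This is what puts both
  \<open>defect\<close> and \<open>conn_diff\<close> into the endomorphism sheaf.\<close>

lemma lifts_diff:
 assumes T: "lifts X L U D T" "lifts X L U D T'" and D: "D : ders X U"
 shows "fam' L U (%V m. T V m -<L V> T' V m) : Hom L L U"
proof (rule homsI[OF L])
 note t = f_homsD[OF liftsD(1)[OF T(1)]] and t' = f_homsD[OF liftsD(1)[OF T(2)]]
 fix V m assume V: "op V" "V <= U" and m: "m :<L V>"
 note c = t(2)[OF V] t'(2)[OF V]
 show "T V m -<L V> T' V m :<L V>" using c m L V by simp
 show "T V (m +<L V> n) -<L V> T' V (m +<L V> n) =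
   (T V m -<L V> T' V m) +<L V> (T V n -<L V> T' V n)" if n: "n :<L V>" for n
  unfolding t(3)[OF V m n] t'(3)[OF V m n] by (rule pm_minus_swap[OF L V(1)]) (use c m n in simp_all)
 show "T W (res L V W m) -<L W> T' W (res L V W m) = res L V W (T V m -<L V> T' V m)" if W: "op W" "W <= V" for W
  unfolding t(4)[OF V W m] t'(4)[OF V W m] using c m L V W by simp
 show "T V (a *<L V> m) -<L V> T' V (a *<L V> m) = a *<L V> (T V m -<L V> T' V m)"
  if a: "a :<V>" for a
  unfolding liftsD(2)[OF T(1) V a m] liftsD(2)[OF T(2) V a m]
  using pm_minus_swap[OF L V(1), of "a *<L V> T V m" "D V a *<L V> m" "a *<L V> T' V m" "D V a *<L V> m"]
   c m a L V D by (simp add: pm_smult_minus)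
qed

lemma ks_ders_subset: "ks_ders X L U <= ders X U"
 by (auto simp: ks_ders_def)

lemma ks_simps:
 "mcar (ks_sheaf X L) U = ks_ders X L U"
 "res (ks_sheaf X L) U V D = restrict D (ops V)"
 "op V ==> V <= U ==> a :<V> ==> (D +<(ks_sheaf X L) U> D') V a = D V a +<V> D' V a"
 "op V ==> V <= U ==> a :<V> ==> (b *<(ks_sheaf X L) U> D) V a = rs U V b *<V> D V a"
 by (simp_all add: ks_sheaf_def)

lemma lifts_smult:
 assumes U: "op U" and T: "lifts X L U D T" and D: "D : ders X U" and a: "a :<U>"
  and aD: "a *<(ks_sheaf X L) U> D : ders X U"
 shows "lifts X L U (a *<(ks_sheaf X L) U> D) (fam' L U (%V m. rs U V a *<L V> T V m))"
proof (rule liftsI[OF aD])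
 note t = f_homsD[OF liftsD(1)[OF T]]
 fix V m assume V: "op V" "V <= U" and m: "m :<L V>"
 note c = t(2)[OF V]
 have aV: "rs U V a :<V>" using a U V by simp
 show "rs U V a *<L V> T V m :<L V>" using c m aV L V by simp
 show "rs U V a *<L V> T V (m +<L V> n) =
   rs U V a *<L V> T V m +<L V> rs U V a *<L V> T V n" if n: "n :<L V>" for n
  unfolding t(3)[OF V m n] by (rule pm_smult_add(1)[OF L V(1) aV]) (use c m n in simp_all)
 show "rs U W a *<L W> T W (res L V W m) = res L V W (rs U V a *<L V> T V m)" if W: "op W" "W <= V" for W
  unfolding t(4)[OF V W m] using c m L V W U a by simp
 show "rs U V a *<L V> T V (s *<L V> m) =
   s *<L V> (rs U V a *<L V> T V m) +<L V> (a *<(ks_sheaf X L) U> D) V s *<L V> m"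
  if s: "s :<V>" for s
  unfolding liftsD(2)[OF T V s m] ks_simps(4)[OF V s]
  using pm_smult_commute[OF L V(1) aV s c[OF m]] pm_smult_smult[OF L V(1) aV der_closed[OF D V s] m]
   pm_smult_add(1)[OF L V(1) aV, of "s *<L V> T V m" "D V s *<L V> m"] c[OF m] m s der_closed[OF D V s] L V by simp
qed

end

end

section \<open>The Kodaira-Spencer extension for a chosen system of lifts\<close>

locale lr = fsp X for X :: "('x, 'r, 'f) over_space" +
 fixes L :: "('x, 'r, 'm) omod" and N :: "('x, ('x, 'r, 'r) fam, ('x, 'm, 'm) fam) fam"
 assumes L: "pmodule X L" and K: "O_module X (ks_sheaf X L)" and N: "lift_choice X L N"
begin

abbreviation (input) "K \<equiv> ks_sheaf X L"
abbreviation (input) "E \<equiv> end_sheaf X L"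

lemma K': "pmod K" using K by simp
lemma E': "pmod E" by (rule hom_sheaf_pmodule[OF L L])

lemma ks_der: "D : ks_ders X L U ==> D : ders X U"
 using ks_ders_subset[OF L] by blast

lemma ks_ops_closed:
 assumes "op U" "D : ks_ders X L U"
 shows "D' : ks_ders X L U ==> D +<K U> D' : ks_ders X L U"
  "a :<U> ==> a *<K U> D : ks_ders X L U"
  "op V ==> V <= U ==> restrict D (ops V) : ks_ders X L V"
proof -
 note s = ks_simps(1)[OF L, symmetric]
 show "D +<K U> D' : ks_ders X L U" if "D' : ks_ders X L U"
  using pm_closed(1)[OF K' assms(1)] assms(2) that unfolding s by simp
 show "a *<K U> D : ks_ders X L U" if "a :<U>"
  using pm_closed(4)[OF K' assms(1)] assms(2) that unfolding s by simp
 show "restrict D (ops V) : ks_ders X L V" if "op V" "V <= U"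
  using pm_res[OF K' assms(1) that, of D] assms(2) by (simp add: ks_simps(1,2)[OF L])
qed

lemma lift_choice_lifts: "op U ==> D : ks_ders X L U ==> lifts X L U D (N U D)"
 using N op_pts unfolding lift_choice_def by simp

lemma lift_choice_closed:
 "op U ==> D : ks_ders X L U ==> op V ==> V <= U ==> m :<L V> ==> N U D V m :<L V>"
 using f_homsD(2)[OF L liftsD(1)[OF L lift_choice_lifts]] .

lemma lift_choice_add:
 assumes "op U" "D : ks_ders X L U" "D' : ks_ders X L U" "op V" "V <= U" "m :<L V>"
 shows "N U (D +<K U> D') V m = N U D V m +<L V> N U D' V m"
proof -
 have "N U (D +<K U> D') = N U D +<(f_end_sheaf X L) U> N U D'"
  using N assms op_pts unfolding lift_choice_def by simp
 then show ?thesis using assms by (simp add: f_end_sheaf_def)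
qed

lemma lift_choice_res:
 assumes "op U" "D : ks_ders X L U" "op V" "V <= U" "op W" "W <= V"
 shows "N V (restrict D (ops V)) W m = N U D W m"
proof -
 have "N V (res K U V D) = res (f_end_sheaf X L) U V (N U D)"
  using N assms op_pts unfolding lift_choice_def by simp
 then show ?thesis using assms by (simp add: f_end_sheaf_def ks_simps(2)[OF L])
qed

lemma defect_eq:
 assumes U: "op U" and a: "a :<U>" and D: "D : ks_ders X L U"
 shows "defect X L N U a D =
  fam' L U (%V m. rs U V a *<L V> N U D V m -<L V> N U (a *<K U> D) V m)"
  "defect X L N U a D : Hom L L U"
proof -
 note aD = ks_ops_closed(2)[OF U D a]
 note l = lifts_smult[OF L U lift_choice_lifts[OF U D] ks_der[OF D] a ks_der[OF aD]]
 have e: "a *<(f_end_sheaf X L) U> N U D = fam' L U (%V m. rs U V a *<L V> N U D V m)"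
  by (simp add: f_end_sheaf_def)
 show eq: "defect X L N U a D =
   fam' L U (%V m. rs U V a *<L V> N U D V m -<L V> N U (a *<K U> D) V m)"
  unfolding defect_def e f_end_minus[OF L U liftsD(1)[OF L l] liftsD(1)[OF L lift_choice_lifts[OF U aD]]]
  by (intro restrict_ext) simp
 have "fam' L U (%V m. fam' L U (%V m. rs U V a *<L V> N U D V m) V m -<L V> N U (a *<K U> D) V m)
   : Hom L L U"
  by (rule lifts_diff[OF L l lift_choice_lifts[OF U aD] ks_der[OF aD]])
 moreover have "fam' L U (%V m. fam' L U (%V m. rs U V a *<L V> N U D V m) V m -<L V> N U (a *<K U> D) V m)
   = defect X L N U a D" unfolding eq by (intro restrict_ext) simp
 ultimately show "defect X L N U a D : Hom L L U" by simp
qed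

lemma pm_minus_split:
 assumes "op V" "x :<L V>" "y :<L V>" "z :<L V>"
 shows "x -<L V> z = (x -<L V> y) +<L V> (y -<L V> z)"
 using pm_telescope[OF L assms(1,4,3,2)] pm_comm[OF L assms(1)] assms L by simp

text \<open>The conditions under which the twisted scalar multiplication of \<open>lr_sheaf\<close>
  is a module structure compatible with restriction. The second one is behind associativity; it
  holds by inserting \<open>a N(b D)\<close> between \<open>a b N(D)\<close> and
  \<open>N(a b D)\<close>.\<close>

lemma defect_props:
 assumes U: "op U" and a: "a :<U>" and D: "D : ks_ders X L U"
 shows "b :<U> ==>
   defect X L N U (a +<U> b) D = defect X L N U a D +<E U> defect X L N U b D" (is "_ ==> ?t1")
  "b :<U> ==> defect X L N U (a *<U> b) D =
   a *<E U> defect X L N U b D +<E U> defect X L N U a (b *<K U> D)" (is "_ ==> ?t2")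
  "D' : ks_ders X L U ==>
   defect X L N U a (D +<K U> D') = defect X L N U a D +<E U> defect X L N U a D'" (is "_ ==> ?t3")
  "defect X L N U 1<U> D = 0<E U>"
  "op W ==> W <= U ==>
   defect X L N W (rs U W a) (restrict D (ops W)) = restrict (defect X L N U a D) (ops W)" (is "_ ==> _ ==> ?t5")
proof -
 note aD = ks_ops_closed(2)[OF U D a]
 have D': "D :<K U>" using D by (simp add: ks_simps(1)[OF L])
 note NC = lift_choice_closed[OF U]
 {
  assume b: "b :<U>"
  note bD = ks_ops_closed(2)[OF U D b]
  have ab: "a +<U> b :<U>" "a *<U> b :<U>" using U a b by auto
  show ?t1
   unfolding defect_eq(1)[OF U ab(1) D] defect_eq(1)[OF U a D] defect_eq(1)[OF U b D] hom_simps
  proof (intro restrict_ext)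
   fix V m assume "V : ops U" and m: "m :<L V>"
   then have V: "op V" "V <= U" by auto
   have abV: "rs U V a :<V>" "rs U V b :<V>" using a b U V by auto
   show "rs U V (a +<U> b) *<L V> N U D V m -<L V> N U ((a +<U> b) *<K U> D) V m =
    fam' L U (%V m. rs U V a *<L V> N U D V m -<L V> N U (a *<K U> D) V m) V m +<L V>
    fam' L U (%V m. rs U V b *<L V> N U D V m -<L V> N U (b *<K U> D) V m) V m"
    unfolding pm_smult_add(2)[OF K' U a b D'] lift_choice_add[OF U aD bD V m]
    using pm_smult_add(2)[OF L V(1) abV NC[OF D V m]] V m U a b
     pm_minus_swap[OF L V(1) pm_closed(4)[OF L V(1) abV(1) NC[OF D V m]] pm_closed(4)[OF L V(1) abV(2) NC[OF D V m]]
      NC[OF aD V m] NC[OF bD V m]] by simp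
  qed
  show ?t2
   unfolding defect_eq(1)[OF U ab(2) D] defect_eq(1)[OF U a bD] defect_eq(1)[OF U b D] hom_simps
  proof (intro restrict_ext)
   fix V m assume "V : ops U" and m: "m :<L V>"
   then have V: "op V" "V <= U" by auto
   have abV: "rs U V a :<V>" "rs U V b :<V>" using a b U V by auto
   show "rs U V (a *<U> b) *<L V> N U D V m -<L V> N U ((a *<U> b) *<K U> D) V m =
    fam' L U (%V m. rs U V a *<L V>
     fam' L U (%V m. rs U V b *<L V> N U D V m -<L V> N U (b *<K U> D) V m) V m) V m +<L V>
    fam' L U (%V m. rs U V a *<L V> N U (b *<K U> D) V m -<L V>
     N U (a *<K U> (b *<K U> D)) V m) V m"
    unfolding pm_smult_smult[OF K' U a b D', symmetric]
    using pm_smult_smult[OF L V(1) abV NC[OF D V m]] V m U a b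
     pm_smult_minus[OF L V(1) abV(1) pm_closed(4)[OF L V(1) abV(2) NC[OF D V m]] NC[OF bD V m]]
     pm_minus_split[OF V(1) pm_closed(4)[OF L V(1) abV(1) pm_closed(4)[OF L V(1) abV(2) NC[OF D V m]]]
      pm_closed(4)[OF L V(1) abV(1) NC[OF bD V m]] NC[OF ks_ops_closed(2)[OF U bD a] V m]] by simp
  qed
 }
 {
  assume D2: "D' : ks_ders X L U"
  note DD = ks_ops_closed(1)[OF U D D2]
  note aD2 = ks_ops_closed(2)[OF U D2 a]
  have D2': "D' :<K U>" using D2 by (simp add: ks_simps(1)[OF L])
  show ?t3
   unfolding defect_eq(1)[OF U a DD] defect_eq(1)[OF U a D] defect_eq(1)[OF U a D2] hom_simps
  proof (intro restrict_ext)
   fix V m assume "V : ops U" and m: "m :<L V>"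
   then have V: "op V" "V <= U" by auto
   have aV: "rs U V a :<V>" using a U V by auto
   show "rs U V a *<L V> N U (D +<K U> D') V m -<L V> N U (a *<K U> (D +<K U> D')) V m =
    fam' L U (%V m. rs U V a *<L V> N U D V m -<L V> N U (a *<K U> D) V m) V m +<L V>
    fam' L U (%V m. rs U V a *<L V> N U D' V m -<L V> N U (a *<K U> D') V m) V m"
    unfolding pm_smult_add(1)[OF K' U a D' D2'] lift_choice_add[OF U aD aD2 V m] lift_choice_add[OF U D D2 V m]
     pm_smult_add(1)[OF L V(1) aV NC[OF D V m] NC[OF D2 V m]]
    using V m U a
     pm_minus_swap[OF L V(1) pm_closed(4)[OF L V(1) aV NC[OF D V m]] pm_closed(4)[OF L V(1) aV NC[OF D2 V m]]
      NC[OF aD V m] NC[OF aD2 V m]] by simp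
  qed
 }
 have one: "1<U> :<U>" using U by simp
 show "defect X L N U 1<U> D = 0<E U>"
  unfolding defect_eq(1)[OF U one D] hom_simps pm_simps(3)[OF K' U D']
  by (intro restrict_ext) (use U NC[OF D] L in simp)
 assume W: "op W" "W <= U"
 have s: "V <= U" if "V <= W" for V using that W by blast
 have aW: "rs U W a :<W>" using a U W by simp
 have smr: "rs U W a *<K W> restrict D (ops W) = restrict (a *<K U> D) (ops W)"
  using pm_res_smult[OF K' U W a D'] by (simp add: ks_simps(2)[OF L])
 show ?t5
  unfolding defect_eq(1)[OF W(1) aW ks_ops_closed(3)[OF U D W]] defect_eq(1)[OF U a D]
   restrict_restrict opens_Int_subset[OF W(2)] smr
  by (intro restrict_ext) (use U W a s in \<open>simp add: lift_choice_res[OF U D W] lift_choice_res[OF U aD W]\<close>)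
qed

lemma lr_simps:
 "(k, D) :<(lr_sheaf X L N) U> \<longleftrightarrow> k :<E U> & D :<K U>"
 "0<(lr_sheaf X L N) U> = (0<E U>, 0<K U>)"
 "(k, D) +<(lr_sheaf X L N) U> (k', D') = (k +<E U> k', D +<K U> D')"
 "a *<(lr_sheaf X L N) U> (k, D) = (a *<E U> k +<E U> defect X L N U a D, a *<K U> D)"
 "res (lr_sheaf X L N) U V (k, D) = (res E U V k, res K U V D)"
 by (simp_all add: lr_sheaf_def del: hom_simps)

end

context lr
begin

abbreviation (input) "LR \<equiv> lr_sheaf X L N"

lemma defect_closed: "op U ==> a :<U> ==> D :<K U> ==> defect X L N U a D :<E U>"
 using defect_eq(2) by (simp add: ks_simps(1)[OF L])

lemma defect_res:
 "op U ==> a :<U> ==> D :<K U> ==> op V ==> V <= U ==>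
  res E U V (defect X L N U a D) = defect X L N V (rs U V a) (res K U V D)"
 using defect_props(5) by (simp add: ks_simps(1,2)[OF L])

lemmas defect_simps = defect_props(1-4)[folded ks_simps(1)[OF L]]

lemma lr_pmodule: "pmod LR"
 unfolding pmodule_def
proof (intro conjI allI impI ballI)
 show "presheaf_on (tsp X) (mcar LR) (res LR)"
  unfolding presheaf_on_def
 proof (intro conjI allI impI funcsetI ballI)
  show "res LR U V z :<LR V>" if "op U & op V & V <= U" "z :<LR U>" for U V z
   using that K' E' by (cases z) (simp add: lr_simps del: hom_simps)
  show "res LR U U z = z" if "op U" "z :<LR U>" for U z
   using that K' E' by (cases z) (simp add: lr_simps del: hom_simps)
  show "res LR V W (res LR U V z) = res LR U W z" if "op U & op V & op W & W <= V & V <= U" "z :<LR U>" for U V W z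
   using that K' E' by (cases z) (simp add: lr_simps del: hom_simps)
 qed
 show "module (osec X U) (sec LR U)" if U: "op U" for U
 proof -
  interpret ME: module "osec X U" "sec E U" by (rule pm_module[OF E' U])
  interpret MK: module "osec X U" "sec K U" by (rule pm_module[OF K' U])
  show ?thesis
  proof (intro moduleI abelian_groupI O_cring[OF U])
   show "0<LR U> :<LR U>" by (simp add: lr_simps del: hom_simps)
   fix x assume "x :<LR U>"
   then obtain e c where x: "x = (e, c)" "e :<E U>" "c :<K U>"
    by (cases x) (simp add: lr_simps)
   show "0<LR U> +<LR U> x = x" "1<U> *<LR U> x = x"
    using x defect_simps(4)[OF U _ x(3), of "1<U>"] U by (simp_all add: lr_simps del: hom_simps)
   show "EX y:mcar LR U. y +<LR U> x = 0<LR U>"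
    using x by (intro bexI[of _ "(\<ominus>\<^bsub>sec E U\<^esub> e, \<ominus>\<^bsub>sec K U\<^esub> c)"])
     (simp_all add: lr_simps ME.l_neg MK.l_neg del: hom_simps)
   {
    fix a assume a: "a :<U>"
    note da = defect_closed[OF U a]
    show "a *<LR U> x :<LR U>" using a x U da[OF x(3)] by (simp add: lr_simps del: hom_simps)
    fix b assume b: "b :<U>"
    note db = defect_closed[OF U b]
    show "(a +<U> b) *<LR U> x = a *<LR U> x +<LR U> b *<LR U> x"
     using a b x da[OF x(3)] db[OF x(3)] pm_add_swap[OF E' U, of "a *<E U> e" "b *<E U> e"]
     by (simp add: lr_simps ME.smult_l_distr MK.smult_l_distr defect_simps(1)[OF U a x(3) b] del: hom_simps)
    have bc: "b *<K U> c :<K U>" using b x by simp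
    show "(a *<U> b) *<LR U> x = a *<LR U> (b *<LR U> x)"
     using a b x da[OF bc] db[OF x(3)]
     by (simp add: lr_simps ME.smult_assoc1 MK.smult_assoc1 ME.smult_r_distr ME.a_assoc defect_simps(2)[OF U a x(3) b] del: hom_simps)
   }
   fix y assume "y :<LR U>"
   then obtain e' c' where y: "y = (e', c')" "e' :<E U>" "c' :<K U>"
    by (cases y) (simp add: lr_simps)
   show "x +<LR U> y :<LR U>" using x y U by (simp add: lr_simps del: hom_simps)
   show "x +<LR U> y = y +<LR U> x" using x y by (simp add: lr_simps ME.a_comm MK.a_comm del: hom_simps)
   show "a *<LR U> (x +<LR U> y) = a *<LR U> x +<LR U> a *<LR U> y"
    if a: "a :<U>" for a
    using a x y defect_closed[OF U a x(3)] defect_closed[OF U a y(3)] pm_add_swap[OF E' U, of "a *<E U> e" "a *<E U> e'"]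
    by (simp add: lr_simps ME.smult_r_distr MK.smult_r_distr defect_simps(3)[OF U a x(3) y(3)] del: hom_simps)
   fix z assume "z :<LR U>"
   then obtain e'' c'' where z: "z = (e'', c'')" "e'' :<E U>" "c'' :<K U>"
    by (cases z) (simp add: lr_simps)
   show "x +<LR U> y +<LR U> z = x +<LR U> (y +<LR U> z)"
    using x y z by (simp add: lr_simps ME.a_assoc MK.a_assoc del: hom_simps)
  qed
 qed
 fix U V x assume "op U & V : ops U" and x: "x :<LR U>"
 then have U: "op U" "op V" "V <= U" by auto
 obtain e c where x': "x = (e, c)" "e :<E U>" "c :<K U>" using x by (cases x) (simp add: lr_simps)
 show "res LR U V (x +<LR U> y) = res LR U V x +<LR V> res LR U V y" if "y :<LR U>" for y
  using that x U E' K' by (cases x; cases y) (simp add: lr_simps del: hom_simps)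
 show "res LR U V (a *<LR U> x) = rs U V a *<LR V> res LR U V x" if a: "a :<U>" for a
  using a x' U E' K' defect_closed[OF U(1) a x'(3)] defect_res[OF U(1) a x'(3) U(2,3)]
  by (simp add: lr_simps del: hom_simps)
qed

lemma lr_O_module:
 assumes LO: "omod L"
 shows "omod LR"
 unfolding O_module_iff
proof (rule conjI[OF lr_pmodule])
 have EO: "omod E" by (rule hom_sheaf_O_module[OF L LO])
 have "mcar LR = (%U. mcar E U \<times> mcar K U)" "res LR = (%U V. map_prod (res E U V) (res K U V))"
  by (simp_all add: lr_sheaf_def)
 moreover have "sheaf_on (tsp X) (%U. mcar E U \<times> mcar K U) (%U V. map_prod (res E U V) (res K U V))"
  by (rule sheaf_on_Times) (use EO K in \<open>simp_all add: O_module_iff del: hom_simps hom_sheaf_O_module\<close>)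
 ultimately show "sheaf_on (tsp X) (mcar LR) (res LR)" by (simp only:)
qed

lemma lr_inc_hom: "lr_inc X L : mor X E LR"
proof -
 have "fam' E (pts X) (%U k. (k, 0<K U>)) : mor X E LR"
 proof (rule homsI[OF E'])
  fix V k assume V: "op V" and k: "k :<E V>"
  interpret MK: module "osec X V" "sec K V" by (rule pm_module[OF K' V])
  show "(k, 0<K V>) :<LR V>" using k by (simp add: lr_simps del: hom_simps)
  show "(k +<E V> p, 0<K V>) = (k, 0<K V>) +<LR V> (p, 0<K V>)" for p
   by (simp add: lr_simps del: hom_simps)
  show "(res E V W k, 0<K W>) = res LR V W (k, 0<K V>)" if "op W" "W <= V" for W
   using that V K' by (simp add: lr_simps del: hom_simps)
  show "(a *<E V> k, 0<K V>) = a *<LR V> (k, 0<K V>)" if a: "a :<V>" for a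
  proof -
   have z: "0<K V> :<K V>" by simp
   interpret ME: module "osec X V" "sec E V" by (rule pm_module[OF E' V])
   \<comment> \<open>Additivity of the defect in the derivation makes it vanish at the zero
     derivation. Hence the twist disappears on the endomorphism part, and the inclusion is
     linear.\<close>
   have "defect X L N V a 0<K V> +<E V> defect X L N V a 0<K V> = defect X L N V a 0<K V>"
    using defect_simps(3)[OF V a z z] z by (simp del: hom_simps)
   then have "defect X L N V a 0<K V> = 0<E V>"
    using ME.add.l_cancel_one[OF defect_closed[OF V a z] defect_closed[OF V a z]] by (simp del: hom_simps)
   then show ?thesis using a k V E' K' by (simp add: lr_simps del: hom_simps)
  qed
 qed
 then show ?thesis by (simp add: lr_inc_def)
qed

lemma lr_prj_eq: "lr_prj X L = fam' LR (pts X) (%U z. snd z)"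
 by (simp add: lr_prj_def lr_sheaf_def)

lemma lr_prj_hom: "lr_prj X L : mor X LR K"
 unfolding lr_prj_eq
proof (rule homsI[OF lr_pmodule])
 fix V z assume V: "op V" and z: "z :<LR V>"
 obtain k D where z': "z = (k, D)" "k :<E V>" "D :<K V>" using z by (cases z) (simp add: lr_simps)
 show "snd z :<K V>" using z' by simp
 show "snd (z +<LR V> y) = snd z +<K V> snd y" if "y :<LR V>" for y
  using z' by (cases y) (simp add: lr_simps del: hom_simps)
 show "snd (a *<LR V> z) = a *<K V> snd z" for a using z' by (simp add: lr_simps del: hom_simps)
 show "snd (res LR V W z) = res K V W (snd z)" for W using z' by (simp add: lr_simps del: hom_simps)
qed

subsection \<open>The local splitting by a generator\<close>

text \<open>The connection over \<open>U\<close> for which the generator \<open>e\<close> is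
  horizontal. It is linear in the derivation over the structure sheaf, whereas the chosen lifts
  \<open>N\<close> are merely additive.\<close>

definition conn :: "'x set => 'm => 'x set => ('x, 'r, 'r) fam => ('x, 'm, 'm) fam"
 where "conn U e V D = fam' L V (%W m. D W (coef L U e W m) *<L W> res L U W e)"

text \<open>The correction from the additive choice \<open>N\<close> to the linear choice
  \<open>conn\<close>; it becomes the endomorphism component of the local splitting.\<close>

definition conn_diff :: "'x set => 'm => 'x set => ('x, 'r, 'r) fam => ('x, 'm, 'm) fam"
 where "conn_diff U e V D = fam' L V (%W m. conn U e V D W m -<L W> N V D W m)"

context
 fixes U e assumes U: "op U" and e: "generates L U e"
begin

lemma conn_lifts:
 assumes V: "op V" "V <= U" and D: "D : ks_ders X L V"
 shows "lifts X L V D (conn U e V D)"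
 unfolding conn_def
proof (rule liftsI[OF L ks_der[OF D]])
 note D' = ks_der[OF D]
 fix W m assume W: "op W" "W <= V" and m: "m :<L W>"
 have WU: "W <= U" using W V by blast
 note c = coef_closed[OF L U e W(1) WU] and re = gen_res[OF L U e W(1) WU]
 note Dc = der_closed[OF D' W]
 interpret R: cring "osec X W" by (rule O_cring[OF W(1)])
 show "D W (coef L U e W m) *<L W> res L U W e :<L W>" using Dc[OF c[OF m]] re L W by simp
 show "D W (coef L U e W (m +<L W> n)) *<L W> res L U W e =
   D W (coef L U e W m) *<L W> res L U W e +<L W> D W (coef L U e W n) *<L W> res L U W e" if n: "n :<L W>" for n
  unfolding coef_add[OF L U e W(1) WU m n] der_add[OF D' W c[OF m] c[OF n]]
  by (rule pm_smult_add(2)[OF L W(1) Dc[OF c[OF m]] Dc[OF c[OF n]] re])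
 show "D Y (coef L U e Y (res L W Y m)) *<L Y> res L U Y e = res L W Y (D W (coef L U e W m) *<L W> res L U W e)"
  if Y: "op Y" "Y <= W" for Y
  unfolding coef_res[OF L U e W(1) WU Y m] der_res[OF D' W Y c[OF m]]
  using Dc[OF c[OF m]] re L W Y WU U gen_closed[OF L U e] by simp
 show "D W (coef L U e W (s *<L W> m)) *<L W> res L U W e =
   s *<L W> (D W (coef L U e W m) *<L W> res L U W e) +<L W> D W s *<L W> m" if s: "s :<W>" for s
 proof -
  let ?c = "coef L U e W m" and ?e = "res L U W e"
  have "D W s *<L W> m = D W s *<L W> (?c *<L W> ?e)" using coef_eq[OF L U e W(1) WU m] by simp
  also have "\<dots> = (?c *<W> D W s) *<L W> ?e"
   unfolding pm_smult_smult[OF L W(1) Dc[OF s] c[OF m] re] using Dc[OF s] c[OF m] by (simp add: R.m_comm)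
  finally show ?thesis
   unfolding coef_smult[OF L U e W(1) WU m s] der_mult[OF D' W s c[OF m]]
   using pm_smult_add(2)[OF L W(1) _ _ re, of "s *<W> D W ?c" "?c *<W> D W s"]
    pm_smult_smult[OF L W(1) s Dc[OF c[OF m]] re] s c[OF m] Dc[OF s] Dc[OF c[OF m]] by simp
 qed
qed

lemma conn_diff_homs:
 assumes V: "op V" "V <= U" and D: "D : ks_ders X L V"
 shows "conn_diff U e V D :<E V>"
 unfolding conn_diff_def hom_simps by (rule lifts_diff[OF L conn_lifts[OF V D] lift_choice_lifts[OF V(1) D] ks_der[OF D]])

lemma conn_closed:
 assumes V: "op V" "V <= U" and D: "D : ks_ders X L V" and W: "op W" "W <= V" and m: "m :<L W>"
 shows "conn U e V D W m :<L W>"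
 by (rule f_homsD(2)[OF L liftsD(1)[OF L conn_lifts[OF V D]] W m])

lemma conn_props:
 assumes V: "op V" "V <= U" and D: "D : ks_ders X L V" and W: "op W" "W <= V" and m: "m :<L W>"
 shows "D' : ks_ders X L V ==> conn U e V (D +<K V> D') W m = conn U e V D W m +<L W> conn U e V D' W m"
  "a :<V> ==> conn U e V (a *<K V> D) W m = rs V W a *<L W> conn U e V D W m"
  "op Y ==> W <= Y ==> Y <= V ==> conn U e Y (restrict D (ops Y)) W m = conn U e V D W m"
proof -
 have WU: "W <= U" using W V by blast
 note c = coef_closed[OF L U e W(1) WU m] and re = gen_res[OF L U e W(1) WU]
 note Dc = der_closed[OF ks_der[OF D] W c]
 show "conn U e V (D +<K V> D') W m = conn U e V D W m +<L W> conn U e V D' W m" if D': "D' : ks_ders X L V"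
  unfolding conn_def using W m ks_simps(3)[OF L W c, of D D'] pm_smult_add(2)[OF L W(1) Dc der_closed[OF ks_der[OF D'] W c] re] by simp
 show "conn U e V (a *<K V> D) W m = rs V W a *<L W> conn U e V D W m" if a: "a :<V>"
  unfolding conn_def using W m ks_simps(4)[OF L W c, of a D] pm_smult_smult[OF L W(1) _ Dc re, of "rs V W a"] a V by simp
 show "conn U e Y (restrict D (ops Y)) W m = conn U e V D W m" if "op Y" "W <= Y" "Y <= V"
  unfolding conn_def using W m that by simp
qed

lemma conn_diff_apply:
 "op W ==> W <= V ==> m :<L W> ==> conn_diff U e V D W m = conn U e V D W m -<L W> N V D W m"
 by (simp add: conn_diff_def)

text \<open>\<open>conn\<close> is linear in the derivation and \<open>N\<close> is linear up to
  \<open>defect\<close>, so \<open>conn_diff\<close> picks up exactly the defect under scalars. This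
  matches the scalar multiplication of \<open>lr_sheaf\<close>, whence the pairs
  \<open>(conn_diff U e V D, D)\<close> depend linearly on \<open>D\<close>.\<close>

lemma conn_diff_props:
 assumes V: "op V" "V <= U" and D: "D : ks_ders X L V"
 shows "D' : ks_ders X L V ==> conn_diff U e V (D +<K V> D') = conn_diff U e V D +<E V> conn_diff U e V D'" (is "_ ==> ?t1")
  "a :<V> ==>
   conn_diff U e V (a *<K V> D) = a *<E V> conn_diff U e V D +<E V> defect X L N V a D" (is "_ ==> ?t2")
  "op W ==> W <= V ==> conn_diff U e W (restrict D (ops W)) = res E V W (conn_diff U e V D)"
proof -
 note cD = conn_closed[OF V D] and nD = lift_choice_closed[OF V(1) D]
 show ?t1 if D': "D' : ks_ders X L V"
  unfolding hom_simps conn_diff_def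
  by (intro restrict_ext)
   (use L in \<open>simp add: conn_props(1)[OF V D _ _ _ D'] lift_choice_add[OF V(1) D D'] pm_minus_swap cD nD
    conn_closed[OF V D'] lift_choice_closed[OF V(1) D']\<close>)
 show ?t2 if a: "a :<V>"
  unfolding hom_simps conn_diff_def defect_eq(1)[OF V(1) a D]
 proof (intro restrict_ext)
  fix W m assume "W : ops V" and m: "m :<L W>"
  then have W: "op W" "W <= V" by auto
  have aW: "rs V W a :<W>" using a V W by simp
  show "conn U e V (a *<K V> D) W m -<L W> N V (a *<K V> D) W m =
   fam' L V (%W m. rs V W a *<L W> fam' L V (%W m. conn U e V D W m -<L W> N V D W m) W m) W m +<L W>
   fam' L V (%W m. rs V W a *<L W> N V D W m -<L W> N V (a *<K V> D) W m) W m"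
   unfolding conn_props(2)[OF V D W m a]
   using W m pm_smult_minus[OF L W(1) aW cD[OF W m] nD[OF W m]]
    pm_minus_split[OF W(1) pm_closed(4)[OF L W(1) aW cD[OF W m]] pm_closed(4)[OF L W(1) aW nD[OF W m]]
     lift_choice_closed[OF V(1) ks_ops_closed(2)[OF V(1) D a] W m]] by simp
 qed
 assume W: "op W" "W <= V"
 show "conn_diff U e W (restrict D (ops W)) = res E V W (conn_diff U e V D)"
  unfolding hom_simps conn_diff_def restrict_restrict opens_Int_subset[OF W(2)]
  by (intro restrict_ext)
   (use W in \<open>simp add: conn_props(3)[OF V D _ _ _ W(1) _ W(2)] lift_choice_res[OF V(1) D W] subset_trans[OF _ W(2)]\<close>)
qed

lemma lr_split:
 "split_over K E LR (lr_inc X L) (lr_prj X L) U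
  (fam' K U (%V D. (conn_diff U e V D, D)))
  (fam' LR U (%V z. fst z -<E V> conn_diff U e V (snd z)))" (is "split_over _ _ _ _ _ _ ?s ?r")
proof -
 note cdc = conn_diff_homs[folded ks_simps(1)[OF L]]
 note cdp = conn_diff_props[folded ks_simps(1)[OF L] ks_simps(2)[OF L]]
 have cdr: "conn_diff U e W (res K V W D) = res E V W (conn_diff U e V D)" if "op V" "V <= U" "D :<K V>" "op W" "W <= V" for V W D
  using conn_diff_props(3)[OF that(1,2) _ that(4,5)] that(3) unfolding ks_simps(1,2)[OF L] by blast
 have s: "?s : Hom K LR U"
 proof (rule homsI[OF K'])
  fix V D assume V: "op V" "V <= U" and D: "D :<K V>"
  show "(conn_diff U e V D, D) :<LR V>" using cdc[OF V D] D by (simp only: lr_simps)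
  show "(conn_diff U e V (D +<K V> D'), D +<K V> D') = (conn_diff U e V D, D) +<LR V> (conn_diff U e V D', D')"
   if "D' :<K V>" for D' using cdp(1)[OF V D that] by (simp only: lr_simps)
  show "(conn_diff U e V (a *<K V> D), a *<K V> D) = a *<LR V> (conn_diff U e V D, D)"
   if "a :<V>" for a using cdp(2)[OF V D that] by (simp only: lr_simps)
  show "(conn_diff U e W (res K V W D), res K V W D) = res LR V W (conn_diff U e V D, D)" if "op W" "W <= V" for W
   using cdr[OF V D that] by (simp only: lr_simps)
 qed
 have r: "?r : Hom LR E U"
 proof (rule homsI[OF lr_pmodule])
  fix V z assume V: "op V" "V <= U" and z: "z :<LR V>"
  obtain k D where z': "z = (k, D)" "k :<E V>" "D :<K V>" using z by (cases z) (simp add: lr_simps)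
  note c = cdc[OF V z'(3)]
  show "fst z -<E V> conn_diff U e V (snd z) :<E V>"
   using pm_closed(2)[OF E' V(1) z'(2) c] z' by (simp del: hom_simps)
  show "fst (z +<LR V> y) -<E V> conn_diff U e V (snd (z +<LR V> y)) =
    (fst z -<E V> conn_diff U e V (snd z)) +<E V> (fst y -<E V> conn_diff U e V (snd y))"
   if y: "y :<LR V>" for y
  proof -
   obtain p D' where y': "y = (p, D')" "p :<E V>" "D' :<K V>" using y by (cases y) (simp add: lr_simps)
   show ?thesis using pm_minus_swap[OF E' V(1) z'(2) y'(2) c cdc[OF V y'(3)]]
    by (simp add: z'(1) y'(1) lr_simps cdp(1)[OF V z'(3) y'(3)] del: hom_simps)
  qed
  show "fst (a *<LR V> z) -<E V> conn_diff U e V (snd (a *<LR V> z)) =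
    a *<E V> (fst z -<E V> conn_diff U e V (snd z))" if a: "a :<V>" for a
  proof -
   \<comment> \<open>Both terms of the difference that defines the retraction acquire the same
     defect under scalars, and it cancels.\<close>
   note d = defect_closed[OF V(1) a z'(3)]
   note ap = pm_closed(4)[OF E' V(1) a z'(2)] and ac = pm_closed(4)[OF E' V(1) a c]
   show ?thesis
    using pm_minus_swap[OF E' V(1) ap d ac d] pm_simps(6)[OF E' V(1) d] pm_simps(1)[OF E' V(1) pm_closed(2)[OF E' V(1) ap ac]]
     pm_smult_minus[OF E' V(1) a z'(2) c]
    by (simp add: z'(1) lr_simps cdp(2)[OF V z'(3) a] del: hom_simps)
  qed
  show "fst (res LR V W z) -<E W> conn_diff U e W (snd (res LR V W z)) =
    res E V W (fst z -<E V> conn_diff U e V (snd z))" if W: "op W" "W <= V" for W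
   using pm_res_minus[OF E' V(1) W z'(2) c] by (simp add: z'(1) lr_simps cdr[OF V z'(3) W] del: hom_simps)
 qed
 show ?thesis
  unfolding split_over_def
 proof (intro conjI s r allI impI ballI)
  fix V assume "op V & V <= U"
  then have V: "op V" "V <= U" by auto
  note pm = E' V(1)
  {
   fix a assume a: "a :<E V>"
   have z: "0<K V> :<K V>" by (rule pm_closed(5)[OF K' V(1)])
   have "conn_diff U e V 0<K V> = 0<E V>"
    using homs_zero[OF s V K' lr_pmodule] V z by (simp add: lr_simps del: hom_simps)
   then have "a -<E V> conn_diff U e V 0<K V> = a"
    using pm_add_minus[OF pm a pm_closed(5)[OF pm]] pm_simps(1)[OF pm a] by (simp del: hom_simps)
   then show "?r V (lr_inc X L V a) = a"
    unfolding lr_inc_def using V a z op_pts[OF V(1)] by (simp add: lr_simps del: hom_simps)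
  }
  show "lr_prj X L V (?s V b) = b" if b: "b :<K V>" for b
   unfolding lr_prj_eq using V b cdc[OF V b] op_pts[OF V(1)] by (simp add: lr_simps del: hom_simps)
  fix z assume z: "z :<LR V>"
  obtain k D where z': "z = (k, D)" "k :<E V>" "D :<K V>" using z by (cases z) (simp add: lr_simps)
  note c = cdc[OF V z'(3)]
  show "lr_inc X L V (?r V z) +<LR V> ?s V (lr_prj X L V z) = z"
   unfolding lr_prj_eq lr_inc_def using V z z' c op_pts[OF V(1)] pm_closed(2)[OF pm z'(2) c] pm_minus_add[OF pm z'(2) c] K'
   by (simp add: lr_simps del: hom_simps)
 qed
qed

end

end

section \<open>From local splittings to Cech cocycles\<close>

context rsp
begin

lemma homs_mor_comp:
 assumes s: "s : Hom M N U" and k: "k : mor X N P" and U: "op U" and M: "pmod M"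
 shows "fam' M U (%V m. k V (s V m)) : Hom M P U"
proof -
 have "fam' M U (%V m. restrict k (ops U) V (s V m)) : Hom M P U"
  by (rule homs_comp[OF s homs_restrict[OF k U op_pts[OF U]] M])
 moreover have "fam' M U (%V m. restrict k (ops U) V (s V m)) = fam' M U (%V m. k V (s V m))"
  by (intro restrict_ext) simp
 ultimately show ?thesis by simp
qed

lemma mor_homs_comp:
 assumes k: "k : mor X M N" and r: "r : Hom N P U" and U: "op U" and M: "pmod M"
 shows "fam' M U (%V m. r V (k V m)) : Hom M P U"
proof -
 have "fam' M U (%V m. r V (restrict k (ops U) V m)) : Hom M P U"
  by (rule homs_comp[OF homs_restrict[OF k U op_pts[OF U]] r M])
 moreover have "fam' M U (%V m. r V (restrict k (ops U) V m)) = fam' M U (%V m. r V (k V m))"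
  by (intro restrict_ext) simp
 ultimately show ?thesis by simp
qed

text \<open>The Kodaira-Spencer class consists of extensions equivalent to the one with middle term
  \<open>lr_sheaf\<close>; the splittings constructed for the latter are carried over to each of
  them.\<close>

lemma split_over_equiv:
 assumes A: "pmod A" and B: "pmod B" and E: "pmod E" and E': "pmod E'" and U: "op U"
  and i: "i : mor X A E" and p: "p : mor X E B"
  and sp: "split_over B A E i p U s r" and k: "mor_iso X E E' k"
  and i': "mor_comp X A k i = i'" and p': "mor_comp X E p' k = p"
 shows "split_over B A E' i' p' U (fam' B U (%V b. k V (s V b))) (fam' E' U (%V x. r V (mor_inv X E E' k V x)))"
 unfolding split_over_def
proof (intro conjI allI impI ballI)
 note kh = mor_isoD(1)[OF k]
 show "fam' B U (%V b. k V (s V b)) : Hom B E' U"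
  by (rule homs_mor_comp[OF split_overD(1)[OF sp] kh U B])
 show "fam' E' U (%V x. r V (mor_inv X E E' k V x)) : Hom E' A U"
  by (rule mor_homs_comp[OF mor_inv_mor[OF E E' k] split_overD(2)[OF sp] U E'])
 fix V assume "op V & V <= U"
 then have V: "op V" "V <= U" by auto
 have ic: "i V a :<E V>" if "a :<A V>" for a by (rule homs_closed[OF i V(1) op_pts[OF V(1)] that])
 have sc: "s V b :<E V>" if "b :<B V>" for b by (rule homs_closed[OF split_overD(1)[OF sp] V that])
 have i'e: "i' V a = k V (i V a)" if "a :<A V>" for a using that V unfolding i'[symmetric] by simp
 have p'e: "p' V (k V y) = p V y" if "y :<E V>" for y using that V unfolding p'[symmetric] by simp
 {
  fix a assume a: "a :<A V>"
  have "r V (mor_inv X E E' k V (i' V a)) = a"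
   unfolding i'e[OF a] mor_inv_left[OF k V(1) ic[OF a]] by (rule split_overD(3)[OF sp V a])
  then show "fam' E' U (%V x. r V (mor_inv X E E' k V x)) V (i' V a) = a"
   using V iso_closed[OF k V(1) ic[OF a]] i'e[OF a] by simp
 }
 show "p' V (fam' B U (%V b. k V (s V b)) V b) = b" if b: "b :<B V>" for b
  using V b p'e[OF sc[OF b]] split_overD(4)[OF sp V b] by simp
 fix x assume x: "x :<E' V>"
 let ?y = "mor_inv X E E' k V x"
 have y: "?y :<E V>" by (rule mor_inv_closed[OF k V(1) x])
 have xy: "k V ?y = x" by (rule mor_inv_right[OF k V(1) x])
 have rc: "r V ?y :<A V>" by (rule homs_closed[OF split_overD(2)[OF sp] V y])
 have px: "p' V x = p V ?y" using p'e[OF y] xy by simp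
 have iy: "i V (r V ?y) :<E V>" by (rule ic[OF rc])
 have eq: "i V (r V ?y) +<E V> s V (p V ?y) = ?y" by (rule split_overD(5)[OF sp V y])
 have pc: "p V ?y :<B V>" by (rule homs_closed[OF p V(1) op_pts[OF V(1)] y])
 have "k V (i V (r V ?y)) +<E' V> k V (s V (p V ?y)) = k V (i V (r V ?y) +<E V> s V (p V ?y))"
  by (rule homs_add[OF kh V(1) op_pts[OF V(1)] iy sc[OF pc], symmetric])
 then show "i' V (fam' E' U (%V x. r V (mor_inv X E E' k V x)) V x) +<E' V>
   fam' B U (%V b. k V (s V b)) V (p' V x) = x"
  using V x px i'e[OF rc] pc eq xy by simp
qed

text \<open>Let \<open>c\<close> be the coevaluation of 1 and \<open>s' U\<close> the tensored
  splitting. The pairs \<open>(s' U c, 1)\<close> are lifts of 1 in the pullback. If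
  \<open>s V\<close> exceeds \<open>s U\<close> by \<open>i h\<close>, then \<open>s' V\<close>
  exceeds \<open>s' U\<close> by the tensored inclusion applied to \<open>k\<close>, where
  \<open>k\<close> is \<open>h \<otimes> id\<close>; hence the cocycle is \<open>k c\<close>. As
  \<open>h\<close> exists only over \<open>U Int V\<close>, the map \<open>k\<close> is described by
  its values on pure tensors.\<close>

lemma shift_cocycle:
 assumes A: "omod A" and lf: "locally_free X B" and x: "extension X B A (E, i, p)" and C: "covering X C"
  and sp: "!!U. U : C ==> split_over B A E i p U (s U) (r U)"
  and h: "!!U V. U : C ==> V : C ==> h U V : Hom B A (U Int V)"
  and diff: "!!U V W b. U : C ==> V : C ==> op W ==> W <= U ==> W <= V ==> b :<B W> ==>
   s V W b = i W (h U V W b) +<E W> s U W b"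
  and k: "!!U V. U : C ==> V : C ==> k U V : Hom (tens B (dual X B)) (tens A (dual X B)) (U Int V)"
   "!!U V W b n. U : C ==> V : C ==> op W ==> W <= U Int V ==> b :<B W> ==> n :<(dual X B) W> ==>
    k U V W (pt B (dual X B) W b n) = pt A (dual X B) W (h U V W b) n"
 shows "extension X (ox X) (tens A (dual X B))
   (ext_pullback X (ox X) (tens A (dual X B)) (coev X B) (ext_tensor X B A (dual X B) (E, i, p)))" (is ?t1)
  "ext_cocycle (tens A (dual X B))
   (ext_pullback X (ox X) (tens A (dual X B)) (coev X B) (ext_tensor X B A (dual X B) (E, i, p)))
   (C, %U V. k U V (U Int V) (coev X B (U Int V) 1<(U Int V)>))" (is ?t2)
proof -
 have BO: "omod B" using lf by (simp add: locally_free_def)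
 then have B: "pmod B" and A': "pmod A" using A by auto
 have D: "pmod (dual X B)" by (intro hom_sheaf_pmodule B) simp
 have E: "pmod E" and i: "i : mor X A E" and p: "p : mor X E B" using extensionD(1-3)[OF x] by auto
 let ?D = "dual X B"
 let ?TA = "tens A ?D" and ?TB = "tens B ?D" and ?TE = "tens E ?D"
 let ?i = "tensor_map X A ?D E ?D i (mor_id X ?D)" and ?p = "tensor_map X E ?D B ?D p (mor_id X ?D)"
 note TA = tensor_O_module[OF A' D] and TB = tensor_O_module[OF B D] and TE = tensor_O_module[OF E D]
 note TE' = omod_pmod[OF TE]
 note ti = tensor_map_props[OF A' D E D i mor_id_hom[OF D]] and tp = tensor_map_props[OF E D B D p mor_id_hom[OF D]]
 note cv = coev_props(1)[OF lf]
 have opC: "op U" if "U : C" for U by (rule coveringD(1)[OF C that])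
 have tx: "extension X ?TB ?TA (?TE, ?i, ?p)"
 proof -
  have "\<exists>U s r. op U & x : U & split_over B A E i p U s r" if "x : pts X" for x
   using coveringD(2)[OF C that] opC sp by blast
  from tensor_extension[OF A' B D x this] show ?thesis by (simp add: ext_tensor_def)
 qed
 let ?P = "pb ?TE (ox X) ?p (coev X B)"
 note px = pullback_extension[OF TA TB ox_O_module tx cv]
 show ?t1 using px by (simp add: ext_tensor_def)
 have P: "pmod ?P" using extensionD(1)[OF px[unfolded ext_pullback_pb]] by simp
 define c where "c W = coev X B W 1<W>" for W
 have c: "c W :<?TB W>" if "op W" for W
  unfolding c_def by (rule homs_closed[OF cv that op_pts[OF that]]) (use that in simp)
 have cr: "res ?TB U W (c U) = c W" if "op U" "op W" "W <= U" for U W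
  unfolding c_def using homs_res[OF cv that(1) op_pts[OF that(1)] that(2,3), of "1<U>"] that by simp
 \<comment> \<open>The premise \<open>U : C\<close> is moved inside, so that \<open>choice\<close>
   applies twice and delivers \<open>s'\<close> and \<open>r'\<close> as functions of
   \<open>U\<close>.\<close>
 have "\<forall>U. \<exists>s' r'. U : C --> split_over ?TB ?TA ?TE ?i ?p U s' r' &
  (\<forall>V b n. op V & V <= U & b :<B V> & n :<?D V> -->
   s' V (pt B ?D V b n) = pt E ?D V (s U V b) n)" (is "\<forall>U. ?Q U")
 proof
  fix U
  show "?Q U"
  proof (cases "U : C")
   case True
   show ?thesis
   proof (rule split_over_tensor[OF A' B E D opC[OF True] i p sp[OF True]])
    fix s' r'
    assume "split_over ?TB ?TA ?TE ?i ?p U s' r'"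
     and "!!V b n. op V ==> V <= U ==> b :<B V> ==> n :<?D V> ==>
      s' V (pt B ?D V b n) = pt E ?D V (s U V b) n"
    then show ?thesis by (intro exI[of _ s'] exI[of _ r']) simp
   qed
  qed simp
 qed
 then obtain s' where "\<forall>U. \<exists>r'. U : C --> split_over ?TB ?TA ?TE ?i ?p U (s' U) r' &
  (\<forall>V b n. op V & V <= U & b :<B V> & n :<?D V> -->
   s' U V (pt B ?D V b n) = pt E ?D V (s U V b) n)" by (rule choice[THEN exE])
 then obtain r' where Q: "\<forall>U. U : C --> split_over ?TB ?TA ?TE ?i ?p U (s' U) (r' U) &
  (\<forall>V b n. op V & V <= U & b :<B V> & n :<?D V> -->
   s' U V (pt B ?D V b n) = pt E ?D V (s U V b) n)" by (rule choice[THEN exE])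
 have sp': "split_over ?TB ?TA ?TE ?i ?p U (s' U) (r' U)" if "U : C" for U using Q that by metis
 have s'p: "s' U V (pt B ?D V b n) = pt E ?D V (s U V b) n"
  if "U : C" "op V" "V <= U" "b :<B V>" "n :<?D V>" for U V b n using Q that by metis
 note s'h = split_overD(1)[OF sp']
 define e where "e U = (s' U U (c U), 1<U>)" for U
 have e: "e U :<?P U>" if U: "U : C" for U
  using homs_closed[OF s'h[OF U] opC[OF U] order_refl c[OF opC[OF U]]] split_overD(4)[OF sp'[OF U] opC[OF U] order_refl c[OF opC[OF U]]]
   opC[OF U] by (simp add: e_def pb_simps c_def)
 have er: "res ?P U W (e U) = (s' U W (c W), 1<W>)" if U: "U : C" and W: "op W" "W <= U" for U W
  using homs_res[OF s'h[OF U] opC[OF U] order_refl W c[OF opC[OF U]]] cr[OF opC[OF U] W] O_res_one[OF opC[OF U] W]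
  by (simp add: e_def pb_simps)
 show ?t2
  unfolding ext_cocycle_def ext_tensor_def prod.case ext_pullback_pb
 proof (intro conjI C exI[of _ e] ballI)
  fix U assume U: "U : C"
  show "e U :<?P U>" by (rule e[OF U])
  show "fam' ?P (pts X) (%U z. snd z) U (e U) = 1<U>" using opC[OF U] e[OF U] by (simp add: e_def)
  fix V assume V: "V : C"
  let ?W = "U Int V"
  have W: "op ?W" "?W <= U" "?W <= V" using opC[OF U] opC[OF V] by auto
  let ?k = "k U V ?W (c ?W)"
  have kc: "?k :<?TA ?W>" by (rule homs_closed[OF k(1)[OF U V] W(1) order_refl c[OF W(1)]])
  then show "k U V ?W (coev X B ?W 1<?W>) :<?TA ?W>" by (simp add: c_def)
  have ik: "fam' ?TB ?W (%Y t. ?i Y (k U V Y t)) : Hom ?TB ?TE ?W"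
   by (rule homs_mor_comp[OF k(1)[OF U V] ti(1) W(1) omod_pmod[OF TB]])
  note sU = homs_restrict[OF s'h[OF U] W(1,2)] and sV = homs_restrict[OF s'h[OF V] W(1,3)]
  note sum = homs_sum[OF ik sU omod_pmod[OF TB] TE']
  \<comment> \<open>The relation \<open>diff\<close> between the splittings is lifted to the tensor
    product by testing on pure tensors; only afterwards can it be evaluated at the coevaluation of
    1, which need not be a pure tensor.\<close>
  have eq: "restrict (s' V) (ops ?W) =
   fam' ?TB ?W (%Y t. fam' ?TB ?W (%Y t. ?i Y (k U V Y t)) Y t +<?TE Y> restrict (s' U) (ops ?W) Y t)"
  proof (rule tensor_hom_eqI[OF B D TE W(1) sV sum])
   fix Y b n assume Y: "op Y" "Y <= ?W" and b: "b :<B Y>" and n: "n :<?D Y>"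
   have YUV: "Y <= U" "Y <= V" using Y by auto
   have hb: "h U V Y b :<A Y>" by (rule homs_closed[OF h[OF U V] Y b])
   have ih: "i Y (h U V Y b) :<E Y>" by (rule homs_closed[OF i Y(1) op_pts[OF Y(1)] hb])
   have sb: "s U Y b :<E Y>" by (rule homs_closed[OF split_overD(1)[OF sp[OF U]] Y(1) YUV(1) b])
   note kp = k(2)[OF U V Y b n]
   have "?i Y (k U V Y (pt B ?D Y b n)) = pt E ?D Y (i Y (h U V Y b)) n"
    using ti(2)[OF Y(1) hb n] kp n Y by (simp del: hom_simps)
   then show "restrict (s' V) (ops ?W) Y (pt B ?D Y b n) =
     fam' ?TB ?W (%Y t. fam' ?TB ?W (%Y t. ?i Y (k U V Y t)) Y t +<?TE Y> restrict (s' U) (ops ?W) Y t) Y (pt B ?D Y b n)"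
    using Y pt_closed[OF B D Y(1) b n] s'p[OF V Y(1) YUV(2) b n] s'p[OF U Y(1) YUV(1) b n] diff[OF U V Y(1) YUV b]
     bilinD(2)[OF pt_bilin[OF E D] Y(1) order_refl ih n sb] by (simp del: hom_simps)
  qed
  have sVW: "s' V ?W (c ?W) = ?i ?W ?k +<?TE ?W> s' U ?W (c ?W)"
   using fun_cong[OF fun_cong[OF eq], of ?W "c ?W"] W(1) c[OF W(1)] by simp
  let ?ik = "(?i ?W ?k, 0<?W>)"
  have ikW: "?ik :<?P ?W>"
   using homs_closed[OF extensionD(2)[OF px[unfolded ext_pullback_pb]] W(1) op_pts[OF W(1)] kc] W(1) kc op_pts[OF W(1)] by simp
  have "res ?P V ?W (e V) = ?ik +<?P ?W> res ?P U ?W (e U)"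
  proof -
   interpret R: cring "osec X ?W" by (rule O_cring[OF W(1)])
   show ?thesis unfolding er[OF V W(1,3)] er[OF U W(1,2)] pb_simps sVW by simp
  qed
  then have "res ?P V ?W (e V) -<?P ?W> res ?P U ?W (e U) = ?ik"
   using pm_add_minus[OF P W(1) ikW, of "res ?P U ?W (e U)"] pm_res[OF P opC[OF U] W(1,2) e[OF U]] by simp
  then show "fam' ?TA (pts X) (%U a. (?i U a, 0<(ox X) U>)) ?W (k U V ?W (coev X B ?W 1<?W>)) =
    res ?P V ?W (e V) -<?P ?W> res ?P U ?W (e U)"
   using kc W(1) op_pts[OF W(1)] by (simp add: c_def)
 qed
qed

end

section \<open>Generators of a line bundle and its class in the Picard group\<close>

context rsp
begin

text \<open>Each generator has a coefficient with respect to the other. The two coefficients are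
  inverse to each other because coefficients with respect to a generator are unique.\<close>

lemma generator_change:
 assumes L: "pmod L" and U: "op U" "generates L U e" and V: "op V" "generates L V e'" and W: "op W" "W <= U" "W <= V"
 obtains g where "g : Units (osec X W)" "res L U W e = g *<L W> res L V W e'"
proof -
 let ?g = "coef L V e' W (res L U W e)" and ?h = "coef L U e W (res L V W e')"
 note re = gen_res[OF L U W(1,2)] and re' = gen_res[OF L V W(1,3)]
 have g: "?g :<W>" by (rule coef_closed[OF L V W(1,3) re])
 have h: "?h :<W>" by (rule coef_closed[OF L U W(1,2) re'])
 have ge: "?g *<L W> res L V W e' = res L U W e" by (rule coef_eq[OF L V W(1,3) re])
 have he: "?h *<L W> res L U W e = res L V W e'" by (rule coef_eq[OF L U W(1,2) re'])
 interpret R: cring "osec X W" by (rule O_cring[OF W(1)])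
 have "?h *<W> ?g = 1<W>"
 proof (rule gen_inj[OF L V W(1,3)])
  show "(?h *<W> ?g) *<L W> res L V W e' = 1<W> *<L W> res L V W e'"
   unfolding pm_smult_smult[OF L W(1) h g re', symmetric] ge he using re' L W by simp
 qed (use g h in simp_all)
 then have "?g : Units (osec X W)" using g h R.m_comm[OF g h] by (auto simp: Units_def)
 then show thesis using that ge by metis
qed

text \<open>The data over which the union in \<open>pic_class\<close> ranges.\<close>

definition trivializes :: "('x, 'r, 'm) omod => 'x set set => ('x set => 'm) => ('x set => 'x set => 'r) => bool"
 where "trivializes L C e g \<longleftrightarrow> covering X C & (ALL U:C. generates L U (e U)) &
  (ALL U:C. ALL V:C. g U V : Units (osec X (U Int V)) &
   res L U (U Int V) (e U) = g U V *<L (U Int V)> res L V (U Int V) (e V))"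

lemma pic_class_eq: "pic_class X L = \<Union>{H1_class X (units X) (rs) (C, g) | C e g. trivializes L C e g}"
 unfolding pic_class_def trivializes_def generates_def ..

lemma trivializesD:
 assumes t: "trivializes L C e g"
 shows "covering X C" "U : C ==> op U" "U : C ==> generates L U (e U)"
  "U : C ==> V : C ==> g U V : Units (osec X (U Int V))"
  "U : C ==> V : C ==> res L U (U Int V) (e U) = g U V *<L (U Int V)> res L V (U Int V) (e V)"
 using t coveringD(1) by (auto simp: trivializes_def)

lemma O_res_Units: "op U ==> op V ==> V <= U ==> a : Units (osec X U) ==> rs U V a : Units (osec X V)"
 using ab_res[OF units_ab_presheaf] by (simp add: units_of_def)

lemma trivializes_res:
 assumes L: "pmod L" and t: "trivializes L C e g" and UV: "U : C" "V : C" and W: "op W" "W <= U" "W <= V"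
 shows "rs (U Int V) W (g U V) :<W>"
  "rs (U Int V) W (g U V) *<L W> res L V W (e V) = res L U W (e U)"
proof -
 note o = trivializesD(2)[OF t UV(1)] trivializesD(2)[OF t UV(2)]
 have Y: "op (U Int V)" "W <= U Int V" using o W by auto
 have g: "g U V :<(U Int V)>" using trivializesD(4)[OF t UV] by (simp add: Units_def)
 show "rs (U Int V) W (g U V) :<W>" using g Y W by simp
 note cU = gen_closed[OF L o(1) trivializesD(3)[OF t UV(1)]] and cV = gen_closed[OF L o(2) trivializesD(3)[OF t UV(2)]]
 have "res L (U Int V) W (res L U (U Int V) (e U)) = res L (U Int V) W (g U V *<L (U Int V)> res L V (U Int V) (e V))"
  using trivializesD(5)[OF t UV] by simp
 then show "rs (U Int V) W (g U V) *<L W> res L V W (e V) = res L U W (e U)"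
  using o Y W g cU cV L by simp
qed

text \<open>Both sides are the coefficient of the generator over \<open>U\<close> with respect to
  the one over \<open>T\<close>.\<close>

lemma trivializes_cocycle:
 assumes L: "pmod L" and t: "trivializes L C e g"
 shows "cocycle X (units X) (rs) (C, g)"
 unfolding cocycle_def prod.case
proof (intro conjI ballI trivializesD(1)[OF t])
 fix U V assume U: "U : C" and V: "V : C"
 show "g U V : carrier (units_of (osec X (U Int V)))" using trivializesD(4)[OF t U V] by (simp add: units_of_def)
 fix T assume T: "T : C"
 let ?W = "U Int V Int T"
 note o = trivializesD(2)[OF t U] trivializesD(2)[OF t V] trivializesD(2)[OF t T]
 have W: "op ?W" "?W <= U" "?W <= V" "?W <= T" using o by auto
 note uv = trivializes_res[OF L t U V W(1,2,3)] and vt = trivializes_res[OF L t V T W(1,3,4)] and ut = trivializes_res[OF L t U T W(1,2,4)]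
 note eT = gen_res[OF L o(3) trivializesD(3)[OF t T] W(1,4)]
 have "rs (U Int V) ?W (g U V) *<?W> rs (V Int T) ?W (g V T) = rs (U Int T) ?W (g U T)"
 proof (rule gen_inj[OF L o(3) trivializesD(3)[OF t T] W(1,4) _ ut(1)])
  show "rs (U Int V) ?W (g U V) *<?W> rs (V Int T) ?W (g V T) :<?W>"
   by (rule O_closed(2)[OF W(1) uv(1) vt(1)])
  show "(rs (U Int V) ?W (g U V) *<?W> rs (V Int T) ?W (g V T)) *<L ?W> res L T ?W (e T) =
    rs (U Int T) ?W (g U T) *<L ?W> res L T ?W (e T)"
   unfolding pm_smult_smult[OF L W(1) uv(1) vt(1) eT, symmetric] vt(2) uv(2) ut(2) ..
 qed
 then show "rs (U Int V) ?W (g U V) *{(units_of (osec X ?W))} rs (V Int T) ?W (g V T) = rs (U Int T) ?W (g U T)"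
  by (simp add: units_of_def)
qed

text \<open>On the common refinement the generators are related by units,
  \<open>e (\<sigma> w) = b w e' (\<tau> w)\<close>. Expressing \<open>e (\<sigma> w)\<close>
  through \<open>e' (\<tau> w')\<close> in two ways, by way of \<open>e (\<sigma> w')\<close> or of
  \<open>e' (\<tau> w)\<close>, gives the coboundary relation.\<close>

lemma trivializes_cohomologous:
 assumes L: "pmod L" and t: "trivializes L C e g" and t': "trivializes L D e' g'"
 shows "cohomologous X (units X) (rs) (C, g) (D, g')"
proof -
 let ?W = "{U Int V | U V. U : C & V : D}"
 have "\<forall>w. \<exists>q. w : ?W --> fst q : C & snd q : D & w = fst q Int snd q" by auto
 then obtain q where q: "\<forall>w. w : ?W --> fst (q w) : C & snd (q w) : D & w = fst (q w) Int snd (q w)"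
  by (rule choice[THEN exE])
 define \<sigma> where "\<sigma> w = fst (q w)" for w
 define \<tau> where "\<tau> w = snd (q w)" for w
 have \<sigma>: "\<sigma> w : C" "w <= \<sigma> w" and \<tau>: "\<tau> w : D" "w <= \<tau> w" and ow: "op w" if "w : ?W" for w
 proof -
  have w: "fst (q w) : C" "snd (q w) : D" "w = fst (q w) Int snd (q w)" using q that by blast+
  show "\<sigma> w : C" "w <= \<sigma> w" "\<tau> w : D" "w <= \<tau> w" unfolding \<sigma>_def \<tau>_def using w by auto
  have "op (fst (q w) Int snd (q w))" by (rule op_Int[OF trivializesD(2)[OF t w(1)] trivializesD(2)[OF t' w(2)]])
  then show "op w" using w(3) by metis
 qed
 have "\<forall>w. \<exists>b. w : ?W --> b : Units (osec X w) & res L (\<sigma> w) w (e (\<sigma> w)) = b *<L w> res L (\<tau> w) w (e' (\<tau> w))" (is "\<forall>w. \<exists>b. ?Q w b")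
 proof
  fix w show "\<exists>b. ?Q w b"
  proof (cases "w : ?W")
   case True
   note s = \<sigma>[OF True] \<tau>[OF True] ow[OF True]
   obtain b where "b : Units (osec X w)" "res L (\<sigma> w) w (e (\<sigma> w)) = b *<L w> res L (\<tau> w) w (e' (\<tau> w))"
    by (rule generator_change[OF L trivializesD(2,3)[OF t s(1)] trivializesD(2,3)[OF t' s(3)] s(5,2,4)])
   then show ?thesis by blast
  qed blast
 qed
 then obtain b where b: "\<forall>w. ?Q w (b w)" by (rule choice[THEN exE])
 have bU: "b w : Units (osec X w)" and be: "res L (\<sigma> w) w (e (\<sigma> w)) = b w *<L w> res L (\<tau> w) w (e' (\<tau> w))" if "w : ?W" for w
  using b that by blast+
 have bc: "b w :<w>" if "w : ?W" for w using bU[OF that] by (simp add: Units_def)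
 have ber: "rs w y (b w) *<L y> res L (\<tau> w) y (e' (\<tau> w)) = res L (\<sigma> w) y (e (\<sigma> w))"
  if w: "w : ?W" and y: "op y" "y <= w" for w y
 proof -
  note s = \<sigma>[OF w] \<tau>[OF w] ow[OF w]
  have "res L w y (res L (\<sigma> w) w (e (\<sigma> w))) = res L w y (b w *<L w> res L (\<tau> w) w (e' (\<tau> w)))" using be[OF w] by simp
  then show ?thesis
   using s y bc[OF w] trivializesD(2)[OF t s(1)] trivializesD(2)[OF t' s(3)]
    gen_closed[OF L trivializesD(2,3)[OF t s(1)]] gen_closed[OF L trivializesD(2,3)[OF t' s(3)]] L by simp
 qed
 have cov: "covering X ?W"
 proof (rule coveringI)
  show "op U" if "U : ?W" for U by (rule ow[OF that])
  show "EX U:?W. x : U" if x: "x : pts X" for x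
  proof -
   obtain U V where "U : C" "x : U" "V : D" "x : V"
    using coveringD(2)[OF trivializesD(1)[OF t] x] coveringD(2)[OF trivializesD(1)[OF t'] x] by blast
   then show ?thesis by (intro bexI[of _ "U Int V"]) auto
  qed
 qed
 show ?thesis
 proof (rule cohomologousI[OF units_ab_presheaf cov, where \<sigma> = \<sigma> and \<tau> = \<tau> and b = b])
  fix w assume w: "w : ?W"
  show "\<sigma> w : C & w <= \<sigma> w" "\<tau> w : D & w <= \<tau> w" using \<sigma>[OF w] \<tau>[OF w] by auto
  show "b w : carrier (units_of (osec X w))" using bU[OF w] by (simp add: units_of_def)
  fix w' assume w': "w' : ?W"
  let ?y = "w Int w'"
  have y: "op ?y" "?y <= w" "?y <= w'" using ow[OF w] ow[OF w'] by auto
  have ys: "?y <= \<sigma> w" "?y <= \<sigma> w'" "?y <= \<tau> w" "?y <= \<tau> w'" using \<sigma>[OF w] \<sigma>[OF w'] \<tau>[OF w] \<tau>[OF w'] by auto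
  note g = trivializes_res[OF L t \<sigma>(1)[OF w] \<sigma>(1)[OF w'] y(1) ys(1,2)]
  note g' = trivializes_res[OF L t' \<tau>(1)[OF w] \<tau>(1)[OF w'] y(1) ys(3,4)]
  have c: "rs w ?y (b w) :<?y>" "rs w' ?y (b w') :<?y>"
   using bc[OF w] bc[OF w'] ow[OF w] ow[OF w'] y by auto
  note gen' = trivializesD(2,3)[OF t' \<tau>(1)[OF w']]
  note re' = gen_res[OF L gen' y(1) ys(4)]
  let ?a = "rs (\<sigma> w Int \<sigma> w') ?y (g (\<sigma> w) (\<sigma> w'))" and ?a' = "rs (\<tau> w Int \<tau> w') ?y (g' (\<tau> w) (\<tau> w'))"
  have "?a *<?y> rs w' ?y (b w') = rs w ?y (b w) *<?y> ?a'"
  proof (rule gen_inj[OF L gen' y(1) ys(4) O_closed(2)[OF y(1) g(1) c(2)] O_closed(2)[OF y(1) c(1) g'(1)]])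
   show "(?a *<?y> rs w' ?y (b w')) *<L ?y> res L (\<tau> w') ?y (e' (\<tau> w')) =
     (rs w ?y (b w) *<?y> ?a') *<L ?y> res L (\<tau> w') ?y (e' (\<tau> w'))"
    unfolding pm_smult_smult[OF L y(1) g(1) c(2) re', symmetric] pm_smult_smult[OF L y(1) c(1) g'(1) re', symmetric]
     g'(2) ber[OF w' y(1,3)] g(2) ber[OF w y(1,2)] ..
  qed
  then show "?a *{(units_of (osec X ?y))} rs w' ?y (b w') = rs w ?y (b w) *{(units_of (osec X ?y))} ?a'"
   by (simp add: units_of_def)
 qed
qed

text \<open>All trivializations give cohomologous cocycles, so the union in \<open>pic_class\<close>
  is over a single class.\<close>

lemma pic_class_trivializes:
 assumes L: "pmod L" and t: "trivializes L C e g"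
 shows "pic_class X L = H1_class X (units X) (rs) (C, g)"
proof -
 have "H1_class X (units X) (rs) (D, g') = H1_class X (units X) (rs) (C, g)" if "trivializes L D e' g'" for D e' g'
  by (rule H1_class_eqI[OF units_ab_presheaf trivializes_cocycle[OF L that] trivializes_cocycle[OF L t]
   trivializes_cohomologous[OF L that t]])
 then have "{H1_class X (units X) (rs) (C, g) | C e g. trivializes L C e g} = {H1_class X (units X) (rs) (C, g)}"
  using t by blast
 then show ?thesis unfolding pic_class_eq by simp
qed

text \<open>The covering by all open sets that admit a generator, with generators and transition
  units chosen arbitrarily.\<close>

lemma line_bundle_trivializes:
 assumes L: "line_bundle X L"
 obtains C e g where "trivializes L C e g"
proof -
 have L': "pmod L" using L by (simp add: line_bundle_def)
 define C where "C = {U. op U & (\<exists>e. generates L U e)}"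
 define e where "e U = (SOME e. generates L U e)" for U
 have e: "generates L U (e U)" if "U : C" for U using that unfolding C_def e_def by (auto intro: someI_ex)
 have opC: "op U" if "U : C" for U using that by (simp add: C_def)
 have cov: "covering X C"
 proof (rule coveringI[OF opC])
  show "EX U:C. x : U" if x: "x : pts X" for x
  proof -
   obtain U e where "op U" "x : U" "generates L U e" by (rule line_bundle_generator[OF L x])
   then show ?thesis unfolding C_def by blast
  qed
 qed
 define g where "g U V = (SOME g. g : Units (osec X (U Int V)) &
  res L U (U Int V) (e U) = g *<L (U Int V)> res L V (U Int V) (e V))" for U V
 have g: "g U V : Units (osec X (U Int V)) & res L U (U Int V) (e U) = g U V *<L (U Int V)> res L V (U Int V) (e V)"
  if U: "U : C" and V: "V : C" for U V
 proof -
  have W: "op (U Int V)" "U Int V <= U" "U Int V <= V" using opC U V by auto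
  obtain h where h: "h : Units (osec X (U Int V))" "res L U (U Int V) (e U) = h *<L (U Int V)> res L V (U Int V) (e V)"
   by (rule generator_change[OF L' opC[OF U] e[OF U] opC[OF V] e[OF V] W])
  from conjI[OF h] show ?thesis unfolding g_def by (rule someI)
 qed
 have "trivializes L C e g" unfolding trivializes_def by (intro conjI ballI cov e g[THEN conjunct1] g[THEN conjunct2])
 then show thesis by (rule that)
qed

end

section \<open>The logarithmic differential and the generalized Chern class\<close>

context fsp
begin

lemma Units_inv: "op U ==> u : Units (osec X U) ==> u :<U> & inv\<^bsub>osec X U\<^esub> u :<U> &
  inv\<^bsub>osec X U\<^esub> u *<U> u = 1<U>"
proof -
 assume U: "op U" and u: "u : Units (osec X U)"
 interpret R: cring "osec X U" by (rule O_cring[OF U])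
 show ?thesis using u R.Units_closed[OF u] by simp
qed

lemma O_res_inv:
 assumes U: "op U" "op V" "V <= U" and u: "u : Units (osec X U)"
 shows "rs U V (inv\<^bsub>osec X U\<^esub> u) = inv\<^bsub>osec X V\<^esub> (rs U V u)"
proof -
 interpret R: cring "osec X V" by (rule O_cring[OF U(2)])
 note i = Units_inv[OF U(1) u]
 have "rs U V (inv\<^bsub>osec X U\<^esub> u) *<V> rs U V u = 1<V>"
  using O_res_mult[OF U, of "inv\<^bsub>osec X U\<^esub> u" u] O_res_one[OF U] i by simp
 then have "inv\<^bsub>osec X V\<^esub> (rs U V u) = rs U V (inv\<^bsub>osec X U\<^esub> u)"
  using i U by (intro R.comm_inv_char) (simp_all add: R.m_comm)
 then show ?thesis by simp
qed

lemma dlog_closed: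
 assumes U: "op U" and u: "u : Units (osec X U)"
 shows "dlog X U u :<(kaehler X) U>"
 unfolding dlog_def using Units_inv[OF U u] U by simp

lemma dlog_res:
 assumes U: "op U" "op V" "V <= U" and u: "u : Units (osec X U)"
 shows "dlog X V (rs U V u) = res (kaehler X) U V (dlog X U u)"
 unfolding dlog_def using Units_inv[OF U(1) u] U by (simp add: O_res_inv[OF U u] kd_res)

text \<open>The product rule for \<open>d\<close>, divided by \<open>u v\<close>.\<close>

lemma dlog_mult:
 assumes U: "op U" and u: "u : Units (osec X U)" and v: "v : Units (osec X U)"
 shows "dlog X U (u *<U> v) = dlog X U u +<(kaehler X) U> dlog X U v"
proof -
 interpret R: cring "osec X U" by (rule O_cring[OF U])
 have Kp: "pmod (kaehler X)" by simp
 note iu = Units_inv[OF U u] and iv = Units_inv[OF U v]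
 let ?R = "osec X U" and ?iu = "inv\<^bsub>osec X U\<^esub> u" and ?iv = "inv\<^bsub>osec X U\<^esub> v"
 have c: "u : carrier ?R" "v : carrier ?R" "?iu : carrier ?R" "?iv : carrier ?R" "?iu *{?R} ?iv : carrier ?R" using iu iv by auto
 have "(?iu *{?R} ?iv) *{?R} u = ?iv *{?R} (?iu *{?R} u)" using c by (simp only: R.m_ac)
 then have 1: "(?iu *{?R} ?iv) *{?R} u = ?iv" using iu c by simp
 have "(?iu *{?R} ?iv) *{?R} v = ?iu *{?R} (?iv *{?R} v)" using c by (simp only: R.m_ac)
 then have 2: "(?iu *{?R} ?iv) *{?R} v = ?iu" using iv c by simp
 have inv: "inv\<^bsub>?R\<^esub> (u *{?R} v) = ?iu *{?R} ?iv"
 proof (rule R.comm_inv_char)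
  have "(u *{?R} v) *{?R} (?iu *{?R} ?iv) = ((?iu *{?R} ?iv) *{?R} u) *{?R} v"
   using c by (simp only: R.m_ac)
  then show "(u *{?R} v) *{?R} (?iu *{?R} ?iv) = 1{?R}" unfolding 1 using iv by simp
 qed (use c in simp_all)
 note du = kd_closed[OF U c(1)] and dv = kd_closed[OF U c(2)]
 have "dlog X U (u *{?R} v) = ?iv *<(kaehler X) U> kd_d X U v +<(kaehler X) U> ?iu *<(kaehler X) U> kd_d X U u"
  unfolding dlog_def inv kd_mult[OF U c(1,2)]
   pm_smult_add(1)[OF Kp U c(5) pm_closed(4)[OF Kp U c(1) dv] pm_closed(4)[OF Kp U c(2) du]]
   pm_smult_smult[OF Kp U c(5,1) dv] pm_smult_smult[OF Kp U c(5,2) du] 1 2 ..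
 also have "\<dots> = dlog X U u +<(kaehler X) U> dlog X U v"
  unfolding dlog_def by (rule pm_comm[OF Kp U pm_closed(4)[OF Kp U c(4) dv] pm_closed(4)[OF Kp U c(3) du]])
 finally show ?thesis .
qed

text \<open>Both \<open>dlog\<close> and the quotient map are homomorphisms of sheaves of abelian
  groups, so \<open>H1_map_class\<close>, applied once for each, computes the class from the single
  cocycle \<open>g\<close>.\<close>

lemma gen_chern_class_trivializes:
 assumes L: "pmod L" and I: "sub_O_module X (kaehler X) I" and t: "trivializes L C e g"
 shows "gen_chern_class X I L = H1_mod_class X (quot_sheaf X (kaehler X) I)
   (C, %U V. quot_map X (kaehler X) I (U Int V) (dlog X (U Int V) (g U V)))"
  "gen_chern_class X I L : H1_mod X (quot_sheaf X (kaehler X) I)"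
proof -
 let ?\<Omega> = "kaehler X" and ?Q = "quot_sheaf X (kaehler X) I" and ?q = "quot_map X (kaehler X) I"
 have \<Omega>: "pmod ?\<Omega>" by simp
 have Q: "pmod ?Q" by (rule omod_pmod[OF quot_sheaf_O_module[OF \<Omega> sub_O_module_sub_pmodule[OF I]]])
 note q = quot_map_hom[OF \<Omega> sub_O_module_sub_pmodule[OF I]]
 have 1: "cocycle X (madd ?\<Omega>) (res ?\<Omega>) (C, %U V. dlog X (U Int V) (g U V))"
  "H1_map X ?\<Omega> (dlog X) (H1_class X (units X) (rs) (C, g)) = H1_mod_class X ?\<Omega> (C, %U V. dlog X (U Int V) (g U V))"
  by (rule H1_map_class[OF units_ab_presheaf \<Omega> _ _ _ trivializes_cocycle[OF L t]];
   simp add: units_of_def dlog_closed dlog_mult dlog_res)+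
 have 2: "cocycle X (madd ?Q) (res ?Q) (C, %U V. ?q (U Int V) (dlog X (U Int V) (g U V)))"
  "H1_map X ?Q ?q (H1_mod_class X ?\<Omega> (C, %U V. dlog X (U Int V) (g U V))) =
   H1_mod_class X ?Q (C, %U V. ?q (U Int V) (dlog X (U Int V) (g U V)))"
  by (rule H1_map_class[OF madd_ab_presheaf[OF \<Omega>] Q _ _ _ 1(1)];
   simp add: homs_closed[OF q _ op_pts] homs_add[OF q _ op_pts] homs_res[OF q _ op_pts])+
 show eq: "gen_chern_class X I L = H1_mod_class X ?Q (C, %U V. ?q (U Int V) (dlog X (U Int V) (g U V)))"
  unfolding gen_chern_class_def chern_class_def pic_class_trivializes[OF L t] 1(2) 2(2) ..
 show "gen_chern_class X I L : H1_mod X ?Q"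
  unfolding eq by (rule H1_class_H1[OF madd_ab_presheaf[OF Q] 2(1)])
qed

end

section \<open>Preparations for comparing the two cocycles\<close>

context rsp
begin

lemma represents_cong:
 assumes "represents G k (C, c)" "!!U V. U : C ==> V : C ==> c U V = c' U V"
 shows "represents G k (C, c')"
proof -
 have "ext_cocycle G \<epsilon> (C, c')" if "ext_cocycle G \<epsilon> (C, c)" for \<epsilon>
  using that assms(2) by (cases \<epsilon>) (simp add: ext_cocycle_def)
 then show ?thesis using assms(1) unfolding represents_def by blast
qed

lemma tensor_map_iso:
 assumes A: "pmod A" and G: "pmod G" and D: "pmod D" and \<theta>: "mor_iso X G D \<theta>"
 shows "mor_iso X (tens A D) (tens A G) (tensor_map X A D A G (mor_id X A) (mor_inv X G D \<theta>))"
proof -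
 note \<theta>h = mor_isoD(1)[OF \<theta>]
 note f = tensor_map_props[OF A D A G mor_id_hom[OF A] mor_inv_mor[OF G D \<theta>]]
 note b = tensor_map_props[OF A G A D mor_id_hom[OF A] \<theta>h]
 let ?f = "tensor_map X A D A G (mor_id X A) (mor_inv X G D \<theta>)" and ?b = "tensor_map X A G A D (mor_id X A) \<theta>"
 note TD = tensor_O_module[OF A D] and TG = tensor_O_module[OF A G]
 note TD' = omod_pmod[OF TD] and TG' = omod_pmod[OF TG]
 have 1: "mor_comp X (tens A D) ?b ?f = mor_id X (tens A D)"
 proof (rule tensor_hom_eqI[OF A D TD openin_topspace mor_comp_hom[OF f(1) b(1) TD'] mor_id_hom[OF TD']])
  fix V m n assume V: "op V" and m: "m :<A V>" and n: "n :<D V>"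
  show "mor_comp X (tens A D) ?b ?f V (pt A D V m n) = mor_id X (tens A D) V (pt A D V m n)"
   using V m n pt_closed[OF A D V m n] mor_inv_closed[OF \<theta> V n] mor_inv_right[OF \<theta> V n] by (simp add: f(2) b(2))
 qed
 have 2: "mor_comp X (tens A G) ?f ?b = mor_id X (tens A G)"
 proof (rule tensor_hom_eqI[OF A G TG openin_topspace mor_comp_hom[OF b(1) f(1) TG'] mor_id_hom[OF TG']])
  fix V m n assume V: "op V" and m: "m :<A V>" and n: "n :<G V>"
  show "mor_comp X (tens A G) ?f ?b V (pt A G V m n) = mor_id X (tens A G) V (pt A G V m n)"
   using V m n pt_closed[OF A G V m n] iso_closed[OF \<theta> V n] mor_inv_left[OF \<theta> V n] by (simp add: f(2) b(2))
 qed
 show ?thesis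
 proof (rule iso_if_inverse[OF f(1) b(1)])
  show "?b V (?f V m) = m" if "op V" "m :<(tens A D) V>" for V m
   using fun_cong[OF fun_cong[OF 1], of V m] that by simp
  show "?f V (?b V m) = m" if "op V" "m :<(tens A G) V>" for V m
   using fun_cong[OF fun_cong[OF 2], of V m] that by simp
 qed
qed

text \<open>Preceded by the contraction, composition with a functional becomes a map on the tensor
  product of \<open>B\<close> with its dual. In \<open>trace_cocycle\<close> this is the description
  that can be evaluated at the coevaluation of 1.\<close>

lemma homs_postcompose:
 assumes B: "pmod B" and N: "pmod N" and f: "f : Hom B N U" and U: "op U"
 shows "fam' (End B) U (%V k. fam' B V (%W b. f W (k W b))) : Hom (End B) (hom_sheaf X B N) U"
proof (rule homsI[OF hom_sheaf_pmodule[OF B B]])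
 fix V k assume V: "op V" "V <= U" and "k :<(End B) V>"
 then have k: "k : Hom B B V" by simp
 have s: "W <= U" if "W <= V" for W using that V by blast
 note kc = homs_closed[OF k]
 have "fam' B V (%W b. restrict f (ops V) W (k W b)) : Hom B N V"
  by (rule homs_comp[OF k homs_restrict[OF f V] B])
 moreover have "fam' B V (%W b. restrict f (ops V) W (k W b)) = fam' B V (%W b. f W (k W b))"
  by (intro restrict_ext) simp
 ultimately show "fam' B V (%W b. f W (k W b)) :<(hom_sheaf X B N) V>" by simp
 show "fam' B V (%W b. f W ((k +<(End B) V> p) W b)) =
   fam' B V (%W b. f W (k W b)) +<(hom_sheaf X B N) V> fam' B V (%W b. f W (p W b))"
  if "p :<(End B) V>" for p
  unfolding hom_simps
 proof (intro restrict_ext)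
  fix W b assume "W : ops V" and b: "b :<B W>"
  then have W: "op W" "W <= V" by auto
  have "p W b :<B W>" using homs_closed[of p B B V W b] that W b by simp
  from homs_add[OF f W(1) s[OF W(2)] kc[OF W b] this]
  show "f W (fam' B V (%V m. k V m +<B V> p V m) W b) =
    fam' B V (%W b. f W (k W b)) W b +<N W> fam' B V (%W b. f W (p W b)) W b"
   using W b by simp
 qed
 show "fam' B V (%W b. f W ((a *<(End B) V> k) W b)) =
   a *<(hom_sheaf X B N) V> fam' B V (%W b. f W (k W b))" if a: "a :<V>" for a
  unfolding hom_simps
 proof (intro restrict_ext)
  fix W b assume "W : ops V" and b: "b :<B W>"
  then have W: "op W" "W <= V" by auto
  from homs_smult[OF f W(1) s[OF W(2)] O_res_closed[OF V(1) W a] kc[OF W b]]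
  show "f W (fam' B V (%W b. rs V W a *<B W> k W b) W b) =
    rs V W a *<N W> fam' B V (%W b. f W (k W b)) W b"
   using W b by simp
 qed
 fix W assume W: "op W" "W <= V"
 have "Y : ops V" if "Y : ops W" for Y using that W by auto
 then show "fam' B W (%Y b. f Y (res (End B) V W k Y b)) = res (hom_sheaf X B N) V W (fam' B V (%Y b. f Y (k Y b)))"
  unfolding hom_simps restrict_restrict opens_Int_subset[OF W(2)] by (intro restrict_ext) simp
qed

end

context lr
begin

text \<open>Every point has a neighbourhood with a generator, and there \<open>lr_split\<close>
  splits the sequence; this suffices by \<open>extensionI_split\<close>.\<close>

lemma lr_extension:
 assumes LB: "line_bundle X L"
 shows "extension X K E (LR, lr_inc X L, lr_prj X L)"
proof -
 have LO: "omod L" using LB by (simp add: line_bundle_def)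
 show ?thesis
 proof (rule extensionI_split[OF hom_sheaf_O_module[OF L LO] K lr_O_module[OF LO] lr_inc_hom lr_prj_hom])
  show "lr_prj X L V (lr_inc X L V a) = 0<K V>" if "op V" "a :<E V>" for V a
   using that op_pts[OF that(1)] pm_closed(5)[OF K' that(1)]
   by (simp add: lr_prj_eq lr_inc_def lr_simps del: hom_simps)
  show "\<exists>U s r. op U & x : U & split_over K E LR (lr_inc X L) (lr_prj X L) U s r" if x: "x : pts X" for x
  proof -
   obtain U e where U: "op U" "x : U" "generates L U e" by (rule line_bundle_generator[OF LB x])
   show ?thesis using U(1,2) lr_split[OF U(1,3)] by blast
  qed
 qed
qed

text \<open>The logarithmic derivative of \<open>u\<close>, that is, the functional on the
  Kodaira-Spencer sheaf which \<open>dlog u\<close> induces.\<close>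

definition log_der :: "'x set => 'r => ('x, ('x, 'r, 'r) fam, 'r) fam"
 where "log_der U u = fam' K U (%W D. inv\<^bsub>osec X W\<^esub> (rs U W u) *<W> D W (rs U W u))"

lemma log_der_apply:
 "op W ==> W <= U ==> D : ks_ders X L W ==>
  log_der U u W D = inv\<^bsub>osec X W\<^esub> (rs U W u) *<W> D W (rs U W u)"
 by (simp add: log_der_def ks_simps(1)[OF L])

lemma log_der_homs:
 assumes U: "op U" and u: "u : Units (osec X U)"
 shows "log_der U u : Hom K (ox X) U"
 unfolding log_der_def
proof (rule homsI[OF K'])
 fix V D assume V: "op V" "V <= U" and "D :<K V>"
 then have D: "D : ks_ders X L V" by (simp add: ks_simps(1)[OF L])
 interpret R: cring "osec X V" by (rule O_cring[OF V(1)])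
 let ?v = "rs U V u"
 note vU = O_res_Units[OF U V u]
 have v: "?v :<V>" "inv\<^bsub>osec X V\<^esub> ?v :<V>" using Units_inv[OF V(1) vU] by auto
 note Dc = der_closed[OF ks_der[OF D] V(1) order_refl v(1)]
 show "inv\<^bsub>osec X V\<^esub> ?v *<V> D V ?v :<(ox X) V>" using v Dc by simp
 show "inv\<^bsub>osec X V\<^esub> ?v *<V> (D +<K V> D') V ?v =
   inv\<^bsub>osec X V\<^esub> ?v *<V> D V ?v +<(ox X) V> inv\<^bsub>osec X V\<^esub> ?v *<V> D' V ?v" if "D' :<K V>" for D'
 proof -
  have "D' : ks_ders X L V" using that by (simp add: ks_simps(1)[OF L])
  note D'c = der_closed[OF ks_der[OF this] V(1) order_refl v(1)]
  show ?thesis unfolding ks_simps(3)[OF L V(1) order_refl v(1)] using v Dc D'c by (simp add: R.r_distr)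
 qed
 show "inv\<^bsub>osec X V\<^esub> ?v *<V> (a *<K V> D) V ?v = a *<(ox X) V> (inv\<^bsub>osec X V\<^esub> ?v *<V> D V ?v)"
  if a: "a :<V>" for a
  unfolding ks_simps(4)[OF L V(1) order_refl v(1)] using a v Dc V by (simp add: R.m_lcomm)
 fix W assume W: "op W" "W <= V"
 have WU: "W <= U" using W V by blast
 have uc: "u :<U>" using Units_inv[OF U u] by simp
 have "D W (rs U W u) = rs V W (D V ?v)"
  using der_res[OF ks_der[OF D] V(1) order_refl W v(1)] U V W uc by simp
 moreover have "inv\<^bsub>osec X W\<^esub> (rs U W u) = rs V W (inv\<^bsub>osec X V\<^esub> ?v)"
  using O_res_inv[OF V(1) W vU] U V W uc by simp
 ultimately show "inv\<^bsub>osec X W\<^esub> (rs U W u) *<W> res K V W D W (rs U W u) =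
   res (ox X) V W (inv\<^bsub>osec X V\<^esub> ?v *<V> D V ?v)"
  using W V v Dc by (simp add: ks_simps(2)[OF L])
qed

lemma kd_to_ks_dual_dlog:
 assumes U: "op U" and u: "u : Units (osec X U)"
 shows "kd_to_ks_dual X L U (dlog X U u) = log_der U u"
proof -
 let ?k = "kd_to_tangent_dual X"
 note k = kd_to_tangent_dual_props
 note i = Units_inv[OF U u]
 have uc: "u :<U>" and ic: "inv\<^bsub>osec X U\<^esub> u :<U>" using i by auto
 have eq: "?k U (dlog X U u) = inv\<^bsub>osec X U\<^esub> u *<(dual X (tangent X)) U> ?k U (kd_d X U u)"
  unfolding dlog_def by (rule homs_smult[OF k(1) U op_pts[OF U] ic kd_closed[OF U uc]])
 have "?k U (dlog X U u) V D = inv\<^bsub>osec X V\<^esub> (rs U V u) *<V> D V (rs U V u)"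
  if V: "op V" "V <= U" and D: "D : ks_ders X L V" for V D
 proof -
  have D': "D :<(tangent X) V>" using ks_der[OF D] by (simp add: tangent_def)
  show ?thesis unfolding eq using V D' k(2)[OF U uc V ks_der[OF D]] O_res_inv[OF U V u] by simp
 qed
 then show ?thesis
  unfolding kd_to_ks_dual_def log_der_def ks_simps(1)[OF L]
  using U op_pts[OF U] dlog_closed[OF U u] by (simp, intro restrict_ext) simp
qed

text \<open>Write \<open>m = c e_U\<close> and \<open>e_U = k e_V\<close> with the transition unit
  \<open>k\<close>. The connection of \<open>e_V\<close> sends \<open>m = c k e_V\<close> to
  \<open>D(c k) e_V = c D(k) e_V + k D(c) e_V\<close>. The first term is
  \<open>(D(k) / k) m\<close>; the second is \<open>D(c) e_U\<close>, which is the connection of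
  \<open>e_U\<close> at \<open>m\<close>. The chosen lift \<open>N\<close> is subtracted on both
  sides and cancels.\<close>

lemma conn_change:
 assumes t: "trivializes L C e g" and UV: "U : C" "V : C" and W: "op W" "W <= U" "W <= V" and D: "D : ks_ders X L W"
 shows "conn_diff V (e V) W D = homothety X L W (log_der (U Int V) (g U V) W D) +<E W> conn_diff U (e U) W D"
proof -
 note o = trivializesD(2)[OF t UV(1)] trivializesD(2)[OF t UV(2)]
 note gU = trivializesD(3)[OF t UV(1)] and gV = trivializesD(3)[OF t UV(2)]
 have UVo: "op (U Int V)" "W <= U Int V" using o W by auto
 note gu = trivializesD(4)[OF t UV]
 have lc: "log_der (U Int V) (g U V) W D :<W>"
  using homs_closed[OF log_der_homs[OF UVo(1) gu] W(1) UVo(2), of D] D by (simp add: ks_simps(1)[OF L])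
 have key: "conn V (e V) W D Y m = rs W Y (log_der (U Int V) (g U V) W D) *<L Y> m +<L Y> conn U (e U) W D Y m"
  if Y: "op Y" "Y <= W" and m: "m :<L Y>" for Y m
 proof -
  interpret R: cring "osec X Y" by (rule O_cring[OF Y(1)])
  have YU: "Y <= U" "Y <= V" "Y <= U Int V" using Y W by auto
  let ?R = "osec X Y"
  let ?k = "rs (U Int V) Y (g U V)" and ?c = "coef L U (e U) Y m" and ?e = "res L V Y (e V)" and ?D = "D Y"
  note kU = O_res_Units[OF UVo(1) Y(1) YU(3) gu]
  note k = Units_inv[OF Y(1) kU]
  have kc: "?k : carrier ?R" and ic: "inv\<^bsub>?R\<^esub> ?k : carrier ?R" using k by auto
  note re = gen_res[OF L o(2) gV Y(1) YU(2)]
  note eU = trivializes_res(2)[OF L t UV Y(1) YU(1,2)]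
  note cc = coef_closed[OF L o(1) gU Y(1) YU(1) m]
  note d = der_closed[OF ks_der[OF D] Y]
  have m_eq: "m = (?c *{?R} ?k) *<L Y> ?e"
   using coef_eq[OF L o(1) gU Y(1) YU(1) m] pm_smult_smult[OF L Y(1) cc kc re] eU by simp
  have cV: "coef L V (e V) Y m = ?c *{?R} ?k"
   using coef_unique[OF L o(2) gV Y(1) YU(2) O_closed(2)[OF Y(1) cc kc]] m_eq by simp
  have logY: "rs W Y (log_der (U Int V) (g U V) W D) = inv\<^bsub>?R\<^esub> ?k *{?R} ?D ?k"
  proof -
   have "restrict D (ops Y) : ks_ders X L Y" by (rule ks_ops_closed(3)[OF W(1) D Y])
   then have "log_der (U Int V) (g U V) Y (restrict D (ops Y)) = inv\<^bsub>?R\<^esub> ?k *{?R} ?D ?k"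
    using Y by (simp add: log_der_apply[OF Y(1) YU(3)])
   then show ?thesis
    using homs_res[OF log_der_homs[OF UVo(1) gu] W(1) UVo(2) Y, of D] D by (simp add: ks_simps(1,2)[OF L])
  qed
  have a: "(inv\<^bsub>?R\<^esub> ?k *{?R} ?D ?k) *{?R} (?c *{?R} ?k) = ?c *{?R} ?D ?k"
  proof -
   have "(inv\<^bsub>?R\<^esub> ?k *{?R} ?D ?k) *{?R} (?c *{?R} ?k) = (inv\<^bsub>?R\<^esub> ?k *{?R} ?k) *{?R} (?c *{?R} ?D ?k)"
    using ic d[OF kc] cc kc by (simp only: R.m_ac R.m_closed)
   then show ?thesis using k d[OF kc] cc by simp
  qed
  have "conn V (e V) W D Y m = (?c *{?R} ?D ?k +{?R} ?k *{?R} ?D ?c) *<L Y> ?e"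
   unfolding conn_def using Y m cV der_mult[OF ks_der[OF D] Y cc kc] by simp
  also have "\<dots> = (?c *{?R} ?D ?k) *<L Y> ?e +<L Y> (?k *{?R} ?D ?c) *<L Y> ?e"
   by (rule pm_smult_add(2)[OF L Y(1) _ _ re]) (use cc kc d in simp_all)
  also have "(?c *{?R} ?D ?k) *<L Y> ?e = (inv\<^bsub>?R\<^esub> ?k *{?R} ?D ?k) *<L Y> m"
  proof -
   have "(inv\<^bsub>?R\<^esub> ?k *{?R} ?D ?k) *<L Y> m = (inv\<^bsub>?R\<^esub> ?k *{?R} ?D ?k) *<L Y> ((?c *{?R} ?k) *<L Y> ?e)"
    using m_eq by metis
   also have "\<dots> = (?c *{?R} ?D ?k) *<L Y> ?e"
    unfolding pm_smult_smult[OF L Y(1) O_closed(2)[OF Y(1) ic d[OF kc]] O_closed(2)[OF Y(1) cc kc] re] a ..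
   finally show ?thesis ..
  qed
  also have "(?k *{?R} ?D ?c) *<L Y> ?e = ?D ?c *<L Y> res L U Y (e U)"
   unfolding eU[symmetric] pm_smult_smult[OF L Y(1) d[OF cc] kc re] using d[OF cc] kc by (simp add: R.m_comm)
  also have "\<dots> = conn U (e U) W D Y m" unfolding conn_def using Y m by simp
  finally show ?thesis unfolding logY .
 qed
 have ho: "homothety X L W (log_der (U Int V) (g U V) W D) : Hom L L W"
  using homs_closed[OF homothety_hom[OF L] W(1) op_pts[OF W(1)], of "log_der (U Int V) (g U V) W D"] lc by simp
 have cU: "conn_diff U (e U) W D :<E W>" by (rule conn_diff_homs[OF o(1) gU W(1,2) D])
 have cV: "conn_diff V (e V) W D : Hom L L W" using conn_diff_homs[OF o(2) gV W(1,3) D] by simp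
 have sum: "homothety X L W (log_der (U Int V) (g U V) W D) +<E W> conn_diff U (e U) W D :<E W>"
  by (rule pm_closed(1)[OF E' W(1)]) (use ho cU in simp_all)
 show ?thesis
 proof (rule homs_eqI[OF cV])
  show "homothety X L W (log_der (U Int V) (g U V) W D) +<E W> conn_diff U (e U) W D : Hom L L W"
   using sum unfolding hom_simps(1) .
  fix Y m assume Y: "op Y" "Y <= W" and m: "m :<L Y>"
  let ?x = "rs W Y (log_der (U Int V) (g U V) W D) *<L Y> m" and ?y = "conn U (e U) W D Y m" and ?n = "N W D Y m"
  have c: "?x :<L Y>" "?y :<L Y>" "?n :<L Y>"
   using lc W Y m L conn_closed[OF o(1) gU W(1,2) D Y m] lift_choice_closed[OF W(1) D Y m] by simp_all
  have "(?x +<L Y> ?y) -<L Y> ?n = ?x +<L Y> (?y -<L Y> ?n)"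
  proof -
   interpret MM: module "osec X Y" "sec L Y" by (rule pm_module[OF L Y(1)])
   show ?thesis using c by (simp add: a_minus_def MM.a_assoc)
  qed
  then show "conn_diff V (e V) W D Y m = (homothety X L W (log_der (U Int V) (g U V) W D) +<E W> conn_diff U (e U) W D) Y m"
   using Y m key[OF Y m] homothety_apply[OF W(1) lc Y m] by (simp add: conn_diff_apply[OF o(1) gU] conn_diff_apply[OF o(2) gV])
 qed
qed

end

section \<open>Evaluation of \<open>psi\<close> on the Kodaira-Spencer class\<close>

context lr
begin

context
 fixes I \<theta> C e g
 assumes LB: "line_bundle X L" and lf: "locally_free X K"
  and I: "sub_O_module X (kaehler X) I"
  and \<theta>: "mor_iso X (quot_sheaf X (kaehler X) I) (dual X K) \<theta>"
  and \<theta>q: "mor_comp X (kaehler X) \<theta> (quot_map X (kaehler X) I) = kd_to_ks_dual X L"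
  and t: "trivializes L C e g"
begin

abbreviation (input) "G \<equiv> quot_sheaf X (kaehler X) I"
abbreviation (input) "KD \<equiv> dual X K"

lemma G_O: "omod G"
 by (rule quot_sheaf_O_module[OF omod_pmod[OF kaehler_O_module] sub_O_module_sub_pmodule[OF I]])

lemma KD_O: "omod KD"
 by (rule hom_sheaf_O_module[OF K' ox_O_module])

lemma \<theta>_quot_dlog:
 assumes U: "op U" and u: "u : Units (osec X U)"
 shows "\<theta> U (quot_map X (kaehler X) I U (dlog X U u)) = log_der U u"
proof -
 have "\<theta> U (quot_map X (kaehler X) I U (dlog X U u)) = mor_comp X (kaehler X) \<theta> (quot_map X (kaehler X) I) U (dlog X U u)"
  by (rule mor_comp_apply[OF U dlog_closed[OF U u], symmetric])
 then show ?thesis unfolding \<theta>q kd_to_ks_dual_dlog[OF U u] .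
qed

text \<open>Two maps from the tensor product of \<open>K\<close> with its dual to that dual are
  compared: \<open>\<theta>\<close> after the maps on the left hand side, and the contraction
  followed by composition with the functional \<open>?l\<close>. Both send the pure tensor of
  \<open>D\<close> and \<open>n\<close> to \<open>?l D\<close> times \<open>n\<close>, so they are
  equal. At the coevaluation of 1 the contraction is the identity, and the second map returns
  \<open>?l\<close>, which is \<open>\<theta>\<close> of the right hand side.\<close>

lemma trace_cocycle:
 assumes UV: "U : C" "V : C"
  and k: "k : Hom (tens K KD) (tens E KD) (U Int V)"
   "!!W D n. op W ==> W <= U Int V ==> D :<K W> ==> n :<KD W> ==>
    k W (pt K KD W D n) = pt E KD W (homothety X L W (log_der (U Int V) (g U V) W D)) n"
 shows "end_tensor_iso X L G (U Int V) (tensor_map X E KD E G (mor_id X E) (mor_inv X G KD \<theta>) (U Int V)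
   (k (U Int V) (coev X K (U Int V) 1<(U Int V)>))) =
  quot_map X (kaehler X) I (U Int V) (dlog X (U Int V) (g U V))"
proof -
 let ?W = "U Int V" and ?l = "log_der (U Int V) (g U V)"
 let ?T = "tens K KD" and ?f2 = "tensor_map X E KD E G (mor_id X E) (mor_inv X G KD \<theta>)" and ?f3 = "end_tensor_iso X L G"
 have W: "op ?W" using trivializesD(2)[OF t UV(1)] trivializesD(2)[OF t UV(2)] by simp
 note gu = trivializesD(4)[OF t UV]
 note l = log_der_homs[OF W gu]
 have lc: "?l Y D :<Y>" if "op Y" "Y <= ?W" "D :<K Y>" for Y D
  using homs_closed[OF l that] by simp
 note G' = omod_pmod[OF G_O] and KD' = omod_pmod[OF KD_O]
 note T' = omod_pmod[OF tensor_O_module[OF K' KD']]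
 note f2 = tensor_map_props[OF E' KD' E' G' mor_id_hom[OF E'] mor_inv_mor[OF G' KD' \<theta>]]
 note f3 = end_tensor_iso_props[OF LB G_O]
 note f3h = mor_isoD(1)[OF f3(1)] and \<theta>h = mor_isoD(1)[OF \<theta>]
 note ec = end_contraction_props[OF K' K]
 have F1: "fam' ?T ?W (%Y t. \<theta> Y (fam' ?T ?W (%Y t. ?f3 Y (fam' ?T ?W (%Y t. ?f2 Y (k Y t)) Y t)) Y t)) : Hom ?T KD ?W" (is "?F1 : _")
  by (rule homs_mor_comp[OF homs_mor_comp[OF homs_mor_comp[OF k(1) f2(1) W T'] f3h W T'] \<theta>h W T'])
 let ?post = "fam' (End K) ?W (%V p. fam' K V (%W b. ?l W (p W b)))"
 have F2: "fam' ?T ?W (%Y t. ?post Y (end_contraction X K Y t)) : Hom ?T KD ?W" (is "?F2 : _")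
  by (rule mor_homs_comp[OF ec(1) homs_postcompose[OF K' omod_pmod[OF ox_O_module] l W] W T'])
 have eq: "?F1 = ?F2"
 proof (rule tensor_hom_eqI[OF K' KD' KD_O W F1 F2])
  fix Y D n assume Y: "op Y" "Y <= ?W" and D: "D :<K Y>" and n: "n :<KD Y>"
  then have nh: "n : Hom K (ox X) Y" by simp
  let ?pt = "pt K KD Y D n"
  note pc = pt_closed[OF K' KD' Y(1) D n]
  let ?h = "homothety X L Y (?l Y D)"
  have h: "?h :<E Y>" by (rule homs_closed[OF homothety_hom[OF L] Y(1) op_pts[OF Y(1)]]) (use lc[OF Y D] in simp)
  then have hh: "?h : Hom L L Y" by simp
  have inv: "mor_inv X (ox X) E (homothety X L) Y ?h = ?l Y D"
   by (rule mor_inv_left[OF homothety_iso[OF LB] Y(1)]) (use lc[OF Y D] in simp)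
  have nc: "mor_inv X G KD \<theta> Y n :<G Y>" by (rule mor_inv_closed[OF \<theta> Y(1) n])
  have "?f2 Y (k Y ?pt) = pt E G Y ?h (mor_inv X G KD \<theta> Y n)"
   unfolding k(2)[OF Y D n] f2(2)[OF Y(1) h n] mor_id_apply[OF Y(1) h] ..
  then have "?f3 Y (?f2 Y (k Y ?pt)) = ?l Y D *<G Y> mor_inv X G KD \<theta> Y n"
   using f3(2)[OF Y(1) hh nc] inv by simp
  then have "\<theta> Y (?f3 Y (?f2 Y (k Y ?pt))) = ?l Y D *<KD Y> n"
   using homs_smult[OF \<theta>h Y(1) op_pts[OF Y(1)] lc[OF Y D] nc] mor_inv_right[OF \<theta> Y(1) n] by metis
  then have lhs: "?F1 Y ?pt = ?l Y D *<KD Y> n" using Y pc by (simp del: hom_simps)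
  have ecD: "end_contraction X K Y ?pt = fam' K Y (%Z w. n Z w *<K Z> res K Y Z D)" by (rule ec(2)[OF Y(1) D nh])
  have ecc: "end_contraction X K Y ?pt :<(End K) Y>" by (rule homs_closed[OF ec(1) Y(1) op_pts[OF Y(1)] pc])
  have "?F2 Y ?pt = fam' K Y (%Z w. ?l Z (end_contraction X K Y ?pt Z w))" using Y pc ecc by (simp del: hom_simps)
  also have "\<dots> = ?l Y D *<KD Y> n"
   unfolding hom_simps
  proof (intro restrict_ext)
   fix Z w assume "Z : ops Y" and w: "w :<K Z>"
   then have Z: "op Z" "Z <= Y" by auto
   have ZW: "Z <= ?W" using Z Y by blast
   interpret R: cring "osec X Z" by (rule O_cring[OF Z(1)])
   have nw: "n Z w :<Z>" using homs_closed[OF nh Z w] by simp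
   have DZ: "res K Y Z D :<K Z>" by (rule pm_res[OF K' Y(1) Z D])
   have "?l Z (end_contraction X K Y ?pt Z w) = ?l Z (n Z w *<K Z> res K Y Z D)" using Z w by (simp add: ecD)
   also have "\<dots> = n Z w *<Z> rs Y Z (?l Y D)"
    using homs_smult[OF l Z(1) ZW nw DZ] homs_res[OF l Y Z D] by simp
   also have "\<dots> = rs Y Z (?l Y D) *<(ox X) Z> n Z w"
    using nw lc[OF Y D] Y Z by (simp add: R.m_comm)
   finally show "?l Z (end_contraction X K Y ?pt Z w) = rs Y Z (?l Y D) *<(ox X) Z> n Z w" .
  qed
  finally show "?F1 Y ?pt = ?F2 Y ?pt" using lhs by simp
 qed
 let ?c = "coev X K ?W 1<?W>"
 have one: "1<?W> :<?W>" using W by simp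
 have c: "?c :<?T ?W>" by (rule homs_closed[OF coev_props(1)[OF lf] W op_pts[OF W]]) (use one in simp)
 let ?r = "?f3 ?W (?f2 ?W (k ?W ?c))"
 have r: "?r :<G ?W>"
  by (rule homs_closed[OF f3h W op_pts[OF W] homs_closed[OF f2(1) W op_pts[OF W] homs_closed[OF k(1) W order_refl c]]])
 have ecc: "end_contraction X K ?W ?c :<(End K) ?W>" by (rule homs_closed[OF ec(1) W op_pts[OF W] c])
 have "\<theta> ?W ?r = ?F1 ?W ?c" using W c by simp
 also have "\<dots> = ?F2 ?W ?c" unfolding eq ..
 also have "\<dots> = fam' K ?W (%Z w. ?l Z (homothety X K ?W 1<?W> Z w))"
  using W c ecc by (simp add: coev_props(2)[OF lf W one] del: hom_simps)
 also have "\<dots> = fam' K ?W ?l"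
  by (intro restrict_ext) (use W one K' in \<open>simp add: homothety_apply\<close>)
 also have "\<dots> = ?l" by (rule homs_extensional[OF l, symmetric])
 also have "\<dots> = \<theta> ?W (quot_map X (kaehler X) I ?W (dlog X ?W (g U V)))" by (rule \<theta>_quot_dlog[OF W gu, symmetric])
 finally have \<theta>_eq: "\<theta> ?W ?r = \<theta> ?W (quot_map X (kaehler X) I ?W (dlog X ?W (g U V)))" .
 have q: "quot_map X (kaehler X) I ?W (dlog X ?W (g U V)) :<G ?W>"
  by (rule homs_closed[OF quot_map_hom[OF omod_pmod[OF kaehler_O_module] sub_O_module_sub_pmodule[OF I]] W op_pts[OF W] dlog_closed[OF W gu]])
 \<comment> \<open>The equality has been established among functionals; since
   \<open>\<theta>\<close> is injective it descends to the quotient of the differentials.\<close>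
 show ?thesis by (rule iso_inj[OF \<theta> W r q]) (rule \<theta>_eq)
qed

text \<open>All members of the class receive the same cocycle, because passing along an equivalence
  changes neither the difference \<open>h\<close> of two splittings nor the map \<open>k\<close>
  obtained from it by tensoring. The cocycle is pushed through the two isomorphisms in
  \<open>psi\<close> and identified by \<open>trace_cocycle\<close>.\<close>

lemma psi_KS: "psi X L G \<theta> (KS X L N) =
  H1_mod_class X G (C, %U V. quot_map X (kaehler X) I (U Int V) (dlog X (U Int V) (g U V)))"
proof -
 have LO: "omod L" using LB by (simp add: line_bundle_def)
 have EO: "omod E" by (rule hom_sheaf_O_module[OF L LO])
 note G' = omod_pmod[OF G_O] and KD' = omod_pmod[OF KD_O]
 let ?T = "tens K KD" and ?TE = "tens E KD" and ?TG = "tens E G"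
 let ?f2 = "tensor_map X E KD E G (mor_id X E) (mor_inv X G KD \<theta>)" and ?f3 = "end_tensor_iso X L G"
 note TE' = omod_pmod[OF tensor_O_module[OF E' KD']] and TG' = omod_pmod[OF tensor_O_module[OF E' G']]
 \<comment> \<open>By \<open>conn_change\<close>, the difference of the splittings over
   \<open>V\<close> and \<open>U\<close>, as a map into the endomorphism sheaf.\<close>
 define h where "h U V = fam' K (U Int V) (%W D. homothety X L W (log_der (U Int V) (g U V) W D))" for U V
 have opC: "op U" if "U : C" for U by (rule trivializesD(2)[OF t that])
 have h: "h U V : Hom K E (U Int V)" if "U : C" "V : C" for U V
  unfolding h_def using opC that
  by (intro homs_mor_comp[OF log_der_homs[OF _ trivializesD(4)[OF t that]] homothety_hom[OF L] _ K']) simp_all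
 have h_apply: "h U V W D = homothety X L W (log_der (U Int V) (g U V) W D)"
  if "op W" "W <= U Int V" "D :<K W>" for U V W D using that by (simp add: h_def)
 \<comment> \<open>The tensor product of \<open>h U V\<close> with the identity exists over
   \<open>U Int V\<close> only; one such map is chosen for each pair \<open>q\<close> of members of
   the covering.\<close>
 have "\<forall>q. \<exists>k. fst q : C & snd q : C --> k : Hom ?T ?TE (fst q Int snd q) &
  (\<forall>W D n. op W & W <= fst q Int snd q & D :<K W> & n :<KD W> -->
   k W (pt K KD W D n) = pt E KD W (h (fst q) (snd q) W D) n)" (is "\<forall>q. \<exists>k. ?P q k")
 proof
  fix q show "\<exists>k. ?P q k"
  proof (cases "fst q : C & snd q : C")
   case True
   have W: "op (fst q Int snd q)" using opC True by simp
   note id = homs_restrict[OF mor_id_hom[OF KD'] W op_pts[OF W]]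
   show ?thesis
   proof (rule tensor_map_ex[OF K' KD' E' KD' W h id])
    show "fst q : C" "snd q : C" using True by auto
    fix k assume k: "k : Hom ?T ?TE (fst q Int snd q)"
     "!!V m n. op V ==> V <= fst q Int snd q ==> m :<K V> ==> n :<KD V> ==>
      k V (pt K KD V m n) = pt E KD V (h (fst q) (snd q) V m) (restrict (mor_id X KD) (ops (fst q Int snd q)) V n)"
    have "k W (pt K KD W D n) = pt E KD W (h (fst q) (snd q) W D) n"
     if W: "op W" "W <= fst q Int snd q" "D :<K W>" "n :<KD W>" for W D n
    proof -
     have "restrict (mor_id X KD) (ops (fst q Int snd q)) W n = n"
      using W mor_id_apply[OF W(1,4)] by (simp del: hom_simps)
     then show ?thesis using k(2)[OF W] by simp
    qed
    then show "\<exists>k. ?P q k" using k(1) by (intro exI[of _ k]) (simp del: hom_simps)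
   qed
  next
   case False
   then show ?thesis by (intro exI impI; erule notE; assumption)
  qed
 qed
 then obtain k' where k': "\<forall>q. ?P q (k' q)" by (rule choice[THEN exE])
 define k where "k U V = k' (U, V)" for U V
 have k: "k U V : Hom ?T ?TE (U Int V)"
  "!!W D n. op W ==> W <= U Int V ==> D :<K W> ==> n :<KD W> ==>
   k U V W (pt K KD W D n) = pt E KD W (h U V W D) n" if "U : C" "V : C" for U V
  using k'[rule_format, of "(U, V)"] that unfolding k_def by (simp_all del: hom_simps)
 note xLR = lr_extension[OF LB]
 have "extension X (ox X) ?TE (ext_pullback X (ox X) ?TE (coev X K) (ext_tensor X K E KD \<epsilon>)) &
  ext_cocycle ?TE (ext_pullback X (ox X) ?TE (coev X K) (ext_tensor X K E KD \<epsilon>))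
   (C, %U V. k U V (U Int V) (coev X K (U Int V) 1<(U Int V)>))" if \<epsilon>: "\<epsilon> : KS X L N" for \<epsilon>
 proof -
  obtain E1 i1 p1 where \<epsilon>1: "\<epsilon> = (E1, i1, p1)" by (cases \<epsilon>)
  have x1: "extension X K E (E1, i1, p1)" and eq: "ext_equiv X K E (LR, lr_inc X L, lr_prj X L) (E1, i1, p1)"
   using \<epsilon> unfolding \<epsilon>1 KS_def ext_class_def by auto
  obtain p where p: "mor_iso X LR E1 p" "mor_comp X E p (lr_inc X L) = i1" "mor_comp X LR p1 p = lr_prj X L"
   using eq unfolding ext_equiv_def by auto
  have E1: "pmod E1" using extensionD(1)[OF x1] by simp
  note ph = mor_isoD(1)[OF p(1)]
  \<comment> \<open>The splitting given by the generator \<open>e U\<close>, carried along the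
    equivalence \<open>p\<close> from the standard extension to the given member of the
    class.\<close>
  have sp: "split_over K E E1 i1 p1 U (fam' K U (%V b. p V (fam' K U (%V D. (conn_diff U (e U) V D, D)) V b)))
   (fam' E1 U (%V x. fam' LR U (%V z. fst z -<E V> conn_diff U (e U) V (snd z)) V (mor_inv X LR E1 p V x)))"
   (is "split_over _ _ _ _ _ _ (?s U) (?r U)") if U: "U : C" for U
   by (rule split_over_equiv[OF E' K' lr_pmodule E1 opC[OF U] lr_inc_hom lr_prj_hom lr_split[OF opC[OF U] trivializesD(3)[OF t U]] p])
  have diff: "?s V W D = i1 W (h U V W D) +<E1 W> ?s U W D"
   if UV: "U : C" "V : C" and W: "op W" "W <= U" "W <= V" and D: "D :<K W>" for U V W D
  proof -
   have WUV: "W <= U Int V" using W by simp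
   have D': "D : ks_ders X L W" using D by (simp add: ks_simps(1)[OF L])
   have hc: "h U V W D :<E W>" by (rule homs_closed[OF h[OF UV] W(1) WUV D])
   have cd: "conn_diff U (e U) W D :<E W>" by (rule conn_diff_homs[OF opC[OF UV(1)] trivializesD(3)[OF t UV(1)] W(1,2) D'])
   have ie: "lr_inc X L W (h U V W D) = (h U V W D, 0<K W>)"
    unfolding lr_inc_def using W(1) op_pts[OF W(1)] hc by simp
   have i1: "i1 W (h U V W D) = p W (h U V W D, 0<K W>)"
    unfolding p(2)[symmetric] mor_comp_apply[OF W(1) hc] ie ..
   have m1: "(h U V W D, 0<K W>) :<LR W>" "(conn_diff U (e U) W D, D) :<LR W>"
    using hc cd D pm_closed(5)[OF K' W(1)] by (simp_all add: lr_simps del: hom_simps)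
   have "(conn_diff V (e V) W D, D) = (h U V W D, 0<K W>) +<LR W> (conn_diff U (e U) W D, D)"
    unfolding lr_simps conn_change[OF t UV W D'] h_apply[OF W(1) WUV D] using pm_simps(2)[OF K' W(1) D] by simp
   then have "p W (conn_diff V (e V) W D, D) = p W (h U V W D, 0<K W>) +<E1 W> p W (conn_diff U (e U) W D, D)"
    using homs_add[OF ph W(1) op_pts[OF W(1)] m1] by simp
   then show ?thesis unfolding i1 using W D by simp
  qed
  show ?thesis
   unfolding \<epsilon>1
  proof (intro conjI)
   note sc = shift_cocycle[OF EO lf x1 trivializesD(1)[OF t] sp h diff k]
   show "extension X (ox X) ?TE (ext_pullback X (ox X) ?TE (coev X K) (ext_tensor X K E KD (E1, i1, p1)))"
    by (rule sc(1))
   show "ext_cocycle ?TE (ext_pullback X (ox X) ?TE (coev X K) (ext_tensor X K E KD (E1, i1, p1)))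
     (C, %U V. k U V (U Int V) (coev X K (U Int V) 1<(U Int V)>))"
    by (rule sc(2))
  qed
 qed
 moreover have "KS X L N ~= {}" unfolding KS_def by (rule ext_class_nonempty[OF E' K' xLR])
 ultimately have "represents ?TE (ext_dual_shift X K E (KS X L N)) (C, %U V. k U V (U Int V) (coev X K (U Int V) 1<(U Int V)>))"
  unfolding ext_dual_shift_def by (intro represents_UN represents_ext_class[OF TE']) simp_all
 from represents_push[OF TG' G' end_tensor_iso_props(1)[OF LB G_O] represents_push[OF TE' TG' tensor_map_iso[OF E' G' KD' \<theta>] this]]
 have "represents G (ext_push X (ox X) ?TG G ?f3 (ext_push X (ox X) ?TE ?TG ?f2 (ext_dual_shift X K E (KS X L N))))
  (C, %U V. ?f3 (U Int V) (?f2 (U Int V) (k U V (U Int V) (coev X K (U Int V) 1<(U Int V)>))))" .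
 then have "represents G (ext_push X (ox X) ?TG G ?f3 (ext_push X (ox X) ?TE ?TG ?f2 (ext_dual_shift X K E (KS X L N))))
  (C, %U V. quot_map X (kaehler X) I (U Int V) (dlog X (U Int V) (g U V)))"
 proof (rule represents_cong)
  fix U V assume UV: "U : C" "V : C"
  show "?f3 (U Int V) (?f2 (U Int V) (k U V (U Int V) (coev X K (U Int V) 1<(U Int V)>))) =
    quot_map X (kaehler X) I (U Int V) (dlog X (U Int V) (g U V))"
  proof (rule trace_cocycle[OF UV k(1)[OF UV]])
   fix W D n assume W: "op W" "W <= U Int V" and D: "D :<K W>" and n: "n :<KD W>"
   show "k U V W (pt K KD W D n) = pt E KD W (homothety X L W (log_der (U Int V) (g U V) W D)) n"
    unfolding k(2)[OF UV W D n] h_apply[OF W D] ..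
  qed
 qed
 from represents_H1[OF G' this] show ?thesis unfolding psi_def Let_def .
qed

end

end

theorem proposition3p11:
  fixes X :: "('x, 'r, 'f) over_space"
    and L :: "('x, 'r, 'm) omod"
    and I :: "'x set \<Rightarrow> ('x, 'r) kd set"
    and \<theta> :: "('x, 'x \<Rightarrow> ('x, ('x, 'r) kd set) germ, ('x, ('x, 'r, 'r) fam, 'r) fam) fam"
    and N :: "('x, ('x, 'r, 'r) fam, ('x, 'm, 'm) fam) fam"
  assumes "scheme_over_field X"
    and "line_bundle X L"
    and "locally_free X (ks_sheaf X L)"
    and "sub_O_module X (kaehler X) I"
    and "mor_iso X (quot_sheaf X (kaehler X) I) (dual X (ks_sheaf X L)) \<theta>"
    and "mor_comp X (kaehler X) \<theta> (quot_map X (kaehler X) I) = kd_to_ks_dual X L"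
    and "lift_choice X L N"
  shows "KS X L N \<in> Ext1 X (ks_sheaf X L) (end_sheaf X L) \<and>
    gen_chern_class X I L \<in> H1_mod X (quot_sheaf X (kaehler X) I) \<and>
    psi X L (quot_sheaf X (kaehler X) I) \<theta> (KS X L N) = gen_chern_class X I L"
proof -
  have L: "pmodule X L" using assms(2) by (simp add: line_bundle_def)
  \<comment> \<open>That the Kodaira-Spencer sheaf is a sheaf of modules, as the locale asks, is
    part of its being locally free.\<close>
  interpret lr X L N
    by unfold_locales (use assms L in \<open>simp_all add: locally_free_def\<close>)
  obtain C e g where t: "trivializes L C e g" by (rule line_bundle_trivializes[OF assms(2)])
  have "KS X L N \<in> Ext1 X (ks_sheaf X L) (end_sheaf X L)"
    unfolding KS_def Ext1_def using lr_extension[OF assms(2)] by blast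
  moreover note gen_chern_class_trivializes[OF L assms(4) t]
  moreover note psi_KS[OF assms(2-6) t]
  ultimately show ?thesis by simp
qed

end
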